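(* Let $X$ be a locally finite tree with a countable end space and a unique maximal end. If $C$ is a locally finite tree whose end space is homeomorphic to Cantor space, then $\mathrm{Maps}(X\vee C)$ has a dense conjugacy class.
   Context: All graphs are connected and locally finite; $X\vee C$ is the wedge (one-point union at a vertex of each). The end space of a graph $X$ is $\partial X=\varprojlim_{K}\pi_0(X\setminus K)$ ($K\subset X$ compact) with the inverse limit topology. For ends $\nu,\nu'$ of a tree: $\nu\preceq\nu'$ if every neighborhood of $\nu'$ in $\partial X$ contains a homeomorphic copy, as a clopen subset, of a neighborhood of $\nu$; $\nu\sim\nu'$ if $\nu\preceq\nu'\preceq\nu$; an end $\mu$ is maximal if $\mu\preceq\nu$ implies $\nu\sim\mu$. $\mathrm{Maps}(X)$ is the group of proper homotopy equivalences $X\to X$ modulo proper homotopy (a proper homotopy is one through proper maps; a proper homotopy equivalence is a proper map with a proper inverse up to proper homotopy). For a finite subgraph $K\subset X$, let $U_K$ be the set of classes $[f]$ with a representative $f$ such that $f|_K=\mathrm{id}$, $f$ preserves each component of $X\setminus K$, some representative $g$ of $[f]^{-1}$ has the same two properties, and there are proper homotopies $g\circ f\simeq \mathrm{id}$, $f\circ g\simeq \mathrm{id}$ stationary on $K$ and preserving each component of $X\setminus K$. The topology on $\mathrm{Maps}(X)$ is the coarsest one making all $U_K$ open and multiplication and inversion continuous. *)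

theory Defs
  imports "HOL-Analysis.Analysis" "HOL-Algebra.Group"
begin

section \<open>Graphs, trees, wedges\<close>

text \<open>Only trees occur below, so graphs are simple: an edge is the set of its two endpoints.\<close>

record 'v graph =
  verts :: "'v set"
  edges :: "'v set set"

definition wf_graph :: "'v graph \<Rightarrow> bool" where
  "wf_graph G \<longleftrightarrow> (\<forall>e \<in> edges G. e \<subseteq> verts G \<and> card e = 2)"

definition locally_finite_graph :: "'v graph \<Rightarrow> bool" where
  "locally_finite_graph G \<longleftrightarrow> (\<forall>v \<in> verts G. finite {e \<in> edges G. v \<in> e})"

definition connected_graph :: "'v graph \<Rightarrow> bool" where
  "connected_graph G \<longleftrightarrow>
     verts G \<noteq> {} \<and> (\<forall>u \<in> verts G. \<forall>v \<in> verts G. (u, v) \<in> {(a, b). {a, b} \<in> edges G}\<^sup>*)"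

definition cycle_in :: "'v graph \<Rightarrow> 'v list \<Rightarrow> bool" where
  "cycle_in G vs \<longleftrightarrow>
     3 \<le> length vs \<and> distinct vs \<and>
     (\<forall>i < length vs. {vs ! i, vs ! (Suc i mod length vs)} \<in> edges G)"

definition locally_finite_tree :: "'v graph \<Rightarrow> bool" where
  "locally_finite_tree G \<longleftrightarrow>
     wf_graph G \<and> locally_finite_graph G \<and> connected_graph G \<and> (\<nexists>vs. cycle_in G vs)"

definition finite_subgraph :: "'v graph \<Rightarrow> 'v graph \<Rightarrow> bool" where
  "finite_subgraph K G \<longleftrightarrow>
     wf_graph K \<and> verts K \<subseteq> verts G \<and> edges K \<subseteq> edges G \<and> finite (verts K) \<and> finite (edges K)"

text \<open>The wedge of two graphs at vertices \<open>x\<close>, \<open>c\<close>: the disjoint union in which the copy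
  \<open>Inr c\<close> of \<open>c\<close> is replaced by \<open>Inl x\<close>.\<close>

definition wedge_vertex :: "'a \<Rightarrow> 'b \<Rightarrow> 'b \<Rightarrow> 'a + 'b" where
  "wedge_vertex x c v = (if v = c then Inl x else Inr v)"

definition wedge :: "'a graph \<Rightarrow> 'a \<Rightarrow> 'b graph \<Rightarrow> 'b \<Rightarrow> ('a + 'b) graph" where
  "wedge X x C c =
     \<lparr>verts = Inl ` verts X \<union> wedge_vertex x c ` verts C,
      edges = (\<lambda>e. Inl ` e) ` edges X \<union> (\<lambda>e. wedge_vertex x c ` e) ` edges C\<rparr>"


section \<open>Geometric realization\<close>

text \<open>Points are given by barycentric coordinates, so that the realization of a subgraph is
  literally a subset of the realization of the graph.  The topology is the weak (CW) topology
  with respect to the closed cells; a cell carries its Euclidean topology, which is the one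
  induced by the product topology on \<open>'v \<Rightarrow> real\<close>.\<close>

definition cell :: "'v set \<Rightarrow> ('v \<Rightarrow> real) set" where
  "cell e = {p. (\<forall>v. 0 \<le> p v) \<and> (\<forall>v. v \<notin> e \<longrightarrow> p v = 0) \<and> (\<Sum>v\<in>e. p v) = 1}"

definition cells :: "'v graph \<Rightarrow> ('v \<Rightarrow> real) set set" where
  "cells G = (\<lambda>v. cell {v}) ` verts G \<union> cell ` edges G"

definition realization :: "'v graph \<Rightarrow> ('v \<Rightarrow> real) set" where
  "realization G = \<Union> (cells G)"

definition graph_space :: "'v graph \<Rightarrow> ('v \<Rightarrow> real) topology" where
  "graph_space G =
     topology (\<lambda>U. U \<subseteq> realization G \<and> (\<forall>c \<in> cells G. openin (top_of_set c) (U \<inter> c)))"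

lemma istopology_graph_space:
  "istopology (\<lambda>U. U \<subseteq> realization G \<and> (\<forall>c \<in> cells G. openin (top_of_set c) (U \<inter> c)))"
  unfolding istopology_def
proof (intro conjI allI impI; (elim conjE)?)
  fix S T :: "('a \<Rightarrow> real) set"
  assume "S \<subseteq> realization G" "\<forall>c \<in> cells G. openin (top_of_set c) (S \<inter> c)"
    and "T \<subseteq> realization G" "\<forall>c \<in> cells G. openin (top_of_set c) (T \<inter> c)"
  moreover have "S \<inter> T \<inter> c = (S \<inter> c) \<inter> (T \<inter> c)" for c
    by blast
  ultimately show "S \<inter> T \<subseteq> realization G"
    and "\<forall>c \<in> cells G. openin (top_of_set c) (S \<inter> T \<inter> c)"
    by (auto intro: openin_Int)
next
  fix \<K> :: "('a \<Rightarrow> real) set set"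
  assume *: "\<forall>K\<in>\<K>. K \<subseteq> realization G \<and> (\<forall>c \<in> cells G. openin (top_of_set c) (K \<inter> c))"
  then show "\<Union>\<K> \<subseteq> realization G"
    by blast
  show "\<forall>c \<in> cells G. openin (top_of_set c) (\<Union>\<K> \<inter> c)"
  proof
    fix c assume "c \<in> cells G"
    with * have "openin (top_of_set c) (\<Union>K\<in>\<K>. K \<inter> c)"
      by (intro openin_Union) auto
    then show "openin (top_of_set c) (\<Union>\<K> \<inter> c)"
      by (simp only: Int_Union2)
  qed
qed

lemma openin_graph_space:
  "openin (graph_space G) U \<longleftrightarrow>
     U \<subseteq> realization G \<and> (\<forall>c \<in> cells G. openin (top_of_set c) (U \<inter> c))"
  unfolding graph_space_def by (simp add: topology_inverse'[OF istopology_graph_space])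

lemma topspace_graph_space [simp]: "topspace (graph_space G) = realization G"
proof
  show "topspace (graph_space G) \<subseteq> realization G"
    using openin_topspace[of "graph_space G"] unfolding openin_graph_space by simp
  have "realization G \<inter> c = c" if "c \<in> cells G" for c
    using that by (auto simp: realization_def)
  then have "openin (graph_space G) (realization G)"
    by (simp add: openin_graph_space)
  then show "realization G \<subseteq> topspace (graph_space G)"
    by (rule openin_subset)
qed


section \<open>Ends\<close>

definition pi0_compl :: "'p topology \<Rightarrow> 'p set \<Rightarrow> 'p set set" where
  "pi0_compl X K = path_components_of (subtopology X (topspace X - K))"

text \<open>A point of the inverse limit assigns to each compact \<open>K\<close> a component of the complement,
  compatibly with the maps induced by inclusion: for \<open>K \<subseteq> L\<close>, the component of the
  complement of \<open>L\<close> is sent to the component of the complement of \<open>K\<close> containing it.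
  Functions are extensional outside the compact sets, by the convention of
  \<open>product_topology\<close>.\<close>

definition end_space :: "'p topology \<Rightarrow> ('p set \<Rightarrow> 'p set) topology" where
  "end_space X =
     subtopology
       (product_topology (\<lambda>K. discrete_topology (pi0_compl X K)) {K. compactin X K})
       {\<nu>. \<forall>K L. compactin X K \<and> compactin X L \<and> K \<subseteq> L \<longrightarrow> \<nu> L \<subseteq> \<nu> K}"

definition nbhd :: "'a topology \<Rightarrow> 'a \<Rightarrow> 'a set \<Rightarrow> bool" where
  "nbhd T x U \<longleftrightarrow> U \<subseteq> topspace T \<and> x \<in> T interior_of U"

text \<open>The following relations are those of the end space \<open>T\<close>.\<close>

definition end_le :: "'e topology \<Rightarrow> 'e \<Rightarrow> 'e \<Rightarrow> bool" where
  "end_le T \<nu> \<nu>' \<longleftrightarrow>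
     (\<forall>U. nbhd T \<nu>' U \<longrightarrow>
        (\<exists>V W. nbhd T \<nu> V \<and> W \<subseteq> U \<and> openin T W \<and> closedin T W \<and>
               subtopology T V homeomorphic_space subtopology T W))"

definition end_equiv :: "'e topology \<Rightarrow> 'e \<Rightarrow> 'e \<Rightarrow> bool" where
  "end_equiv T \<nu> \<nu>' \<longleftrightarrow> end_le T \<nu> \<nu>' \<and> end_le T \<nu>' \<nu>"

definition maximal_end :: "'e topology \<Rightarrow> 'e \<Rightarrow> bool" where
  "maximal_end T \<mu> \<longleftrightarrow>
     \<mu> \<in> topspace T \<and> (\<forall>\<nu> \<in> topspace T. end_le T \<mu> \<nu> \<longrightarrow> end_equiv T \<nu> \<mu>)"

definition cantor_space :: "(nat \<Rightarrow> bool) topology" where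
  "cantor_space = product_topology (\<lambda>_. discrete_topology UNIV) UNIV"


section \<open>Proper homotopy equivalences and the mapping class group\<close>

definition continuous_proper :: "'p topology \<Rightarrow> 'q topology \<Rightarrow> ('p \<Rightarrow> 'q) \<Rightarrow> bool" where
  "continuous_proper X Y f \<longleftrightarrow> continuous_map X Y f \<and> proper_map X Y f"

text \<open>The homotopy is required to be proper as a map on \<open>[0,1] \<times> X\<close>.  Asking only that each
  stage be proper would not give the usual notion: on a tree it makes all proper self-maps
  homotopic, since \<open>f\<close> can be deformed to \<open>g\<close> by a modification coming in from infinity.\<close>

definition proper_homotopy ::
    "'p topology \<Rightarrow> 'q topology \<Rightarrow> ('p \<Rightarrow> 'q) \<Rightarrow> ('p \<Rightarrow> 'q) \<Rightarrow> (real \<times> 'p \<Rightarrow> 'q) \<Rightarrow> bool" where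
  "proper_homotopy X Y f g H \<longleftrightarrow>
     continuous_proper (prod_topology (top_of_set {0..1}) X) Y H \<and>
     (\<forall>x \<in> topspace X. H (0, x) = f x \<and> H (1, x) = g x)"

definition properly_homotopic :: "'p topology \<Rightarrow> 'q topology \<Rightarrow> ('p \<Rightarrow> 'q) \<Rightarrow> ('p \<Rightarrow> 'q) \<Rightarrow> bool" where
  "properly_homotopic X Y f g \<longleftrightarrow> (\<exists>H. proper_homotopy X Y f g H)"

definition proper_homotopy_equivs :: "'p topology \<Rightarrow> ('p \<Rightarrow> 'p) set" where
  "proper_homotopy_equivs X =
     {f. continuous_proper X X f \<and>
         (\<exists>g. continuous_proper X X g \<and>
              properly_homotopic X X (g \<circ> f) id \<and> properly_homotopic X X (f \<circ> g) id)}"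

definition proper_homotopy_rel :: "'p topology \<Rightarrow> (('p \<Rightarrow> 'p) \<times> ('p \<Rightarrow> 'p)) set" where
  "proper_homotopy_rel X =
     {(f, g). f \<in> proper_homotopy_equivs X \<and> g \<in> proper_homotopy_equivs X \<and>
              properly_homotopic X X f g}"

text \<open>Values of representatives outside \<open>topspace X\<close> are irrelevant: maps that agree on
  \<open>topspace X\<close> lie in the same class.\<close>

definition Maps :: "'v graph \<Rightarrow> (('v \<Rightarrow> real) \<Rightarrow> ('v \<Rightarrow> real)) set monoid" where
  "Maps G =
     (let X = graph_space G; R = proper_homotopy_rel X in
      \<lparr>carrier = proper_homotopy_equivs X // R,
       mult = (\<lambda>A B. \<Union>f\<in>A. \<Union>g\<in>B. R `` {f \<circ> g}),
       one = R `` {id}\<rparr>)"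

definition fixes_preserves :: "'p topology \<Rightarrow> 'p set \<Rightarrow> ('p \<Rightarrow> 'p) \<Rightarrow> bool" where
  "fixes_preserves X K f \<longleftrightarrow> (\<forall>x \<in> K. f x = x) \<and> (\<forall>D \<in> pi0_compl X K. f ` D \<subseteq> D)"

definition basic_nbhd ::
    "'v graph \<Rightarrow> 'v graph \<Rightarrow> (('v \<Rightarrow> real) \<Rightarrow> ('v \<Rightarrow> real)) set set" where
  "basic_nbhd G K =
     {A \<in> carrier (Maps G).
        \<exists>f \<in> A. \<exists>g \<in> inv\<^bsub>Maps G\<^esub> A.
          fixes_preserves (graph_space G) (realization K) f \<and>
          fixes_preserves (graph_space G) (realization K) g \<and>
          (\<exists>H. proper_homotopy (graph_space G) (graph_space G) (g \<circ> f) id H \<and>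
               (\<forall>t \<in> {0..1}. fixes_preserves (graph_space G) (realization K) (\<lambda>x. H (t, x)))) \<and>
          (\<exists>H. proper_homotopy (graph_space G) (graph_space G) (f \<circ> g) id H \<and>
               (\<forall>t \<in> {0..1}. fixes_preserves (graph_space G) (realization K) (\<lambda>x. H (t, x))))}"

definition admissible_topology ::
    "'v graph \<Rightarrow> (('v \<Rightarrow> real) \<Rightarrow> ('v \<Rightarrow> real)) set topology \<Rightarrow> bool" where
  "admissible_topology G T \<longleftrightarrow>
     topspace T = carrier (Maps G) \<and>
     (\<forall>K. finite_subgraph K G \<longrightarrow> openin T (basic_nbhd G K)) \<and>
     continuous_map (prod_topology T T) T (\<lambda>(a, b). a \<otimes>\<^bsub>Maps G\<^esub> b) \<and>
     continuous_map T T (\<lambda>a. inv\<^bsub>Maps G\<^esub> a)"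

definition coarsest_admissible ::
    "'v graph \<Rightarrow> (('v \<Rightarrow> real) \<Rightarrow> ('v \<Rightarrow> real)) set topology \<Rightarrow> bool" where
  "coarsest_admissible G T \<longleftrightarrow>
     admissible_topology G T \<and>
     (\<forall>T'. admissible_topology G T' \<longrightarrow> (\<forall>U. openin T U \<longrightarrow> openin T' U))"

lemma coarsest_admissible_unique:
  "coarsest_admissible G T \<Longrightarrow> coarsest_admissible G T' \<Longrightarrow> T = T'"
  unfolding coarsest_admissible_def topology_eq by blast

definition Maps_topology :: "'v graph \<Rightarrow> (('v \<Rightarrow> real) \<Rightarrow> ('v \<Rightarrow> real)) set topology" where
  "Maps_topology G = (THE T. coarsest_admissible G T)"

definition conjugacy_class :: "('g, 'm) monoid_scheme \<Rightarrow> 'g \<Rightarrow> 'g set" where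
  "conjugacy_class M a = {g \<otimes>\<^bsub>M\<^esub> a \<otimes>\<^bsub>M\<^esub> inv\<^bsub>M\<^esub> g | g. g \<in> carrier M}"

end

theory Submission
  imports Defs "HOL-Library.Countable_Set" "HOL-Library.Nat_Bijection"
begin

text \<open>
  A proper map of a locally finite tree acts on the ends (\<open>bd\<close>), and this action
  is invariant under proper homotopies. If two proper maps \<open>f\<close>, \<open>g\<close> act in the same way, then moving
  \<open>f x\<close> to \<open>g x\<close> along the geodesic is a proper homotopy, because far out \<open>f x\<close> and \<open>g x\<close> lie in a
  common branch (\<open>homotopic_iff\<close>). Every continuous self-map of the end space is induced by a proper
  simplicial map, which can be taken to be the identity on any ball whose complementary branches are
  preserved (\<open>bd_realize\<close>). Hence \<open>Maps\<close> of the tree is the homeomorphism group of its end space.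

  Under this identification the sets \<open>U\<^sub>K\<close>, for \<open>K\<close> the ball of radius \<open>n\<close>, are
  the stabilizers of the partition of the ends into those beyond the vertices of depth \<open>n + 1\<close>.
  They are subgroups, any two contain a third one, and so does every conjugate, since homeomorphisms
  take clopen partitions to clopen partitions. Therefore their cosets are a base of a group topology,
  which is the coarsest admissible one (\<open>Maps_topology_eq\<close>), and the class of \<open>h\<close> has a dense
  conjugacy class as soon as for every homeomorphism \<open>g\<close> and finitely many clopen sets some conjugate
  of \<open>h\<close> moves these sets in the same way as \<open>g\<close>. A space with such an \<open>h\<close> is called \<open>rokhlin\<close> below.

  The ends of the wedge form the disjoint union of a clopen copy of the countable end space of
  \<open>X\<close> and a clopen Cantor set. Nonempty open subsets of the Cantor set are uncountable, so every
  homeomorphism preserves the two parts, and it suffices to treat them separately (\<open>rokhlin_sum\<close>).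
  In both cases \<open>h\<close> is assembled from a sequence of partial homeomorphisms representing the countably
  many ways in which finitely many clopen sets can be moved.

  Cantor space is a countable power of itself, and \<open>h\<close> acts by the \<open>k\<close>-th representative on the
  \<open>k\<close>-th factor. Finitely many clopen sets depend on finitely many coordinates, which a permutation of
  the coordinates takes into the \<open>k\<close>-th factor (\<open>rokhlin_cantor\<close>).

  In the countable space let \<open>\<mu>\<close> be the unique maximal end. Every clopen set missing \<open>\<mu>\<close> has clopen
  copies missing \<open>\<mu>\<close> in every neighbourhood of \<open>\<mu>\<close>. Otherwise consider the points near which this
  fails. They form a nonempty countable closed set, which has an isolated point \<open>\<nu>\<close>. As \<open>\<nu> \<preceq> \<mu>\<close>, a
  neighbourhood of \<open>\<nu>\<close> has copies near \<open>\<mu>\<close>, and such a copy can be made to miss \<open>\<mu>\<close>, for no end other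
  than \<open>\<mu>\<close> is above \<open>\<mu>\<close>: a contradiction (\<open>selfsimilar_if_unique_maximal\<close>). Now a representative is a
  homeomorphism of a clopen set missing \<open>\<mu>\<close>, and \<open>h\<close> acts by the representatives on disjoint copies of
  their domains, which converge to \<open>\<mu>\<close>, and fixes all other points. By Hilbert's hotel the complements
  of clopen sets missing \<open>\<mu>\<close> are all homeomorphic, so the homeomorphism from the domain of a
  representative to its copy extends to the whole space and conjugates as required
  (\<open>selfsimilar.rokhlin\<close>).
\<close>

section \<open>Homeomorphism groups with a dense conjugacy class\<close>

definition clopenin :: "'e topology \<Rightarrow> 'e set \<Rightarrow> bool" where
  "clopenin T A \<longleftrightarrow> openin T A \<and> closedin T A"

text \<open>The conjugacy class of \<open>h\<close> is dense for the topology in which a basic neighbourhood of \<open>g\<close>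
  consists of the homeomorphisms that move finitely many given clopen sets in the same way as \<open>g\<close>.\<close>

definition rokhlin :: "'e topology \<Rightarrow> bool" where
  "rokhlin T \<longleftrightarrow>
     (\<exists>h. homeomorphic_map T T h \<and>
        (\<forall>g \<A>. homeomorphic_map T T g \<longrightarrow> finite \<A> \<longrightarrow> (\<forall>A\<in>\<A>. clopenin T A) \<longrightarrow>
           (\<exists>\<phi>. homeomorphic_map T T \<phi> \<and> (\<forall>A\<in>\<A>. h ` \<phi> ` A = \<phi> ` g ` A))))"

lemma clopenin_subset: "clopenin T A \<Longrightarrow> A \<subseteq> topspace T"
  unfolding clopenin_def using openin_subset by blast

lemma clopenin_Un: "clopenin T A \<Longrightarrow> clopenin T B \<Longrightarrow> clopenin T (A \<union> B)"
  and clopenin_Int: "clopenin T A \<Longrightarrow> clopenin T B \<Longrightarrow> clopenin T (A \<inter> B)"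
  and clopenin_diff: "clopenin T A \<Longrightarrow> clopenin T B \<Longrightarrow> clopenin T (A - B)"
  and clopenin_empty [simp]: "clopenin T {}"
  and clopenin_topspace [simp]: "clopenin T (topspace T)"
  unfolding clopenin_def by (auto intro: openin_diff closedin_diff)

lemma clopenin_Union: "finite \<A> \<Longrightarrow> (\<And>A. A \<in> \<A> \<Longrightarrow> clopenin T A) \<Longrightarrow> clopenin T (\<Union>\<A>)"
  by (induction \<A> rule: finite_induct) (auto intro: clopenin_Un)

lemma clopenin_subtopology: "clopenin T W \<Longrightarrow> clopenin (subtopology T W) A \<longleftrightarrow> clopenin T A \<and> A \<subseteq> W"
  unfolding clopenin_def by (auto simp: openin_open_subtopology closedin_closed_subtopology)

lemma clopenin_subset_subtopology: "clopenin T A \<Longrightarrow> A \<subseteq> W \<Longrightarrow> clopenin (subtopology T W) A"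
proof -
  assume A: "clopenin T A" "A \<subseteq> W"
  have "openin (subtopology T W) (W \<inter> A)" "closedin (subtopology T W) (W \<inter> A)"
    using A(1) unfolding clopenin_def by (auto intro: openin_subtopology_Int2 closedin_subtopology_Int_closed)
  then show ?thesis using A(2) by (simp add: clopenin_def Int_absorb1)
qed

lemma homeomorphic_clopenin: "homeomorphic_map T T' k \<Longrightarrow> clopenin T A \<Longrightarrow> clopenin T' (k ` A)"
proof -
  assume k: "homeomorphic_map T T' k" and A: "clopenin T A"
  show ?thesis
    using A homeomorphic_map_openness[OF k clopenin_subset[OF A]] homeomorphic_map_closedness[OF k clopenin_subset[OF A]]
    by (simp add: clopenin_def)
qed

lemma homeomorphic_image: "homeomorphic_map T T' k \<Longrightarrow> k ` topspace T = topspace T'"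
  by (rule homeomorphic_imp_surjective_map)

lemma homeomorphic_inj: "homeomorphic_map T T' k \<Longrightarrow> inj_on k (topspace T)"
  by (rule homeomorphic_imp_injective_map)

lemma homeomorphic_inverse:
  assumes "homeomorphic_map T T' k"
  obtains k' where "homeomorphic_map T' T k'" "\<And>x. x \<in> topspace T \<Longrightarrow> k' (k x) = x" "\<And>y. y \<in> topspace T' \<Longrightarrow> k (k' y) = y"
proof -
  obtain k' where "homeomorphic_maps T T' k k'" using assms unfolding homeomorphic_map_maps by blast
  then show thesis using that[of k'] unfolding homeomorphic_maps_map by simp
qed

lemma homeomorphic_restrict:
  assumes "homeomorphic_map (subtopology T D) (subtopology T' W) k" "D \<subseteq> topspace T" "W \<subseteq> topspace T'" "A \<subseteq> D"
  shows "homeomorphic_map (subtopology T A) (subtopology T' (k ` A)) k" "k ` A \<subseteq> W"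
proof -
  have img: "k ` D = W" using homeomorphic_image[OF assms(1)] assms(2,3) by (simp add: Int_absorb1)
  then show kW: "k ` A \<subseteq> W" using assms(4) by blast
  have "homeomorphic_map (subtopology (subtopology T D) A) (subtopology (subtopology T' W) (k ` A)) k"
    by (rule homeomorphic_map_subtopologies[OF assms(1)])
      (use assms(2-4) kW in \<open>simp add: Int_absorb1 Int_absorb2 subset_trans[of A D] subset_trans[of "k ` A" W]\<close>)
  then show "homeomorphic_map (subtopology T A) (subtopology T' (k ` A)) k"
    using assms(4) kW by (simp add: subtopology_subtopology Int_absorb1)
qed

text \<open>On a clopen partition, the two pieces of a map need not satisfy any compatibility condition.\<close>

lemma glue_continuous:
  assumes P: "openin T P" "openin T P'" "P \<union> P' = topspace T" "P \<inter> P' = {}"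
    and f: "continuous_map (subtopology T P) T' f" "continuous_map (subtopology T P') T' f'"
  shows "continuous_map T T' (\<lambda>x. if x \<in> P then f x else f' x)"
  unfolding continuous_map_def
proof (intro conjI allI impI)
  have sub: "P \<subseteq> topspace T" "P' \<subseteq> topspace T" using P(3) by auto
  show "(\<lambda>x. if x \<in> P then f x else f' x) \<in> topspace T \<rightarrow> topspace T'"
    using f P(3) sub by (auto simp: continuous_map_def Pi_iff)
  fix U assume U: "openin T' U"
  have "openin (subtopology T P) {x \<in> topspace (subtopology T P). f x \<in> U}"
    "openin (subtopology T P') {x \<in> topspace (subtopology T P'). f' x \<in> U}"
    using f U openin_continuous_map_preimage by blast+
  then have "openin T {x \<in> P. f x \<in> U}" "openin T {x \<in> P'. f' x \<in> U}"
    using P sub by (auto simp: openin_open_subtopology Int_absorb1)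
  then have "openin T ({x \<in> P. f x \<in> U} \<union> {x \<in> P'. f' x \<in> U})" by blast
  moreover have "{x \<in> P. f x \<in> U} \<union> {x \<in> P'. f' x \<in> U} = {x \<in> topspace T. (if x \<in> P then f x else f' x) \<in> U}"
    using P(3,4) by auto
  ultimately show "openin T {x \<in> topspace T. (if x \<in> P then f x else f' x) \<in> U}" by simp
qed

lemma glue_homeomorphic:
  assumes P: "openin T P" "openin T P'" "P \<union> P' = topspace T" "P \<inter> P' = {}"
    and Q: "openin T' Q" "openin T' Q'" "Q \<union> Q' = topspace T'" "Q \<inter> Q' = {}"
    and f: "homeomorphic_map (subtopology T P) (subtopology T' Q) f"
    and f': "homeomorphic_map (subtopology T P') (subtopology T' Q') f'"
  shows "homeomorphic_map T T' (\<lambda>x. if x \<in> P then f x else f' x)"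
proof -
  have sub: "P \<subseteq> topspace T" "P' \<subseteq> topspace T" "Q \<subseteq> topspace T'" "Q' \<subseteq> topspace T'" using P(3) Q(3) by auto
  then have ts: "topspace (subtopology T P) = P" "topspace (subtopology T P') = P'"
    "topspace (subtopology T' Q) = Q" "topspace (subtopology T' Q') = Q'" by (auto simp: Int_absorb1)
  obtain k where k: "homeomorphic_map (subtopology T' Q) (subtopology T P) k"
    "\<And>x. x \<in> P \<Longrightarrow> k (f x) = x" "\<And>y. y \<in> Q \<Longrightarrow> f (k y) = y"
    using homeomorphic_inverse[OF f] unfolding ts by metis
  obtain k' where k': "homeomorphic_map (subtopology T' Q') (subtopology T P') k'"
    "\<And>x. x \<in> P' \<Longrightarrow> k' (f' x) = x" "\<And>y. y \<in> Q' \<Longrightarrow> f' (k' y) = y"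
    using homeomorphic_inverse[OF f'] unfolding ts by metis
  have im: "f ` P = Q" "f' ` P' = Q'" "k ` Q = P" "k' ` Q' = P'"
    using homeomorphic_image[OF f] homeomorphic_image[OF f'] homeomorphic_image[OF k(1)] homeomorphic_image[OF k'(1)] ts by auto
  have c: "continuous_map (subtopology T P) T' f" "continuous_map (subtopology T P') T' f'"
    "continuous_map (subtopology T' Q) T k" "continuous_map (subtopology T' Q') T k'"
    using f f' k k' homeomorphic_imp_continuous_map continuous_map_into_fulltopology by blast+
  have "homeomorphic_maps T T' (\<lambda>x. if x \<in> P then f x else f' x) (\<lambda>y. if y \<in> Q then k y else k' y)"
    unfolding homeomorphic_maps_def
  proof (intro conjI ballI)
    fix x assume "x \<in> topspace T"
    then consider "x \<in> P" | "x \<in> P'" "x \<notin> P" using P(3,4) by blast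
    then show "(if (if x \<in> P then f x else f' x) \<in> Q then k (if x \<in> P then f x else f' x) else k' (if x \<in> P then f x else f' x)) = x"
    proof cases
      case 1 then show ?thesis using im k by auto
    next
      case 2
      then have "f' x \<in> Q'" using im by blast
      then have "f' x \<notin> Q" using Q(4) by blast
      then show ?thesis using 2 k' by simp
    qed
  next
    fix y assume "y \<in> topspace T'"
    then consider "y \<in> Q" | "y \<in> Q'" "y \<notin> Q" using Q(3,4) by blast
    then show "(if (if y \<in> Q then k y else k' y) \<in> P then f (if y \<in> Q then k y else k' y) else f' (if y \<in> Q then k y else k' y)) = y"
    proof cases
      case 1 then show ?thesis using im k by auto
    next
      case 2
      then have "k' y \<in> P'" using im by blast
      then have "k' y \<notin> P" using P(4) by blast
      then show ?thesis using 2 k' by simp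
    qed
  qed (rule glue_continuous[OF P c(1,2)], rule glue_continuous[OF Q c(3,4)])
  then show ?thesis using homeomorphic_maps_map by blast
qed

lemma homeomorphic_space_disjoint_Un:
  assumes "clopenin E A" "clopenin E B" "A \<inter> B = {}" "clopenin E A'" "clopenin E B'" "A' \<inter> B' = {}"
    and "subtopology E A homeomorphic_space subtopology E A'" "subtopology E B homeomorphic_space subtopology E B'"
  shows "subtopology E (A \<union> B) homeomorphic_space subtopology E (A' \<union> B')"
proof -
  obtain f g where f: "homeomorphic_map (subtopology E A) (subtopology E A') f"
    and g: "homeomorphic_map (subtopology E B) (subtopology E B') g"
    using assms(7,8) homeomorphic_space by blast
  have "homeomorphic_map (subtopology E (A \<union> B)) (subtopology E (A' \<union> B')) (\<lambda>x. if x \<in> A then f x else g x)"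
  proof (rule glue_homeomorphic)
    show "openin (subtopology E (A \<union> B)) A" "openin (subtopology E (A \<union> B)) B"
      "openin (subtopology E (A' \<union> B')) A'" "openin (subtopology E (A' \<union> B')) B'"
      using assms clopenin_subset_subtopology[of E] unfolding clopenin_def by (metis Un_upper1 Un_upper2)+
    show "A \<union> B = topspace (subtopology E (A \<union> B))" "A' \<union> B' = topspace (subtopology E (A' \<union> B'))"
      using assms(1,2,4,5) clopenin_subset by fastforce+
    show "homeomorphic_map (subtopology (subtopology E (A \<union> B)) A) (subtopology (subtopology E (A' \<union> B')) A') f"
      "homeomorphic_map (subtopology (subtopology E (A \<union> B)) B) (subtopology (subtopology E (A' \<union> B')) B') g"
      using f g by (simp_all add: subtopology_subtopology Int_absorb1)
  qed (use assms in auto)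
  then show ?thesis using homeomorphic_space by blast
qed

lemma rokhlin_homeomorphic:
  assumes "T homeomorphic_space T'" and R: "rokhlin T"
  shows "rokhlin T'"
proof -
  obtain k where k: "homeomorphic_map T T' k" using assms(1) homeomorphic_space by blast
  obtain k' where k': "homeomorphic_map T' T k'" "\<And>x. x \<in> topspace T \<Longrightarrow> k' (k x) = x" "\<And>y. y \<in> topspace T' \<Longrightarrow> k (k' y) = y"
    using homeomorphic_inverse[OF k] by metis
  have kk: "k ` k' ` A = A" if "A \<subseteq> topspace T'" for A
  proof -
    have "k ` k' ` A = (\<lambda>x. x) ` A" unfolding image_image using that k'(3) by (intro image_cong) auto
    then show ?thesis by simp
  qed
  have k'k: "k' ` k ` A = A" if "A \<subseteq> topspace T" for A
  proof -
    have "k' ` k ` A = (\<lambda>x. x) ` A" unfolding image_image using that k'(2) by (intro image_cong) auto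
    then show ?thesis by simp
  qed
  obtain h where h: "homeomorphic_map T T h"
    and dense: "\<And>g \<A>. homeomorphic_map T T g \<Longrightarrow> finite \<A> \<Longrightarrow> (\<forall>A\<in>\<A>. clopenin T A) \<Longrightarrow>
           (\<exists>\<phi>. homeomorphic_map T T \<phi> \<and> (\<forall>A\<in>\<A>. h ` \<phi> ` A = \<phi> ` g ` A))"
    using R unfolding rokhlin_def by (elim exE conjE) (rule that, auto)
  note comp = homeomorphic_map_compose
  show ?thesis
    unfolding rokhlin_def
  proof (rule exI[of _ "k \<circ> (h \<circ> k')"], intro conjI allI impI)
    show "homeomorphic_map T' T' (k \<circ> (h \<circ> k'))" by (rule comp[OF comp[OF k'(1) h] k])
    fix g \<A> assume g: "homeomorphic_map T' T' g" and fin: "finite \<A>" and A: "\<forall>A\<in>\<A>. clopenin T' A"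
    have g0: "homeomorphic_map T T (k' \<circ> (g \<circ> k))" by (rule comp[OF comp[OF k g] k'(1)])
    have "\<exists>\<phi>. homeomorphic_map T T \<phi> \<and> (\<forall>A\<in>(`) k' ` \<A>. h ` \<phi> ` A = \<phi> ` (k' \<circ> (g \<circ> k)) ` A)"
      by (rule dense[OF g0]) (use fin A homeomorphic_clopenin[OF k'(1)] in auto)
    then obtain \<phi> where p: "homeomorphic_map T T \<phi>" "\<forall>A\<in>(`) k' ` \<A>. h ` \<phi> ` A = \<phi> ` (k' \<circ> (g \<circ> k)) ` A"
      by (elim exE conjE) (rule that)
    show "\<exists>\<phi>. homeomorphic_map T' T' \<phi> \<and> (\<forall>A\<in>\<A>. (k \<circ> (h \<circ> k')) ` \<phi> ` A = \<phi> ` g ` A)"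
    proof (intro exI[of _ "k \<circ> (\<phi> \<circ> k')"] conjI ballI)
      show "homeomorphic_map T' T' (k \<circ> (\<phi> \<circ> k'))" by (rule comp[OF comp[OF k'(1) p(1)] k])
      fix A assume AA: "A \<in> \<A>"
      then have sub: "A \<subseteq> topspace T'" using A clopenin_subset by blast
      have 1: "\<phi> ` k' ` A \<subseteq> topspace T"
        using sub homeomorphic_image[OF k'(1)] homeomorphic_image[OF p(1)] by blast
      have "(k \<circ> (h \<circ> k')) ` (k \<circ> (\<phi> \<circ> k')) ` A = k ` h ` k' ` k ` \<phi> ` k' ` A" by (simp only: image_comp o_assoc)
      also have "\<dots> = k ` h ` \<phi> ` k' ` A" using k'k[OF 1] by simp
      also have "\<dots> = k ` \<phi> ` (k' \<circ> (g \<circ> k)) ` k' ` A" using p(2) AA by simp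
      also have "\<dots> = k ` \<phi> ` k' ` g ` k ` k' ` A" by (simp only: image_comp o_assoc)
      also have "\<dots> = k ` \<phi> ` k' ` g ` A" using kk[OF sub] by simp
      finally show "(k \<circ> (h \<circ> k')) ` (k \<circ> (\<phi> \<circ> k')) ` A = (k \<circ> (\<phi> \<circ> k')) ` g ` A" by (simp only: image_comp o_assoc)
    qed
  qed
qed

text \<open>Since \<open>W\<close> is invariant, a homeomorphism of \<open>T\<close> is a pair of homeomorphisms of \<open>W\<close> and \<open>W'\<close>, and
  conjugation acts on the two parts separately.\<close>

lemma rokhlin_sum:
  assumes W: "clopenin T W" "clopenin T W'" "W \<union> W' = topspace T" "W \<inter> W' = {}"
    and inv: "\<And>g. homeomorphic_map T T g \<Longrightarrow> g ` W = W"
    and R: "rokhlin (subtopology T W)" "rokhlin (subtopology T W')"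
  shows "rokhlin T"
proof -
  have sub: "W \<subseteq> topspace T" "W' \<subseteq> topspace T" using W(3) by auto
  have op: "openin T W" "openin T W'" using W by (auto simp: clopenin_def)
  have inv': "g ` W' = W'" if g: "homeomorphic_map T T g" for g
  proof -
    have "W' = topspace T - W" using W(3,4) by blast
    then have "g ` W' = g ` topspace T - g ` W" using inj_on_image_set_diff[OF homeomorphic_inj[OF g]] sub by simp
    then show ?thesis using inv[OF g] homeomorphic_image[OF g] \<open>W' = topspace T - W\<close> by simp
  qed
  obtain h where h: "homeomorphic_map (subtopology T W) (subtopology T W) h"
    and d: "\<And>g \<A>. homeomorphic_map (subtopology T W) (subtopology T W) g \<Longrightarrow> finite \<A> \<Longrightarrow> (\<forall>A\<in>\<A>. clopenin (subtopology T W) A) \<Longrightarrow>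
           (\<exists>\<phi>. homeomorphic_map (subtopology T W) (subtopology T W) \<phi> \<and> (\<forall>A\<in>\<A>. h ` \<phi> ` A = \<phi> ` g ` A))"
    using R(1) unfolding rokhlin_def by (elim exE conjE) (rule that, auto)
  obtain h' where h': "homeomorphic_map (subtopology T W') (subtopology T W') h'"
    and d': "\<And>g \<A>. homeomorphic_map (subtopology T W') (subtopology T W') g \<Longrightarrow> finite \<A> \<Longrightarrow> (\<forall>A\<in>\<A>. clopenin (subtopology T W') A) \<Longrightarrow>
           (\<exists>\<phi>. homeomorphic_map (subtopology T W') (subtopology T W') \<phi> \<and> (\<forall>A\<in>\<A>. h' ` \<phi> ` A = \<phi> ` g ` A))"
    using R(2) unfolding rokhlin_def by (elim exE conjE) (rule that, auto)
  note glue = glue_homeomorphic[OF op W(3,4) op W(3,4)]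
  let ?glue = "\<lambda>f f' x. if x \<in> W then f x else f' x"
  have im: "f ` W = W" "f' ` W' = W'" if "homeomorphic_map (subtopology T W) (subtopology T W) f" "homeomorphic_map (subtopology T W') (subtopology T W') f'" for f f'
    using homeomorphic_image[OF that(1)] homeomorphic_image[OF that(2)] sub by (auto simp: Int_absorb1)
  show ?thesis
    unfolding rokhlin_def
  proof (rule exI[of _ "?glue h h'"], intro conjI allI impI)
    show "homeomorphic_map T T (?glue h h')" by (rule glue[OF h h'])
    fix g \<A> assume g: "homeomorphic_map T T g" and fin: "finite \<A>" and A: "\<forall>A\<in>\<A>. clopenin T A"
    have gW: "homeomorphic_map (subtopology T W) (subtopology T W) g" "homeomorphic_map (subtopology T W') (subtopology T W') g"
      using homeomorphic_restrict(1)[of T "topspace T" T "topspace T" g W] homeomorphic_restrict(1)[of T "topspace T" T "topspace T" g W'] 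
        g sub inv[OF g] inv'[OF g] by simp_all
    have "\<exists>\<phi>. homeomorphic_map (subtopology T W) (subtopology T W) \<phi> \<and> (\<forall>A\<in>(\<lambda>A. A \<inter> W) ` \<A>. h ` \<phi> ` A = \<phi> ` g ` A)"
      by (rule d[OF gW(1)]) (use fin A clopenin_Int[OF _ W(1)] in \<open>auto simp: clopenin_subtopology[OF W(1)]\<close>)
    then obtain \<phi> where p: "homeomorphic_map (subtopology T W) (subtopology T W) \<phi>" "\<forall>A\<in>(\<lambda>A. A \<inter> W) ` \<A>. h ` \<phi> ` A = \<phi> ` g ` A"
      by (elim exE conjE) (rule that)
    have "\<exists>\<phi>. homeomorphic_map (subtopology T W') (subtopology T W') \<phi> \<and> (\<forall>A\<in>(\<lambda>A. A \<inter> W') ` \<A>. h' ` \<phi> ` A = \<phi> ` g ` A)"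
      by (rule d'[OF gW(2)]) (use fin A clopenin_Int[OF _ W(2)] in \<open>auto simp: clopenin_subtopology[OF W(2)]\<close>)
    then obtain \<phi>' where p': "homeomorphic_map (subtopology T W') (subtopology T W') \<phi>'" "\<forall>A\<in>(\<lambda>A. A \<inter> W') ` \<A>. h' ` \<phi>' ` A = \<phi>' ` g ` A"
      by (elim exE conjE) (rule that)
    have gl: "?glue f f' ` A = f ` (A \<inter> W) \<union> f' ` (A \<inter> W')" if "A \<subseteq> topspace T" for f f' :: "'a \<Rightarrow> 'a" and A
      using that W(3,4) by auto
    show "\<exists>\<phi>. homeomorphic_map T T \<phi> \<and> (\<forall>A\<in>\<A>. ?glue h h' ` \<phi> ` A = \<phi> ` g ` A)"
    proof (intro exI[of _ "?glue \<phi> \<phi>'"] conjI ballI)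
      show "homeomorphic_map T T (?glue \<phi> \<phi>')" by (rule glue[OF p(1) p'(1)])
      fix A assume AA: "A \<in> \<A>"
      then have sA: "A \<subseteq> topspace T" using A clopenin_subset by blast
      have 1: "\<phi> ` (A \<inter> W) \<subseteq> W" "\<phi>' ` (A \<inter> W') \<subseteq> W'" using im[OF p(1) p'(1)] by blast+
      then have 2: "(\<phi> ` (A \<inter> W) \<union> \<phi>' ` (A \<inter> W')) \<inter> W = \<phi> ` (A \<inter> W)" "(\<phi> ` (A \<inter> W) \<union> \<phi>' ` (A \<inter> W')) \<inter> W' = \<phi>' ` (A \<inter> W')"
        using W(4) by auto
      have 3: "g ` A \<inter> W = g ` (A \<inter> W)" "g ` A \<inter> W' = g ` (A \<inter> W')"
        using inv[OF g] inv'[OF g] inj_on_image_Int[OF homeomorphic_inj[OF g] sA] sub by metis+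
      have gA: "g ` A \<subseteq> topspace T" using sA homeomorphic_image[OF g] by blast
      have "?glue h h' ` ?glue \<phi> \<phi>' ` A = h ` \<phi> ` (A \<inter> W) \<union> h' ` \<phi>' ` (A \<inter> W')"
        unfolding gl[OF sA] using 1 sub by (subst gl) (auto simp: 2)
      also have "\<dots> = \<phi> ` g ` (A \<inter> W) \<union> \<phi>' ` g ` (A \<inter> W')" using p(2) p'(2) AA by simp
      also have "\<dots> = ?glue \<phi> \<phi>' ` g ` A" unfolding gl[OF gA] 3 ..
      finally show "?glue h h' ` ?glue \<phi> \<phi>' ` A = ?glue \<phi> \<phi>' ` g ` A" .
    qed
  qed
qed

text \<open>A condition \<open>r\<close> will be a finite list of pairs of clopen sets, and \<open>P x r\<close> will say that \<open>x\<close> maps the first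
  member of each pair to the second one. There are only countably many conditions, so one
  representative for each of them that can be satisfied yields a sequence.\<close>

lemma countable_representatives:
  assumes C: "countable C" and x0: "good x0"
  shows "\<exists>e :: nat \<Rightarrow> 'x. (\<forall>k. good (e k)) \<and>
    (\<forall>x r. good x \<longrightarrow> finite r \<longrightarrow> r \<subseteq> C \<times> C \<longrightarrow> P x r \<longrightarrow> (\<exists>k. P (e k) r))"
proof -
  define R where "R = {r. finite r \<and> r \<subseteq> C \<times> C}"
  have "countable (C \<times> C)" by (intro countable_SIGMA C)
  then have cR: "countable R" unfolding R_def by (rule countable_Collect_finite_subset)
  have "{} \<in> R" by (simp add: R_def)
  \<comment> \<open>Conditions that cannot be satisfied get the default value \<open>x0\<close>.\<close>
  define e where "e k = (if \<exists>x. good x \<and> P x (from_nat_into R k) then SOME x. good x \<and> P x (from_nat_into R k) else x0)" for k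
  have e: "good (e k)" for k using x0 someI_ex[of "\<lambda>x. good x \<and> P x (from_nat_into R k)"] by (auto simp: e_def)
  have "\<exists>k. P (e k) r" if x: "good x" "P x r" and r: "r \<in> R" for x r
  proof -
    obtain k where k: "from_nat_into R k = r" using from_nat_into_surj[OF cR r] by blast
    then show ?thesis using someI[of "\<lambda>x. good x \<and> P x (from_nat_into R k)" x] x by (intro exI[of _ k]) (auto simp: e_def)
  qed
  then show ?thesis using e unfolding R_def by (intro exI[of _ e]) auto
qed

section \<open>Cantor space\<close>

lemma topspace_cantor [simp]: "topspace cantor_space = UNIV"
  by (simp add: cantor_space_def)

lemma continuous_map_cantor:
  "continuous_map Z cantor_space f \<longleftrightarrow> (\<forall>i. continuous_map Z (discrete_topology UNIV) (\<lambda>x. f x i))"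
  unfolding cantor_space_def by (rule continuous_map_componentwise_UNIV)

lemma continuous_map_cantor_coord: "continuous_map cantor_space (discrete_topology UNIV) (\<lambda>x. x i)"
  unfolding cantor_space_def by (rule continuous_map_product_projection) simp

definition determined :: "nat \<Rightarrow> (nat \<Rightarrow> bool) set \<Rightarrow> bool" where
  "determined n A \<longleftrightarrow> (\<forall>x y. (\<forall>i<n. x i = y i) \<longrightarrow> x \<in> A \<longrightarrow> y \<in> A)"

lemma determined_mono: "determined n A \<Longrightarrow> n \<le> m \<Longrightarrow> determined m A"
  unfolding determined_def
proof (intro allI impI)
  fix x y
  assume "\<forall>x y. (\<forall>i<n. x i = y i) \<longrightarrow> x \<in> A \<longrightarrow> y \<in> A" "n \<le> m" "\<forall>i<m. x i = y i" "x \<in> A"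
  then show "y \<in> A" by (elim allE[of _ x] allE[of _ y]) auto
qed

lemma openin_cantor:
  assumes U: "openin cantor_space U" "x \<in> U"
  shows "\<exists>n. \<forall>y. (\<forall>i<n. y i = x i) \<longrightarrow> y \<in> U"
proof -
  have 1: "openin (product_topology (\<lambda>_::nat. discrete_topology (UNIV :: bool set)) UNIV) U" using U(1) by (simp add: cantor_space_def)
  have 2: "\<exists>W. finite {i \<in> UNIV. W i \<noteq> topspace (discrete_topology (UNIV :: bool set))} \<and> (\<forall>i\<in>UNIV. openin (discrete_topology UNIV) (W i)) \<and> x \<in> Pi\<^sub>E UNIV W \<and> Pi\<^sub>E UNIV W \<subseteq> U"
    using 1[unfolded openin_product_topology_alt] U(2) by (rule bspec)
  then obtain W where W0: "finite {i \<in> UNIV. W i \<noteq> topspace (discrete_topology (UNIV :: bool set))}" and W: "x \<in> Pi\<^sub>E UNIV W" "Pi\<^sub>E UNIV W \<subseteq> U" by (elim exE conjE) (rule that)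
  have "finite {i. W i \<noteq> UNIV}" using W0 by simp
  then obtain n where n: "\<And>i. W i \<noteq> UNIV \<Longrightarrow> i < n"
    using finite_nat_set_iff_bounded[of "{i. W i \<noteq> UNIV}"] by auto
  have "y \<in> U" if y: "\<forall>i<n. y i = x i" for y
  proof -
    have "y i \<in> W i" for i using n[of i] y W(1) by (cases "W i = UNIV") auto
    then show ?thesis using W(2) by auto
  qed
  then show ?thesis by blast
qed

lemma openin_cylinder: "openin cantor_space {y. \<forall>i<n. y i = x i}"
proof -
  have 1: "openin cantor_space {y. y i = x i}" for i
    using openin_continuous_map_preimage[OF continuous_map_cantor_coord, of "{x i}" i] by simp
  have "openin cantor_space (UNIV \<inter> (\<Inter>i\<in>{..<n}. {y. y i = x i}))"
    using 1 by (induction n) (auto simp: lessThan_Suc Int_left_commute intro: openin_Int openin_topspace[of cantor_space, simplified])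
  moreover have "UNIV \<inter> (\<Inter>i\<in>{..<n}. {y. y i = x i}) = {y. \<forall>i<n. y i = x i}" by auto
  ultimately show ?thesis by simp
qed

lemma compact_cantor: "compact_space cantor_space"
  unfolding cantor_space_def by (simp add: compact_space_product_topology compact_space_discrete_topology)

text \<open>Compactness: finitely many cylinders, each contained in \<open>A\<close> or disjoint from \<open>A\<close>, cover the space.\<close>

lemma clopen_determined:
  assumes A: "clopenin cantor_space A"
  shows "\<exists>n. determined n A"
proof -
  have co: "openin cantor_space A" "openin cantor_space (UNIV - A)" using A by (auto simp: clopenin_def closedin_def)
  have "\<exists>n. \<forall>y z. (\<forall>i<n. y i = x i) \<longrightarrow> (y \<in> A \<longleftrightarrow> x \<in> A)" for x
    using openin_cantor[OF co(1), of x] openin_cantor[OF co(2), of x] by (cases "x \<in> A") auto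
  then obtain N where N: "\<And>x y. (\<forall>i<N x. y i = x i) \<Longrightarrow> (y \<in> A \<longleftrightarrow> x \<in> A)" by metis
  define cyl where "cyl x = {y. \<forall>i<N x. y i = x i}" for x
  have "compactin cantor_space UNIV" using compact_cantor by (simp add: compact_space_def)
  then obtain \<F> where F: "finite \<F>" "\<F> \<subseteq> range cyl" "UNIV \<subseteq> \<Union>\<F>"
  proof (rule compactinD[THEN exE])
    show "openin cantor_space U" if "U \<in> range cyl" for U using that openin_cylinder unfolding cyl_def by auto
    show "UNIV \<subseteq> \<Union> (range cyl)" unfolding cyl_def by auto
  qed auto
  obtain I where I: "finite I" "\<F> = cyl ` I" using finite_subset_image[OF F(1,2)] by auto
  obtain M where M: "\<forall>x\<in>I. N x \<le> M" using I(1) by (meson Max_ge finite_imageI imageI)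
  have "determined M A"
    unfolding determined_def
  proof (intro allI impI)
    fix x y assume xy: "\<forall>i<M. x i = y i" "x \<in> A"
    obtain z where z: "z \<in> I" "x \<in> cyl z" using F(3) I(2) by blast
    then have "\<forall>i<N z. x i = z i" by (simp add: cyl_def)
    moreover have "\<forall>i<N z. y i = z i" using calculation xy(1) M z(1) by (metis less_le_trans)
    ultimately show "y \<in> A" using N[of z x] N[of z y] xy(2) by simp
  qed
  then show ?thesis ..
qed

lemma countable_clopen_cantor: "countable {A. clopenin cantor_space A}"
proof -
  define f where "f = (\<lambda>(n, L). {x :: nat \<Rightarrow> bool. map x [0..<n] \<in> L})"
  have "{A. clopenin cantor_space A} \<subseteq> f ` (UNIV \<times> {L. finite L})"
  proof
    fix A assume "A \<in> {A. clopenin cantor_space A}"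
    then obtain n where n: "determined n A" using clopen_determined by blast
    define L where "L = (\<lambda>x. map x [0..<n]) ` A"
    have "L \<subseteq> {xs. set xs \<subseteq> UNIV \<and> length xs = n}" by (auto simp: L_def)
    then have "finite L" by (rule finite_subset) (rule finite_lists_length_eq, simp)
    moreover have "A = f (n, L)"
    proof
      show "A \<subseteq> f (n, L)" by (auto simp: f_def L_def)
      show "f (n, L) \<subseteq> A"
      proof
        fix x assume "x \<in> f (n, L)"
        then obtain y where y: "y \<in> A" "map x [0..<n] = map y [0..<n]" by (auto simp: f_def L_def)
        then have "\<forall>i<n. y i = x i" by (auto simp: map_eq_conv)
        then show "x \<in> A" using n y(1) unfolding determined_def by blast
      qed
    qed
    ultimately show "A \<in> f ` (UNIV \<times> {L. finite L})" by blast
  qed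
  moreover have "countable (f ` (UNIV \<times> {L. finite L}))"
    by (intro countable_image countable_SIGMA countableI_type countable_Collect_finite)
  ultimately show ?thesis by (rule countable_subset)
qed

text \<open>The initial values of \<open>s\<close> and their positions occupy a finite set, in which equally many places
  and values remain. These are matched, and all other numbers are fixed.\<close>

lemma bij_extending:
  fixes s :: "nat \<Rightarrow> nat"
  assumes "inj s" shows "\<exists>\<sigma>. bij \<sigma> \<and> (\<forall>j<n. \<sigma> j = s j)"
proof -
  define F where "F = {..<n} \<union> s ` {..<n}"
  have fin: "finite F" by (simp add: F_def)
  have "card (F - {..<n}) = card (F - s ` {..<n})"
    using fin assms by (simp add: card_Diff_subset F_def card_image inj_on_subset[OF assms])
  then obtain b where b: "bij_betw b (F - {..<n}) (F - s ` {..<n})"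
    using finite_same_card_bij[of "F - {..<n}" "F - s ` {..<n}"] fin by blast
  have s: "bij_betw s {..<n} (s ` {..<n})" using inj_on_subset[OF assms, of "{..<n}"] by (simp add: bij_betw_def)
  have "bij_betw (\<lambda>j. if j \<in> {..<n} then s j else b j) ({..<n} \<union> (F - {..<n})) (s ` {..<n} \<union> (F - s ` {..<n}))"
    by (rule bij_betw_disjoint_Un[OF s b]) auto
  moreover have "{..<n} \<union> (F - {..<n}) = F" "s ` {..<n} \<union> (F - s ` {..<n}) = F" by (auto simp: F_def)
  ultimately have F: "bij_betw (\<lambda>j. if j \<in> {..<n} then s j else b j) F F" by simp
  have "bij_betw (\<lambda>j. if j \<in> F then (if j \<in> {..<n} then s j else b j) else j) (F \<union> (- F)) (F \<union> (- F))"
    by (rule bij_betw_disjoint_Un[OF F]) (auto simp: bij_betw_def inj_on_def)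
  then have "bij (\<lambda>j. if j \<in> F then (if j \<in> {..<n} then s j else b j) else j)" by simp
  then show ?thesis by (intro exI conjI) (auto simp: F_def)
qed

text \<open>Splitting the coordinates into the blocks \<open>{prod_encode (k, j) | j. True}\<close> identifies Cantor space
  with a countable power of itself.\<close>

definition slice :: "nat \<Rightarrow> (nat \<Rightarrow> bool) \<Rightarrow> nat \<Rightarrow> bool" where
  "slice k x j = x (prod_encode (k, j))"

definition slicewise :: "(nat \<Rightarrow> (nat \<Rightarrow> bool) \<Rightarrow> (nat \<Rightarrow> bool)) \<Rightarrow> (nat \<Rightarrow> bool) \<Rightarrow> nat \<Rightarrow> bool" where
  "slicewise g x i = g (fst (prod_decode i)) (slice (fst (prod_decode i)) x) (snd (prod_decode i))"

lemma slice_slicewise: "slice k (slicewise g x) = g k (slice k x)"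
proof
  fix j
  show "slice k (slicewise g x) j = g k (slice k x) j" unfolding slice_def[of k "slicewise g x"] slicewise_def by simp
qed

lemma slice_eqI: "(\<And>k. slice k x = slice k y) \<Longrightarrow> x = y"
proof
  fix i assume a: "\<And>k. slice k x = slice k y"
  have "slice (fst (prod_decode i)) x (snd (prod_decode i)) = slice (fst (prod_decode i)) y (snd (prod_decode i))" using a by simp
  then show "x i = y i" by (simp add: slice_def)
qed

lemma continuous_slice: "continuous_map cantor_space cantor_space (slice k)"
  unfolding continuous_map_cantor slice_def by (intro allI continuous_map_cantor_coord)

lemma continuous_slicewise:
  assumes "\<And>k. continuous_map cantor_space cantor_space (g k)"
  shows "continuous_map cantor_space cantor_space (slicewise g)"
  unfolding continuous_map_cantor
proof
  fix i
  have "continuous_map cantor_space cantor_space (\<lambda>x. g (fst (prod_decode i)) (slice (fst (prod_decode i)) x))"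
    using continuous_map_compose[OF continuous_slice assms] by (simp add: o_def)
  then show "continuous_map cantor_space (discrete_topology UNIV) (\<lambda>x. slicewise g x i)"
    unfolding slicewise_def continuous_map_cantor by (rule spec)
qed

text \<open>The homeomorphism \<open>h\<close> acts on the \<open>k\<close>-th slice as the \<open>k\<close>-th representative \<open>e k\<close>. If \<open>e k\<close> moves the
  given sets as \<open>g\<close> does and these sets depend on the first \<open>n\<close> coordinates, then a permutation of
  the coordinates that moves the first \<open>n\<close> of them into the \<open>k\<close>-th block turns a condition on a point
  into the same condition on its \<open>k\<close>-th slice.\<close>

theorem rokhlin_cantor: "rokhlin cantor_space"
proof -
  let ?C = cantor_space
  define good where "good g \<longleftrightarrow> homeomorphic_map ?C ?C g" for g
  define P where "P g r \<longleftrightarrow> (\<forall>(A, B)\<in>r. g ` A = B)" for g :: "(nat \<Rightarrow> bool) \<Rightarrow> (nat \<Rightarrow> bool)" and r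
  have gid: "good id" by (simp add: good_def)
  obtain e :: "nat \<Rightarrow> (nat \<Rightarrow> bool) \<Rightarrow> nat \<Rightarrow> bool" where "(\<forall>k. good (e k)) \<and> (\<forall>x r. good x \<longrightarrow> finite r \<longrightarrow>
      r \<subseteq> {A. clopenin ?C A} \<times> {A. clopenin ?C A} \<longrightarrow> P x r \<longrightarrow> (\<exists>k. P (e k) r))"
    by (rule exE[OF countable_representatives[OF countable_clopen_cantor, where good = good and P = P, OF gid]])
      (rule that, assumption)
  then have e0: "\<forall>k. good (e k)" and rep0: "\<forall>x r. good x \<longrightarrow> finite r \<longrightarrow>
      r \<subseteq> {A. clopenin ?C A} \<times> {A. clopenin ?C A} \<longrightarrow> P x r \<longrightarrow> (\<exists>k. P (e k) r)"
    by (rule conjunct1, rule conjunct2)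
  have e: "good (e k)" for k using e0 by simp
  have rep: "\<exists>k. P (e k) r" if "good g" "finite r" "r \<subseteq> {A. clopenin ?C A} \<times> {A. clopenin ?C A}" "P g r" for g r
    using rep0 that by simp
  have "\<exists>k'. homeomorphic_map ?C ?C k' \<and> (\<forall>x. k' (e k x) = x) \<and> (\<forall>y. e k (k' y) = y)" for k
  proof -
    have ek: "homeomorphic_map ?C ?C (e k)" using e by (simp add: good_def)
    obtain k' where "homeomorphic_map ?C ?C k'" "\<And>x. x \<in> topspace ?C \<Longrightarrow> k' (e k x) = x" "\<And>y. y \<in> topspace ?C \<Longrightarrow> e k (k' y) = y"
      using homeomorphic_inverse[OF ek] by metis
    then show ?thesis by (intro exI[of _ k']) simp
  qed
  then obtain e' where e': "\<And>k. homeomorphic_map ?C ?C (e' k)" "\<And>k x. e' k (e k x) = x" "\<And>k x. e k (e' k x) = x" by metis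
  define h where "h = slicewise e"
  have ce: "continuous_map ?C ?C (e k)" "continuous_map ?C ?C (e' k)" for k
    using homeomorphic_imp_continuous_map[of ?C ?C] e[unfolded good_def] e'(1) by blast+
  have "homeomorphic_maps ?C ?C h (slicewise e')"
    unfolding homeomorphic_maps_def h_def
  proof (intro conjI ballI)
    show "continuous_map ?C ?C (slicewise e)" "continuous_map ?C ?C (slicewise e')"
      by (rule continuous_slicewise[OF ce(1)], rule continuous_slicewise[OF ce(2)])
    fix x
    show "slicewise e' (slicewise e x) = x" by (rule slice_eqI) (simp only: slice_slicewise e')
    show "slicewise e (slicewise e' x) = x" by (rule slice_eqI) (simp only: slice_slicewise e')
  qed
  then have h: "homeomorphic_map ?C ?C h" using homeomorphic_maps_map by blast
  have hsurj: "\<exists>w. h w = z" for z using homeomorphic_image[OF h] unfolding topspace_cantor by (metis surjD)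
  show ?thesis
    unfolding rokhlin_def
  proof (rule exI[of _ h], intro conjI h allI impI)
    fix g \<A> assume g: "homeomorphic_map ?C ?C g" and fin: "finite \<A>" and A: "\<forall>A\<in>\<A>. clopenin ?C A"
    have "\<exists>k. P (e k) ((\<lambda>A. (A, g ` A)) ` \<A>)"
      by (rule rep[of g]) (use g fin A homeomorphic_clopenin[OF g] in \<open>auto simp: good_def P_def\<close>)
    then obtain k where k0: "P (e k) ((\<lambda>A. (A, g ` A)) ` \<A>)" by (rule exE)
    have k: "e k ` A = g ` A" if "A \<in> \<A>" for A using k0 that unfolding P_def by simp
    have "\<forall>A\<in>\<A>. \<exists>n. determined n A \<and> determined n (g ` A)"
    proof
      fix A assume AA: "A \<in> \<A>"
      obtain n where "determined n A" using clopen_determined[of A] A AA by blast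
      moreover obtain m where "determined m (g ` A)" using clopen_determined[OF homeomorphic_clopenin[OF g]] A AA by blast
      ultimately show "\<exists>n. determined n A \<and> determined n (g ` A)"
        using determined_mono by (intro exI[of _ "max n m"]) auto
    qed
    then obtain N where N: "\<And>A. A \<in> \<A> \<Longrightarrow> determined (N A) A \<and> determined (N A) (g ` A)" by metis
    obtain n where n: "\<forall>A\<in>\<A>. N A \<le> n" using fin by (meson Max_ge finite_imageI imageI)
    \<comment> \<open>The first \<open>n\<close> coordinates go to the first \<open>n\<close> positions of the \<open>k\<close>-th block.\<close>
    have "inj (\<lambda>j. prod_encode (k, j))" by (simp add: inj_def prod_encode_eq)
    then obtain \<sigma> where s: "bij \<sigma>" "\<And>j. j < n \<Longrightarrow> \<sigma> j = prod_encode (k, j)" using bij_extending by metis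
    define \<phi> where "\<phi> x = (\<lambda>i. x (inv_into UNIV \<sigma> i))" for x :: "nat \<Rightarrow> bool"
    define \<phi>' where "\<phi>' x = (\<lambda>i. x (\<sigma> i))" for x :: "nat \<Rightarrow> bool"
    have inv: "\<phi>' (\<phi> x) = x" "\<phi> (\<phi>' x) = x" for x
      using s(1) by (auto simp: \<phi>_def \<phi>'_def bij_is_inj bij_is_surj surj_f_inv_f)
    have "homeomorphic_maps ?C ?C \<phi> \<phi>'"
      unfolding homeomorphic_maps_def using inv continuous_map_cantor_coord
      by (auto simp: continuous_map_cantor \<phi>_def \<phi>'_def)
    then have p: "homeomorphic_map ?C ?C \<phi>" using homeomorphic_maps_map by blast
    have slice: "slice k (\<phi> x) j = x j" if "j < n" for x j
      using s that by (simp add: slice_def \<phi>_def bij_is_inj inv_f_f flip: s(2))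
    have img: "\<phi> ` B = {z. slice k z \<in> B}" if B: "determined n B" for B
    proof (intro equalityI subsetI)
      fix z assume "z \<in> \<phi> ` B"
      then obtain x where x: "x \<in> B" "z = \<phi> x" by blast
      then have "slice k z \<in> B" using B[unfolded determined_def, rule_format, of x "slice k z"] slice by simp
      then show "z \<in> {z. slice k z \<in> B}" by simp
    next
      fix z assume "z \<in> {z. slice k z \<in> B}"
      then have "slice k (\<phi> (\<phi>' z)) \<in> B" using inv by simp
      then have "\<phi>' z \<in> B"
        using B[unfolded determined_def, rule_format, of "slice k (\<phi> (\<phi>' z))" "\<phi>' z"] slice by simp
      then show "z \<in> \<phi> ` B" using inv(2)[of z] by (metis imageI)
    qed
    show "\<exists>\<phi>. homeomorphic_map ?C ?C \<phi> \<and> (\<forall>A\<in>\<A>. h ` \<phi> ` A = \<phi> ` g ` A)"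
    proof (intro exI[of _ \<phi>] conjI ballI p)
      fix A assume AA: "A \<in> \<A>"
      have dt: "determined n A" "determined n (g ` A)" using N[OF AA] n AA determined_mono by blast+
      have "h ` {z. slice k z \<in> A} = {z. slice k z \<in> e k ` A}"
      proof (intro equalityI subsetI)
        fix z assume "z \<in> h ` {z. slice k z \<in> A}"
        then show "z \<in> {z. slice k z \<in> e k ` A}" by (auto simp: h_def slice_slicewise)
      next
        fix z assume z: "z \<in> {z. slice k z \<in> e k ` A}"
        obtain w where w: "h w = z" using hsurj by blast
        have "slice k z = e k (slice k w)" using slice_slicewise[of k e w] w by (simp add: h_def)
        then have "e k (slice k w) \<in> e k ` A" using z by simp
        then obtain a where "a \<in> A" "e k (slice k w) = e k a" by blast
        then have "slice k w \<in> A" using e'(2) by metis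
        then show "z \<in> h ` {z. slice k z \<in> A}" using w by blast
      qed
      then show "h ` \<phi> ` A = \<phi> ` g ` A" unfolding img[OF dt(1)] img[OF dt(2)] k[OF AA] .
    qed
  qed
qed

section \<open>Spaces that are self-similar at a point\<close>

locale zero_dimensional =
  fixes E :: "'e topology"
  assumes compact_E: "compact_space E" and Hausdorff_E: "Hausdorff_space E"
    and zero_dim: "openin E U \<Longrightarrow> x \<in> U \<Longrightarrow> \<exists>A. clopenin E A \<and> x \<in> A \<and> A \<subseteq> U"
    and countable_clopen: "countable {A. clopenin E A}"

text \<open>The guiding example is a countable space in which \<open>\<mu>\<close> is the unique maximal end: everything away
  from \<open>\<mu>\<close> reappears arbitrarily close to \<open>\<mu>\<close>.\<close>

locale selfsimilar = zero_dimensional E for E :: "'e topology" +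
  fixes \<mu> :: 'e
  assumes \<mu>_in: "\<mu> \<in> topspace E"
    and \<mu>_fixed: "homeomorphic_map E E g \<Longrightarrow> g \<mu> = \<mu>"
    and embeds: "clopenin E D \<Longrightarrow> \<mu> \<notin> D \<Longrightarrow> clopenin E U \<Longrightarrow> \<mu> \<in> U \<Longrightarrow>
      \<exists>W. clopenin E W \<and> W \<subseteq> U \<and> \<mu> \<notin> W \<and> subtopology E D homeomorphic_space subtopology E W"
begin

definition small :: "'e set \<Rightarrow> bool" where
  "small D \<longleftrightarrow> clopenin E D \<and> \<mu> \<notin> D"

text \<open>Disjoint clopen sets that converge to \<open>\<mu>\<close>.\<close>

definition null_family :: "(nat \<Rightarrow> 'e set) \<Rightarrow> bool" where
  "null_family W \<longleftrightarrow> (\<forall>i. small (W i)) \<and> disjoint_family W \<and>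
     (\<forall>U. clopenin E U \<longrightarrow> \<mu> \<in> U \<longrightarrow> finite {i. \<not> W i \<subseteq> U})"

lemma small_clopenin: "small D \<Longrightarrow> clopenin E D" and small_subset: "small D \<Longrightarrow> D \<subseteq> topspace E"
  using clopenin_subset by (auto simp: small_def)

lemma small_Un: "small A \<Longrightarrow> small B \<Longrightarrow> small (A \<union> B)"
  by (simp add: small_def clopenin_Un)

lemma small_sub: "small A \<Longrightarrow> clopenin E B \<Longrightarrow> B \<subseteq> A \<Longrightarrow> small B"
  by (auto simp: small_def)

lemma small_compl: "small D \<Longrightarrow> clopenin E (topspace E - D) \<and> \<mu> \<in> topspace E - D"
  using \<mu>_in by (simp add: small_def clopenin_diff)

text \<open>Finite intersections of the countably many clopen neighbourhoods of \<open>\<mu>\<close>.\<close>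

lemma nbhd_base:
  obtains B :: "nat \<Rightarrow> 'e set" where "\<And>n. clopenin E (B n)" "\<And>n. \<mu> \<in> B n" 
    "\<And>U. clopenin E U \<Longrightarrow> \<mu> \<in> U \<Longrightarrow> \<exists>n. \<forall>m\<ge>n. B m \<subseteq> U"
proof -
  define N where "N = {A. clopenin E A \<and> \<mu> \<in> A}"
  have cN: "countable N" unfolding N_def by (rule countable_subset[OF _ countable_clopen]) auto
  have ne: "N \<noteq> {}" using \<mu>_in clopenin_topspace unfolding N_def by blast
  define B where "B n = \<Inter>(from_nat_into N ` {..n})" for n
  have c: "clopenin E (from_nat_into N i) \<and> \<mu> \<in> from_nat_into N i" for i
    using from_nat_into[OF ne, of i] by (simp add: N_def)
  have "clopenin E (B n)" for n
  proof (induction n)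
    case 0 then show ?case using c[of 0] by (simp add: B_def)
  next
    case (Suc n)
    have eq: "B (Suc n) = from_nat_into N (Suc n) \<inter> B n" by (simp add: B_def atMost_Suc)
    show ?case unfolding eq by (rule clopenin_Int) (use Suc c in auto)
  qed
  moreover have "\<mu> \<in> B n" for n using c by (simp add: B_def)
  moreover have "\<exists>n. \<forall>m\<ge>n. B m \<subseteq> U" if "clopenin E U" "\<mu> \<in> U" for U
  proof -
    have "U \<in> N" using that by (simp add: N_def)
    then obtain n where "from_nat_into N n = U" using from_nat_into_surj[OF cN] by blast
    then show ?thesis by (intro exI[of _ n]) (auto simp: B_def)
  qed
  ultimately show thesis using that by blast
qed

text \<open>The copies are chosen one after the other, the \<open>n\<close>-th one inside the \<open>n\<close>-th basic neighbourhood of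
  \<open>\<mu>\<close> and outside the clopen set \<open>Z n\<close> formed by \<open>B\<close> and the previous copies, which misses \<open>\<mu>\<close>.\<close>

lemma null_copies:
  assumes D: "\<And>i. small (D i)" and B: "small B"
  obtains W where "null_family W" "\<And>i. W i \<inter> B = {}"
    "\<And>i. subtopology E (D i) homeomorphic_space subtopology E (W i)"
proof -
  obtain N :: "nat \<Rightarrow> 'e set" where N: "\<And>n. clopenin E (N n)" "\<And>n. \<mu> \<in> N n"
    "\<And>U. clopenin E U \<Longrightarrow> \<mu> \<in> U \<Longrightarrow> \<exists>n. \<forall>m\<ge>n. N m \<subseteq> U" using nbhd_base by metis
  have ex: "\<exists>W. small W \<and> W \<subseteq> N n \<and> W \<inter> Z = {} \<and> subtopology E (D n) homeomorphic_space subtopology E W"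
    if "small Z" for n :: nat and Z
  proof -
    have "clopenin E (N n - Z)" "\<mu> \<in> N n - Z" using N that by (auto simp: small_def clopenin_diff)
    then obtain W where "clopenin E W \<and> W \<subseteq> N n - Z \<and> \<mu> \<notin> W \<and> subtopology E (D n) homeomorphic_space subtopology E W"
      using embeds[of "D n" "N n - Z"] D unfolding small_def by blast
    then show ?thesis unfolding small_def by blast
  qed
  define pick where "pick n Z = (SOME W. small W \<and> W \<subseteq> N n \<and> W \<inter> Z = {} \<and> subtopology E (D n) homeomorphic_space subtopology E W)" for n :: nat and Z
  have pick: "small (pick n Z) \<and> pick n Z \<subseteq> N n \<and> pick n Z \<inter> Z = {} \<and> subtopology E (D n) homeomorphic_space subtopology E (pick n Z)"
    if "small Z" for n :: nat and Z using someI_ex[OF ex[OF that, of n]] unfolding pick_def .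
  define Z where "Z = rec_nat B (\<lambda>n Z. Z \<union> pick n Z)"
  have Z: "Z 0 = B" "Z (Suc n) = Z n \<union> pick n (Z n)" for n by (simp_all add: Z_def)
  have sZ: "small (Z n)" for n by (induction n) (use B pick in \<open>auto simp: Z intro: small_Un\<close>)
  define W where "W n = pick n (Z n)" for n
  have W: "small (W n)" "W n \<subseteq> N n" "W n \<inter> Z n = {}" "subtopology E (D n) homeomorphic_space subtopology E (W n)" for n
    using pick[OF sZ[of n], of n] by (simp_all add: W_def)
  have Zmono: "Z m \<subseteq> Z n" if "m \<le> n" for m n
    using that by (induction n rule: dec_induct) (auto simp: Z)
  have WZ: "W m \<subseteq> Z n" if "m < n" for m n
    using Zmono[of "Suc m" n] that by (auto simp: Z W_def)
  have "disjoint_family W"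
    unfolding disjoint_family_on_def
  proof (intro ballI impI)
    fix m n :: nat assume "m \<noteq> n"
    then consider "m < n" | "n < m" by linarith
    then show "W m \<inter> W n = {}" using WZ[of m n] WZ[of n m] W(3)[of n] W(3)[of m] by cases blast+
  qed
  moreover have "finite {i. \<not> W i \<subseteq> U}" if U: "clopenin E U" "\<mu> \<in> U" for U
  proof -
    obtain n where n: "\<forall>m\<ge>n. N m \<subseteq> U" using N(3)[OF U] by blast
    have "{i. \<not> W i \<subseteq> U} \<subseteq> {..<n}"
    proof
      fix i assume i: "i \<in> {i. \<not> W i \<subseteq> U}"
      show "i \<in> {..<n}"
      proof (rule ccontr)
        assume "i \<notin> {..<n}"
        then have "N i \<subseteq> U" using n by simp
        then show False using i W(2)[of i] by blast
      qed
    qed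
    then show ?thesis using finite_subset by blast
  qed
  ultimately have "null_family W" using W(1) by (simp add: null_family_def)
  moreover have "W i \<inter> B = {}" for i using W(3)[of i] Zmono[of 0 i] Z(1) by blast
  ultimately show thesis using that W(4) by blast
qed

text \<open>Continuity is an issue only at \<open>\<mu>\<close>. A neighbourhood of \<open>\<mu>\<close> contains \<open>P i\<close> and \<open>Q i\<close> for all but
  finitely many \<open>i\<close>, and the remaining \<open>P i\<close> are clopen and can be removed from it.\<close>

lemma null_map:
  assumes P: "null_family P" and Q: "null_family Q"
    and k: "\<And>i. homeomorphic_map (subtopology E (P i)) (subtopology E (Q i)) (k i)"
    and off: "\<And>i. Q i \<inter> (topspace E - (\<Union>i. P i)) = {}"
  obtains \<Psi> where "homeomorphic_map E (subtopology E ((topspace E - (\<Union>i. P i)) \<union> (\<Union>i. Q i))) \<Psi>"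
    "\<And>i x. x \<in> P i \<Longrightarrow> \<Psi> x = k i x" "\<And>x. x \<in> topspace E - (\<Union>i. P i) \<Longrightarrow> \<Psi> x = x"
proof -
  define \<Psi> where "\<Psi> x = (if \<exists>i. x \<in> P i then k (THE i. x \<in> P i) x else x)" for x
  have sP: "small (P i)" and sQ: "small (Q i)" for i using P Q by (auto simp: null_family_def)
  have dP: "i = j" if "x \<in> P i" "x \<in> P j" for x i j
    using P that unfolding null_family_def disjoint_family_on_def by blast
  have dQ: "i = j" if "x \<in> Q i" "x \<in> Q j" for x i j
    using Q that unfolding null_family_def disjoint_family_on_def by blast
  have \<Psi>P: "\<Psi> x = k i x" if "x \<in> P i" for x i
  proof -
    have "(THE i. x \<in> P i) = i" using that dP by blast
    then show ?thesis using that by (auto simp: \<Psi>_def)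
  qed
  have \<Psi>o: "\<Psi> x = x" if "x \<notin> (\<Union>i. P i)" for x using that by (simp add: \<Psi>_def)
  have tP: "topspace (subtopology E (P i)) = P i" "topspace (subtopology E (Q i)) = Q i" for i
    using small_subset[OF sP] small_subset[OF sQ] by (auto simp: Int_absorb1)
  have kim: "k i ` P i = Q i" and kinj: "inj_on (k i) (P i)" for i
    using homeomorphic_image[OF k[of i]] homeomorphic_inj[OF k[of i]] tP by auto
  have \<Psi>Q: "\<Psi> x \<in> Q i" if "x \<in> P i" for x i using \<Psi>P[OF that] kim that by auto
  have \<mu>P: "\<mu> \<notin> (\<Union>i. P i)" using sP by (auto simp: small_def)
  have cont: "continuous_map E E \<Psi>"
    unfolding continuous_map_def
  proof (intro conjI allI impI)
    show "\<Psi> \<in> topspace E \<rightarrow> topspace E"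
    proof
      fix x assume x: "x \<in> topspace E"
      show "\<Psi> x \<in> topspace E"
      proof (cases "x \<in> (\<Union>i. P i)")
        case True then show ?thesis using \<Psi>Q small_subset[OF sQ] by blast
      next
        case False then show ?thesis using \<Psi>o x by simp
      qed
    qed
    fix U assume U: "openin E U"
    have "\<exists>A. openin E A \<and> x \<in> A \<and> A \<subseteq> {x \<in> topspace E. \<Psi> x \<in> U}" if x: "x \<in> topspace E" "\<Psi> x \<in> U" for x
    proof (cases "x \<in> (\<Union>i. P i)")
      case True
      then obtain i where i: "x \<in> P i" by blast
      let ?A = "{z \<in> topspace (subtopology E (P i)). k i z \<in> U \<inter> Q i}"
      have "openin (subtopology E (Q i)) (U \<inter> Q i)" using U by (auto simp: openin_subtopology)
      then have "openin (subtopology E (P i)) ?A"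
        using openin_continuous_map_preimage[OF homeomorphic_imp_continuous_map[OF k]] by blast
      then have "openin E ?A" using openin_open_subtopology sP[of i] by (auto simp: small_def clopenin_def)
      moreover have "x \<in> ?A" using i x \<Psi>P[OF i] \<Psi>Q[OF i] tP by auto
      moreover have "?A \<subseteq> {x \<in> topspace E. \<Psi> x \<in> U}" using \<Psi>P[of _ i] tP(1)[of i] small_subset[OF sP[of i]] by auto
      ultimately show ?thesis by blast
    next
      case False
      have xU: "x \<in> U" using x \<Psi>o[OF False] by simp
      obtain C where C: "clopenin E C" "x \<in> C" "C \<subseteq> U" using zero_dim[OF U xU] by blast
      \<comment> \<open>If \<open>\<mu> \<notin> C\<close>, the sets \<open>P i \<subseteq> V\<close> do not meet \<open>C\<close>, and \<open>\<Psi>\<close> is the identity on \<open>A\<close>.\<close>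
      define V where "V = (if \<mu> \<in> C then C else topspace E - C)"
      have V: "clopenin E V" "\<mu> \<in> V" using C \<mu>_in by (auto simp: V_def clopenin_diff)
      have fin: "finite {i. \<not> P i \<subseteq> V}" "finite {i. \<not> Q i \<subseteq> V}" using P Q V unfolding null_family_def by blast+
      define A where "A = C - \<Union>(P ` ({i. \<not> P i \<subseteq> V} \<union> {i. \<not> Q i \<subseteq> V}))"
      have "clopenin E (\<Union>(P ` ({i. \<not> P i \<subseteq> V} \<union> {i. \<not> Q i \<subseteq> V})))"
        using fin small_clopenin[OF sP] by (intro clopenin_Union) auto
      then have "clopenin E A" unfolding A_def using C(1) clopenin_diff by blast
      moreover have "x \<in> A" using C False by (auto simp: A_def)
      moreover have "A \<subseteq> {x \<in> topspace E. \<Psi> x \<in> U}"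
      proof
        fix z assume z: "z \<in> A"
        then have zC: "z \<in> C" "z \<in> topspace E" using clopenin_subset[OF C(1)] by (auto simp: A_def)
        have "\<Psi> z \<in> C"
        proof (cases "z \<in> (\<Union>i. P i)")
          case True
          then obtain i where i: "z \<in> P i" by blast
          then have PV: "P i \<subseteq> V" "Q i \<subseteq> V" using z by (auto simp: A_def)
          have "V = C" using PV(1) i zC by (auto simp: V_def split: if_splits)
          then show ?thesis using \<Psi>Q[OF i] PV(2) by blast
        next
          case False then show ?thesis using \<Psi>o zC by simp
        qed
        then show "z \<in> {x \<in> topspace E. \<Psi> x \<in> U}" using zC C(3) by blast
      qed
      ultimately show ?thesis unfolding clopenin_def by blast
    qed
    then show "openin E {x \<in> topspace E. \<Psi> x \<in> U}" by (subst openin_subopen) blast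
  qed
  have inj: "inj_on \<Psi> (topspace E)"
  proof (rule inj_onI)
    fix x y assume xy: "x \<in> topspace E" "y \<in> topspace E" "\<Psi> x = \<Psi> y"
    have no: False if "a \<in> P i" "b \<in> topspace E" "b \<notin> (\<Union>i. P i)" "\<Psi> a = \<Psi> b" for a b i
      using \<Psi>Q[OF that(1)] \<Psi>o[OF that(3)] off[of i] that by auto
    consider i j where "x \<in> P i" "y \<in> P j" | "x \<notin> (\<Union>i. P i)" "y \<notin> (\<Union>i. P i)"
      using no[of x _ y] no[of y _ x] xy by (metis UN_E)
    then show "x = y"
    proof cases
      case (1 i j)
      then have "i = j" using dQ[of "\<Psi> x" i j] \<Psi>Q xy(3) by metis
      then show ?thesis using 1 kinj[of i] \<Psi>P xy(3) by (metis inj_onD)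
    next
      case 2 then show ?thesis using \<Psi>o xy(3) by simp
    qed
  qed
  have img: "\<Psi> ` topspace E = (topspace E - (\<Union>i. P i)) \<union> (\<Union>i. Q i)"
  proof (intro equalityI subsetI)
    fix y assume "y \<in> \<Psi> ` topspace E"
    then obtain x where x: "x \<in> topspace E" "y = \<Psi> x" by blast
    show "y \<in> (topspace E - (\<Union>i. P i)) \<union> (\<Union>i. Q i)"
    proof (cases "x \<in> (\<Union>i. P i)")
      case True then show ?thesis using \<Psi>Q x by blast
    next
      case False then show ?thesis using \<Psi>o x by simp
    qed
  next
    fix y assume "y \<in> (topspace E - (\<Union>i. P i)) \<union> (\<Union>i. Q i)"
    then consider "y \<in> topspace E" "y \<notin> (\<Union>i. P i)" | i where "y \<in> Q i" by blast
    then show "y \<in> \<Psi> ` topspace E"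
    proof cases
      case 1 then show ?thesis using \<Psi>o[of y] by (metis imageI)
    next
      case (2 i)
      then obtain x where "x \<in> P i" "y = k i x" using kim[of i] by blast
      then show ?thesis using \<Psi>P[of x i] small_subset[OF sP[of i]] by (metis imageI subsetD)
    qed
  qed
  have "embedding_map E E \<Psi>" by (rule continuous_imp_embedding_map[OF cont compact_E Hausdorff_E inj])
  then have "homeomorphic_map E (subtopology E (\<Psi> ` topspace E)) \<Psi>" by (simp add: embedding_map_def)
  then show thesis using that[of \<Psi>] \<Psi>P \<Psi>o unfolding img by blast
qed

text \<open>Hilbert's hotel: \<open>D\<close> moves to the first set of a null family of copies of \<open>D\<close>, and each copy to the next.\<close>

lemma absorb:
  assumes D: "small D"
  shows "E homeomorphic_space subtopology E (topspace E - D)"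
proof -
  obtain W where W: "null_family W" "\<And>i. W i \<inter> D = {}"
    "\<And>i. subtopology E D homeomorphic_space subtopology E (W i)"
    using null_copies[of "\<lambda>_. D" D] D by metis
  have sW: "small (W i)" for i using W(1) by (simp add: null_family_def)
  define P where "P i = (case i of 0 \<Rightarrow> D | Suc j \<Rightarrow> W j)" for i
  have P0: "P 0 = D" "P (Suc j) = W j" for j by (simp_all add: P_def)
  have "subtopology E (P i) homeomorphic_space subtopology E (W i)" for i
  proof (cases i)
    case 0 then show ?thesis using W(3) P0 by simp
  next
    case (Suc j)
    have "subtopology E (W j) homeomorphic_space subtopology E D" using W(3)[of j] homeomorphic_space_sym by blast
    then show ?thesis using W(3)[of i] homeomorphic_space_trans Suc P0 by metis
  qed
  then have "\<exists>k. homeomorphic_map (subtopology E (P i)) (subtopology E (W i)) k" for i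
    using homeomorphic_space by blast
  then obtain k where k: "\<And>i. homeomorphic_map (subtopology E (P i)) (subtopology E (W i)) (k i)" by metis
  have UP: "(\<Union>i. P i) = D \<union> (\<Union>i. W i)"
  proof (intro equalityI subsetI)
    fix x assume "x \<in> (\<Union>i. P i)"
    then obtain i where "x \<in> P i" by blast
    then show "x \<in> D \<union> (\<Union>i. W i)" by (cases i) (auto simp: P0)
  next
    fix x assume "x \<in> D \<union> (\<Union>i. W i)"
    then show "x \<in> (\<Union>i. P i)" using P0 by (metis UN_iff UnE UNIV_I)
  qed
  have "null_family P"
    unfolding null_family_def
  proof (intro conjI allI impI)
    show "small (P i)" for i using D sW by (cases i) (auto simp: P0)
    show "disjoint_family P"
      unfolding disjoint_family_on_def
    proof (intro ballI impI)
      fix i j :: nat assume "i \<noteq> j"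
      moreover have "W a \<inter> W b = {}" if "a \<noteq> b" for a b using W(1) that by (auto simp: null_family_def disjoint_family_on_def)
      ultimately show "P i \<inter> P j = {}" using W(2) by (cases i; cases j) (auto simp: P0)
    qed
    fix U assume U: "clopenin E U" "\<mu> \<in> U"
    have "{i. \<not> P i \<subseteq> U} \<subseteq> insert 0 (Suc ` {i. \<not> W i \<subseteq> U})"
    proof
      fix i assume "i \<in> {i. \<not> P i \<subseteq> U}"
      then show "i \<in> insert 0 (Suc ` {i. \<not> W i \<subseteq> U})" by (cases i) (auto simp: P0)
    qed
    moreover have "finite {i. \<not> W i \<subseteq> U}" using W(1) U by (simp add: null_family_def)
    ultimately show "finite {i. \<not> P i \<subseteq> U}" using finite_subset by blast
  qed
  moreover have "W i \<inter> (topspace E - (\<Union>i. P i)) = {}" for i unfolding UP by blast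
  ultimately obtain \<Psi> where "homeomorphic_map E (subtopology E ((topspace E - (\<Union>i. P i)) \<union> (\<Union>i. W i))) \<Psi>"
    using null_map[OF _ W(1) k] by metis
  moreover have "(topspace E - (\<Union>i. P i)) \<union> (\<Union>i. W i) = topspace E - D"
    unfolding UP using W(2) small_subset[OF sW] by blast
  ultimately show ?thesis using homeomorphic_space by metis
qed

text \<open>The complements of \<open>D\<close> and of \<open>D'\<close> are both homeomorphic to \<open>E\<close>.\<close>

lemma extend_homeomorphism:
  assumes D: "small D" and D': "small D'" and k: "homeomorphic_map (subtopology E D) (subtopology E D') k"
  obtains \<phi> where "homeomorphic_map E E \<phi>" "\<And>x. x \<in> D \<Longrightarrow> \<phi> x = k x"
proof -
  have "subtopology E (topspace E - D) homeomorphic_space subtopology E (topspace E - D')"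
    using absorb[OF D] absorb[OF D'] homeomorphic_space_sym homeomorphic_space_trans by metis
  then obtain j where j: "homeomorphic_map (subtopology E (topspace E - D)) (subtopology E (topspace E - D')) j"
    using homeomorphic_space by blast
  have op: "openin E D" "openin E (topspace E - D)" "openin E D'" "openin E (topspace E - D')"
    using D D' small_compl[OF D] small_compl[OF D'] by (auto simp: small_def clopenin_def)
  have "homeomorphic_map E E (\<lambda>x. if x \<in> D then k x else j x)"
    by (rule glue_homeomorphic[OF op(1,2) _ _ op(3,4) _ _ k j]) (use small_subset[OF D] small_subset[OF D'] in auto)
  then show thesis using that by simp
qed

text \<open>A homeomorphism between two clopen sets missing \<open>\<mu>\<close> extends to a permutation of a larger
  one: after adding a copy of \<open>D \<inter> D'\<close>, the two complements become copies of \<open>D'\<close> and \<open>D\<close>.\<close>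

lemma extend_within:
  assumes D: "small D" and D': "small D'" and f: "homeomorphic_map (subtopology E D) (subtopology E D') f"
  obtains Q F where "small Q" "D \<subseteq> Q" "D' \<subseteq> Q" "homeomorphic_map (subtopology E Q) (subtopology E Q) F" "\<And>x. x \<in> D \<Longrightarrow> F x = f x"
proof -
  have cl: "clopenin E D" "clopenin E D'" using D D' by (auto simp: small_def)
  have "small (D \<inter> D')" using small_sub[OF D] clopenin_Int[OF cl] by blast
  then obtain Z where Z: "clopenin E Z" "Z \<subseteq> topspace E - (D \<union> D')" "\<mu> \<notin> Z"
     "subtopology E (D \<inter> D') homeomorphic_space subtopology E Z"
    using embeds[of "D \<inter> D'" "topspace E - (D \<union> D')"] small_compl[OF small_Un[OF D D']] unfolding small_def by blast
  define Q where "Q = D \<union> D' \<union> Z"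
  have Q: "small Q" unfolding Q_def using D D' Z by (intro small_Un) (auto simp: small_def)
  have Z': "subtopology E Z homeomorphic_space subtopology E (D \<inter> D')" using Z(4) homeomorphic_space_sym by blast
  have 1: "subtopology E ((D' - D) \<union> Z) homeomorphic_space subtopology E ((D' - D) \<union> (D \<inter> D'))"
    by (rule homeomorphic_space_disjoint_Un) (use cl Z Z' in \<open>auto simp: clopenin_diff clopenin_Int homeomorphic_space_refl\<close>)
  have 2: "subtopology E ((D - D') \<union> (D \<inter> D')) homeomorphic_space subtopology E ((D - D') \<union> Z)"
    by (rule homeomorphic_space_disjoint_Un) (use cl Z in \<open>auto simp: clopenin_diff clopenin_Int homeomorphic_space_refl\<close>)
  have e: "(D' - D) \<union> (D \<inter> D') = D'" "(D - D') \<union> (D \<inter> D') = D" by auto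
  have "subtopology E D' homeomorphic_space subtopology E D" using f homeomorphic_space homeomorphic_space_sym by blast
  then have "subtopology E ((D' - D) \<union> Z) homeomorphic_space subtopology E ((D - D') \<union> Z)"
    using 1 2 unfolding e using homeomorphic_space_trans by blast
  then obtain j where j: "homeomorphic_map (subtopology E ((D' - D) \<union> Z)) (subtopology E ((D - D') \<union> Z)) j"
    using homeomorphic_space by blast
  have sub: "D \<subseteq> Q" "(D' - D) \<union> Z \<subseteq> Q" "D' \<subseteq> Q" "(D - D') \<union> Z \<subseteq> Q" by (auto simp: Q_def)
  have c: "clopenin E ((D' - D) \<union> Z)" "clopenin E ((D - D') \<union> Z)" using cl Z by (auto simp: clopenin_diff clopenin_Un)
  have "homeomorphic_map (subtopology E Q) (subtopology E Q) (\<lambda>x. if x \<in> D then f x else j x)"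
  proof (rule glue_homeomorphic)
    show "openin (subtopology E Q) D" "openin (subtopology E Q) ((D' - D) \<union> Z)"
      "openin (subtopology E Q) D'" "openin (subtopology E Q) ((D - D') \<union> Z)"
      using clopenin_subset_subtopology[OF cl(1) sub(1)] clopenin_subset_subtopology[OF c(1) sub(2)]
        clopenin_subset_subtopology[OF cl(2) sub(3)] clopenin_subset_subtopology[OF c(2) sub(4)] by (auto simp: clopenin_def)
    have tQ: "topspace (subtopology E Q) = Q" using small_subset[OF Q] by (simp add: Int_absorb1)
    show "D \<union> ((D' - D) \<union> Z) = topspace (subtopology E Q)" "D' \<union> ((D - D') \<union> Z) = topspace (subtopology E Q)"
      unfolding tQ by (auto simp: Q_def)
    show "D \<inter> ((D' - D) \<union> Z) = {}" "D' \<inter> ((D - D') \<union> Z) = {}" using Z(2) by auto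
    show "homeomorphic_map (subtopology (subtopology E Q) D) (subtopology (subtopology E Q) D') f"
      using f sub by (simp add: subtopology_subtopology Int_absorb1)
    show "homeomorphic_map (subtopology (subtopology E Q) ((D' - D) \<union> Z)) (subtopology (subtopology E Q) ((D - D') \<union> Z)) j"
      using j sub by (simp add: subtopology_subtopology Int_absorb1 del: Un_subset_iff)
  qed
  then show thesis using that[OF Q sub(1,3)] by simp
qed

text \<open>The representatives are pairs \<open>(Q, F)\<close> of a clopen set missing \<open>\<mu>\<close> and a homeomorphism of it. The
  homeomorphism \<open>h\<close> acts as \<open>F k\<close> on a copy \<open>W k\<close> of \<open>Q k\<close>, where the copies form a null family, and
  fixes the rest. A given \<open>g\<close> fixes \<open>\<mu>\<close>; restricted to a clopen set missing \<open>\<mu>\<close> it is therefore part of such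
  a pair, and the homeomorphism \<open>Q k \<rightarrow> W k\<close> extends to the required \<open>\<phi>\<close>.\<close>

theorem rokhlin: "rokhlin E"
proof -
  define good where "good QF \<longleftrightarrow> small (fst QF) \<and> homeomorphic_map (subtopology E (fst QF)) (subtopology E (fst QF)) (snd QF)" for QF :: "'e set \<times> ('e \<Rightarrow> 'e)"
  define R where "R QF r \<longleftrightarrow> (\<forall>(A, B)\<in>r. A \<subseteq> fst QF \<and> snd QF ` A = B)" for QF :: "'e set \<times> ('e \<Rightarrow> 'e)" and r
  have g0: "good ({}, id)" by (simp add: good_def small_def)
  obtain e :: "nat \<Rightarrow> 'e set \<times> ('e \<Rightarrow> 'e)" where "(\<forall>k. good (e k)) \<and> (\<forall>x r. good x \<longrightarrow> finite r \<longrightarrow>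
      r \<subseteq> {A. clopenin E A} \<times> {A. clopenin E A} \<longrightarrow> R x r \<longrightarrow> (\<exists>k. R (e k) r))"
    by (rule exE[OF countable_representatives[OF countable_clopen, where good = good and P = R, OF g0]])
      (rule that, assumption)
  then have e: "\<forall>k. good (e k)" and rep: "\<forall>x r. good x \<longrightarrow> finite r \<longrightarrow>
      r \<subseteq> {A. clopenin E A} \<times> {A. clopenin E A} \<longrightarrow> R x r \<longrightarrow> (\<exists>k. R (e k) r)"
    by (rule conjunct1, rule conjunct2)
  define Q where "Q k = fst (e k)" for k
  define F where "F k = snd (e k)" for k
  have Q: "small (Q k)" and F: "homeomorphic_map (subtopology E (Q k)) (subtopology E (Q k)) (F k)" for k
    using e by (simp_all add: good_def Q_def F_def)
  have s0: "small {}" by (simp add: small_def)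
  obtain W where W: "null_family W" "\<And>i. subtopology E (Q i) homeomorphic_space subtopology E (W i)"
    using null_copies[of Q "{}"] Q s0 by metis
  have sW: "small (W i)" for i using W(1) by (simp add: null_family_def)
  have "\<exists>k. homeomorphic_map (subtopology E (Q i)) (subtopology E (W i)) k" for i
    using W(2)[of i] homeomorphic_space by blast
  then obtain \<iota> where i: "\<And>i. homeomorphic_map (subtopology E (Q i)) (subtopology E (W i)) (\<iota> i)" by metis
  have tQ: "topspace (subtopology E (Q i)) = Q i" for i using small_subset[OF Q] by (simp add: Int_absorb1)
  have "\<exists>k. homeomorphic_map (subtopology E (W i)) (subtopology E (Q i)) k \<and> (\<forall>x\<in>Q i. k (\<iota> i x) = x)" for i
    using homeomorphic_inverse[OF i[of i]] unfolding tQ by metis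
  then obtain \<kappa> where k: "\<And>i. homeomorphic_map (subtopology E (W i)) (subtopology E (Q i)) (\<kappa> i)"
    "\<And>i x. x \<in> Q i \<Longrightarrow> \<kappa> i (\<iota> i x) = x" by metis
  have hW: "homeomorphic_map (subtopology E (W i)) (subtopology E (W i)) (\<iota> i \<circ> (F i \<circ> \<kappa> i))" for i
    by (rule homeomorphic_map_compose[OF homeomorphic_map_compose[OF k(1) F] i])
  have "W i \<inter> (topspace E - (\<Union>i. W i)) = {}" for i by blast
  then obtain h where h0: "homeomorphic_map E (subtopology E ((topspace E - (\<Union>i. W i)) \<union> (\<Union>i. W i))) h"
    and hx: "\<And>i x. x \<in> W i \<Longrightarrow> h x = (\<iota> i \<circ> (F i \<circ> \<kappa> i)) x"
    using null_map[OF W(1) W(1) hW] by metis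
  have "(topspace E - (\<Union>i. W i)) \<union> (\<Union>i. W i) = topspace E" using small_subset[OF sW] by blast
  then have h: "homeomorphic_map E E h" using h0 by simp
  show ?thesis
    unfolding rokhlin_def
  proof (rule exI[of _ h], intro conjI h allI impI)
    fix g \<A> assume g: "homeomorphic_map E E g" and fin: "finite \<A>" and A: "\<forall>A\<in>\<A>. clopenin E A"
    \<comment> \<open>The images of a set and of its complement determine each other, so the sets may be assumed to miss \<open>\<mu>\<close>.\<close>
    define c where "c A = (if \<mu> \<in> A then topspace E - A else A)" for A
    have sc: "small (c A)" if "A \<in> \<A>" for A using A that \<mu>_in by (simp add: c_def small_def clopenin_diff)
    define D where "D = \<Union>(c ` \<A>)"
    have sD: "small D" using sc fin by (auto simp: small_def D_def intro: clopenin_Union)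
    have cD: "c A \<subseteq> D" if "A \<in> \<A>" for A using that by (auto simp: D_def)
    have gD: "homeomorphic_map (subtopology E D) (subtopology E (g ` D)) g"
      using homeomorphic_restrict(1)[of E "topspace E" E "topspace E" g D] g small_subset[OF sD] by simp
    have cl: "clopenin E (g ` B)" if "clopenin E B" for B using homeomorphic_clopenin[OF g that] .
    have "\<mu> \<notin> g ` D"
    proof
      assume "\<mu> \<in> g ` D"
      then obtain x where "x \<in> D" "g x = g \<mu>" using \<mu>_fixed[OF g] by auto
      then have "x = \<mu>" using inj_onD[OF homeomorphic_inj[OF g]] small_subset[OF sD] \<mu>_in by blast
      then show False using \<open>x \<in> D\<close> sD by (simp add: small_def)
    qed
    then have sgD: "small (g ` D)" using cl sD by (simp add: small_def)
    obtain Q0 F0 where Q0: "small Q0" "D \<subseteq> Q0" "g ` D \<subseteq> Q0" "homeomorphic_map (subtopology E Q0) (subtopology E Q0) F0"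
      "\<And>x. x \<in> D \<Longrightarrow> F0 x = g x" using extend_within[OF sD sgD gD] by metis
    let ?r = "(\<lambda>A. (c A, g ` c A)) ` \<A>"
    have "R (Q0, F0) ?r"
      unfolding R_def
    proof (clarsimp, intro conjI)
      fix A assume AA: "A \<in> \<A>"
      show "c A \<subseteq> Q0" using cD[OF AA] Q0(2) by blast
      show "F0 ` c A = g ` c A" using cD[OF AA] Q0(5) by (intro image_cong) auto
    qed
    moreover have "good (Q0, F0)" using Q0 by (simp add: good_def)
    moreover have "finite ?r" using fin by simp
    moreover have "?r \<subseteq> {A. clopenin E A} \<times> {A. clopenin E A}" using sc cl by (auto simp: small_def)
    ultimately have "\<exists>k. R (e k) ?r" using rep by simp
    then obtain k where "R (e k) ?r" by (rule exE)
    then have kA: "c A \<subseteq> Q k" "F k ` c A = g ` c A" if "A \<in> \<A>" for A using that by (auto simp: R_def Q_def F_def)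
    obtain \<phi> where p: "homeomorphic_map E E \<phi>" "\<And>x. x \<in> Q k \<Longrightarrow> \<phi> x = \<iota> k x"
      using extend_homeomorphism[OF Q sW i] by metis
    have key: "h ` \<phi> ` c A = \<phi> ` g ` c A" if AA: "A \<in> \<A>" for A
    proof -
      have gQ: "g ` c A \<subseteq> Q k"
        using homeomorphic_image[OF F[of k]] kA[OF AA] unfolding tQ by blast
      have "h (\<phi> x) = \<iota> k (F k x)" if x: "x \<in> c A" for x
      proof -
        have xQ: "x \<in> Q k" using kA(1)[OF AA] x by blast
        have "\<iota> k x \<in> W k" using homeomorphic_image[OF i[of k]] xQ small_subset[OF sW[of k]] unfolding tQ by auto
        then show ?thesis using hx[of "\<iota> k x" k] k(2)[OF xQ] p(2)[OF xQ] by simp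
      qed
      then have "h ` \<phi> ` c A = \<iota> k ` F k ` c A" unfolding image_image by (intro image_cong) auto
      also have "\<dots> = \<iota> k ` g ` c A" using kA(2)[OF AA] by simp
      also have "\<dots> = \<phi> ` g ` c A" using p(2) gQ by (intro image_cong) auto
      finally show ?thesis .
    qed
    have compl: "u ` v ` (topspace E - B) = topspace E - u ` v ` B" if "homeomorphic_map E E u" "homeomorphic_map E E v" "B \<subseteq> topspace E" for u v B
    proof -
      have uv: "homeomorphic_map E E (u \<circ> v)" using homeomorphic_map_compose[OF that(2,1)] .
      have "(u \<circ> v) ` (topspace E - B) = (u \<circ> v) ` topspace E - (u \<circ> v) ` B"
        by (rule inj_on_image_set_diff[OF homeomorphic_inj[OF uv]]) (use that(3) in auto)
      then show ?thesis using homeomorphic_image[OF uv] by (simp add: image_comp)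
    qed
    show "\<exists>\<phi>. homeomorphic_map E E \<phi> \<and> (\<forall>A\<in>\<A>. h ` \<phi> ` A = \<phi> ` g ` A)"
    proof (rule exI[of _ \<phi>], intro conjI ballI p(1))
      fix A assume AA: "A \<in> \<A>"
      have sA: "A \<subseteq> topspace E" using A AA clopenin_subset by blast
      show "h ` \<phi> ` A = \<phi> ` g ` A"
      proof (cases "\<mu> \<in> A")
        case True
        then have "h ` \<phi> ` (topspace E - A) = \<phi> ` g ` (topspace E - A)" using key[OF AA] by (simp add: c_def)
        then have "topspace E - h ` \<phi> ` A = topspace E - \<phi> ` g ` A"
          using compl[OF h p(1) sA] compl[OF p(1) g sA] by simp
        moreover have "h ` \<phi> ` A \<subseteq> topspace E" "\<phi> ` g ` A \<subseteq> topspace E"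
          using sA homeomorphic_image[OF h] homeomorphic_image[OF p(1)] homeomorphic_image[OF g] by blast+
        ultimately show ?thesis by blast
      next
        case False then show ?thesis using key[OF AA] by (simp add: c_def)
      qed
    qed
  qed
qed

end

section \<open>Countable spaces with a unique maximal end\<close>

context zero_dimensional
begin

text \<open>The preorder of ends in terms of clopen neighbourhoods alone, see \<open>end_le_iff\<close>.\<close>

definition clopen_le :: "'e \<Rightarrow> 'e \<Rightarrow> bool" where
  "clopen_le \<nu> \<nu>' \<longleftrightarrow> (\<forall>U. clopenin E U \<longrightarrow> \<nu>' \<in> U \<longrightarrow>
     (\<exists>N W. clopenin E N \<and> \<nu> \<in> N \<and> clopenin E W \<and> W \<subseteq> U \<and> subtopology E N homeomorphic_space subtopology E W))"

lemma clopen_image: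
  assumes k: "homeomorphic_map (subtopology E D) (subtopology E D') k" and D: "D \<subseteq> topspace E" "clopenin E D'"
    and A: "clopenin E A" "A \<subseteq> D"
  shows "clopenin E (k ` A)" "k ` A \<subseteq> D'" "homeomorphic_map (subtopology E A) (subtopology E (k ` A)) k"
proof -
  have "clopenin (subtopology E D) A" using clopenin_subset_subtopology A by blast
  then have "clopenin (subtopology E D') (k ` A)" by (rule homeomorphic_clopenin[OF k])
  then show "clopenin E (k ` A)" "k ` A \<subseteq> D'" using clopenin_subtopology[OF D(2)] by auto
  show "homeomorphic_map (subtopology E A) (subtopology E (k ` A)) k"
    by (rule homeomorphic_restrict(1)[OF k D(1) clopenin_subset[OF D(2)] A(2)])
qed

lemma nbhd_clopen:
  assumes "nbhd E x V" obtains N where "clopenin E N" "x \<in> N" "N \<subseteq> V"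
proof -
  have "x \<in> E interior_of V" using assms by (simp add: nbhd_def)
  then obtain N where "clopenin E N" "x \<in> N" "N \<subseteq> E interior_of V" using zero_dim[OF openin_interior_of] by blast
  then show thesis using that interior_of_subset[of E V] by blast
qed

lemma clopen_nbhd: "clopenin E N \<Longrightarrow> x \<in> N \<Longrightarrow> nbhd E x N"
  using clopenin_subset[of E N] interior_of_openin[of E N] by (simp add: nbhd_def clopenin_def)

lemma end_le_iff: "end_le E \<nu> \<nu>' \<longleftrightarrow> clopen_le \<nu> \<nu>'"
proof
  assume le: "end_le E \<nu> \<nu>'"
  show "clopen_le \<nu> \<nu>'"
    unfolding clopen_le_def
  proof (intro allI impI)
    fix U assume U: "clopenin E U" "\<nu>' \<in> U"
    obtain V W where V: "nbhd E \<nu> V" and W: "W \<subseteq> U" "openin E W" "closedin E W"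
      "subtopology E V homeomorphic_space subtopology E W"
      using le clopen_nbhd[OF U] unfolding end_le_def by blast
    obtain k where k: "homeomorphic_map (subtopology E V) (subtopology E W) k" using W(4) homeomorphic_space by blast
    have VW: "V \<subseteq> topspace E" "clopenin E W" using V W by (auto simp: nbhd_def clopenin_def)
    obtain N where N: "clopenin E N" "\<nu> \<in> N" "N \<subseteq> V" using nbhd_clopen[OF V] by metis
    have "subtopology E N homeomorphic_space subtopology E (k ` N)"
      using clopen_image(3)[OF k VW N(1,3)] homeomorphic_space by blast
    then show "\<exists>N W. clopenin E N \<and> \<nu> \<in> N \<and> clopenin E W \<and> W \<subseteq> U \<and> subtopology E N homeomorphic_space subtopology E W"
      using N clopen_image(1,2)[OF k VW N(1,3)] W(1) by (intro exI[of _ N] exI[of _ "k ` N"]) auto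
  qed
next
  assume le: "clopen_le \<nu> \<nu>'"
  show "end_le E \<nu> \<nu>'"
    unfolding end_le_def
  proof (intro allI impI)
    fix U assume U: "nbhd E \<nu>' U"
    obtain C where C: "clopenin E C" "\<nu>' \<in> C" "C \<subseteq> U" using nbhd_clopen[OF U] by metis
    obtain N W where NW: "clopenin E N" "\<nu> \<in> N" "clopenin E W" "W \<subseteq> C" "subtopology E N homeomorphic_space subtopology E W"
      using le[unfolded clopen_le_def, rule_format, OF C(1,2)] by (elim exE conjE) (rule that)
    then show "\<exists>V W. nbhd E \<nu> V \<and> W \<subseteq> U \<and> openin E W \<and> closedin E W \<and> subtopology E V homeomorphic_space subtopology E W"
      using C(3) clopen_nbhd[OF NW(1,2)] by (intro exI[of _ N] exI[of _ W]) (auto simp: clopenin_def)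
  qed
qed

lemma clopen_le_refl: "clopen_le \<nu> \<nu>"
  unfolding clopen_le_def using homeomorphic_space_refl by blast

lemma clopen_le_trans:
  assumes "clopen_le x y" "clopen_le y z" shows "clopen_le x z"
  unfolding clopen_le_def
proof (intro allI impI)
  fix U assume U: "clopenin E U" "z \<in> U"
  obtain N W where NW: "clopenin E N" "y \<in> N" "clopenin E W" "W \<subseteq> U" "subtopology E N homeomorphic_space subtopology E W"
    using assms(2)[unfolded clopen_le_def, rule_format, OF U] by (elim exE conjE) (rule that)
  obtain M Z where MZ: "clopenin E M" "x \<in> M" "clopenin E Z" "Z \<subseteq> N" "subtopology E M homeomorphic_space subtopology E Z"
    using assms(1)[unfolded clopen_le_def, rule_format, OF NW(1,2)] by (elim exE conjE) (rule that)
  obtain k where k: "homeomorphic_map (subtopology E N) (subtopology E W) k" using NW(5) homeomorphic_space by blast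
  note ci = clopen_image[OF k clopenin_subset[OF NW(1)] NW(3) MZ(3,4)]
  have "subtopology E Z homeomorphic_space subtopology E (k ` Z)" using ci(3) homeomorphic_space by blast
  then have "subtopology E M homeomorphic_space subtopology E (k ` Z)" using MZ(5) homeomorphic_space_trans by blast
  then show "\<exists>N W. clopenin E N \<and> x \<in> N \<and> clopenin E W \<and> W \<subseteq> U \<and> subtopology E N homeomorphic_space subtopology E W"
    using MZ ci NW(4) by (intro exI[of _ M] exI[of _ "k ` Z"]) auto
qed

text \<open>The condition on \<open>x\<close> concerns each clopen neighbourhood of \<open>x\<close>, and a clopen set is a neighbourhood
  of all its points.\<close>

lemma closedin_above: "closedin E {x \<in> topspace E. clopen_le \<nu> x}"
proof -
  have "\<exists>U. openin E U \<and> x \<in> U \<and> U \<subseteq> topspace E - {x \<in> topspace E. clopen_le \<nu> x}"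
    if "x \<in> topspace E - {x \<in> topspace E. clopen_le \<nu> x}" for x
  proof -
    have "\<not> clopen_le \<nu> x" using that by blast
    then obtain U where U: "clopenin E U" "x \<in> U"
      "\<not> (\<exists>N W. clopenin E N \<and> \<nu> \<in> N \<and> clopenin E W \<and> W \<subseteq> U \<and> subtopology E N homeomorphic_space subtopology E W)"
      unfolding clopen_le_def by blast
    have "\<not> clopen_le \<nu> y" if "y \<in> U" for y
      using U(3) U(1) that unfolding clopen_le_def by blast
    then show ?thesis using U clopenin_subset[OF U(1)] by (intro exI[of _ U]) (auto simp: clopenin_def)
  qed
  then have "openin E (topspace E - {x \<in> topspace E. clopen_le \<nu> x})" by (subst openin_subopen) blast
  then show ?thesis unfolding closedin_def by blast
qed

text \<open>Run through the countably many ends and climb whenever possible. The sets of ends above the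
  members \<open>s k\<close> of the chain are closed and nested, so some end \<open>x\<close> is above all of them. An end above
  \<open>x\<close> was reached when its turn came and is therefore below \<open>x\<close>.\<close>

lemma maximal_above:
  assumes cnt: "countable (topspace E)" and \<nu>: "\<nu> \<in> topspace E"
  shows "\<exists>x. clopen_le \<nu> x \<and> maximal_end E x"
proof -
  define e where "e = from_nat_into (topspace E)"
  define s where "s = rec_nat \<nu> (\<lambda>k x. if clopen_le x (e k) then e k else x)"
  have s: "s 0 = \<nu>" "s (Suc k) = (if clopen_le (s k) (e k) then e k else s k)" for k by (simp_all add: s_def)
  have e_in: "e k \<in> topspace E" for k
    unfolding e_def by (rule from_nat_into) (use \<nu> in blast)
  have s_in: "s k \<in> topspace E" for k by (induction k) (use \<nu> e_in in \<open>auto simp: s\<close>)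
  have step: "clopen_le (s k) (s (Suc k))" for k using clopen_le_refl by (auto simp: s)
  define C where "C k = {x \<in> topspace E. clopen_le (s k) x}" for k
  have "(\<Inter>k. C k) \<noteq> {}"
  proof (rule compact_space_imp_nest[OF compact_E])
    show "closedin E (C k)" for k unfolding C_def by (rule closedin_above)
    show "C k \<noteq> {}" for k using s_in[of k] clopen_le_refl[of "s k"] by (auto simp: C_def)
    show "decseq C" unfolding decseq_Suc_iff C_def using clopen_le_trans[OF step] by blast
  qed
  then obtain x where x: "\<And>k. x \<in> C k" by blast
  have "clopen_le y x" if y: "y \<in> topspace E" "clopen_le x y" for y
  proof -
    obtain k where k: "e k = y" using from_nat_into_surj[OF cnt y(1)] by (auto simp: e_def)
    have "clopen_le (s k) x" using x[of k] by (simp add: C_def)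
    then have "clopen_le (s k) y" using y(2) by (rule clopen_le_trans)
    then have "s (Suc k) = y" using k by (simp add: s)
    then show ?thesis using x[of "Suc k"] by (simp add: C_def)
  qed
  then have "maximal_end E x" using x[of 0] by (simp add: maximal_end_def end_equiv_def end_le_iff C_def)
  then show ?thesis using x[of 0] s(1) by (auto simp: C_def)
qed

text \<open>A nonempty closed set without isolated points is perfect, hence has at least the cardinality of the
  continuum.\<close>

lemma countable_isolated:
  assumes B: "closedin E B" "B \<noteq> {}" "countable B"
  shows "\<exists>x\<in>B. \<exists>T. openin E T \<and> x \<in> T \<and> T \<inter> B \<subseteq> {x}"
proof (rule ccontr)
  assume con: "\<not> ?thesis"
  have sub: "B \<subseteq> topspace E" using B(1) closedin_subset by blast
  have "E derived_set_of B = B"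
  proof
    show "E derived_set_of B \<subseteq> B" using B(1) by (simp add: closedin_contains_derived_set)
    show "B \<subseteq> E derived_set_of B"
    proof
      fix x assume x: "x \<in> B"
      have "\<exists>y. y \<noteq> x \<and> y \<in> B \<and> y \<in> T" if T: "openin E T" "x \<in> T" for T
      proof (rule ccontr)
        assume "\<nexists>y. y \<noteq> x \<and> y \<in> B \<and> y \<in> T"
        then have "T \<inter> B \<subseteq> {x}" by blast
        then show False using con x T by blast
      qed
      then show "x \<in> E derived_set_of B" using x sub by (auto simp: in_derived_set_of)
    qed
  qed
  moreover have "locally_compact_space E" using compact_E by (rule compact_imp_locally_compact_space)
  ultimately have "(UNIV :: real set) \<lesssim> B" by (intro lepoll_perfect_set) (use Hausdorff_E B(2) in auto)
  then have "countable (UNIV :: real set)" using B(3) countable_lepoll by blast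
  then show False using uncountable_UNIV_real by blast
qed

text \<open>Let \<open>P D\<close> say that \<open>D\<close> has clopen copies missing \<open>\<mu>\<close> in every neighbourhood of \<open>\<mu>\<close>. By compactness, a
  clopen set \<open>D\<close> missing \<open>\<mu>\<close> and violating \<open>P\<close> contains points all of whose clopen neighbourhoods violate \<open>P\<close>. These
  form a closed set \<open>B\<close>; let \<open>\<nu>\<close> be isolated in \<open>B\<close>. A small neighbourhood \<open>N\<close> of \<open>\<nu>\<close> consists of a
  neighbourhood \<open>L\<close> of \<open>\<nu>\<close>, which embeds near \<open>\<mu>\<close> because \<open>\<nu> \<preceq> \<mu>\<close>, and of \<open>N - L\<close>, which avoids \<open>B\<close> and
  thus satisfies \<open>P\<close>. The copy of \<open>L\<close> misses \<open>\<mu>\<close>, for the point of \<open>L\<close> mapped to \<open>\<mu>\<close> would be an end above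
  \<open>\<mu>\<close> other than \<open>\<mu>\<close>. So \<open>N\<close> satisfies \<open>P\<close>, a contradiction.\<close>

theorem selfsimilar_if_unique_maximal:
  assumes cnt: "countable (topspace E)" and uniq: "\<exists>!\<mu>. maximal_end E \<mu>"
  shows "\<exists>\<mu>. selfsimilar E \<mu>"
proof -
  obtain \<mu> where m: "maximal_end E \<mu>" and u: "\<And>x. maximal_end E x \<Longrightarrow> x = \<mu>" using uniq by blast
  have m_in: "\<mu> \<in> topspace E" using m by (simp add: maximal_end_def)
  have top: "clopen_le x \<mu>" if "x \<in> topspace E" for x using maximal_above[OF cnt that] u by blast
  have only: "x = \<mu>" if "x \<in> topspace E" "clopen_le \<mu> x" for x
  proof (rule u)
    show "maximal_end E x"
      unfolding maximal_end_def end_equiv_def end_le_iff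
      using that top clopen_le_trans by blast
  qed
  have fixed: "g \<mu> = \<mu>" if g: "homeomorphic_map E E g" for g
  proof (rule only)
    show "g \<mu> \<in> topspace E" using homeomorphic_image[OF g] m_in by blast
    obtain g' where g': "homeomorphic_map E E g'" "\<And>x. x \<in> topspace E \<Longrightarrow> g' (g x) = x" "\<And>x. x \<in> topspace E \<Longrightarrow> g (g' x) = x"
      using homeomorphic_inverse[OF g] by metis
    show "clopen_le \<mu> (g \<mu>)"
      unfolding clopen_le_def
    proof (intro allI impI)
      fix U assume U: "clopenin E U" "g \<mu> \<in> U"
      have "\<mu> \<in> g' ` U" using g'(2)[OF m_in] U(2) by (metis imageI)
      moreover have "clopenin E (g' ` U)" using homeomorphic_clopenin[OF g'(1) U(1)] .
      moreover have "homeomorphic_map (subtopology E U) (subtopology E (g' ` U)) g'"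
        using homeomorphic_restrict(1)[of E "topspace E" E "topspace E" g' U] g'(1) clopenin_subset[OF U(1)] by simp
      then have "subtopology E (g' ` U) homeomorphic_space subtopology E U" using homeomorphic_space homeomorphic_space_sym by blast
      ultimately show "\<exists>N W. clopenin E N \<and> \<mu> \<in> N \<and> clopenin E W \<and> W \<subseteq> U \<and> subtopology E N homeomorphic_space subtopology E W"
        using U by blast
    qed
  qed
  define P where "P D \<longleftrightarrow> (\<forall>U. clopenin E U \<longrightarrow> \<mu> \<in> U \<longrightarrow>
      (\<exists>W. clopenin E W \<and> W \<subseteq> U \<and> \<mu> \<notin> W \<and> subtopology E D homeomorphic_space subtopology E W))" for D
  have PI: "P D" if "\<And>U. clopenin E U \<Longrightarrow> \<mu> \<in> U \<Longrightarrow>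
      \<exists>W. clopenin E W \<and> W \<subseteq> U \<and> \<mu> \<notin> W \<and> subtopology E D homeomorphic_space subtopology E W" for D
    using that unfolding P_def by blast
  have PD: "\<exists>W. clopenin E W \<and> W \<subseteq> U \<and> \<mu> \<notin> W \<and> subtopology E D homeomorphic_space subtopology E W"
    if "P D" "clopenin E U" "\<mu> \<in> U" for D U using that unfolding P_def by blast
  have P_sub: "P A" if A: "clopenin E A" "A \<subseteq> D" and D: "clopenin E D" "P D" for A D
  proof (rule PI)
    fix U assume U: "clopenin E U" "\<mu> \<in> U"
    obtain W where W: "clopenin E W" "W \<subseteq> U" "\<mu> \<notin> W" "subtopology E D homeomorphic_space subtopology E W"
      using PD[OF D(2) U] by blast
    obtain k where k: "homeomorphic_map (subtopology E D) (subtopology E W) k" using W(4) homeomorphic_space by blast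
    note ci = clopen_image[OF k clopenin_subset[OF D(1)] W(1) A]
    have "subtopology E A homeomorphic_space subtopology E (k ` A)" using ci(3) homeomorphic_space by blast
    then show "\<exists>W. clopenin E W \<and> W \<subseteq> U \<and> \<mu> \<notin> W \<and> subtopology E A homeomorphic_space subtopology E W"
      using ci W by (intro exI[of _ "k ` A"]) auto
  qed
  have P_Un: "P (A \<union> B)" if A: "clopenin E A" "P A" and B: "clopenin E B" "P B" for A B
  proof (rule PI)
    fix U assume U: "clopenin E U" "\<mu> \<in> U"
    have BA: "clopenin E (B - A)" using clopenin_diff A B by blast
    then have PB: "P (B - A)" using P_sub[OF BA _ B] by blast
    obtain W where W: "clopenin E W" "W \<subseteq> U" "\<mu> \<notin> W" "subtopology E A homeomorphic_space subtopology E W"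
      using PD[OF A(2) U] by blast
    have "clopenin E (U - W)" "\<mu> \<in> U - W" using U W clopenin_diff by auto
    from PD[OF PB this] obtain Z where Z: "clopenin E Z" "Z \<subseteq> U - W" "\<mu> \<notin> Z" "subtopology E (B - A) homeomorphic_space subtopology E Z"
      by blast
    have "subtopology E (A \<union> (B - A)) homeomorphic_space subtopology E (W \<union> Z)"
      by (rule homeomorphic_space_disjoint_Un[OF A(1) BA _ W(1) Z(1) _ W(4) Z(4)]) (use Z in auto)
    moreover have "A \<union> (B - A) = A \<union> B" by auto
    ultimately show "\<exists>W. clopenin E W \<and> W \<subseteq> U \<and> \<mu> \<notin> W \<and> subtopology E (A \<union> B) homeomorphic_space subtopology E W"
      using W Z clopenin_Un by (intro exI[of _ "W \<union> Z"]) auto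
  qed
  have P_empty: "P {}" unfolding P_def by (metis clopenin_empty empty_iff empty_subsetI homeomorphic_space_refl)
  have P_finite: "P (\<Union>\<F>)" if "finite \<F>" "\<And>A. A \<in> \<F> \<Longrightarrow> clopenin E A \<and> P A" for \<F>
    using that
  proof (induction \<F> rule: finite_induct)
    case empty then show ?case using P_empty by simp
  next
    case (insert A \<F>)
    have "clopenin E (\<Union>\<F>)" using insert by (intro clopenin_Union) auto
    then show ?case using P_Un[of A "\<Union>\<F>"] insert by simp
  qed
  have embeds: "P D" if D: "clopenin E D" "\<mu> \<notin> D" for D
  proof (rule ccontr)
    assume nP: "\<not> P D"
    define B where "B = {x \<in> D. \<forall>N. clopenin E N \<longrightarrow> x \<in> N \<longrightarrow> \<not> P N}"
    have off: "P C" if C: "clopenin E C" "C \<subseteq> D" "C \<inter> B = {}" for C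
    proof -
      have ex: "\<exists>N. clopenin E N \<and> x \<in> N \<and> P N" if "x \<in> C" for x using C that unfolding B_def by blast
      have "closedin E C" using C(1) by (simp add: clopenin_def)
      then have cc: "compactin E C" using closedin_compact_space[OF compact_E] by blast
      let ?U = "{N. clopenin E N \<and> P N}"
      obtain \<F> where F: "finite \<F>" "\<F> \<subseteq> ?U" "C \<subseteq> \<Union>\<F>"
      proof (rule exE[OF compactinD[OF cc, of ?U]])
        show "openin E N" if "N \<in> ?U" for N using that by (simp add: clopenin_def)
        show "C \<subseteq> \<Union>?U" using ex by blast
      qed (use that in blast)
      have PF: "P (\<Union>\<F>)" using P_finite[OF F(1)] F(2) by blast
      have "clopenin E (\<Union>\<F>)" using F by (intro clopenin_Union) auto
      then show ?thesis using P_sub[OF C(1) F(3) _ PF] by blast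
    qed
    have Bne: "B \<noteq> {}" using off[OF D(1)] nP by blast
    have BD: "B \<subseteq> D" "D \<subseteq> topspace E" using clopenin_subset[OF D(1)] by (auto simp: B_def)
    have "closedin E B"
    proof -
      have "openin E (D - B)"
      proof -
        have "\<exists>T. openin E T \<and> x \<in> T \<and> T \<subseteq> D - B" if "x \<in> D - B" for x
        proof -
          obtain N where N: "clopenin E N" "x \<in> N" "P N" using \<open>x \<in> D - B\<close> unfolding B_def by blast
          then have "N \<inter> B = {}" unfolding B_def by blast
          then show ?thesis using N D that by (intro exI[of _ "D \<inter> N"]) (auto simp: clopenin_def)
        qed
        then show ?thesis by (subst openin_subopen) blast
      qed
      then have "closedin E (D - (D - B))" using D(1) by (intro closedin_diff) (auto simp: clopenin_def)
      moreover have "D - (D - B) = B" using BD by blast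
      ultimately show ?thesis by simp
    qed
    moreover have "countable B" using cnt BD countable_subset by (metis order_trans)
    ultimately obtain \<nu> T where nu: "\<nu> \<in> B" "openin E T" "\<nu> \<in> T" "T \<inter> B \<subseteq> {\<nu>}" using countable_isolated Bne by blast
    have nuD: "\<nu> \<in> D" using nu BD by blast
    have "openin E (T \<inter> D)" using nu(2) D(1) by (auto simp: clopenin_def)
    then obtain N where N: "clopenin E N" "\<nu> \<in> N" "N \<subseteq> T \<inter> D" using zero_dim[of "T \<inter> D" \<nu>] nu(3) nuD by blast
    have "P N"
    proof (rule PI)
      fix U assume U: "clopenin E U" "\<mu> \<in> U"
      obtain M W where MW: "clopenin E M" "\<nu> \<in> M" "clopenin E W" "W \<subseteq> U" "subtopology E M homeomorphic_space subtopology E W"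
        using top[of \<nu>, unfolded clopen_le_def, rule_format, OF _ U] nuD BD by blast
      obtain k where k: "homeomorphic_map (subtopology E M) (subtopology E W) k" using MW(5) homeomorphic_space by blast
      define L where "L = M \<inter> N"
      have L: "clopenin E L" "L \<subseteq> M" "L \<subseteq> N" "\<nu> \<in> L" using MW N clopenin_Int by (auto simp: L_def)
      note ci = clopen_image[OF k clopenin_subset[OF MW(1)] MW(3)]
      have mL: "\<mu> \<notin> k ` L"
      proof
        assume "\<mu> \<in> k ` L"
        then obtain x where x: "x \<in> L" "k x = \<mu>" by blast
        have "clopen_le \<mu> x"
          unfolding clopen_le_def
        proof (intro allI impI)
          fix U' assume U': "clopenin E U'" "x \<in> U'"
          let ?A = "L \<inter> U'"
          have A: "clopenin E ?A" "?A \<subseteq> M" using L U' clopenin_Int by auto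
          have "subtopology E (k ` ?A) homeomorphic_space subtopology E ?A"
            using ci(3)[OF A] homeomorphic_space homeomorphic_space_sym by blast
          moreover have "\<mu> \<in> k ` ?A" using x U' by blast
          ultimately show "\<exists>N W. clopenin E N \<and> \<mu> \<in> N \<and> clopenin E W \<and> W \<subseteq> U' \<and> subtopology E N homeomorphic_space subtopology E W"
            using A(1) ci(1)[OF A] by (intro exI[of _ "k ` ?A"] exI[of _ ?A]) auto
        qed
        then have "x = \<mu>" using only[of x] x(1) L(1) clopenin_subset by blast
        then show False using x(1) L(3) N(3) D(2) by blast
      qed
      have NL: "clopenin E (N - L)" using N(1) L(1) clopenin_diff by blast
      have "P (N - L)" using off[OF NL] N(3) nu(4) L(4) by blast
      moreover have "clopenin E (U - k ` L)" using U(1) ci(1)[OF L(1,2)] clopenin_diff by blast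
      moreover have "\<mu> \<in> U - k ` L" using U(2) mL by blast
      ultimately obtain Z where Z: "clopenin E Z" "Z \<subseteq> U - k ` L" "\<mu> \<notin> Z" "subtopology E (N - L) homeomorphic_space subtopology E Z"
        using PD by blast
      have kL: "subtopology E L homeomorphic_space subtopology E (k ` L)" using ci(3)[OF L(1,2)] homeomorphic_space by blast
      have "subtopology E (L \<union> (N - L)) homeomorphic_space subtopology E (k ` L \<union> Z)"
        by (rule homeomorphic_space_disjoint_Un[OF L(1) NL _ ci(1)[OF L(1,2)] Z(1) _ kL Z(4)]) (use Z in auto)
      moreover have "L \<union> (N - L) = N" using L by blast
      ultimately show "\<exists>W. clopenin E W \<and> W \<subseteq> U \<and> \<mu> \<notin> W \<and> subtopology E N homeomorphic_space subtopology E W"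
        using Z mL MW(4) ci(1,2)[OF L(1,2)] clopenin_Un by (intro exI[of _ "k ` L \<union> Z"]) auto
    qed
    then show False using nu(1) N unfolding B_def by blast
  qed
  have "selfsimilar E \<mu>"
  proof (unfold_locales)
    show "\<mu> \<in> topspace E" by (rule m_in)
    show "g \<mu> = \<mu>" if "homeomorphic_map E E g" for g using fixed that by blast
    show "\<exists>W. clopenin E W \<and> W \<subseteq> U \<and> \<mu> \<notin> W \<and> subtopology E D homeomorphic_space subtopology E W"
      if "clopenin E D" "\<mu> \<notin> D" "clopenin E U" "\<mu> \<in> U" for D U using PD[OF embeds] that by blast
  qed
  then show ?thesis by blast
qed

corollary rokhlin_if_unique_maximal:
  assumes "countable (topspace E)" "\<exists>!\<mu>. maximal_end E \<mu>"
  shows "rokhlin E"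
proof -
  obtain \<mu> where "selfsimilar E \<mu>" using selfsimilar_if_unique_maximal[OF assms] by (rule exE)
  then show ?thesis by (rule selfsimilar.rokhlin)
qed

end

section \<open>Rooted trees and their ends\<close>

lemma finite_nat_bound: "finite A \<Longrightarrow> \<exists>M. \<forall>w\<in>A. f w \<le> (M::nat)"
  by (meson Max_ge finite_imageI imageI)

text \<open>Orienting a tree towards a root makes induction on the depth available.\<close>

locale rooted_tree =
  fixes V :: "'v set" and r :: 'v and par :: "'v \<Rightarrow> 'v" and d :: "'v \<Rightarrow> nat"
  assumes root_in: "r \<in> V"
    and d_zero: "v \<in> V \<Longrightarrow> d v = 0 \<longleftrightarrow> v = r"
    and par_in: "v \<in> V \<Longrightarrow> v \<noteq> r \<Longrightarrow> par v \<in> V"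
    and d_par: "v \<in> V \<Longrightarrow> v \<noteq> r \<Longrightarrow> d v = Suc (d (par v))"
    and finite_children: "v \<in> V \<Longrightarrow> finite {w \<in> V - {r}. par w = v}"
begin

lemma d_root [simp]: "d r = 0"
  using d_zero root_in by blast

lemma not_root: "v \<in> V \<Longrightarrow> 0 < d v \<Longrightarrow> v \<noteq> r"
  by auto

lemma finite_level: "finite {v \<in> V. d v = n}"
proof (induction n)
  case 0
  have "{v \<in> V. d v = 0} \<subseteq> {r}" using d_zero by auto
  then show ?case using finite_subset by blast
next
  case (Suc n)
  have "{v \<in> V. d v = Suc n} \<subseteq> (\<Union>u\<in>{v \<in> V. d v = n}. {w \<in> V - {r}. par w = u})"
  proof
    fix v assume v: "v \<in> {v \<in> V. d v = Suc n}"
    then have "v \<noteq> r" by auto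
    then show "v \<in> (\<Union>u\<in>{v \<in> V. d v = n}. {w \<in> V - {r}. par w = u})"
      using v par_in[of v] d_par[of v] by auto
  qed
  moreover have "finite (\<Union>u\<in>{v \<in> V. d v = n}. {w \<in> V - {r}. par w = u})"
    using Suc finite_children by auto
  ultimately show ?case using finite_subset by blast
qed

lemma finite_upto: "finite {v \<in> V. d v \<le> n}"
proof -
  have "{v \<in> V. d v \<le> n} = (\<Union>k\<le>n. {v \<in> V. d v = k})" by auto
  then show ?thesis using finite_level by simp
qed

text \<open>The subtraction is truncated: \<open>anc n v = v\<close> for \<open>n \<ge> d v\<close>.\<close>

definition anc :: "nat \<Rightarrow> 'v \<Rightarrow> 'v" where
  "anc n v = (par ^^ (d v - n)) v"

lemma anc_self [simp]: "d v \<le> n \<Longrightarrow> anc n v = v"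
  by (simp add: anc_def)

lemma anc_step: "v \<in> V \<Longrightarrow> n < d v \<Longrightarrow> anc n v = anc n (par v)"
proof -
  assume v: "v \<in> V" "n < d v"
  then have "d v = Suc (d (par v))" using d_par not_root by auto
  then have "d v - n = Suc (d (par v) - n)" using v by simp
  then show ?thesis by (simp add: anc_def funpow_swap1)
qed

lemma anc_props: "v \<in> V \<Longrightarrow> anc n v \<in> V \<and> d (anc n v) = min n (d v)"
proof (induction "d v" arbitrary: v)
  case 0 then show ?case by simp
next
  case (Suc k)
  show ?case
  proof (cases "n < d v")
    case False then show ?thesis using Suc by simp
  next
    case True
    have "v \<noteq> r" using Suc by auto
    then have "par v \<in> V" "d v = Suc (d (par v))" using Suc par_in d_par by auto
    then show ?thesis using Suc(1)[of "par v"] Suc(2) True anc_step[OF Suc(3) True] by auto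
  qed
qed

lemma anc_in [simp]: "v \<in> V \<Longrightarrow> anc n v \<in> V"
  and d_anc [simp]: "v \<in> V \<Longrightarrow> d (anc n v) = min n (d v)"
  using anc_props by auto

lemma anc_anc: "v \<in> V \<Longrightarrow> n \<le> m \<Longrightarrow> anc n (anc m v) = anc n v"
proof (induction "d v" arbitrary: v)
  case 0 then show ?case by simp
next
  case (Suc k)
  show ?case
  proof (cases "m < d v")
    case False then show ?thesis using Suc by simp
  next
    case True
    have "v \<noteq> r" using Suc by auto
    then have "par v \<in> V" "d v = Suc (d (par v))" using Suc par_in d_par by auto
    then show ?thesis using Suc anc_step[of v m] anc_step[of v n] True by auto
  qed
qed

lemma par_anc: "v \<in> V \<Longrightarrow> n < d v \<Longrightarrow> par (anc (Suc n) v) = anc n v"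
proof -
  assume v: "v \<in> V" "n < d v"
  have "anc n v = anc n (anc (Suc n) v)" using anc_anc[of v n "Suc n"] v by simp
  also have "\<dots> = anc n (par (anc (Suc n) v))"
    by (rule anc_step) (use v in auto)
  also have "\<dots> = par (anc (Suc n) v)"
  proof (rule anc_self)
    have "anc (Suc n) v \<in> V" "d (anc (Suc n) v) = Suc n" using v by auto
    then show "d (par (anc (Suc n) v)) \<le> n" using d_par[of "anc (Suc n) v"] not_root by force
  qed
  finally show ?thesis by simp
qed

lemma par_eq_anc: "v \<in> V \<Longrightarrow> v \<noteq> r \<Longrightarrow> par v = anc (d v - 1) v"
  using d_par[of v] par_anc[of v "d v - 1"] by simp

text \<open>Every end of a tree is represented by exactly one ray starting at the root.\<close>

definition rays :: "(nat \<Rightarrow> 'v) set" where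
  "rays = {\<xi>. \<forall>n. \<xi> n \<in> V \<and> d (\<xi> n) = n \<and> par (\<xi> (Suc n)) = \<xi> n}"

definition ends :: "(nat \<Rightarrow> 'v) topology" where
  "ends = subtopology (product_topology (\<lambda>_. discrete_topology UNIV) UNIV) rays"

definition shadow :: "'v \<Rightarrow> (nat \<Rightarrow> 'v) set" where
  "shadow v = {\<xi> \<in> rays. \<xi> (d v) = v}"

lemma ray_in: "\<xi> \<in> rays \<Longrightarrow> \<xi> n \<in> V"
  and ray_d: "\<xi> \<in> rays \<Longrightarrow> d (\<xi> n) = n"
  and ray_par: "\<xi> \<in> rays \<Longrightarrow> par (\<xi> (Suc n)) = \<xi> n"
  by (auto simp: rays_def)

lemma ray_anc: "\<xi> \<in> rays \<Longrightarrow> n \<le> m \<Longrightarrow> anc n (\<xi> m) = \<xi> n"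
proof (induction m)
  case 0 then show ?case using ray_d by simp
next
  case (Suc m)
  show ?case
  proof (cases "n = Suc m")
    case True then show ?thesis using Suc ray_d by simp
  next
    case False
    then show ?thesis
      using Suc anc_step[of "\<xi> (Suc m)" n] ray_in[of \<xi> "Suc m"] ray_d[of \<xi> "Suc m"] ray_par[of \<xi> m] by simp
  qed
qed

lemma rays_agree: "\<xi> \<in> rays \<Longrightarrow> \<eta> \<in> rays \<Longrightarrow> \<xi> m = \<eta> m \<Longrightarrow> n \<le> m \<Longrightarrow> \<xi> n = \<eta> n"
  by (metis ray_anc)

lemma topspace_ends [simp]: "topspace ends = rays"
  by (simp add: ends_def)

lemma shadow_subset: "shadow v \<subseteq> rays"
  by (auto simp: shadow_def)

lemma ray_in_shadow: "\<xi> \<in> rays \<Longrightarrow> \<xi> \<in> shadow (\<xi> n)"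
  by (simp add: shadow_def ray_d)

lemma shadow_anc: "v \<in> V \<Longrightarrow> shadow v \<subseteq> shadow (anc n v)"
  using ray_anc by (fastforce simp: shadow_def min_def)

lemma openin_cyl: "openin ends {\<xi> \<in> rays. Q (\<xi> n)}"
proof -
  have "{\<xi> \<in> rays. Q (\<xi> n)} = {\<xi> \<in> topspace (product_topology (\<lambda>_. discrete_topology UNIV) UNIV). \<xi> n \<in> Collect Q} \<inter> rays"
    by auto
  moreover have "openin (product_topology (\<lambda>_. discrete_topology UNIV) (UNIV :: nat set)) 
     {\<xi> \<in> topspace (product_topology (\<lambda>_. discrete_topology UNIV) UNIV). \<xi> n \<in> Collect Q}"
    by (rule openin_continuous_map_preimage[OF continuous_map_product_projection]) auto
  ultimately show ?thesis unfolding ends_def openin_subtopology by blast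
qed

lemma closedin_cyl: "closedin ends {\<xi> \<in> rays. Q (\<xi> n)}"
proof -
  have "rays - {\<xi> \<in> rays. Q (\<xi> n)} = {\<xi> \<in> rays. \<not> Q (\<xi> n)}" by auto
  then show ?thesis using openin_cyl[of "\<lambda>v. \<not> Q v"] by (auto simp: closedin_def)
qed

lemma openin_shadow: "openin ends (shadow v)" and closedin_shadow: "closedin ends (shadow v)"
  unfolding shadow_def by (rule openin_cyl closedin_cyl)+

lemma openin_ends:
  "openin ends U \<longleftrightarrow> U \<subseteq> rays \<and> (\<forall>\<xi>\<in>U. \<exists>n. shadow (\<xi> n) \<subseteq> U)"
proof
  assume U: "openin ends U"
  have sub: "U \<subseteq> rays" using openin_subset[OF U] by simp
  obtain T where T: "openin (product_topology (\<lambda>_. discrete_topology UNIV) (UNIV::nat set)) T" "U = T \<inter> rays"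
    using U by (auto simp: ends_def openin_subtopology)
  have "\<exists>n. shadow (\<xi> n) \<subseteq> U" if xi: "\<xi> \<in> U" for \<xi>
  proof -
    have "\<xi> \<in> T" using xi T by auto
    then obtain W where W: "finite {i \<in> UNIV. W i \<noteq> topspace (discrete_topology UNIV)}"
        "\<xi> \<in> Pi\<^sub>E UNIV W" "Pi\<^sub>E UNIV W \<subseteq> T"
      using T(1) unfolding openin_product_topology_alt by metis
    then have "finite {i. W i \<noteq> UNIV}" by simp
    then obtain n where n: "\<And>i. W i \<noteq> UNIV \<Longrightarrow> i \<le> n"
      using finite_nat_set_iff_bounded_le by auto
    have "shadow (\<xi> n) \<subseteq> U"
    proof
      fix \<eta> assume "\<eta> \<in> shadow (\<xi> n)"
      then have eta: "\<eta> \<in> rays" "\<eta> n = \<xi> n" using xi sub ray_d by (auto simp: shadow_def)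
      have "\<eta> i \<in> W i" for i
      proof (cases "W i = UNIV")
        case False
        then have "i \<le> n" using n by blast
        then have "\<eta> i = \<xi> i" using rays_agree[of \<eta> \<xi> n i] eta xi sub by blast
        then show ?thesis using W(2) by auto
      qed auto
      then have "\<eta> \<in> Pi\<^sub>E UNIV W" by auto
      then show "\<eta> \<in> U" using W(3) T eta by blast
    qed
    then show ?thesis ..
  qed
  with sub show "U \<subseteq> rays \<and> (\<forall>\<xi>\<in>U. \<exists>n. shadow (\<xi> n) \<subseteq> U)" by blast
next
  assume U: "U \<subseteq> rays \<and> (\<forall>\<xi>\<in>U. \<exists>n. shadow (\<xi> n) \<subseteq> U)"
  have "\<exists>T. openin ends T \<and> \<xi> \<in> T \<and> T \<subseteq> U" if "\<xi> \<in> U" for \<xi>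
    using that U openin_shadow ray_in_shadow by (metis subsetD)
  then show "openin ends U" using openin_subopen by metis
qed

lemma Hausdorff_ends: "Hausdorff_space ends"
  unfolding ends_def by (intro Hausdorff_space_subtopology) (simp add: Hausdorff_space_product_topology Hausdorff_space_discrete_topology)

text \<open>The rays form a closed subset of the product of the levels, which are finite.\<close>

lemma compact_ends: "compact_space ends"
proof -
  define T where "T = product_topology (\<lambda>_. discrete_topology (UNIV :: 'v set)) (UNIV::nat set)"
  have c: "compactin T (Pi\<^sub>E UNIV (\<lambda>n. {v \<in> V. d v = n}))"
    unfolding T_def compactin_PiE by (auto simp: compactin_discrete_topology finite_level)
  have op: "openin T {\<xi>. Q (\<xi> n)}" for Q n
  proof -
    have "openin T {\<xi> \<in> topspace T. \<xi> n \<in> Collect Q}"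
      unfolding T_def by (rule openin_continuous_map_preimage[OF continuous_map_product_projection]) auto
    then show ?thesis by (simp add: T_def)
  qed
  have op2: "openin T {\<xi>. Q (\<xi> n) (\<xi> m)}" for Q n m
  proof -
    have "{\<xi>. Q (\<xi> n) (\<xi> m)} = (\<Union>a. \<Union>b\<in>{b. Q a b}. {\<xi>. \<xi> n = a} \<inter> {\<xi>. \<xi> m = b})" by auto
    moreover have "openin T \<dots>"
      using op by (intro openin_Union) (auto intro!: openin_Union openin_Int simp del: UN_simps)
    ultimately show ?thesis by simp
  qed
  have cl: "closedin T {\<xi>. Q (\<xi> n) (\<xi> m)}" for Q n m
  proof -
    have "topspace T - {\<xi>. Q (\<xi> n) (\<xi> m)} = {\<xi>. \<not> Q (\<xi> n) (\<xi> m)}" by (auto simp: T_def)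
    then show ?thesis using op2[of "\<lambda>a b. \<not> Q a b" n m] unfolding closedin_def by (simp add: T_def)
  qed
  have "rays = (\<Inter>n. {\<xi>. \<xi> n \<in> V \<and> d (\<xi> n) = n \<and> par (\<xi> (Suc n)) = \<xi> n})"
    by (auto simp: rays_def)
  moreover have "closedin T \<dots>" 
    using cl[of "\<lambda>a b. a \<in> V \<and> d a = _ \<and> par b = a"] by (intro closedin_Inter) auto
  ultimately have "closedin T rays" by simp
  moreover have "rays \<subseteq> Pi\<^sub>E UNIV (\<lambda>n. {v \<in> V. d v = n})" by (auto simp: rays_def)
  ultimately have "compactin T rays" using closed_compactin c by blast
  then show ?thesis by (simp add: ends_def T_def compactin_subspace)
qed

text \<open>Compactness of the end space: the increasing sequence of the open sets \<open>{\<xi>. Q (\<xi> n)}\<close> becomes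
  stationary.\<close>

lemma rays_uniform:
  assumes ex: "\<And>\<xi>. \<xi> \<in> rays \<Longrightarrow> \<exists>n. Q (\<xi> n)"
    and mono: "\<And>\<xi> n m. \<xi> \<in> rays \<Longrightarrow> n \<le> m \<Longrightarrow> Q (\<xi> n) \<Longrightarrow> Q (\<xi> m)"
  shows "\<exists>N. \<forall>\<xi>\<in>rays. \<forall>n\<ge>N. Q (\<xi> n)"
proof -
  have "compactin ends rays" using compact_ends by (simp add: compact_space_def)
  then obtain \<F> where F: "finite \<F>" "\<F> \<subseteq> range (\<lambda>n. {\<xi> \<in> rays. Q (\<xi> n)})" "rays \<subseteq> \<Union>\<F>"
  proof (rule compactinD[THEN exE])
    show "rays \<subseteq> \<Union> (range (\<lambda>n. {\<xi> \<in> rays. Q (\<xi> n)}))" using ex by blast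
  next
    fix U assume "U \<in> range (\<lambda>n. {\<xi> \<in> rays. Q (\<xi> n)})"
    then obtain n where "U = {\<xi> \<in> rays. Q (\<xi> n)}" by (rule rangeE)
    then show "openin ends U" using openin_cyl[of Q n] by simp
  qed auto
  then obtain I where I: "finite I" "rays \<subseteq> (\<Union>n\<in>I. {\<xi> \<in> rays. Q (\<xi> n)})"
    using finite_subset_image[OF F(1,2)] F(3) by auto
  then obtain N where N: "\<And>n. n \<in> I \<Longrightarrow> n \<le> N" using finite_nat_bound[OF I(1), of "\<lambda>n. n"] by blast
  have "Q (\<xi> n)" if "\<xi> \<in> rays" "n \<ge> N" for \<xi> n
  proof -
    have "\<xi> \<in> (\<Union>n\<in>I. {\<xi> \<in> rays. Q (\<xi> n)})" using I(2) that(1) by (rule subsetD)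
    then obtain k where "k \<in> I" "Q (\<xi> k)" by auto
    then show ?thesis using mono[OF that(1), of k n] N that(2) by fastforce
  qed
  then show ?thesis by blast
qed

lemma clopen_level:
  assumes "openin ends C" "closedin ends C"
  shows "\<exists>N. \<forall>\<xi>\<in>rays. \<forall>n\<ge>N. shadow (\<xi> n) \<subseteq> C \<or> shadow (\<xi> n) \<inter> C = {}"
proof (rule rays_uniform)
  fix \<xi> assume xi: "\<xi> \<in> rays"
  show "\<exists>n. shadow (\<xi> n) \<subseteq> C \<or> shadow (\<xi> n) \<inter> C = {}"
  proof (cases "\<xi> \<in> C")
    case True then show ?thesis using assms(1) openin_ends by blast
  next
    case False
    have "openin ends (rays - C)" using assms(2) by (simp add: closedin_def)
    moreover have "\<xi> \<in> rays - C" using xi False by simp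
    ultimately show ?thesis unfolding openin_ends by blast
  qed
next
  fix \<xi> and n m :: nat assume "\<xi> \<in> rays" "n \<le> m"
  then have "shadow (\<xi> m) \<subseteq> shadow (\<xi> n)"
    using shadow_anc[of "\<xi> m" n] ray_in ray_anc by simp
  then show "shadow (\<xi> n) \<subseteq> C \<or> shadow (\<xi> n) \<inter> C = {} \<Longrightarrow> shadow (\<xi> m) \<subseteq> C \<or> shadow (\<xi> m) \<inter> C = {}"
    by blast
qed

lemma countable_V: "countable V"
proof -
  have "V = (\<Union>n. {v \<in> V. d v = n})" by auto
  then show ?thesis using countable_UN[of UNIV "\<lambda>n. {v \<in> V. d v = n}"] finite_level by (simp add: countable_finite)
qed

text \<open>A clopen set is determined by a level and by the vertices of this level that it involves.\<close>

lemma countable_clopen_ends: "countable {C. openin ends C \<and> closedin ends C}"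
proof -
  define f where "f = (\<lambda>(N, A). {\<xi> \<in> rays. \<xi> N \<in> A})"
  have "{C. openin ends C \<and> closedin ends C} \<subseteq> f ` (UNIV \<times> {A. finite A \<and> A \<subseteq> V})"
  proof
    fix C assume "C \<in> {C. openin ends C \<and> closedin ends C}"
    then have C: "openin ends C" "closedin ends C" by auto
    then obtain N where N: "\<And>\<xi>. \<xi>\<in>rays \<Longrightarrow> shadow (\<xi> N) \<subseteq> C \<or> shadow (\<xi> N) \<inter> C = {}"
      using clopen_level[OF C] by (meson order_refl)
    define A where "A = (\<lambda>\<xi>. \<xi> N) ` C"
    have sub: "C \<subseteq> rays" using openin_subset[OF C(1)] by simp
    have "A \<subseteq> {v \<in> V. d v = N}" using sub ray_in ray_d by (auto simp: A_def)
    then have "finite A" "A \<subseteq> V" using finite_subset[OF _ finite_level] by auto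
    moreover have "C = f (N, A)"
    proof
      show "C \<subseteq> f (N, A)" using sub by (auto simp: f_def A_def)
      show "f (N, A) \<subseteq> C"
      proof
        fix \<xi> assume "\<xi> \<in> f (N, A)"
        then obtain \<eta> where eta: "\<xi> \<in> rays" "\<eta> \<in> C" "\<xi> N = \<eta> N" by (auto simp: f_def A_def)
        then have "\<xi> \<in> shadow (\<eta> N)" using sub ray_d by (auto simp: shadow_def)
        moreover have "\<eta> \<in> shadow (\<eta> N)" using eta sub ray_in_shadow by blast
        ultimately show "\<xi> \<in> C" using N[of \<eta>] eta sub by blast
      qed
    qed
    ultimately show "C \<in> f ` (UNIV \<times> {A. finite A \<and> A \<subseteq> V})" by blast
  qed
  moreover have "countable (f ` (UNIV \<times> {A. finite A \<and> A \<subseteq> V}))"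
    using countable_Collect_finite_subset[OF countable_V] by (auto simp: conj_commute)
  ultimately show ?thesis using countable_subset by blast
qed

text \<open>Koenig's lemma: among the finitely many children of a vertex with arbitrarily deep descendants, one has
  arbitrarily deep descendants, too.\<close>

lemma shadow_nonempty:
  assumes v: "v \<in> V" and inf: "\<And>N. \<exists>u\<in>V. N \<le> d u \<and> anc (d v) u = v"
  shows "shadow v \<noteq> {}"
proof -
  define deep where "deep v \<longleftrightarrow> v \<in> V \<and> (\<forall>N. \<exists>u\<in>V. N \<le> d u \<and> anc (d v) u = v)" for v
  have step: "\<exists>w. deep w \<and> w \<noteq> r \<and> par w = v" if dv: "deep v" for v
  proof (rule ccontr)
    assume con: "\<not> ?thesis"
    define Ch where "Ch = {w \<in> V - {r}. par w = v}"
    have vV: "v \<in> V" and dvN: "\<And>N. \<exists>u\<in>V. N \<le> d u \<and> anc (d v) u = v"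
      using dv unfolding deep_def by blast+
    have fin: "finite Ch" unfolding Ch_def using finite_children[OF vV] .
    have "\<not> deep w" if "w \<in> Ch" for w using con that unfolding Ch_def by blast
    then have "\<exists>N. \<forall>u\<in>V. N \<le> d u \<longrightarrow> anc (d w) u \<noteq> w" if "w \<in> Ch" for w
      using that unfolding deep_def Ch_def by blast
    then obtain N where N: "\<And>w u. w \<in> Ch \<Longrightarrow> u \<in> V \<Longrightarrow> N w \<le> d u \<Longrightarrow> anc (d w) u \<noteq> w" by metis
    obtain M where M: "\<And>w. w \<in> Ch \<Longrightarrow> N w \<le> M" 
      using fin finite_nat_bound by blast
    obtain u where u: "u \<in> V" "max M (Suc (d v)) \<le> d u" "anc (d v) u = v" using dvN by metis
    define w where "w = anc (Suc (d v)) u"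
    have w: "w \<in> V" "d w = Suc (d v)" "par w = v"
      using u par_anc[of u "d v"] by (auto simp: w_def)
    then have "w \<in> Ch" by (auto simp: Ch_def)
    then show False using N[of w u] M[of w] u w by (auto simp: w_def)
  qed
  then obtain nx where nx: "\<And>v. deep v \<Longrightarrow> deep (nx v) \<and> nx v \<noteq> r \<and> par (nx v) = v" by metis
  have dv: "deep v" using assms unfolding deep_def by blast
  define f where "f k = (nx ^^ k) v" for k
  have f: "deep (f k) \<and> d (f k) = d v + k \<and> par (f (Suc k)) = f k" for k
  proof (induction k)
    case 0 then show ?case using dv nx by (simp add: f_def)
  next
    case (Suc k)
    have e: "f (Suc k) = nx (f k)" "f (Suc (Suc k)) = nx (f (Suc k))" by (auto simp: f_def)
    have "deep (f (Suc k))" "f (Suc k) \<noteq> r" using Suc nx e by auto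
    moreover have "f (Suc k) \<in> V" using calculation(1) unfolding deep_def by blast
    then have "d (f (Suc k)) = Suc (d (f k))" using d_par[of "f (Suc k)"] Suc calculation(2) by simp
    ultimately show ?case using Suc nx e by simp
  qed
  define \<xi> where "\<xi> n = (if n \<le> d v then anc n v else f (n - d v))" for n
  have "\<xi> n \<in> V \<and> d (\<xi> n) = n \<and> par (\<xi> (Suc n)) = \<xi> n" for n
  proof -
    consider "n < d v" | "n = d v" | "n > d v" by linarith
    then show ?thesis
    proof cases
      case 1 then show ?thesis using par_anc v by (auto simp: \<xi>_def)
    next
      case 2 then show ?thesis using v f[of 0] by (auto simp: \<xi>_def) (auto simp: f_def)
    next
      case 3
      have "f (n - d v) \<in> V" using f[of "n - d v"] unfolding deep_def by blast
      then show ?thesis using 3 f[of "n - d v"] by (simp add: \<xi>_def Suc_diff_le)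
    qed
  qed
  then have "\<xi> \<in> rays" by (auto simp: rays_def)
  moreover have "\<xi> (d v) = v" by (simp add: \<xi>_def)
  ultimately show ?thesis by (auto simp: shadow_def)
qed

text \<open>Beyond the vertices of level \<open>k\<close> that no ray passes there are only finitely many vertices.\<close>

lemma shadow_level: "\<exists>N\<ge>k. \<forall>u\<in>V. N \<le> d u \<longrightarrow> shadow (anc k u) \<noteq> {}"
proof -
  define A where "A = {v \<in> V. d v = k \<and> shadow v = {}}"
  have fin: "finite A" unfolding A_def using finite_level[of k] by (rule finite_subset[rotated]) auto
  have "\<exists>N. \<forall>u\<in>V. N \<le> d u \<longrightarrow> anc (d v) u \<noteq> v" if "v \<in> A" for v
    using shadow_nonempty[of v] that unfolding A_def by blast
  then obtain N where N: "\<And>v u. v \<in> A \<Longrightarrow> u \<in> V \<Longrightarrow> N v \<le> d u \<Longrightarrow> anc (d v) u \<noteq> v" by metis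
  obtain M where M: "\<And>w. w \<in> A \<Longrightarrow> N w \<le> M" 
    using fin finite_nat_bound by blast
  have "shadow (anc k u) \<noteq> {}" if u: "u \<in> V" "max M k \<le> d u" for u
  proof
    assume "shadow (anc k u) = {}"
    then have "anc k u \<in> A" using u by (auto simp: A_def)
    then show False using N[of "anc k u" u] M[of "anc k u"] u by (auto simp: A_def)
  qed
  then show ?thesis by (intro exI[of _ "max M k"]) auto
qed

end

section \<open>The order of the vertices\<close>

context rooted_tree
begin

definition below :: "'v \<Rightarrow> 'v \<Rightarrow> bool" where
  "below u v \<longleftrightarrow> d u \<le> d v \<and> anc (d u) v = u"

lemma below_refl [simp]: "below v v"
  by (simp add: below_def)

lemma below_anc: "v \<in> V \<Longrightarrow> below (anc n v) v"
  by (cases "n \<le> d v") (auto simp: below_def min_def)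

lemma below_trans: "w \<in> V \<Longrightarrow> below u v \<Longrightarrow> below v w \<Longrightarrow> below u w"
  unfolding below_def by (metis anc_anc order_trans)

lemma below_level: "below u v \<Longrightarrow> d u = d v \<Longrightarrow> u = v"
  by (simp add: below_def)

lemma below_par: "v \<in> V \<Longrightarrow> v \<noteq> r \<Longrightarrow> below (par v) v"
  using par_eq_anc below_anc by metis

lemma below_root: "v \<in> V \<Longrightarrow> below r v"
proof -
  assume v: "v \<in> V"
  then have "anc 0 v \<in> V" "d (anc 0 v) = 0" by auto
  then have "anc 0 v = r" using d_zero by blast
  then show ?thesis by (simp add: below_def)
qed

lemma below_linear: "w \<in> V \<Longrightarrow> below u w \<Longrightarrow> below v w \<Longrightarrow> d u \<le> d v \<Longrightarrow> below u v"
  unfolding below_def by (metis anc_anc)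

lemma below_par_cases: "v \<in> V \<Longrightarrow> v \<noteq> r \<Longrightarrow> below u v \<Longrightarrow> u = v \<or> below u (par v)"
  by (metis below_linear below_level below_par d_par le_antisym less_Suc_eq_le not_le below_def)

lemma child_towards:
  assumes "u \<in> V" "below v u" "v \<noteq> u"
  shows "\<exists>w\<in>V. w \<noteq> r \<and> par w = v \<and> d w = Suc (d v) \<and> below w u"
proof (intro bexI conjI)
  have "d v \<noteq> d u" using assms below_level by blast
  then have lt: "d v < d u" using assms by (simp add: below_def)
  show "anc (Suc (d v)) u \<in> V" "d (anc (Suc (d v)) u) = Suc (d v)" "below (anc (Suc (d v)) u) u"
    using assms(1) lt below_anc by auto
  then show "anc (Suc (d v)) u \<noteq> r" by (metis d_root nat.distinct(1))
  show "par (anc (Suc (d v)) u) = v" using par_anc[OF assms(1) lt] assms(2) by (simp add: below_def)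
qed

section \<open>The realization in path coordinates\<close>

text \<open>Coordinates for the points of the tree: \<open>y v\<close> measures how far the path from the root to the point
  has advanced on the edge from \<open>par v\<close> to \<open>v\<close>. On this path \<open>y\<close> is 1 up to its last edge, and \<open>y\<close>
  vanishes off the path. The product topology on \<open>Y\<close> is the topology of the tree.\<close>

definition Y :: "('v \<Rightarrow> real) set" where
  "Y = {y. (\<forall>v. 0 \<le> y v \<and> y v \<le> 1) \<and> y r = 1 \<and> (\<forall>v. v \<notin> V \<longrightarrow> y v = 0) \<and>
           (\<forall>v\<in>V. v \<noteq> r \<longrightarrow> 0 < y v \<longrightarrow> y (par v) = 1) \<and>
           (\<forall>u\<in>V. \<forall>v\<in>V. d u = d v \<longrightarrow> 0 < y u \<longrightarrow> 0 < y v \<longrightarrow> u = v) \<and>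
           (\<exists>n. \<forall>v. n < d v \<longrightarrow> y v = 0)}"

lemma YI:
  assumes "\<And>v. 0 \<le> y v" "\<And>v. y v \<le> 1" "y r = 1" "\<And>v. v \<notin> V \<Longrightarrow> y v = 0"
    "\<And>v. v \<in> V \<Longrightarrow> v \<noteq> r \<Longrightarrow> 0 < y v \<Longrightarrow> y (par v) = 1"
    "\<And>u v. u \<in> V \<Longrightarrow> v \<in> V \<Longrightarrow> d u = d v \<Longrightarrow> 0 < y u \<Longrightarrow> 0 < y v \<Longrightarrow> u = v"
    "\<And>v. n < d v \<Longrightarrow> y v = 0"
  shows "y \<in> Y"
  unfolding Y_def using assms by blast

lemma Y_ge0: "y \<in> Y \<Longrightarrow> 0 \<le> y v"
  and Y_le1: "y \<in> Y \<Longrightarrow> y v \<le> 1"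
  and Y_root: "y \<in> Y \<Longrightarrow> y r = 1"
  and Y_out: "y \<in> Y \<Longrightarrow> v \<notin> V \<Longrightarrow> y v = 0"
  and Y_par: "y \<in> Y \<Longrightarrow> v \<in> V \<Longrightarrow> v \<noteq> r \<Longrightarrow> 0 < y v \<Longrightarrow> y (par v) = 1"
  and Y_level: "y \<in> Y \<Longrightarrow> u \<in> V \<Longrightarrow> v \<in> V \<Longrightarrow> d u = d v \<Longrightarrow> 0 < y u \<Longrightarrow> 0 < y v \<Longrightarrow> u = v"
  and Y_bounded: "y \<in> Y \<Longrightarrow> \<exists>n. \<forall>v. n < d v \<longrightarrow> y v = 0"
  unfolding Y_def by blast+

lemma Y_in: "y \<in> Y \<Longrightarrow> 0 < y v \<Longrightarrow> v \<in> V"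
  using Y_out[of y v] by fastforce

lemma Y_below:
  assumes "y \<in> Y" "v \<in> V" "0 < y v" "below u v" "u \<noteq> v"
  shows "y u = 1"
  using assms(2-5)
proof (induction "d v" arbitrary: v)
  case 0 then show ?case by (simp add: below_def)
next
  case (Suc k)
  have v: "v \<noteq> r" using Suc by auto
  have p: "y (par v) = 1" "par v \<in> V" "d v = Suc (d (par v))"
    using Y_par[OF assms(1) Suc(3) v Suc(4)] par_in d_par Suc v by auto
  have "below u (par v)" using below_par_cases[OF Suc(3) v Suc(5)] Suc by auto
  then show ?case using Suc(1)[of "par v"] p Suc(2) by (cases "u = par v") auto
qed

lemma Y_below_pos: "y \<in> Y \<Longrightarrow> v \<in> V \<Longrightarrow> 0 < y v \<Longrightarrow> below u v \<Longrightarrow> 0 < y u"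
  using Y_below[of y v u] by (cases "u = v") auto

lemma Y_chain:
  assumes "y \<in> Y" "u \<in> V" "v \<in> V" "0 < y u" "0 < y v" "d u \<le> d v"
  shows "below u v"
proof -
  have "0 < y (anc (d u) v)" using Y_below_pos[OF assms(1,3,5) below_anc[OF assms(3)]] .
  then have "anc (d u) v = u" using assms by (intro Y_level[OF assms(1)]) auto
  then show ?thesis using assms by (simp add: below_def)
qed

lemma Y_bound_next:
  assumes y: "y \<in> Y" and lt: "\<And>v. v \<in> V \<Longrightarrow> d v = Suc n \<Longrightarrow> y v < 1" and v: "Suc n < d v"
  shows "y v = 0"
proof (rule ccontr)
  assume "y v \<noteq> 0"
  then have pos: "0 < y v" using Y_ge0[OF y, of v] by simp
  then have vV: "v \<in> V" using Y_in[OF y] by blast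
  have "anc (Suc n) v \<noteq> v"
  proof
    assume "anc (Suc n) v = v"
    then show False using v d_anc[OF vV, of "Suc n"] by simp
  qed
  then have "y (anc (Suc n) v) = 1" using Y_below[OF y vV pos below_anc[OF vV]] by blast
  moreover have "anc (Suc n) v \<in> V" "d (anc (Suc n) v) = Suc n" using vV v by auto
  ultimately show False using lt by force
qed

text \<open>The tip of a point is the last vertex that the path to the point has begun to approach.\<close>

lemma Y_tip:
  assumes y: "y \<in> Y"
  obtains v where "v \<in> V" "0 < y v" "\<And>w. w \<in> V \<Longrightarrow> w \<noteq> r \<Longrightarrow> par w = v \<Longrightarrow> y w = 0"
proof -
  obtain n where n: "\<forall>v. n < d v \<longrightarrow> y v = 0" using Y_bounded[OF y] by blast
  define P where "P = {v \<in> V. 0 < y v}"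
  have "d v \<le> n" if "v \<in> P" for v
    using n that by (cases "d v \<le> n") (auto simp: P_def not_le)
  then have fP: "finite P" by (intro finite_subset[OF _ finite_upto[of n]]) (auto simp: P_def)
  have "r \<in> P" using root_in Y_root[OF y] by (simp add: P_def)
  then obtain v where v: "v \<in> P" "\<forall>w\<in>P. d w \<le> d v"
    using ex_is_arg_min_if_finite[of P "\<lambda>v. - int (d v)"] fP by (force simp: is_arg_min_linorder)
  have top: "y w = 0" if "w \<in> V" "w \<noteq> r" "par w = v" for w
  proof -
    have "d w = Suc (d v)" using d_par that by simp
    then have "w \<notin> P" using v by force
    then show ?thesis using that Y_ge0[OF y, of w] by (simp add: P_def)
  qed
  show thesis by (rule that[of v]) (use v(1) top in \<open>auto simp: P_def\<close>)
qed

text \<open>The coordinate at the tip determines the point: the others are 1 on the path to the tip and 0 elsewhere.\<close>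

lemma Y_eqI:
  assumes "y \<in> Y" "z \<in> Y" "v \<in> V" "y v = z v" "0 < y v" "y v < 1 \<or> (\<forall>w\<in>V. w \<noteq> r \<longrightarrow> par w = v \<longrightarrow> y w = 0 \<and> z w = 0)"
  shows "y = z"
proof -
  have *: "z u = 0" if "y u = 0" "y \<in> Y" "z \<in> Y" "y v = z v" "0 < y v" 
     and h: "y v < 1 \<or> (\<forall>w\<in>V. w \<noteq> r \<longrightarrow> par w = v \<longrightarrow> z w = 0)" for y z u
  proof (rule ccontr)
    assume "z u \<noteq> 0"
    then have zu: "0 < z u" using Y_ge0[OF that(3), of u] by simp
    then have uV: "u \<in> V" using Y_in that by blast
    show False
    proof (cases "d u \<le> d v")
      case True
      then have "below u v" using Y_chain[OF that(3) uV assms(3) zu] that by simp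
      then show False using Y_below_pos[OF that(2) assms(3) that(5)] that(1) by force
    next
      case False
      then have b: "below v u" "v \<noteq> u" using Y_chain[OF that(3) assms(3) uV] zu that by auto
      then have "z v = 1" using Y_below[OF that(3) uV zu] by blast
      moreover obtain w where w: "w \<in> V" "w \<noteq> r" "par w = v" "below w u" using child_towards[OF uV b] by blast
      moreover have "0 < z w" by (rule Y_below_pos[OF that(3) uV zu w(4)])
      ultimately show False using h w that(4) by fastforce
    qed
  qed
  have pos: "y u = z u" if yz: "0 < y u" "0 < z u" for u
  proof -
    have uV: "u \<in> V" using Y_in[OF assms(1)] yz by blast
    have zv: "0 < z v" using assms by simp
    consider "u = v" | "below u v" "u \<noteq> v" | "below v u" "v \<noteq> u"
      using Y_chain[OF assms(1) uV assms(3) yz(1) assms(5)] Y_chain[OF assms(1) assms(3) uV assms(5) yz(1)] using nat_le_linear[of "d u" "d v"] by blast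
    then show ?thesis
    proof cases
      case 2
      then show ?thesis using Y_below[OF assms(1,3,5)] Y_below[OF assms(2,3) zv] by simp
    next
      case 3
      then have "y v = 1" using Y_below[OF assms(1) uV yz(1)] by blast
      moreover obtain w where w: "w \<in> V" "w \<noteq> r" "par w = v" "below w u" using child_towards[OF uV 3] by blast
      moreover have "0 < y w" by (rule Y_below_pos[OF assms(1) uV yz(1) w(4)])
      ultimately show ?thesis using assms(6) w by fastforce
    qed (use assms in simp)
  qed
  show ?thesis
  proof
    fix u
    show "y u = z u"
      using *[of y u z] *[of z u y] pos[of u] assms Y_ge0[OF assms(1), of u] Y_ge0[OF assms(2), of u]
      by (metis (no_types, lifting) less_eq_real_def)
  qed
qed

definition vertex_pt :: "'v \<Rightarrow> 'v \<Rightarrow> real" where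
  "vertex_pt v u = (if u \<in> V \<and> below u v then 1 else 0)"

lemma vertex_pt_Y: "v \<in> V \<Longrightarrow> vertex_pt v \<in> Y"
proof (rule YI[where n = "d v"])
  assume v: "v \<in> V"
  show "vertex_pt v r = 1" using v below_root root_in by (simp add: vertex_pt_def)
  show "vertex_pt v (par u) = 1" if "u \<in> V" "u \<noteq> r" "0 < vertex_pt v u" for u
    using that v below_trans[OF v below_par[OF that(1,2)]] par_in by (auto simp: vertex_pt_def split: if_splits)
  show "u = w" if "u \<in> V" "w \<in> V" "d u = d w" "0 < vertex_pt v u" "0 < vertex_pt v w" for u w
    using that by (auto simp: vertex_pt_def below_def split: if_splits)
qed (auto simp: vertex_pt_def below_def)

lemma vertex_pt_self: "v \<in> V \<Longrightarrow> vertex_pt v v = 1"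
  by (simp add: vertex_pt_def)

subsection \<open>Geodesics\<close>

text \<open>While \<open>s\<close> runs from \<open>1 - 2 ^ - d v\<close> to \<open>1 - 2 ^ - (d v + 1)\<close>, the value of \<open>cut s v\<close> grows from 0 to 1. So
  \<open>\<lambda>v. min (y v) (cut s v)\<close>, with the value 1 at the root, runs along the path from the root to \<open>y\<close>,
  passing the vertices of depth \<open>n\<close> at a time depending on \<open>n\<close> alone.\<close>

definition cut :: "real \<Rightarrow> 'v \<Rightarrow> real" where
  "cut s v = min 1 (max 0 (2 ^ Suc (d v) * (s - 1) + 2))"

lemma cut_ge0: "0 \<le> cut s v" and cut_le1: "cut s v \<le> 1"
  by (auto simp: cut_def)

lemma cut_one: "cut 1 v = 1"
  by (simp add: cut_def)

lemma cut_nonpos: "s \<le> 0 \<Longrightarrow> cut s v = 0"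
proof -
  assume s: "s \<le> 0"
  have "(2::real) \<le> 2 ^ Suc (d v)" using power_increasing[of 1 "Suc (d v)" "2::real"] by simp
  then have "2 * 1 \<le> 2 ^ Suc (d v) * (1 - s)" using s by (intro mult_mono) auto
  then show ?thesis by (simp add: cut_def algebra_simps)
qed

lemma cut_par: "v \<in> V \<Longrightarrow> v \<noteq> r \<Longrightarrow> 0 < cut s v \<Longrightarrow> cut s (par v) = 1"
proof -
  assume v: "v \<in> V" "v \<noteq> r" "0 < cut s v"
  then have "0 < 2 ^ Suc (d v) * (s - 1) + 2" by (simp add: cut_def)
  then show ?thesis using v d_par[of v] by (simp add: cut_def algebra_simps)
qed

text \<open>During the first half of the time the point retreats from \<open>y\<close> towards the root until it arrives at
  the branching point \<open>min y z\<close>, where it waits; in the second half it goes on to \<open>z\<close>. As the speed depends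
  on the depth only, all coordinates are continuous in \<open>t\<close>, \<open>y\<close>, \<open>z\<close> jointly.\<close>

definition geo :: "real \<Rightarrow> ('v \<Rightarrow> real) \<Rightarrow> ('v \<Rightarrow> real) \<Rightarrow> 'v \<Rightarrow> real" where
  "geo t y z v = max (min (y v) (z v)) (max (min (y v) (cut (1 - 2 * t) v)) (min (z v) (cut (2 * t - 1) v)))"

lemma geo_0: "y \<in> Y \<Longrightarrow> z \<in> Y \<Longrightarrow> geo 0 y z = y"
proof
  fix v assume "y \<in> Y" "z \<in> Y"
  then have "0 \<le> y v" "y v \<le> 1" "0 \<le> z v" using Y_ge0 Y_le1 by auto
  then show "geo 0 y z v = y v" by (auto simp: geo_def cut_one cut_nonpos max_def min_def)
qed

lemma geo_swap: "geo t y z = geo (1 - t) z y"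
  by (auto simp: geo_def fun_eq_iff min.commute[of "z _"] algebra_simps intro!: arg_cong2[where f = max] max.commute)

lemma geo_1: "y \<in> Y \<Longrightarrow> z \<in> Y \<Longrightarrow> geo 1 y z = z"
  using geo_0[of z y] geo_swap[of 1 y z] by simp

lemma geo_same: "y \<in> Y \<Longrightarrow> geo t y y = y"
  by (auto simp: geo_def fun_eq_iff)

lemma geo_ge: "min (y v) (z v) \<le> geo t y z v"
  and geo_le: "y \<in> Y \<Longrightarrow> z \<in> Y \<Longrightarrow> geo t y z v \<le> max (y v) (z v)"
  by (auto simp: geo_def)

text \<open>Both halves of a geodesic have this form.\<close>

lemma geo_Y_aux:
  assumes y: "y \<in> Y" and z: "z \<in> Y"
    and c: "\<And>v. 0 \<le> c v" "\<And>v. v \<in> V \<Longrightarrow> v \<noteq> r \<Longrightarrow> 0 < c v \<Longrightarrow> c (par v) = 1"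
  shows "(\<lambda>v. max (min (y v) (z v)) (min (y v) (c v))) \<in> Y"
proof -
  obtain n where n: "\<And>v. n < d v \<Longrightarrow> y v = 0" using Y_bounded[OF y] by blast
  have 0: "0 \<le> y v" "0 \<le> z v" "0 \<le> c v" "y v \<le> 1" "z v \<le> 1" for v
    using y z c Y_ge0 Y_le1 by auto
  show ?thesis
  proof (rule YI[where n = n])
    fix v
    show "0 \<le> max (min (y v) (z v)) (min (y v) (c v))" "max (min (y v) (z v)) (min (y v) (c v)) \<le> 1"
      using 0[of v] by (auto simp: max_def min_def)
    show "max (min (y v) (z v)) (min (y v) (c v)) = 0" if "v \<notin> V"
      using Y_out[OF y that] 0[of v] by simp
    show "max (min (y v) (z v)) (min (y v) (c v)) = 0" if "n < d v"
      using n[OF that] 0[of v] by simp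
  next
    show "max (min (y r) (z r)) (min (y r) (c r)) = 1"
      using Y_root[OF y] Y_root[OF z] by simp
  next
    fix v assume v: "v \<in> V" "v \<noteq> r" "0 < max (min (y v) (z v)) (min (y v) (c v))"
    then have a: "y (par v) = 1" and b: "0 < z v \<or> 0 < c v" using Y_par[OF y] by (auto simp: less_max_iff_disj)
    have "z (par v) = 1 \<or> c (par v) = 1" using b Y_par[OF z] c(2) v by blast
    then show "max (min (y (par v)) (z (par v))) (min (y (par v)) (c (par v))) = 1"
      using a 0[of "par v"] by (auto simp: max_def min_def)
  next
    fix u v assume "u \<in> V" "v \<in> V" "d u = d v" "0 < max (min (y u) (z u)) (min (y u) (c u))"
      "0 < max (min (y v) (z v)) (min (y v) (c v))"
    then show "u = v" using Y_level[OF y] by (auto simp: less_max_iff_disj)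
  qed
qed

lemma geo_Y: "y \<in> Y \<Longrightarrow> z \<in> Y \<Longrightarrow> geo t y z \<in> Y"
proof -
  have *: "geo t y z \<in> Y" if "y \<in> Y" "z \<in> Y" "t \<le> 1/2" for y z t
  proof -
    have "geo t y z v = max (min (y v) (z v)) (min (y v) (cut (1 - 2 * t) v))" for v
      using Y_ge0[OF that(1), of v] Y_ge0[OF that(2), of v] cut_ge0[of "1 - 2 * t" v] that(3)
      by (simp add: geo_def cut_nonpos)
    then have "geo t y z = (\<lambda>v. max (min (y v) (z v)) (min (y v) (cut (1 - 2 * t) v)))" by blast
    then show ?thesis using geo_Y_aux[OF that(1,2), of "cut (1 - 2 * t)"] cut_ge0 cut_par by simp
  qed
  assume "y \<in> Y" "z \<in> Y"
  then show ?thesis using *[of y z t] *[of z y "1 - t"] geo_swap[of t y z] by (cases "t \<le> 1/2") auto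
qed

end

section \<open>Spaces homeomorphic to a tree\<close>

locale tree_space = rooted_tree V r par d
  for V :: "'v set" and r :: 'v and par :: "'v \<Rightarrow> 'v" and d :: "'v \<Rightarrow> nat" +
  fixes S :: "'p topology" and crd :: "'p \<Rightarrow> 'v \<Rightarrow> real" and pt :: "('v \<Rightarrow> real) \<Rightarrow> 'p"
  assumes homeo: "homeomorphic_maps S (top_of_set Y) crd pt"
begin

lemma crd_in: "x \<in> topspace S \<Longrightarrow> crd x \<in> Y"
  and pt_in: "y \<in> Y \<Longrightarrow> pt y \<in> topspace S"
  and pt_crd [simp]: "x \<in> topspace S \<Longrightarrow> pt (crd x) = x"
  and crd_pt [simp]: "y \<in> Y \<Longrightarrow> crd (pt y) = y"
  using homeo by (auto simp: homeomorphic_maps_def continuous_map_def)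

lemma crd_inj: "x \<in> topspace S \<Longrightarrow> y \<in> topspace S \<Longrightarrow> crd x = crd y \<Longrightarrow> x = y"
  by (metis pt_crd)

lemma crd_continuous: "continuous_map S euclideanreal (\<lambda>x. crd x v)"
proof -
  have "continuous_map S (product_topology (\<lambda>_. euclideanreal) UNIV) crd"
    using homeo unfolding homeomorphic_maps_def euclidean_product_topology
    by (auto dest: continuous_map_into_fulltopology)
  then show ?thesis by (simp add: continuous_map_componentwise_UNIV)
qed

lemma crd_compose: "continuous_map Z S g \<Longrightarrow> continuous_map Z euclideanreal (\<lambda>z. crd (g z) v)"
  using continuous_map_compose[OF _ crd_continuous, of Z g v] by (simp add: o_def)

lemma pt_continuous:
  assumes "\<And>v. continuous_map Z euclideanreal (\<lambda>z. g z v)" "\<And>z. z \<in> topspace Z \<Longrightarrow> g z \<in> Y"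
  shows "continuous_map Z S (\<lambda>z. pt (g z))"
proof -
  have "continuous_map Z (product_topology (\<lambda>_. euclideanreal) UNIV) g"
    using assms(1) by (simp add: continuous_map_componentwise_UNIV)
  then have "continuous_map Z (top_of_set Y) g"
    unfolding euclidean_product_topology using assms(2) by (auto simp: continuous_map_in_subtopology)
  then show ?thesis
    using homeo continuous_map_compose[of Z "top_of_set Y" g S pt] by (simp add: homeomorphic_maps_def o_def)
qed

lemma Hausdorff_S: "Hausdorff_space S"
proof -
  have "S homeomorphic_space top_of_set Y" using homeo homeomorphic_space_def by blast
  moreover have "Hausdorff_space (top_of_set Y)"
    by (rule Hausdorff_space_subtopology) (simp add: flip: euclidean_product_topology, simp add: Hausdorff_space_product_topology)
  ultimately show ?thesis using homeomorphic_Hausdorff_space by blast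
qed

text \<open>The ball of radius \<open>n\<close> about the root; the points beyond \<open>par v\<close> in the direction of \<open>v\<close> form
  \<open>branch v\<close>, which for \<open>d v = n + 1\<close> is a component of the complement of this ball.\<close>

definition core :: "nat \<Rightarrow> 'p set" where
  "core n = {x \<in> topspace S. \<forall>v. n < d v \<longrightarrow> crd x v = 0}"

definition branch :: "'v \<Rightarrow> 'p set" where
  "branch v = {x \<in> topspace S. 0 < crd x v}"

lemma branch_subset: "branch v \<subseteq> topspace S" and core_subset: "core n \<subseteq> topspace S"
  by (auto simp: branch_def core_def)

lemma branch_root: "branch r = topspace S"
  using Y_root[OF crd_in] by (auto simp: branch_def)

lemma branch_mono: "v \<in> V \<Longrightarrow> below u v \<Longrightarrow> branch v \<subseteq> branch u"
  using Y_below_pos[OF crd_in] by (auto simp: branch_def)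

lemma branch_disjoint: "u \<in> V \<Longrightarrow> v \<in> V \<Longrightarrow> d u = d v \<Longrightarrow> x \<in> branch u \<Longrightarrow> x \<in> branch v \<Longrightarrow> u = v"
  using Y_level[OF crd_in] by (auto simp: branch_def)

lemma vertex_in_branch: "v \<in> V \<Longrightarrow> pt (vertex_pt v) \<in> branch v"
  using vertex_pt_Y pt_in vertex_pt_self by (simp add: branch_def)

lemma openin_branch: "openin S (branch v)"
proof -
  have "openin S {x \<in> topspace S. crd x v \<in> {0<..}}"
    by (rule openin_continuous_map_preimage[OF crd_continuous]) auto
  then show ?thesis by (simp add: branch_def)
qed

lemma outside_core: "x \<in> topspace S \<Longrightarrow> x \<notin> core n \<longleftrightarrow> (\<exists>w\<in>V. d w = Suc n \<and> x \<in> branch w)"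
proof
  assume x: "x \<in> topspace S" "x \<notin> core n"
  then obtain v where v: "n < d v" "crd x v \<noteq> 0" by (auto simp: core_def)
  then have pos: "0 < crd x v" using Y_ge0[OF crd_in[OF x(1)], of v] by simp
  then have vV: "v \<in> V" using Y_in crd_in x by blast
  have "0 < crd x (anc (Suc n) v)"
    using Y_below_pos[OF crd_in[OF x(1)] vV pos below_anc[OF vV]] .
  then show "\<exists>w\<in>V. d w = Suc n \<and> x \<in> branch w"
    using vV v x by (intro bexI[of _ "anc (Suc n) v"]) (auto simp: branch_def)
qed (fastforce simp: core_def branch_def)

lemma core_mono: "m \<le> n \<Longrightarrow> core m \<subseteq> core n"
  by (fastforce simp: core_def)

lemma core_exhaust: "x \<in> topspace S \<Longrightarrow> \<exists>n. x \<in> core n"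
  using Y_bounded[OF crd_in] by (auto simp: core_def)

text \<open>A closed condition cuts this set out of a product of compact intervals.\<close>

lemma compact_Y_bounded: "compact {y \<in> Y. \<forall>v. n < d v \<longrightarrow> y v = 0}"
proof -
  define I where "I v = (if v \<in> V \<and> d v \<le> n then {0..1::real} else {0})" for v
  have "compactin (product_topology (\<lambda>_. euclideanreal) UNIV) (Pi\<^sub>E UNIV I)"
    unfolding compactin_PiE by (auto simp: I_def)
  then have 1: "compact (Pi\<^sub>E UNIV I)" by (simp add: euclidean_product_topology)
  define A where "A = {y :: 'v \<Rightarrow> real. y r = 1} \<inter>
    (\<Inter>v\<in>{v\<in>V. v \<noteq> r}. {y. y v \<le> 0} \<union> {y. y (par v) = 1}) \<inter>
    (\<Inter>(u,v)\<in>{(u,v). u \<in> V \<and> v \<in> V \<and> d u = d v \<and> u \<noteq> v}. {y. y u \<le> 0} \<union> {y. y v \<le> 0})"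
  have cont: "continuous_on UNIV (\<lambda>y :: 'v \<Rightarrow> real. y v)" for v
    by (simp add: continuous_on_product_coordinates)
  have "closed {y :: 'v \<Rightarrow> real. y v = 1}" "closed {y :: 'v \<Rightarrow> real. y v \<le> 0}" for v
    by (intro closed_Collect_eq closed_Collect_le cont continuous_on_const)+
  then have 2: "closed A" unfolding A_def by (intro closed_Int closed_INT ballI) (auto intro!: closed_Un)
  have "{y \<in> Y. \<forall>v. n < d v \<longrightarrow> y v = 0} = Pi\<^sub>E UNIV I \<inter> A"
  proof (intro equalityI subsetI)
    fix y assume y: "y \<in> {y \<in> Y. \<forall>v. n < d v \<longrightarrow> y v = 0}"
    then have yY: "y \<in> Y" by simp
    have "y \<in> Pi\<^sub>E UNIV I"
      using y Y_ge0[OF yY] Y_le1[OF yY] Y_out[OF yY] by (fastforce simp: I_def)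
    moreover have "y \<in> A"
    proof -
      have "y v \<le> 0 \<or> y (par v) = 1" if "v \<in> V" "v \<noteq> r" for v
        using Y_par[OF yY that] by fastforce
      moreover have "y u \<le> 0 \<or> y v \<le> 0" if "u \<in> V" "v \<in> V" "d u = d v" "u \<noteq> v" for u v
        using Y_level[OF yY that(1-3)] that(4) by fastforce
      ultimately show ?thesis using Y_root[OF yY] by (auto simp: A_def)
    qed
    ultimately show "y \<in> Pi\<^sub>E UNIV I \<inter> A" by blast
  next
    fix y assume y: "y \<in> Pi\<^sub>E UNIV I \<inter> A"
    have yI: "y v \<in> I v" for v using y by (auto simp: PiE_iff)
    have zero: "y v = 0" if "\<not> (v \<in> V \<and> d v \<le> n)" for v
      using yI[of v] that by (simp add: I_def split: if_splits)
    have "y \<in> Y"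
    proof (rule YI[where n = n])
      show "0 \<le> y v" "y v \<le> 1" for v using yI[of v] by (auto simp: I_def split: if_splits)
      show "y r = 1" using y by (simp add: A_def)
      show "y (par v) = 1" if "v \<in> V" "v \<noteq> r" "0 < y v" for v
        using y that by (force simp: A_def)
      show "u = v" if "u \<in> V" "v \<in> V" "d u = d v" "0 < y u" "0 < y v" for u v
        using y that by (force simp: A_def)
    qed (use zero in auto)
    then show "y \<in> {y \<in> Y. \<forall>v. n < d v \<longrightarrow> y v = 0}" using zero by simp
  qed
  then show ?thesis using compact_Int_closed[OF 1 2] by simp
qed

lemma compact_core: "compactin S (core n)"
proof -
  have "compactin (top_of_set Y) {y \<in> Y. \<forall>v. n < d v \<longrightarrow> y v = 0}"
    using compact_Y_bounded by (simp add: compactin_subtopology)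
  moreover have "continuous_map (top_of_set Y) S pt" using homeo by (simp add: homeomorphic_maps_def)
  ultimately have "compactin S (pt ` {y \<in> Y. \<forall>v. n < d v \<longrightarrow> y v = 0})" by (rule image_compactin)
  moreover have "pt ` {y \<in> Y. \<forall>v. n < d v \<longrightarrow> y v = 0} = core n"
  proof (intro equalityI subsetI)
    fix x assume x: "x \<in> core n"
    then have "x = pt (crd x)" "crd x \<in> {y \<in> Y. \<forall>v. n < d v \<longrightarrow> y v = 0}" using crd_in by (auto simp: core_def)
    then show "x \<in> pt ` {y \<in> Y. \<forall>v. n < d v \<longrightarrow> y v = 0}" by blast
  qed (auto simp: core_def pt_in)
  ultimately show ?thesis by simp
qed

text \<open>The open ball of radius \<open>n + 1\<close>.\<close>

definition ocore :: "nat \<Rightarrow> 'p set" where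
  "ocore n = {x \<in> topspace S. \<forall>v\<in>V. d v = Suc n \<longrightarrow> crd x v < 1}"

lemma core_ocore: "core n \<subseteq> ocore n"
  by (auto simp: core_def ocore_def)

lemma ocore_core: "ocore n \<subseteq> core (Suc n)"
proof
  fix x assume "x \<in> ocore n"
  then have x: "x \<in> topspace S" "\<And>v. v \<in> V \<Longrightarrow> d v = Suc n \<Longrightarrow> crd x v < 1" by (auto simp: ocore_def)
  then show "x \<in> core (Suc n)" using Y_bound_next[OF crd_in[OF x(1)] x(2)] by (simp add: core_def)
qed

lemma openin_ocore: "openin S (ocore n)"
proof -
  have "ocore n = topspace S \<inter> (\<Inter>v\<in>{v\<in>V. d v = Suc n}. {x \<in> topspace S. crd x v \<in> {..<1}})"
    by (auto simp: ocore_def)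
  also have "openin S \<dots>"
  proof (cases "{v\<in>V. d v = Suc n} = {}")
    case True
    show ?thesis unfolding True by simp
  next
    case False
    have "openin S (\<Inter>v\<in>{v\<in>V. d v = Suc n}. {x \<in> topspace S. crd x v \<in> {..<1}})"
      using finite_level False openin_continuous_map_preimage[OF crd_continuous, of "{..<1}"]
      by (intro openin_INT2) auto
    then show ?thesis by (simp add: openin_Int)
  qed
  finally show ?thesis .
qed

lemma compact_in_core:
  assumes "compactin S K" shows "\<exists>n. K \<subseteq> core n"
proof -
  have sub: "K \<subseteq> topspace S" using assms compactin_subset_topspace by blast
  have cov: "K \<subseteq> \<Union>(range ocore)"
  proof
    fix x assume "x \<in> K"
    then obtain n where "x \<in> core n" using sub core_exhaust[of x] by blast
    then show "x \<in> \<Union>(range ocore)" using subsetD[OF core_ocore] by blast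
  qed
  obtain \<F> where F: "finite \<F>" "\<F> \<subseteq> range ocore" "K \<subseteq> \<Union>\<F>"
    using compactinD[OF assms, of "range ocore"] cov openin_ocore by auto
  obtain I where I: "finite I" "\<F> = ocore ` I" using finite_subset_image[OF F(1,2)] by auto
  obtain N where N: "\<forall>n\<in>I. n \<le> N" using finite_nat_bound[OF I(1), of "\<lambda>n. n"] by blast
  have "ocore n \<subseteq> core (Suc N)" if "n \<in> I" for n
    using ocore_core[of n] core_mono[of "Suc n" "Suc N"] N that by auto
  then have "\<Union>\<F> \<subseteq> core (Suc N)" unfolding I(2) by blast
  then show ?thesis using F(3) by blast
qed

lemma k_space_S: "k_space S"
proof (rule locally_compact_imp_k_space)
  show "locally_compact_space S"
    unfolding locally_compact_space_def
    using core_exhaust openin_ocore compact_core core_ocore ocore_core by (meson subsetD)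
qed

text \<open>The cores exhaust the compact sets, and in a k-space compact preimages of compact sets suffice for
  properness.\<close>

lemma proper_criterion:
  assumes g: "continuous_map Z S g"
    and L: "\<And>n. \<exists>L. compactin Z L \<and> {z \<in> topspace Z. g z \<in> core n} \<subseteq> L"
  shows "continuous_proper Z S g"
  unfolding continuous_proper_def
proof
  show "proper_map Z S g"
  proof (rule compact_imp_proper_map)
    fix K assume K: "compactin S K"
    then obtain n where n: "K \<subseteq> core n" using compact_in_core by blast
    obtain L where L': "compactin Z L" "{z \<in> topspace Z. g z \<in> core n} \<subseteq> L" using L by blast
    have "closedin Z {z \<in> topspace Z. g z \<in> K}"
      using closedin_continuous_map_preimage[OF g] compactin_imp_closedin[OF Hausdorff_S K] by blast
    then show "compactin Z {z \<in> topspace Z. g z \<in> K}"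
      using L' n by (intro closed_compactin[OF L'(1)]) auto
  qed (use k_space_S Hausdorff_S Hausdorff_imp_kc_space g in \<open>auto simp: continuous_map_def\<close>)
qed (use g in auto)

lemma proper_iff:
  "continuous_proper S S f \<longleftrightarrow> continuous_map S S f \<and> (\<forall>n. \<exists>N. \<forall>x\<in>topspace S. f x \<in> core n \<longrightarrow> x \<in> core N)"
proof
  assume f: "continuous_proper S S f"
  then have "\<exists>N. \<forall>x\<in>topspace S. f x \<in> core n \<longrightarrow> x \<in> core N" for n
    using compact_in_core[OF compactin_proper_map_preimage[OF _ compact_core, of S f n]]
    by (auto simp: continuous_proper_def)
  with f show "continuous_map S S f \<and> (\<forall>n. \<exists>N. \<forall>x\<in>topspace S. f x \<in> core n \<longrightarrow> x \<in> core N)"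
    by (simp add: continuous_proper_def)
next
  assume f: "continuous_map S S f \<and> (\<forall>n. \<exists>N. \<forall>x\<in>topspace S. f x \<in> core n \<longrightarrow> x \<in> core N)"
  show "continuous_proper S S f"
  proof (rule proper_criterion)
    fix n
    obtain N where "\<forall>x\<in>topspace S. f x \<in> core n \<longrightarrow> x \<in> core N" using f by blast
    then show "\<exists>L. compactin S L \<and> {z \<in> topspace S. f z \<in> core n} \<subseteq> L"
      using compact_core by (intro exI[of _ "core N"]) auto
  qed (use f in blast)
qed

section \<open>Connectedness\<close>

definition geo_pt :: "real \<Rightarrow> 'p \<Rightarrow> 'p \<Rightarrow> 'p" where
  "geo_pt t x y = pt (geo t (crd x) (crd y))"

lemma geo_pt_in: "x \<in> topspace S \<Longrightarrow> y \<in> topspace S \<Longrightarrow> geo_pt t x y \<in> topspace S"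
  and crd_geo_pt: "x \<in> topspace S \<Longrightarrow> y \<in> topspace S \<Longrightarrow> crd (geo_pt t x y) = geo t (crd x) (crd y)"
  using geo_Y crd_in pt_in by (auto simp: geo_pt_def)

lemma geo_pt_0: "x \<in> topspace S \<Longrightarrow> y \<in> topspace S \<Longrightarrow> geo_pt 0 x y = x"
  and geo_pt_1: "x \<in> topspace S \<Longrightarrow> y \<in> topspace S \<Longrightarrow> geo_pt 1 x y = y"
  and geo_pt_same: "x \<in> topspace S \<Longrightarrow> geo_pt t x x = x"
  using geo_0 geo_1 geo_same crd_in by (auto simp: geo_pt_def)

lemma geo_pt_continuous:
  assumes "continuous_map Z euclideanreal t" "continuous_map Z S f" "continuous_map Z S g"
  shows "continuous_map Z S (\<lambda>z. geo_pt (t z) (f z) (g z))"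
  unfolding geo_pt_def
proof (rule pt_continuous)
  fix v
  have h: "continuous_map euclideanreal euclideanreal (\<lambda>s. cut (a + b * s) v)" for a b
    unfolding cut_def continuous_map_iff_continuous2 by (intro continuous_intros)
  have c: "continuous_map Z euclideanreal (\<lambda>z. cut (a + b * t z) v)" for a b
    using continuous_map_compose[OF assms(1) h[of a b]] by (simp add: o_def)
  have c1: "continuous_map Z euclideanreal (\<lambda>z. cut (1 - 2 * t z) v)" using c[of 1 "-2"] by simp
  have c2: "continuous_map Z euclideanreal (\<lambda>z. cut (2 * t z - 1) v)" using c[of "-1" 2] by (simp add: algebra_simps)
  have f: "continuous_map Z euclideanreal (\<lambda>z. crd (f z) v)" by (rule crd_compose[OF assms(2)])
  have g: "continuous_map Z euclideanreal (\<lambda>z. crd (g z) v)" by (rule crd_compose[OF assms(3)])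
  show "continuous_map Z euclideanreal (\<lambda>z. geo (t z) (crd (f z)) (crd (g z)) v)"
    unfolding geo_def
    by (rule continuous_map_real_max continuous_map_real_min | rule f g c1 c2)+
next
  fix z assume "z \<in> topspace Z"
  then show "geo (t z) (crd (f z)) (crd (g z)) \<in> Y"
    using assms by (intro geo_Y crd_in) (auto simp: continuous_map_def)
qed

lemma path_connected_branch: "path_connectedin S (branch v)"
  unfolding path_connectedin
proof (intro conjI ballI)
  fix x y assume xy: "x \<in> branch v" "y \<in> branch v"
  then have S: "x \<in> topspace S" "y \<in> topspace S" by (auto simp: branch_def)
  let ?g = "\<lambda>t. geo_pt t x y"
  have "pathin S ?g"
    unfolding pathin_def by (rule geo_pt_continuous) (use S in \<open>auto simp: continuous_map_from_subtopology\<close>)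
  moreover have "?g t \<in> branch v" for t
    using xy S geo_ge[of "crd x" v "crd y" t] geo_pt_in[OF S, of t] crd_geo_pt[OF S, of t]
    by (auto simp: branch_def)
  then have "?g \<in> {0..1} \<rightarrow> branch v" by blast
  ultimately show "\<exists>g. pathin S g \<and> g \<in> {0..1} \<rightarrow> branch v \<and> g 0 = x \<and> g 1 = y"
    using geo_pt_0[OF S] geo_pt_1[OF S] by blast
qed (rule branch_subset)

lemma connected_branch: "connectedin S (branch v)"
  using path_connected_branch path_connectedin_imp_connectedin by blast

text \<open>The branches of one level are disjoint and open.\<close>

lemma connected_into_branch:
  assumes A: "connectedin S A" "A \<noteq> {}" and cov: "\<And>x. x \<in> A \<Longrightarrow> \<exists>w\<in>V. d w = n \<and> x \<in> branch w"
  shows "\<exists>w\<in>V. d w = n \<and> A \<subseteq> branch w"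
proof -
  obtain x where x: "x \<in> A" using A by blast
  then obtain w where w: "w \<in> V" "d w = n" "x \<in> branch w" using cov by blast
  define U where "U = (\<Union>u\<in>{u\<in>V. d u = n \<and> u \<noteq> w}. branch u)"
  have "openin S U" unfolding U_def using openin_branch by blast
  moreover have "A \<subseteq> branch w \<union> U" using cov by (fastforce simp: U_def)
  moreover have "branch w \<inter> U \<inter> A = {}" 
  proof -
    have "x \<notin> branch w" if x: "x \<in> U" for x
    proof
      assume xw: "x \<in> branch w"
      obtain u where u: "u \<in> V" "d u = n" "u \<noteq> w" "x \<in> branch u" using x by (auto simp: U_def)
      then show False using branch_disjoint[OF u(1) w(1) _ u(4) xw] w(2) by simp
    qed
    then show ?thesis by blast
  qed
  moreover have "branch w \<inter> A \<noteq> {}" using x w by blast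
  ultimately have "U \<inter> A = {}" using connectedinD[OF A(1) openin_branch[of w], of U] by blast
  then have "A \<subseteq> branch w" using \<open>A \<subseteq> branch w \<union> U\<close> by blast
  then show ?thesis using w by blast
qed

text \<open>Connected sets are geodesically convex: they cannot avoid a point that separates two of
  their points.\<close>

lemma connected_convex:
  assumes A: "connectedin S A" and a: "a \<in> A" and b: "b \<in> A" and q: "q \<in> topspace S"
    and lo: "\<And>v. min (crd a v) (crd b v) \<le> crd q v" and hi: "\<And>v. crd q v \<le> max (crd a v) (crd b v)"
  shows "q \<in> A"
proof (rule ccontr)
  assume nq: "q \<notin> A"
  have AS: "A \<subseteq> topspace S" using A connectedin_subset_topspace by blast
  have qY: "crd q \<in> Y" using crd_in q by blast
  obtain v where vV: "v \<in> V" "0 < crd q v" and top: "\<And>w. w \<in> V \<Longrightarrow> w \<noteq> r \<Longrightarrow> par w = v \<Longrightarrow> crd q w = 0"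
    using Y_tip[OF qY] by metis
  have dis: "openin S {x \<in> topspace S. crd x v < s}" "openin S {x \<in> topspace S. s < crd x v}" for s
    using openin_continuous_map_preimage[OF crd_continuous, of "{..<s}" v]
      openin_continuous_map_preimage[OF crd_continuous, of "{s<..}" v] by auto
  define s where "s = crd q v"
  define U1 where "U1 = {x \<in> topspace S. crd x v < s}"
  show False
  proof (cases "s < 1")
    case True
    \<comment> \<open>Here \<open>q\<close> is an interior point of an edge and separates its two sides.\<close>
    define U2 where "U2 = {x \<in> topspace S. s < crd x v}"
    have ne: "crd x v \<noteq> s" if "x \<in> A" for x
    proof
      assume "crd x v = s"
      then have "crd q = crd x"
        using True vV that AS by (intro Y_eqI[of _ _ v] qY crd_in) (auto simp: s_def)
      then show False using nq that AS q crd_inj by blast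
    qed
    then have cov: "A \<subseteq> U1 \<union> U2" "U1 \<inter> U2 \<inter> A = {}" using AS by (force simp: U1_def U2_def)+
    have "U1 \<inter> A \<noteq> {}" using lo[of v] ne[OF a] ne[OF b] a b AS by (auto simp: U1_def s_def min_def split: if_splits)
    moreover have "U2 \<inter> A \<noteq> {}" using hi[of v] ne[OF a] ne[OF b] a b AS by (auto simp: U2_def s_def max_def split: if_splits)
    ultimately show False
      using connectedinD[OF A dis(1)[of s] dis(2)[of s]] cov unfolding U1_def U2_def by blast
  next
    case False
    then have s1: "s = 1" using Y_le1[OF qY, of v] by (simp add: s_def)
    \<comment> \<open>Here \<open>q\<close> is the vertex \<open>v\<close> and separates the branches of its children from each other and from the rest.\<close>
    define Ch where "Ch = {w \<in> V. w \<noteq> r \<and> par w = v}"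
    define U2 where "U2 = (\<Union>w\<in>Ch. branch w)"
    have cov: "A \<subseteq> U1 \<union> U2"
    proof
      fix x assume x: "x \<in> A"
      then have xS: "x \<in> topspace S" using AS by blast
      show "x \<in> U1 \<union> U2"
      proof (rule ccontr)
        assume no: "x \<notin> U1 \<union> U2"
        then have "crd x v = 1" using xS Y_le1[OF crd_in[OF xS], of v] s1 by (simp add: U1_def)
        moreover have "crd x w = 0" if "w \<in> V" "w \<noteq> r" "par w = v" for w
          using no that xS Y_ge0[OF crd_in[OF xS], of w] by (fastforce simp: U2_def Ch_def branch_def)
        ultimately have "crd q = crd x"
          using vV top s1 by (intro Y_eqI[of _ _ v] qY crd_in xS) (auto simp: s_def)
        then show False using nq x xS q crd_inj by blast
      qed
    qed
    have dj: "U1 \<inter> U2 = {}"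
    proof -
      have "crd x v = 1" if "x \<in> branch w" "w \<in> Ch" for x w
        using Y_par[OF crd_in, of x w] that by (auto simp: branch_def Ch_def)
      then show ?thesis using s1 by (force simp: U1_def U2_def)
    qed
    have "openin S U1" unfolding U1_def by (rule dis)
    moreover have "openin S U2" unfolding U2_def using openin_branch by blast
    ultimately have "U1 \<inter> A = {} \<or> U2 \<inter> A = {}" using connectedinD[OF A, of U1 U2] cov dj by blast
    moreover have "U1 \<inter> A \<noteq> {} \<or> A \<subseteq> U2" using cov by blast
    moreover have "\<not> (a \<in> U1 \<and> b \<in> U1)" using hi[of v] s1 by (auto simp: U1_def s_def)
    ultimately have A2: "A \<subseteq> U2" using cov a b by blast
    have "\<exists>w\<in>V. d w = Suc (d v) \<and> A \<subseteq> branch w"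
    proof (rule connected_into_branch[OF A])
      fix x assume "x \<in> A"
      then obtain w where "w \<in> Ch" "x \<in> branch w" using A2 by (auto simp: U2_def)
      then show "\<exists>w\<in>V. d w = Suc (d v) \<and> x \<in> branch w" using d_par[of w] by (auto simp: Ch_def)
    qed (use a in blast)
    then obtain w where w: "w \<in> V" "d w = Suc (d v)" "A \<subseteq> branch w" by blast
    have "par w = v" 
    proof -
      obtain w' where "w' \<in> Ch" "a \<in> branch w'" using A2 a by (auto simp: U2_def)
      moreover from this have "d w' = d w" "w' \<in> V" using d_par w by (auto simp: Ch_def)
      ultimately show ?thesis using branch_disjoint[of w' w a] w a by (auto simp: Ch_def)
    qed
    moreover have "w \<noteq> r" using w(2) by auto
    ultimately have "crd q w = 0" using top w(1) by blast
    moreover have "0 < crd a w" "0 < crd b w" using w a b by (auto simp: branch_def)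
    ultimately show False using lo[of w] by auto
  qed
qed

end

section \<open>Simplicial maps of rooted trees\<close>

context rooted_tree
begin

text \<open>Edges may be collapsed.\<close>

definition simplicial :: "('v \<Rightarrow> 'v) \<Rightarrow> bool" where
  "simplicial F \<longleftrightarrow> F r = r \<and> (\<forall>v\<in>V. F v \<in> V) \<and>
     (\<forall>v\<in>V. v \<noteq> r \<longrightarrow> F v = F (par v) \<or> F v \<noteq> r \<and> par (F v) = F (par v))"

lemma simplicialD:
  assumes "simplicial F"
  shows "F r = r" "v \<in> V \<Longrightarrow> F v \<in> V"
    "v \<in> V \<Longrightarrow> v \<noteq> r \<Longrightarrow> F v = F (par v) \<or> F v \<noteq> r \<and> par (F v) = F (par v)"
  using assms by (auto simp: simplicial_def)

lemma simplicial_par_below: "simplicial F \<Longrightarrow> v \<in> V \<Longrightarrow> v \<noteq> r \<Longrightarrow> below (F (par v)) (F v)"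
  using simplicialD(3)[of F v] simplicialD(2)[of F v] below_par[of "F v"] by fastforce

lemma simplicial_depth: "simplicial F \<Longrightarrow> v \<in> V \<Longrightarrow> d (F v) \<le> d v"
proof (induction "d v" arbitrary: v)
  case 0
  then have "F v = r" using d_zero[of v] simplicialD(1)[of F] by simp
  then show ?case by simp
next
  case (Suc k)
  then have v: "v \<noteq> r" by auto
  have "d (F (par v)) \<le> d (par v)" using Suc v par_in d_par by auto
  moreover have "d (F v) \<le> Suc (d (F (par v)))"
    using simplicialD(3)[OF Suc(3,4) v] simplicialD(2)[OF Suc(3,4)] d_par[of "F v"] by auto
  ultimately show ?case using d_par[OF Suc(4) v] by simp
qed

lemma simplicial_below: "simplicial F \<Longrightarrow> v \<in> V \<Longrightarrow> below u v \<Longrightarrow> below (F u) (F v)"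
proof (induction "d v" arbitrary: v)
  case 0 then show ?case by (simp add: below_def)
next
  case (Suc k)
  then have v: "v \<noteq> r" by auto
  show ?case
  proof (cases "u = v")
    case False
    then have "below u (par v)" using below_par_cases[OF Suc(4) v Suc(5)] by simp
    then have "below (F u) (F (par v))" using Suc v par_in d_par by auto
    then show ?thesis
      using below_trans[OF simplicialD(2)[OF Suc(3,4)]] simplicial_par_below[OF Suc(3,4) v] by blast
  qed simp
qed

text \<open>The vertices at which the path from the root enters the fibre over \<open>w\<close>.\<close>

definition entry :: "('v \<Rightarrow> 'v) \<Rightarrow> 'v \<Rightarrow> 'v set" where
  "entry F w = {v \<in> V. F v = w \<and> (v = r \<or> F (par v) \<noteq> w)}"

text \<open>The linear extension of \<open>F\<close>: the path to the image point advances towards \<open>w\<close> while the path to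
  the point advances towards its entry into the fibre over \<open>w\<close>.\<close>

definition push :: "('v \<Rightarrow> 'v) \<Rightarrow> ('v \<Rightarrow> real) \<Rightarrow> 'v \<Rightarrow> real" where
  "push F y w = (\<Sum>v\<in>entry F w. y v)"

definition proper_simplicial :: "('v \<Rightarrow> 'v) \<Rightarrow> bool" where
  "proper_simplicial F \<longleftrightarrow> simplicial F \<and> (\<forall>n. \<exists>N. \<forall>v\<in>V. N \<le> d v \<longrightarrow> n \<le> d (F v))"

lemma finite_entry:
  assumes "proper_simplicial F" shows "finite (entry F w)"
proof -
  obtain N where N: "\<And>v. v \<in> V \<Longrightarrow> N \<le> d v \<Longrightarrow> Suc (d w) \<le> d (F v)"
    using assms unfolding proper_simplicial_def by blast
  have "entry F w \<subseteq> {v \<in> V. d v \<le> N}" using N by (force simp: entry_def)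
  then show ?thesis using finite_upto finite_subset by blast
qed

lemma entry_unique:
  assumes F: "simplicial F" and y: "y \<in> Y" and uv: "u \<in> entry F w" "v \<in> entry F w" "0 < y u" "0 < y v"
  shows "u = v"
proof -
  have *: "u = v" if uv: "u \<in> entry F w" "v \<in> entry F w" "0 < y u" "0 < y v" "d u \<le> d v" for u v
  proof (rule ccontr)
    assume ne: "u \<noteq> v"
    have V: "u \<in> V" "v \<in> V" "F u = w" "F v = w" using uv by (auto simp: entry_def)
    have b: "below u v" using Y_chain[OF y V(1,2) uv(3-5)] .
    have v: "v \<noteq> r" 
    proof
      assume "v = r" then have "d u = 0" using uv by simp
      then show False using d_zero V ne \<open>v = r\<close> by blast
    qed
    have pv: "par v \<in> V" using par_in V v by blast
    have "below u (par v)" using below_par_cases[OF V(2) v b] ne by simp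
    then have "below w (F (par v))" using simplicial_below[OF F pv] V by blast
    moreover have "below (F (par v)) w" using simplicial_par_below[OF F V(2) v] V by simp
    ultimately have "F (par v) = w" by (auto simp: below_def intro!: below_level)
    then show False using uv(2) v by (simp add: entry_def)
  qed
  show ?thesis using *[of u v] *[of v u] uv nat_le_linear[of "d u" "d v"] by metis
qed

lemma push_entry:
  assumes F: "proper_simplicial F" and y: "y \<in> Y" and v: "v \<in> entry F w" "0 < y v"
  shows "push F y w = y v"
proof -
  have s: "simplicial F" using F by (simp add: proper_simplicial_def)
  have "y u = 0" if "u \<in> entry F w - {v}" for u
    using entry_unique[OF s y _ v(1) _ v(2), of u] that Y_ge0[OF y, of u] by fastforce
  then show ?thesis unfolding push_def using sum.remove[OF finite_entry[OF F] v(1), of y] by simp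
qed

lemma push_pos:
  assumes y: "y \<in> Y" and p: "push F y w \<noteq> 0"
  shows "\<exists>v\<in>entry F w. 0 < y v"
proof (rule ccontr)
  assume "\<not> ?thesis"
  then have "y v = 0" if "v \<in> entry F w" for v using that Y_ge0[OF y, of v] by fastforce
  then show False using p by (simp add: push_def)
qed

lemma push_cases:
  assumes "proper_simplicial F" "y \<in> Y" "push F y w \<noteq> 0"
  obtains v where "v \<in> entry F w" "0 < y v" "push F y w = y v"
  using push_pos[OF assms(2,3)] push_entry[OF assms(1,2)] by blast

lemma push_branch:
  assumes F: "proper_simplicial F" and y: "y \<in> Y"
  shows "v \<in> V \<Longrightarrow> 0 < y v \<Longrightarrow> 0 < push F y (F v)"
proof (induction "d v" arbitrary: v)
  case 0
  then have "v \<in> entry F (F v)" using d_zero by (simp add: entry_def)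
  then show ?case using push_entry[OF F y] 0 by simp
next
  case (Suc k)
  then have v: "v \<noteq> r" by auto
  show ?case
  proof (cases "v \<in> entry F (F v)")
    case True then show ?thesis using push_entry[OF F y] Suc by simp
  next
    case False
    then have e: "F (par v) = F v" using Suc v by (simp add: entry_def)
    have "0 < y (par v)" using Y_par[OF y Suc(3) v Suc(4)] by simp
    then show ?thesis using Suc(1)[of "par v"] Suc(2,3) v e par_in d_par by force
  qed
qed

lemma push_Y:
  assumes F: "proper_simplicial F" and y: "y \<in> Y"
  shows "push F y \<in> Y"
proof -
  have s: "simplicial F" using F by (simp add: proper_simplicial_def)
  obtain n where n: "\<forall>v. n < d v \<longrightarrow> y v = 0" using Y_bounded[OF y] by blast
  show ?thesis
  proof (rule YI[where n = n])
    fix w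
    show "0 \<le> push F y w" unfolding push_def by (intro sum_nonneg Y_ge0[OF y])
    show "push F y w \<le> 1"
      by (cases "push F y w = 0") (auto elim: push_cases[OF F y] simp: Y_le1[OF y])
    show "push F y w = 0" if "w \<notin> V"
    proof -
      have "entry F w = {}" using simplicialD(2)[OF s] that by (auto simp: entry_def)
      then show ?thesis by (simp add: push_def)
    qed
    show "push F y w = 0" if "n < d w"
    proof (rule ccontr)
      assume "push F y w \<noteq> 0"
      then obtain v where v: "v \<in> entry F w" "0 < y v" by (rule push_cases[OF F y])
      then have "d w \<le> d v" using simplicial_depth[OF s, of v] by (auto simp: entry_def)
      then show False using n that v by auto
    qed
  next
    have "r \<in> entry F r" using root_in simplicialD(1)[OF s] by (simp add: entry_def)
    then show "push F y r = 1" using push_entry[OF F y] Y_root[OF y] by simp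
  next
    fix w assume w: "w \<in> V" "w \<noteq> r" "0 < push F y w"
    then have "push F y w \<noteq> 0" by simp
    then obtain v where v: "v \<in> entry F w" "0 < y v" by (rule push_cases[OF F y])
    have vV: "v \<in> V" "F v = w" using v by (auto simp: entry_def)
    have vr: "v \<noteq> r" using vV w simplicialD(1)[OF s] by auto
    have e: "par w = F (par v)"
      using simplicialD(3)[OF s vV(1) vr] v vV vr by (auto simp: entry_def)
    have p1: "y (par v) = 1" "par v \<in> V" using Y_par[OF y vV(1) vr v(2)] par_in vV vr by auto
    have "push F y (par w) \<noteq> 0" using push_branch[OF F y p1(2)] p1 e by simp
    then obtain u where u: "u \<in> entry F (par w)" "0 < y u" "push F y (par w) = y u" by (rule push_cases[OF F y])
    have uV: "u \<in> V" "F u = F (par v)" using u e by (auto simp: entry_def)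
    have "y u = 1"
    proof (cases "d u < d v")
      case True
      then have "below u v" "u \<noteq> v" using Y_chain[OF y uV(1) vV(1) u(2) v(2)] by auto
      then show ?thesis using Y_below[OF y vV(1) v(2)] by blast
    next
      case False
      then have vu: "below v u" using Y_chain[OF y vV(1) uV(1) v(2) u(2)] by simp
      have "below w (par w)" using simplicial_below[OF s uV(1) vu] uV(2) vV(2) e by simp
      then show ?thesis using d_par[OF w(1,2)] by (simp add: below_def)
    qed
    then show "push F y (par w) = 1" using u by simp
  next
    fix w w' assume w: "w \<in> V" "w' \<in> V" "d w = d w'" "0 < push F y w" "0 < push F y w'"
    then have ne: "push F y w \<noteq> 0" "push F y w' \<noteq> 0" by auto
    obtain v where v: "v \<in> entry F w" "0 < y v" using ne(1) by (rule push_cases[OF F y])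
    obtain v' where v': "v' \<in> entry F w'" "0 < y v'" using ne(2) by (rule push_cases[OF F y])
    have V: "v \<in> V" "F v = w" "v' \<in> V" "F v' = w'" using v v' by (auto simp: entry_def)
    have "below v v' \<or> below v' v"
      using Y_chain[OF y V(1,3) v(2) v'(2)] Y_chain[OF y V(3,1) v'(2) v(2)] nat_le_linear[of "d v" "d v'"] by blast
    then have "below w w' \<or> below w' w" using simplicial_below[OF s] V by blast
    then show "w = w'" using below_level w(3) by metis
  qed
qed

lemma push_id:
  assumes F: "proper_simplicial F" and y: "y \<in> Y"
    and id: "\<And>v. v \<in> V \<Longrightarrow> d v \<le> m \<Longrightarrow> F v = v" and m: "\<And>v. m < d v \<Longrightarrow> y v = 0"
  shows "push F y = y"
proof
  fix w
  have s: "simplicial F" using F by (simp add: proper_simplicial_def)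
  have dv: "d v \<le> m" if "0 < y v" for v using m[of v] that by (cases "d v \<le> m") auto
  show "push F y w = y w"
  proof (cases "0 < y w")
    case True
    then have w: "w \<in> V" "d w \<le> m" using Y_in[OF y] dv by auto
    have "w \<in> entry F w"
    proof -
      have "F (par w) \<noteq> w" if "w \<noteq> r"
        using simplicial_depth[OF s, of "par w"] par_in[OF w(1) that] d_par[OF w(1) that] by auto
      then show ?thesis using w id by (auto simp: entry_def)
    qed
    then show ?thesis using push_entry[OF F y] True by blast
  next
    case False
    have "push F y w = 0"
    proof (rule ccontr)
      assume "push F y w \<noteq> 0"
      then obtain v where v: "v \<in> entry F w" "0 < y v" by (rule push_cases[OF F y])
      then have "v = w" using id[of v] dv by (simp add: entry_def)
      then show False using v False by simp
    qed
    then show ?thesis using False Y_ge0[OF y, of w] by simp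
  qed
qed

section \<open>Simplicial maps inducing a given map of ends\<close>

text \<open>The induced map is built depth by depth: a vertex \<open>v\<close> proceeds to a child of the image of its
  parent if \<open>\<phi>\<close> maps all ends beyond \<open>v\<close> beyond this child, and waits otherwise. The ball of radius
  \<open>m\<close> is fixed. Outside this ball, vertices without ends beyond them wait.\<close>

primrec follow :: "((nat \<Rightarrow> 'v) \<Rightarrow> (nat \<Rightarrow> 'v)) \<Rightarrow> nat \<Rightarrow> nat \<Rightarrow> 'v \<Rightarrow> 'v" where
  "follow \<phi> m 0 v = r"
| "follow \<phi> m (Suc n) v =
     (if Suc n \<le> m then v
      else if \<exists>w\<in>V. w \<noteq> r \<and> par w = follow \<phi> m n (par v) \<and> shadow v \<noteq> {} \<and> \<phi> ` shadow v \<subseteq> shadow w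
      then SOME w. w \<in> V \<and> w \<noteq> r \<and> par w = follow \<phi> m n (par v) \<and> shadow v \<noteq> {} \<and> \<phi> ` shadow v \<subseteq> shadow w
      else follow \<phi> m n (par v))"

lemma shadow_below: "v \<in> V \<Longrightarrow> below u v \<Longrightarrow> shadow v \<subseteq> shadow u"
  using shadow_anc[of v "d u"] by (simp add: below_def)

lemma in_shadow: "\<xi> \<in> shadow v \<longleftrightarrow> \<xi> \<in> rays \<and> \<xi> (d v) = v"
  by (simp add: shadow_def)

lemma ray_below: "\<xi> \<in> rays \<Longrightarrow> n \<le> m \<Longrightarrow> below (\<xi> n) (\<xi> m)"
  by (simp add: below_def ray_d ray_anc)

text \<open>The point is properness. By continuity and compactness, beyond some depth \<open>N0\<close> the ends beyond a vertex
  are mapped beyond a single vertex of depth \<open>n\<close>. From there on, each step along vertices with ends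
  beyond them makes progress until the image has depth \<open>n\<close>, and after \<open>n\<close> steps it has. All but
  finitely many vertices lie beyond such a vertex.\<close>

lemma follow_exists:
  assumes \<phi>: "continuous_map ends ends \<phi>"
    and pres: "\<And>v. v \<in> V \<Longrightarrow> d v \<le> m \<Longrightarrow> \<phi> ` shadow v \<subseteq> shadow v"
  obtains F where "proper_simplicial F" "\<And>v. v \<in> V \<Longrightarrow> d v \<le> m \<Longrightarrow> F v = v"
    "\<And>v. v \<in> V \<Longrightarrow> \<phi> ` shadow v \<subseteq> shadow (F v)"
proof -
  define F where "F v = follow \<phi> m (d v) v" for v
  define Q where "Q v w \<longleftrightarrow> w \<in> V \<and> w \<noteq> r \<and> par w = F (par v) \<and> shadow v \<noteq> {} \<and> \<phi> ` shadow v \<subseteq> shadow w" for v w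
  have Fr: "F r = r" by (simp add: F_def)
  have step: "F v = (if d v \<le> m then v else if \<exists>w. Q v w then SOME w. Q v w else F (par v))"
    if "v \<in> V" "v \<noteq> r" for v
  proof -
    have "d v = Suc (d (par v))" using d_par that by simp
    then show ?thesis unfolding F_def Q_def by (simp add: Bex_def)
  qed
  have id: "F v = v" if "v \<in> V" "d v \<le> m" for v
    using step[OF that(1)] that Fr by (cases "v = r") auto
  have cases: "F v = F (par v) \<or> Q v (F v)" if "v \<in> V" "v \<noteq> r" "m < d v" for v
    using step[OF that(1,2)] that(3) someI_ex[of "Q v"] by (auto split: if_splits)
  have FV: "F v \<in> V" if "v \<in> V" for v
    using that
  proof (induction "d v" arbitrary: v)
    case 0 then show ?case using d_zero Fr root_in by auto
  next
    case (Suc k)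
    then have v: "v \<noteq> r" by auto
    have "F (par v) \<in> V" using Suc v par_in d_par by auto
    then show ?case using cases[OF Suc(3) v] id[OF Suc(3)] Suc(3) by (cases "d v \<le> m") (auto simp: Q_def)
  qed
  have simp: "simplicial F"
    unfolding simplicial_def
  proof (intro conjI ballI impI)
    fix v assume v: "v \<in> V" "v \<noteq> r"
    show "F v = F (par v) \<or> F v \<noteq> r \<and> par (F v) = F (par v)"
    proof (cases "d v \<le> m")
      case True
      then have "F (par v) = par v" using id[of "par v"] par_in d_par v by auto
      then show ?thesis using id[OF v(1) True] v by simp
    next
      case False
      then show ?thesis using cases[OF v] by (auto simp: Q_def)
    qed
  qed (use Fr FV in auto)
  have ray: "\<phi> \<xi> \<in> rays" if "\<xi> \<in> rays" for \<xi> using \<phi> that by (auto simp: continuous_map_def)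
  have sh: "\<phi> ` shadow v \<subseteq> shadow (F v)" if "v \<in> V" for v
    using that
  proof (induction "d v" arbitrary: v)
    case 0 
    then have "v = r" using d_zero by simp
    then show ?case using pres[of r] Fr root_in by simp
  next
    case (Suc k)
    then have v: "v \<noteq> r" by auto
    have IH: "\<phi> ` shadow (par v) \<subseteq> shadow (F (par v))" using Suc v par_in d_par by auto
    have sub: "shadow v \<subseteq> shadow (par v)" using shadow_below[OF Suc(3) below_par[OF Suc(3) v]] .
    show ?case
    proof (cases "d v \<le> m")
      case True then show ?thesis using id[OF Suc(3)] pres[OF Suc(3)] by simp
    next
      case False
      then consider "F v = F (par v)" | "\<phi> ` shadow v \<subseteq> shadow (F v)"
        using cases[OF Suc(3) v] by (auto simp: Q_def)
      then show ?thesis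
      proof cases
        case 1 then show ?thesis unfolding 1 using IH sub by blast
      qed
    qed
  qed
  have progress: "d (F v) = Suc (d (F (par v)))"
    if v: "v \<in> V" "m < d v" "shadow v \<noteq> {}" and w: "w \<in> V" "\<phi> ` shadow v \<subseteq> shadow w" "d (F (par v)) < d w" for v w
  proof -
    have vr: "v \<noteq> r" using v by auto
    obtain \<xi> where xi: "\<xi> \<in> shadow v" using v by blast
    have "\<phi> \<xi> \<in> shadow w" using xi w by blast
    moreover have "\<phi> \<xi> \<in> shadow (F (par v))"
      using xi shadow_below[OF v(1) below_par[OF v(1) vr]] sh[OF par_in[OF v(1) vr]] by blast
    ultimately have "below (F (par v)) w"
      using ray_below[of "\<phi> \<xi>" "d (F (par v))" "d w"] w(3) by (simp add: in_shadow)
    moreover have "F (par v) \<noteq> w" using w(3) by auto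
    ultimately obtain w' where w': "w' \<in> V" "w' \<noteq> r" "par w' = F (par v)" "below w' w"
      using child_towards[OF w(1)] by blast
    have "Q v w'" using w' v(3) w(2) shadow_below[OF w(1) w'(4)] by (auto simp: Q_def)
    then have "Q v (F v)" using step[OF v(1) vr] v(2) someI[of "Q v" w'] by auto
    then show ?thesis using d_par[of "F v"] by (simp add: Q_def)
  qed
  have "\<exists>N. \<forall>v\<in>V. N \<le> d v \<longrightarrow> n \<le> d (F v)" for n
  proof -
    have "\<exists>N. \<forall>\<xi>\<in>rays. \<forall>k\<ge>N. \<exists>w\<in>V. d w = n \<and> \<phi> ` shadow (\<xi> k) \<subseteq> shadow w"
    proof (rule rays_uniform)
      fix \<xi> assume xi: "\<xi> \<in> rays"
      let ?U = "{\<eta> \<in> rays. \<phi> \<eta> \<in> shadow (\<phi> \<xi> n)}"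
      have "openin ends ?U" using openin_continuous_map_preimage[OF \<phi> openin_shadow] by simp
      moreover have "\<xi> \<in> ?U" using xi ray ray_in_shadow by blast
      ultimately obtain k where k: "shadow (\<xi> k) \<subseteq> ?U" unfolding openin_ends by blast
      have "\<phi> \<xi> n \<in> V" "d (\<phi> \<xi> n) = n" using ray_in ray_d ray xi by auto
      then show "\<exists>k. \<exists>w\<in>V. d w = n \<and> \<phi> ` shadow (\<xi> k) \<subseteq> shadow w" using k by blast
    next
      fix \<xi> and k l :: nat assume "\<xi> \<in> rays" "k \<le> l" "\<exists>w\<in>V. d w = n \<and> \<phi> ` shadow (\<xi> k) \<subseteq> shadow w"
      moreover have "shadow (\<xi> l) \<subseteq> shadow (\<xi> k)"
        using shadow_below ray_below calculation ray_in by blast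
      ultimately show "\<exists>w\<in>V. d w = n \<and> \<phi> ` shadow (\<xi> l) \<subseteq> shadow w" by blast
    qed
    then obtain N1 where N1: "\<And>\<xi> k. \<xi> \<in> rays \<Longrightarrow> N1 \<le> k \<Longrightarrow> \<exists>w\<in>V. d w = n \<and> \<phi> ` shadow (\<xi> k) \<subseteq> shadow w"
      by blast
    define N0 where "N0 = max N1 m"
    have N0: "\<exists>w\<in>V. d w = n \<and> \<phi> ` shadow v \<subseteq> shadow w" if v: "v \<in> V" "N0 \<le> d v" "shadow v \<noteq> {}" for v
    proof -
      obtain \<xi> where "\<xi> \<in> rays" "\<xi> (d v) = v" using v by (auto simp: in_shadow)
      then show ?thesis using N1[of \<xi> "d v"] v by (simp add: N0_def)
    qed
    have grow: "min n j \<le> d (F v)" if "v \<in> V" "d v = N0 + j" "shadow v \<noteq> {}" for j v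
      using that
    proof (induction j arbitrary: v)
      case 0 then show ?case by simp
    next
      case (Suc j)
      then have v: "v \<noteq> r" by auto
      have "shadow (par v) \<noteq> {}" using Suc(4) shadow_below[OF Suc(2) below_par[OF Suc(2) v]] by blast
      then have IH: "min n j \<le> d (F (par v))" using Suc(1)[of "par v"] Suc(2,3) v par_in d_par by auto
      show ?case
      proof (cases "d (F (par v)) < n")
        case True
        obtain w where "w \<in> V" "d w = n" "\<phi> ` shadow v \<subseteq> shadow w" using N0[of v] Suc by auto
        then show ?thesis using progress[of v w] Suc True IH by (simp add: N0_def)
      next
        case False
        then show ?thesis using simplicial_par_below[OF simp Suc(2) v] by (auto simp: below_def)
      qed
    qed
    obtain N where N: "N0 + n \<le> N" "\<And>u. u \<in> V \<Longrightarrow> N \<le> d u \<Longrightarrow> shadow (anc (N0 + n) u) \<noteq> {}"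
      using shadow_level[of "N0 + n"] by blast
    have "n \<le> d (F u)" if u: "u \<in> V" "N \<le> d u" for u
    proof -
      have "min n n \<le> d (F (anc (N0 + n) u))" using grow[of "anc (N0 + n) u" n] N u by simp
      also have "\<dots> \<le> d (F u)" using simplicial_below[OF simp u(1) below_anc[OF u(1)]] by (simp add: below_def)
      finally show ?thesis by simp
    qed
    then show ?thesis by blast
  qed
  then have "proper_simplicial F" using simp by (simp add: proper_simplicial_def)
  then show thesis using that id sh by blast
qed

end

context tree_space
begin

section \<open>The action of proper maps on the ends\<close>

lemma branch_core: "x \<in> branch v \<Longrightarrow> N < d v \<Longrightarrow> x \<notin> core N"
  unfolding branch_def core_def by fastforce

lemma ray_root: "\<xi> \<in> rays \<Longrightarrow> \<xi> 0 = r"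
  using d_zero[of "\<xi> 0"] ray_in[of \<xi> 0] ray_d[of \<xi> 0] by simp

lemma shadow_root: "shadow r = rays"
  using ray_root by (auto simp: shadow_def)

text \<open>The action of \<open>f\<close> on the ends: at each level \<open>n\<close>, the far branches along \<open>\<xi>\<close> are mapped into a single branch.\<close>

definition bd :: "('p \<Rightarrow> 'p) \<Rightarrow> (nat \<Rightarrow> 'v) \<Rightarrow> nat \<Rightarrow> 'v" where
  "bd f \<xi> n = (THE w. w \<in> V \<and> d w = n \<and> (\<exists>k. f ` branch (\<xi> k) \<subseteq> branch w))"

text \<open>A far branch is connected, and its image avoids a given core because \<open>f\<close> is proper.\<close>

lemma branch_image:
  assumes f: "continuous_proper S S f"
  shows "\<exists>N. \<forall>v\<in>V. N \<le> d v \<longrightarrow> (\<exists>w\<in>V. d w = n \<and> f ` branch v \<subseteq> branch w)"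
proof -
  have cf: "continuous_map S S f" using f by (simp add: continuous_proper_def)
  have fS: "f x \<in> topspace S" if "x \<in> topspace S" for x using cf that by (auto simp: continuous_map_def)
  show ?thesis
  proof (cases n)
    case 0
    have "f ` branch v \<subseteq> branch r" for v
      using fS subsetD[OF branch_subset] unfolding branch_root by auto
    then show ?thesis using 0 root_in by (intro exI[of _ 0] ballI impI bexI[of _ r]) auto
  next
    case (Suc m)
    obtain N where N: "\<And>x. x \<in> topspace S \<Longrightarrow> f x \<in> core m \<Longrightarrow> x \<in> core N"
      using f unfolding proper_iff by blast
    have "\<exists>w\<in>V. d w = n \<and> f ` branch v \<subseteq> branch w" if v: "v \<in> V" "Suc N \<le> d v" for v
    proof (rule connected_into_branch)
      show "connectedin S (f ` branch v)" using cf connected_branch connectedin_continuous_map_image by blast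
      show "f ` branch v \<noteq> {}" using vertex_in_branch[OF v(1)] by blast
      fix y assume "y \<in> f ` branch v"
      then obtain x where x: "x \<in> branch v" "y = f x" by blast
      then have xS: "x \<in> topspace S" using branch_subset by blast
      have "x \<notin> core N" using branch_core[OF x(1)] v by simp
      then have "f x \<notin> core m" using N xS by blast
      then show "\<exists>w\<in>V. d w = n \<and> y \<in> branch w" using outside_core[OF fS[OF xS]] x Suc by simp
    qed
    then show ?thesis by blast
  qed
qed

lemma branch_ray_mono: "\<xi> \<in> rays \<Longrightarrow> n \<le> m \<Longrightarrow> branch (\<xi> m) \<subseteq> branch (\<xi> n)"
  using branch_mono ray_in ray_below by blast

lemma bd_eqI:
  assumes \<xi>: "\<xi> \<in> rays" and f: "f ` branch (\<xi> k) \<subseteq> branch w" and w: "w \<in> V"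
  shows "bd f \<xi> (d w) = w"
  unfolding bd_def
proof (rule the_equality)
  fix u assume u: "u \<in> V \<and> d u = d w \<and> (\<exists>k. f ` branch (\<xi> k) \<subseteq> branch u)"
  then obtain l where l: "f ` branch (\<xi> l) \<subseteq> branch u" by blast
  obtain x where x: "x \<in> branch (\<xi> (max k l))" using vertex_in_branch ray_in[OF \<xi>] by blast
  then have "f x \<in> branch w" "f x \<in> branch u"
    using subsetD[OF branch_ray_mono[OF \<xi>, of k "max k l"] x] subsetD[OF branch_ray_mono[OF \<xi>, of l "max k l"] x]
      f l by auto
  then show "u = w" using branch_disjoint[of u w "f x"] u w by simp
qed (use f w in blast)

lemma bd_props:
  assumes f: "continuous_proper S S f" and \<xi>: "\<xi> \<in> rays"
  shows "bd f \<xi> n \<in> V \<and> d (bd f \<xi> n) = n \<and> (\<exists>k. f ` branch (\<xi> k) \<subseteq> branch (bd f \<xi> n))"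
proof -
  obtain N where N: "\<forall>v\<in>V. N \<le> d v \<longrightarrow> (\<exists>w\<in>V. d w = n \<and> f ` branch v \<subseteq> branch w)"
    using branch_image[OF f] by blast
  then obtain w where w: "w \<in> V" "d w = n" "f ` branch (\<xi> N) \<subseteq> branch w"
    using N[rule_format, of "\<xi> N"] ray_in[OF \<xi>, of N] ray_d[OF \<xi>, of N] by auto
  then have "bd f \<xi> n = w" using bd_eqI[OF \<xi> w(3,1)] by simp
  then show ?thesis using w by blast
qed

lemma bd_reach: "continuous_proper S S f \<Longrightarrow> \<xi> \<in> rays \<Longrightarrow> \<exists>k. f ` branch (\<xi> k) \<subseteq> branch (bd f \<xi> n)"
  using bd_props by blast

lemma bd_rays:
  assumes f: "continuous_proper S S f" and \<xi>: "\<xi> \<in> rays"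
  shows "bd f \<xi> \<in> rays"
proof -
  have "par (bd f \<xi> (Suc n)) = bd f \<xi> n" for n
  proof -
    let ?w = "bd f \<xi> (Suc n)"
    have w: "?w \<in> V" "d ?w = Suc n" using bd_props[OF f \<xi>] by auto
    then have wr: "?w \<noteq> r" by (metis d_root nat.distinct(1))
    obtain k where k: "f ` branch (\<xi> k) \<subseteq> branch ?w" using bd_reach[OF f \<xi>] by blast
    then have "f ` branch (\<xi> k) \<subseteq> branch (par ?w)" using branch_mono[OF w(1) below_par[OF w(1) wr]] by blast
    then have "bd f \<xi> (d (par ?w)) = par ?w" using bd_eqI[OF \<xi>] par_in w wr by blast
    then show ?thesis using d_par[OF w(1) wr] w by simp
  qed
  then show ?thesis using bd_props[OF f \<xi>] by (simp add: rays_def)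
qed

lemma bd_continuous:
  assumes f: "continuous_proper S S f"
  shows "continuous_map ends ends (bd f)"
  unfolding continuous_map_def topspace_ends
proof (intro conjI allI impI)
  fix U assume U: "openin ends U"
  have "\<exists>n. shadow (\<xi> n) \<subseteq> {\<xi> \<in> rays. bd f \<xi> \<in> U}" if xi: "\<xi> \<in> {\<xi> \<in> rays. bd f \<xi> \<in> U}" for \<xi>
  proof -
    have x: "\<xi> \<in> rays" "bd f \<xi> \<in> U" using xi by auto
    obtain n where n: "shadow (bd f \<xi> n) \<subseteq> U" using U x unfolding openin_ends by blast
    obtain k where k: "f ` branch (\<xi> k) \<subseteq> branch (bd f \<xi> n)" using bd_reach[OF f x(1)] by blast
    have "bd f \<eta> \<in> U" if "\<eta> \<in> shadow (\<xi> k)" for \<eta>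
    proof -
      have e: "\<eta> \<in> rays" "\<eta> k = \<xi> k" using that x ray_d by (auto simp: in_shadow)
      have "bd f \<eta> (d (bd f \<xi> n)) = bd f \<xi> n"
        using k e bd_props[OF f x(1)] by (intro bd_eqI[OF e(1), of f k]) auto
      then show ?thesis using n bd_rays[OF f e(1)] by (auto simp: in_shadow)
    qed
    then show ?thesis by (intro exI[of _ k]) (auto simp: in_shadow)
  qed
  then show "openin ends {\<xi> \<in> rays. bd f \<xi> \<in> U}" unfolding openin_ends by blast
qed (use bd_rays[OF f] in auto)

lemma continuous_proper_comp:
  "continuous_proper S S f \<Longrightarrow> continuous_proper S S g \<Longrightarrow> continuous_proper S S (f \<circ> g)"
  unfolding continuous_proper_def using continuous_map_compose proper_map_compose by blast

lemma continuous_proper_id: "continuous_proper S S id"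
  by (simp add: continuous_proper_def)

lemma bd_id: "\<xi> \<in> rays \<Longrightarrow> bd id \<xi> = \<xi>"
proof
  fix n assume x: "\<xi> \<in> rays"
  show "bd id \<xi> n = \<xi> n" using bd_eqI[OF x, of id n "\<xi> n"] ray_in[OF x] ray_d[OF x] by simp
qed

lemma bd_comp:
  assumes f: "continuous_proper S S f" and g: "continuous_proper S S g" and \<xi>: "\<xi> \<in> rays"
  shows "bd (f \<circ> g) \<xi> = bd f (bd g \<xi>)"
proof
  fix n
  let ?w = "bd f (bd g \<xi>) n"
  have w: "?w \<in> V" "d ?w = n" using bd_props[OF f bd_rays[OF g \<xi>]] by auto
  obtain k where k: "f ` branch (bd g \<xi> k) \<subseteq> branch ?w" using bd_reach[OF f bd_rays[OF g \<xi>]] by blast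
  obtain l where l: "g ` branch (\<xi> l) \<subseteq> branch (bd g \<xi> k)" using bd_reach[OF g \<xi>] by blast
  have "(f \<circ> g) ` branch (\<xi> l) \<subseteq> branch ?w"
    unfolding image_comp[symmetric] using image_mono[OF l, of f] k by (rule order_trans)
  then show "bd (f \<circ> g) \<xi> n = ?w" using bd_eqI[OF \<xi> _ w(1), of "f \<circ> g" l] w(2) by simp
qed

text \<open>The track of a far branch under a proper homotopy is connected and avoids a given core.\<close>

lemma bd_homotopic:
  assumes H: "proper_homotopy S S f g H" and \<xi>: "\<xi> \<in> rays"
  shows "bd f \<xi> = bd g \<xi>"
proof
  fix n
  let ?Z = "prod_topology (top_of_set {0..1::real}) S"
  have cH: "continuous_map ?Z S H" and pH: "proper_map ?Z S H"
    and e: "\<And>x. x \<in> topspace S \<Longrightarrow> H (0, x) = f x \<and> H (1, x) = g x"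
    using H by (auto simp: proper_homotopy_def continuous_proper_def)
  have HS: "H (t, x) \<in> topspace S" if "t \<in> {0..1}" "x \<in> topspace S" for t x
    using cH that by (auto simp: continuous_map_def)
  have "\<exists>k. \<exists>w\<in>V. d w = n \<and> H ` ({0..1} \<times> branch (\<xi> k)) \<subseteq> branch w"
  proof (cases n)
    case 0
    have "H ` ({0..1} \<times> branch (\<xi> 0)) \<subseteq> branch r"
      using HS subsetD[OF branch_subset] unfolding branch_root by auto
    then show ?thesis using 0 root_in d_root by blast
  next
    case (Suc m)
    have "compactin ?Z {z \<in> topspace ?Z. H z \<in> core m}" by (rule compactin_proper_map_preimage[OF pH compact_core])
    then have "compactin S (snd ` {z \<in> topspace ?Z. H z \<in> core m})"
      by (rule image_compactin) (rule continuous_map_snd)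
    then obtain N where N: "snd ` {z \<in> topspace ?Z. H z \<in> core m} \<subseteq> core N" using compact_in_core by blast
    let ?v = "\<xi> (Suc N)"
    have v: "?v \<in> V" "d ?v = Suc N" using ray_in[OF \<xi>] ray_d[OF \<xi>] by auto
    have "\<exists>w\<in>V. d w = n \<and> H ` ({0..1} \<times> branch ?v) \<subseteq> branch w"
    proof (rule connected_into_branch)
      have "connectedin (top_of_set {0..1::real}) {0..1}" by (simp add: connectedin_subtopology)
      then have "connectedin ?Z ({0..1} \<times> branch ?v)" using connected_branch by (simp add: connectedin_Times)
      then show "connectedin S (H ` ({0..1} \<times> branch ?v))" using cH connectedin_continuous_map_image by blast
      show "H ` ({0..1} \<times> branch ?v) \<noteq> {}" using vertex_in_branch[OF v(1)] by auto
      fix y assume "y \<in> H ` ({0..1} \<times> branch ?v)"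
      then obtain t x where x: "t \<in> {0..1}" "x \<in> branch ?v" "y = H (t, x)" by blast
      then have xS: "x \<in> topspace S" using branch_subset by blast
      have "x \<notin> core N" using branch_core[OF x(2)] v by simp
      then have "H (t, x) \<notin> core m" using N xS x(1) by force
      then show "\<exists>w\<in>V. d w = n \<and> y \<in> branch w" using outside_core[OF HS[OF x(1) xS]] x Suc by simp
    qed
    then show ?thesis by blast
  qed
  then obtain k w where w: "w \<in> V" "d w = n" "H ` ({0..1} \<times> branch (\<xi> k)) \<subseteq> branch w" by blast
  have "f x \<in> branch w \<and> g x \<in> branch w" if x: "x \<in> branch (\<xi> k)" for x
  proof -
    have "H (0, x) \<in> branch w" "H (1, x) \<in> branch w" using w(3) x by auto
    then show ?thesis using e x branch_subset by force
  qed
  then have "f ` branch (\<xi> k) \<subseteq> branch w" "g ` branch (\<xi> k) \<subseteq> branch w" by auto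
  then show "bd f \<xi> n = bd g \<xi> n" using bd_eqI[OF \<xi> _ w(1)] w(2) by metis
qed

text \<open>Moving \<open>f x\<close> to \<open>g x\<close> along the geodesic is a proper homotopy if \<open>f\<close> and \<open>g\<close> agree on the ends.\<close>

definition geo_homotopy :: "('p \<Rightarrow> 'p) \<Rightarrow> ('p \<Rightarrow> 'p) \<Rightarrow> real \<times> 'p \<Rightarrow> 'p" where
  "geo_homotopy f g z = geo_pt (fst z) (f (snd z)) (g (snd z))"

text \<open>Far out, \<open>x\<close> lies beyond a vertex of level \<open>k\<close> passed by some ray. The branch of this vertex is mapped
  by \<open>f\<close> and by \<open>g\<close> into branches of level \<open>n + 1\<close>, and these coincide since \<open>f\<close> and \<open>g\<close> agree on
  the ray. So \<open>f x\<close> and \<open>g x\<close> lie in a common branch, and their branching point is not in the core.\<close>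

lemma meet_proper:
  assumes f: "continuous_proper S S f" and g: "continuous_proper S S g"
    and eq: "\<And>\<xi>. \<xi> \<in> rays \<Longrightarrow> bd f \<xi> = bd g \<xi>"
  shows "\<exists>N. \<forall>x\<in>topspace S. (\<forall>v. n < d v \<longrightarrow> min (crd (f x) v) (crd (g x) v) = 0) \<longrightarrow> x \<in> core N"
proof -
  obtain N1 where N1: "\<forall>v\<in>V. N1 \<le> d v \<longrightarrow> (\<exists>w\<in>V. d w = Suc n \<and> f ` branch v \<subseteq> branch w)"
    using branch_image[OF f] by blast
  obtain N2 where N2: "\<forall>v\<in>V. N2 \<le> d v \<longrightarrow> (\<exists>w\<in>V. d w = Suc n \<and> g ` branch v \<subseteq> branch w)"
    using branch_image[OF g] by blast
  define k where "k = max N1 N2"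
  obtain N where N: "k \<le> N" "\<And>u. u \<in> V \<Longrightarrow> N \<le> d u \<Longrightarrow> shadow (anc k u) \<noteq> {}"
    using shadow_level[of k] by blast
  have "\<exists>v. n < d v \<and> min (crd (f x) v) (crd (g x) v) \<noteq> 0" if x: "x \<in> topspace S" "x \<notin> core N" for x
  proof -
    obtain u where u: "u \<in> V" "d u = Suc N" "x \<in> branch u" using outside_core x by blast
    define v where "v = anc k u"
    have v: "v \<in> V" "d v = k" "x \<in> branch v"
      using u N branch_mono[OF u(1) below_anc[OF u(1)], of k] by (auto simp: v_def)
    obtain \<xi> where xi: "\<xi> \<in> rays" "\<xi> k = v" using N(2)[of u] u v by (auto simp: v_def[symmetric] in_shadow)
    obtain w1 where w1: "w1 \<in> V" "d w1 = Suc n" "f ` branch v \<subseteq> branch w1" using N1 v by (auto simp: k_def)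
    obtain w2 where w2: "w2 \<in> V" "d w2 = Suc n" "g ` branch v \<subseteq> branch w2" using N2 v by (auto simp: k_def)
    have "bd f \<xi> (Suc n) = w1" using bd_eqI[OF xi(1), of f k w1] w1 xi by simp
    moreover have "bd g \<xi> (Suc n) = w2" using bd_eqI[OF xi(1), of g k w2] w2 xi by simp
    ultimately have "w1 = w2" using eq[OF xi(1)] by simp
    then have "f x \<in> branch w1" "g x \<in> branch w1" using w1 w2 v by auto
    then show ?thesis using w1 by (intro exI[of _ w1]) (auto simp: branch_def)
  qed
  then show ?thesis by blast
qed

lemma geo_homotopy_proper:
  assumes f: "continuous_proper S S f" and g: "continuous_proper S S g"
    and eq: "\<And>\<xi>. \<xi> \<in> rays \<Longrightarrow> bd f \<xi> = bd g \<xi>"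
  shows "proper_homotopy S S f g (geo_homotopy f g)"
  unfolding proper_homotopy_def
proof
  let ?Z = "prod_topology (top_of_set {0..1::real}) S"
  have cf: "continuous_map S S f" and cg: "continuous_map S S g" using f g by (auto simp: continuous_proper_def)
  have S: "f x \<in> topspace S" "g x \<in> topspace S" if "x \<in> topspace S" for x
    using cf cg that by (auto simp: continuous_map_def)
  show "\<forall>x\<in>topspace S. geo_homotopy f g (0, x) = f x \<and> geo_homotopy f g (1, x) = g x"
    using S geo_pt_0 geo_pt_1 by (simp add: geo_homotopy_def)
  show "continuous_proper ?Z S (geo_homotopy f g)"
  proof (rule proper_criterion)
    have s: "continuous_map ?Z S snd" by (rule continuous_map_snd)
    have "continuous_map ?Z (top_of_set {0..1::real}) fst" by (rule continuous_map_fst)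
    then have "continuous_map ?Z euclideanreal fst" by (rule continuous_map_into_fulltopology)
    moreover have "continuous_map ?Z S (\<lambda>z. f (snd z))" using continuous_map_compose[OF s cf] by (simp add: o_def)
    moreover have "continuous_map ?Z S (\<lambda>z. g (snd z))" using continuous_map_compose[OF s cg] by (simp add: o_def)
    ultimately show "continuous_map ?Z S (geo_homotopy f g)"
      unfolding geo_homotopy_def by (rule geo_pt_continuous)
  next
    fix n
    obtain N where N: "\<forall>x\<in>topspace S. (\<forall>v. n < d v \<longrightarrow> min (crd (f x) v) (crd (g x) v) = 0) \<longrightarrow> x \<in> core N"
      using meet_proper[OF f g eq] by blast
    have "x \<in> core N" if tx: "x \<in> topspace S" "geo_pt t (f x) (g x) \<in> core n" for t x
    proof -
      have "min (crd (f x) v) (crd (g x) v) = 0" if v: "n < d v" for v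
      proof -
        have "min (crd (f x) v) (crd (g x) v) \<le> crd (geo_pt t (f x) (g x)) v"
          using geo_ge crd_geo_pt S[OF tx(1)] by simp
        also have "\<dots> = 0" using tx(2) v by (simp add: core_def)
        finally show ?thesis using Y_ge0[OF crd_in] S[OF tx(1)] by (simp add: antisym)
      qed
      then show ?thesis using N tx(1) by blast
    qed
    then have "{z \<in> topspace ?Z. geo_homotopy f g z \<in> core n} \<subseteq> {0..1} \<times> core N"
      by (auto simp: geo_homotopy_def)
    moreover have "compactin ?Z ({0..1} \<times> core N)"
      using compact_core by (simp add: compactin_Times compactin_subtopology)
    ultimately show "\<exists>L. compactin ?Z L \<and> {z \<in> topspace ?Z. geo_homotopy f g z \<in> core n} \<subseteq> L" by blast
  qed
qed

lemma homotopic_iff: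
  assumes "continuous_proper S S f" "continuous_proper S S g"
  shows "properly_homotopic S S f g \<longleftrightarrow> (\<forall>\<xi>\<in>rays. bd f \<xi> = bd g \<xi>)"
proof
  assume "properly_homotopic S S f g"
  then obtain H where "proper_homotopy S S f g H" unfolding properly_homotopic_def by blast
  then show "\<forall>\<xi>\<in>rays. bd f \<xi> = bd g \<xi>" using bd_homotopic[of f g H] by simp
next
  assume "\<forall>\<xi>\<in>rays. bd f \<xi> = bd g \<xi>"
  then have "proper_homotopy S S f g (geo_homotopy f g)" using geo_homotopy_proper[OF assms] by simp
  then show "properly_homotopic S S f g" unfolding properly_homotopic_def by blast
qed

section \<open>Realizing homeomorphisms of the end space\<close>

text \<open>The maps constructed here are simplicial. They fix the ball of radius \<open>m\<close>, as is
  needed for representing elements of the sets \<open>U\<^sub>K\<close>.\<close>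

lemma bd_realize:
  assumes \<phi>: "continuous_map ends ends \<phi>"
    and pres: "\<And>v. v \<in> V \<Longrightarrow> d v \<le> m \<Longrightarrow> \<phi> ` shadow v \<subseteq> shadow v"
  obtains f where "continuous_proper S S f" "\<And>\<xi>. \<xi> \<in> rays \<Longrightarrow> bd f \<xi> = \<phi> \<xi>"
    "\<And>x. x \<in> core m \<Longrightarrow> f x = x" "\<And>v. v \<in> V \<Longrightarrow> d v \<le> m \<Longrightarrow> f ` branch v \<subseteq> branch v"
proof -
  obtain F where F: "proper_simplicial F" and id: "\<And>v. v \<in> V \<Longrightarrow> d v \<le> m \<Longrightarrow> F v = v"
    and sh: "\<And>v. v \<in> V \<Longrightarrow> \<phi> ` shadow v \<subseteq> shadow (F v)"
  proof (rule follow_exists[OF \<phi>, of m])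
    show "\<phi> ` shadow v \<subseteq> shadow v" if "v \<in> V" "d v \<le> m" for v using pres that by blast
  qed (rule that)
  have simp: "simplicial F" using F by (simp add: proper_simplicial_def)
  define f where "f x = pt (push F (crd x))" for x
  have fS: "f x \<in> topspace S" "crd (f x) = push F (crd x)" if "x \<in> topspace S" for x
    using push_Y[OF F crd_in[OF that]] pt_in by (auto simp: f_def)
  have br: "f ` branch v \<subseteq> branch (F v)" if "v \<in> V" for v
  proof
    fix y assume "y \<in> f ` branch v"
    then obtain x where x: "x \<in> topspace S" "0 < crd x v" "y = f x" by (auto simp: branch_def)
    then show "y \<in> branch (F v)" using push_branch[OF F crd_in[OF x(1)] that x(2)] fS[OF x(1)] by (simp add: branch_def)
  qed
  have cont: "continuous_map S S f"
    unfolding f_def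
  proof (rule pt_continuous)
    show "continuous_map S euclideanreal (\<lambda>z. push F (crd z) w)" for w
      unfolding push_def by (intro continuous_map_sum finite_entry[OF F] crd_continuous)
  qed (use push_Y[OF F crd_in] in blast)
  have proper: "continuous_proper S S f"
    unfolding proper_iff
  proof (intro conjI cont allI)
    fix n
    obtain N where N: "\<And>v. v \<in> V \<Longrightarrow> N \<le> d v \<Longrightarrow> Suc n \<le> d (F v)"
      using F unfolding proper_simplicial_def by blast
    have "f x \<notin> core n" if x: "x \<in> topspace S" "x \<notin> core N" for x
    proof -
      obtain w where w: "w \<in> V" "d w = Suc N" "x \<in> branch w" using outside_core x by blast
      then have "f x \<in> branch (F w)" "Suc n \<le> d (F w)" using br N by auto
      then show ?thesis using branch_core by simp
    qed
    then show "\<exists>N. \<forall>x\<in>topspace S. f x \<in> core n \<longrightarrow> x \<in> core N" by blast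
  qed
  have "bd f \<xi> = \<phi> \<xi>" if xi: "\<xi> \<in> rays" for \<xi>
  proof
    fix n
    have pr: "\<phi> \<xi> \<in> rays" using \<phi> xi by (auto simp: continuous_map_def)
    obtain N where N: "\<And>v. v \<in> V \<Longrightarrow> N \<le> d v \<Longrightarrow> n \<le> d (F v)"
      using F unfolding proper_simplicial_def by blast
    have v: "\<xi> N \<in> V" "n \<le> d (F (\<xi> N))" using N ray_in[OF xi] ray_d[OF xi] by auto
    have "\<phi> \<xi> \<in> shadow (F (\<xi> N))" using sh[OF v(1)] ray_in_shadow[OF xi] by blast
    then have "below (\<phi> \<xi> n) (F (\<xi> N))" using ray_below[OF pr v(2)] by (simp add: in_shadow)
    then have "branch (F (\<xi> N)) \<subseteq> branch (\<phi> \<xi> n)" using branch_mono simplicialD(2)[OF simp v(1)] by blast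
    then have "f ` branch (\<xi> N) \<subseteq> branch (\<phi> \<xi> n)" using br[OF v(1)] by blast
    then show "bd f \<xi> n = \<phi> \<xi> n" using bd_eqI[OF xi, of f N "\<phi> \<xi> n"] ray_in[OF pr] ray_d[OF pr] by simp
  qed
  moreover have "f x = x" if "x \<in> core m" for x
  proof -
    have x: "x \<in> topspace S" "\<And>v. m < d v \<Longrightarrow> crd x v = 0" using that by (auto simp: core_def)
    then have "push F (crd x) = crd x" using push_id[OF F crd_in[OF x(1)] id] by blast
    then show ?thesis using x by (simp add: f_def)
  qed
  ultimately show thesis using that[OF proper] br id by metis
qed

lemma PHE_iff:
  "f \<in> proper_homotopy_equivs S \<longleftrightarrow> continuous_proper S S f \<and> homeomorphic_map ends ends (bd f)"
proof
  assume "f \<in> proper_homotopy_equivs S"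
  then obtain g where f: "continuous_proper S S f" and g: "continuous_proper S S g"
    and h: "properly_homotopic S S (g \<circ> f) id" "properly_homotopic S S (f \<circ> g) id"
    unfolding proper_homotopy_equivs_def by blast
  have gf: "\<forall>\<xi>\<in>rays. bd (g \<circ> f) \<xi> = bd id \<xi>"
    using h(1) homotopic_iff[OF continuous_proper_comp[OF g f] continuous_proper_id] by (rule iffD1[rotated])
  have fg: "\<forall>\<xi>\<in>rays. bd (f \<circ> g) \<xi> = bd id \<xi>"
    using h(2) homotopic_iff[OF continuous_proper_comp[OF f g] continuous_proper_id] by (rule iffD1[rotated])
  have "bd g (bd f \<xi>) = \<xi> \<and> bd f (bd g \<xi>) = \<xi>" if x: "\<xi> \<in> rays" for \<xi>
    using bspec[OF gf x] bspec[OF fg x] unfolding bd_comp[OF g f x] bd_comp[OF f g x] bd_id[OF x] by blast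
  then have "homeomorphic_maps ends ends (bd f) (bd g)"
    using bd_continuous[OF f] bd_continuous[OF g] by (simp add: homeomorphic_maps_def)
  then show "continuous_proper S S f \<and> homeomorphic_map ends ends (bd f)"
    using f homeomorphic_maps_map by blast
next
  assume f: "continuous_proper S S f \<and> homeomorphic_map ends ends (bd f)"
  then obtain \<psi> where psi: "homeomorphic_maps ends ends (bd f) \<psi>" using homeomorphic_map_maps by blast
  then have "continuous_map ends ends \<psi>" by (simp add: homeomorphic_maps_def)
  then obtain g where g: "continuous_proper S S g" "\<And>\<xi>. \<xi> \<in> rays \<Longrightarrow> bd g \<xi> = \<psi> \<xi>"
  proof (rule bd_realize[where m = 0])
    fix v assume "v \<in> V" "d v \<le> 0"
    then have v: "v = r" using d_zero by simp
    show "\<psi> ` shadow v \<subseteq> shadow v" unfolding v shadow_root using \<open>continuous_map ends ends \<psi>\<close> by (auto simp: continuous_map_def)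
  qed blast
  have r: "bd f \<xi> \<in> rays" "\<psi> \<xi> \<in> rays" "\<psi> (bd f \<xi>) = \<xi>" "bd f (\<psi> \<xi>) = \<xi>" if "\<xi> \<in> rays" for \<xi>
    using psi that by (auto simp: homeomorphic_maps_def continuous_map_def)
  have cf: "continuous_proper S S f" using f by blast
  have gf: "bd (g \<circ> f) \<xi> = bd id \<xi>" if x: "\<xi> \<in> rays" for \<xi>
    unfolding bd_comp[OF g(1) cf x] bd_id[OF x] using g(2) r[OF x] by simp
  have fg: "bd (f \<circ> g) \<xi> = bd id \<xi>" if x: "\<xi> \<in> rays" for \<xi>
    unfolding bd_comp[OF cf g(1) x] bd_id[OF x] using g(2)[OF x] r[OF x] by simp
  have "properly_homotopic S S (g \<circ> f) id" "properly_homotopic S S (f \<circ> g) id"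
    using homotopic_iff[OF continuous_proper_comp[OF g(1) cf] continuous_proper_id] gf
      homotopic_iff[OF continuous_proper_comp[OF cf g(1)] continuous_proper_id] fg by simp_all
  then show "f \<in> proper_homotopy_equivs S" using f g unfolding proper_homotopy_equivs_def by blast
qed

end

section \<open>Rays and the end space\<close>

lemma pi0_path_connected: 
  assumes "D \<in> pi0_compl X K" shows "path_connectedin X D" "D \<subseteq> topspace X - K" "D \<noteq> {}"
  using assms path_connectedin_path_components_of[of D "subtopology X (topspace X - K)"]
    nonempty_path_components_of[of D "subtopology X (topspace X - K)"]
  unfolding pi0_compl_def path_connectedin_subtopology by auto

lemma pi0_maximal:
  assumes "D \<in> pi0_compl X K" "path_connectedin X P" "P \<subseteq> topspace X - K" "x \<in> D" "x \<in> P"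
  shows "P \<subseteq> D"
proof (rule path_components_of_maximal)
  show "D \<in> path_components_of (subtopology X (topspace X - K))" using assms(1) by (simp add: pi0_compl_def)
  show "path_connectedin (subtopology X (topspace X - K)) P" using assms(2,3) by (simp add: path_connectedin_subtopology)
qed (use assms(4,5) in \<open>auto simp: disjnt_iff\<close>)

lemma pi0_unique:
  assumes "D \<in> pi0_compl X K" "D' \<in> pi0_compl X K" "x \<in> D" "x \<in> D'"
  shows "D = D'"
  using pi0_maximal[OF assms(1) pi0_path_connected(1,2)[OF assms(2)] assms(3,4)]
    pi0_maximal[OF assms(2) pi0_path_connected(1,2)[OF assms(1)] assms(4,3)] by blast

lemma pi0_exists:
  assumes "path_connectedin X P" "P \<subseteq> topspace X - K" "x \<in> P"
  shows "\<exists>D\<in>pi0_compl X K. P \<subseteq> D"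
proof -
  define D where "D = Collect (path_component_of (subtopology X (topspace X - K)) x)"
  have D: "D \<in> pi0_compl X K" unfolding pi0_compl_def path_components_of_def D_def using assms by auto
  moreover have "x \<in> D" unfolding D_def using assms by (auto simp: path_component_of_refl)
  ultimately show ?thesis using pi0_maximal[OF D assms(1,2) _ assms(3)] by blast
qed

context tree_space
begin

lemma branch_outside: "d w = Suc n \<Longrightarrow> branch w \<subseteq> topspace S - core n"
  using branch_core[of _ w n] branch_subset[of w] by auto

lemma component_branch:
  assumes D: "D \<in> pi0_compl S (core n)" shows "\<exists>w\<in>V. d w = Suc n \<and> D = branch w"
proof -
  have "\<exists>w\<in>V. d w = Suc n \<and> D \<subseteq> branch w"
  proof (rule connected_into_branch)
    show "connectedin S D" using pi0_path_connected(1)[OF D] path_connectedin_imp_connectedin by blast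
    show "D \<noteq> {}" by (rule pi0_path_connected(3)[OF D])
    fix y assume "y \<in> D"
    then have y: "y \<in> topspace S" "y \<notin> core n" using pi0_path_connected(2)[OF D] by auto
    then show "\<exists>w\<in>V. d w = Suc n \<and> y \<in> branch w" using outside_core[OF y(1)] by simp
  qed
  then obtain w where w: "w \<in> V" "d w = Suc n" "D \<subseteq> branch w" by blast
  obtain x where x: "x \<in> D" using pi0_path_connected(3)[OF D] by blast
  have "branch w \<subseteq> D" using pi0_maximal[OF D path_connected_branch branch_outside[OF w(2)] x] w(3) x by blast
  then show ?thesis using w by blast
qed

lemma branch_component:
  assumes v: "v \<in> V" "d v = Suc n" shows "branch v \<in> pi0_compl S (core n)"
proof -
  obtain x where x: "x \<in> branch v" using vertex_in_branch[OF v(1)] by blast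
  obtain D where D: "D \<in> pi0_compl S (core n)" "branch v \<subseteq> D"
    using pi0_exists[OF path_connected_branch branch_outside[OF v(2)] x] by blast
  obtain w where w: "w \<in> V" "d w = Suc n" "D = branch w" using component_branch[OF D(1)] by blast
  have "w = v" using branch_disjoint[of w v x] w v x D(2) by auto
  then show "branch v \<in> pi0_compl S (core n)" using D w by simp
qed

text \<open>A ray chooses the component of the complement of \<open>K\<close> that contains its far branches.\<close>

definition endpt :: "(nat \<Rightarrow> 'v) \<Rightarrow> 'p set \<Rightarrow> 'p set" where
  "endpt \<xi> = (\<lambda>K\<in>{K. compactin S K}. THE D. D \<in> pi0_compl S K \<and> (\<exists>n. branch (\<xi> n) \<subseteq> D))"

lemma endpt_ex:
  assumes K: "compactin S K" and \<xi>: "\<xi> \<in> rays"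
  shows "\<exists>D\<in>pi0_compl S K. \<exists>n. branch (\<xi> n) \<subseteq> D"
proof -
  obtain n where n: "K \<subseteq> core n" using compact_in_core[OF K] by blast
  have "branch (\<xi> (Suc n)) \<subseteq> topspace S - K"
    using n branch_outside[OF ray_d[OF \<xi>, of "Suc n"]] by blast
  moreover obtain x where "x \<in> branch (\<xi> (Suc n))" using vertex_in_branch[OF ray_in[OF \<xi>]] by blast
  ultimately show ?thesis using pi0_exists[OF path_connected_branch] by blast
qed

lemma endpt_eqI:
  assumes K: "compactin S K" and \<xi>: "\<xi> \<in> rays" and D: "D \<in> pi0_compl S K" "branch (\<xi> n) \<subseteq> D"
  shows "endpt \<xi> K = D"
proof -
  have "D' = D" if D': "D' \<in> pi0_compl S K" "branch (\<xi> m) \<subseteq> D'" for D' m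
  proof -
    obtain x where x: "x \<in> branch (\<xi> (max m n))" using vertex_in_branch[OF ray_in[OF \<xi>]] by blast
    have "x \<in> D" "x \<in> D'"
      using x D(2) D'(2) branch_ray_mono[OF \<xi>, of n "max m n"] branch_ray_mono[OF \<xi>, of m "max m n"] by auto
    then show ?thesis using pi0_unique[OF D'(1) D(1)] by blast
  qed
  then have "(THE D. D \<in> pi0_compl S K \<and> (\<exists>n. branch (\<xi> n) \<subseteq> D)) = D" using D by (intro the_equality) blast+
  then show ?thesis using K by (simp add: endpt_def)
qed

lemma endpt_props:
  assumes K: "compactin S K" and \<xi>: "\<xi> \<in> rays"
  shows "endpt \<xi> K \<in> pi0_compl S K" "\<exists>n. branch (\<xi> n) \<subseteq> endpt \<xi> K"
proof -
  obtain D n where D: "D \<in> pi0_compl S K" "branch (\<xi> n) \<subseteq> D" using endpt_ex[OF assms] by blast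
  then have "endpt \<xi> K = D" using endpt_eqI[OF assms] by blast
  then show "endpt \<xi> K \<in> pi0_compl S K" "\<exists>n. branch (\<xi> n) \<subseteq> endpt \<xi> K" using D by auto
qed

lemma endpt_core: "\<xi> \<in> rays \<Longrightarrow> endpt \<xi> (core n) = branch (\<xi> (Suc n))"
  by (rule endpt_eqI[OF compact_core _ branch_component[OF ray_in ray_d]]) auto

lemma topspace_end_space:
  "topspace (end_space X) = {\<nu> \<in> (\<Pi>\<^sub>E K\<in>{K. compactin X K}. pi0_compl X K).
      \<forall>K L. compactin X K \<and> compactin X L \<and> K \<subseteq> L \<longrightarrow> \<nu> L \<subseteq> \<nu> K}"
  by (auto simp: end_space_def)

lemma endpt_in: 
  assumes \<xi>: "\<xi> \<in> rays" shows "endpt \<xi> \<in> topspace (end_space S)"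
proof -
  have "endpt \<xi> L \<subseteq> endpt \<xi> K" if K: "compactin S K" and L: "compactin S L" and KL: "K \<subseteq> L" for K L
  proof -
    obtain n where n: "branch (\<xi> n) \<subseteq> endpt \<xi> K" using endpt_props(2)[OF K \<xi>] by blast
    obtain m where m: "branch (\<xi> m) \<subseteq> endpt \<xi> L" using endpt_props(2)[OF L \<xi>] by blast
    obtain x where x: "x \<in> branch (\<xi> (max m n))" using vertex_in_branch[OF ray_in[OF \<xi>]] by blast
    have xx: "x \<in> endpt \<xi> K" "x \<in> endpt \<xi> L"
      using x n m branch_ray_mono[OF \<xi>, of n "max m n"] branch_ray_mono[OF \<xi>, of m "max m n"] by auto
    show ?thesis
      by (rule pi0_maximal[OF endpt_props(1)[OF K \<xi>] pi0_path_connected(1)[OF endpt_props(1)[OF L \<xi>]] _ xx])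
        (use pi0_path_connected(2)[OF endpt_props(1)[OF L \<xi>]] KL in blast)
  qed
  moreover have "endpt \<xi> \<in> (\<Pi>\<^sub>E K\<in>{K. compactin S K}. pi0_compl S K)"
    using endpt_props(1)[OF _ \<xi>] by (auto simp: endpt_def)
  ultimately show ?thesis unfolding topspace_end_space by blast
qed

text \<open>Every compact set lies in a core, and the components of the complement of a core are branches; so a
  point of the inverse limit is determined by a nested sequence of branches, which is a ray. The
  domain is compact, hence continuity of the bijection suffices.\<close>

theorem end_space_homeomorphic: "ends homeomorphic_space end_space S"
proof -
  have "homeomorphic_map ends (end_space S) endpt"
  proof (rule continuous_imp_homeomorphic_map[OF _ compact_ends])
    show "Hausdorff_space (end_space S)"
      unfolding end_space_def
      by (rule Hausdorff_space_subtopology, subst Hausdorff_space_product_topology) simp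
    have "continuous_map ends (discrete_topology (pi0_compl S K)) (\<lambda>\<xi>. endpt \<xi> K)" if K: "compactin S K" for K
      unfolding continuous_map_def
    proof (intro conjI allI impI)
      show "(\<lambda>\<xi>. endpt \<xi> K) \<in> topspace ends \<rightarrow> topspace (discrete_topology (pi0_compl S K))"
        using endpt_props(1)[OF K] by auto
      fix U
      have "\<exists>n. shadow (\<xi> n) \<subseteq> {\<xi> \<in> rays. endpt \<xi> K \<in> U}" if xi: "\<xi> \<in> rays" "endpt \<xi> K \<in> U" for \<xi>
      proof -
        obtain n where n: "branch (\<xi> n) \<subseteq> endpt \<xi> K" using endpt_props(2)[OF K xi(1)] by blast
        have "endpt \<eta> K = endpt \<xi> K" if "\<eta> \<in> shadow (\<xi> n)" for \<eta>
        proof -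
          have "\<eta> \<in> rays" "\<eta> n = \<xi> n" using that ray_d[OF xi(1)] by (auto simp: in_shadow)
          then show ?thesis using endpt_eqI[OF K _ endpt_props(1)[OF K xi(1)], of \<eta> n] n by simp
        qed
        then have "shadow (\<xi> n) \<subseteq> {\<xi> \<in> rays. endpt \<xi> K \<in> U}" using xi(2) shadow_subset by auto
        then show ?thesis ..
      qed
      then show "openin ends {\<xi> \<in> topspace ends. endpt \<xi> K \<in> U}" unfolding openin_ends by auto
    qed
    then have "continuous_map ends (product_topology (\<lambda>K. discrete_topology (pi0_compl S K)) {K. compactin S K}) endpt"
      unfolding continuous_map_componentwise by (auto simp: endpt_def)
    then show "continuous_map ends (end_space S) endpt"
      unfolding end_space_def using endpt_in by (auto simp: continuous_map_in_subtopology topspace_end_space)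
    show "inj_on endpt (topspace ends)"
    proof (rule inj_onI)
      fix \<xi> \<eta> assume r: "\<xi> \<in> topspace ends" "\<eta> \<in> topspace ends" and eq: "endpt \<xi> = endpt \<eta>"
      then have r: "\<xi> \<in> rays" "\<eta> \<in> rays" by auto
      show "\<xi> = \<eta>"
      proof
        fix n
        show "\<xi> n = \<eta> n"
        proof (cases n)
          case 0 then show ?thesis using ray_root[OF r(1)] ray_root[OF r(2)] by simp
        next
          case (Suc m)
          have "branch (\<xi> n) = branch (\<eta> n)" using endpt_core[OF r(1), of m] endpt_core[OF r(2), of m] eq Suc by simp
          moreover obtain x where "x \<in> branch (\<xi> n)" using vertex_in_branch[OF ray_in[OF r(1)]] by blast
          ultimately show ?thesis
            using branch_disjoint[of "\<xi> n" "\<eta> n" x] ray_in r ray_d by simp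
        qed
      qed
    qed
    show "endpt ` topspace ends = topspace (end_space S)"
    proof (intro equalityI subsetI)
      fix \<nu> assume "\<nu> \<in> topspace (end_space S)"
      then have nu: "\<nu> \<in> (\<Pi>\<^sub>E K\<in>{K. compactin S K}. pi0_compl S K)"
        and compat: "\<And>K L. compactin S K \<Longrightarrow> compactin S L \<Longrightarrow> K \<subseteq> L \<Longrightarrow> \<nu> L \<subseteq> \<nu> K"
        unfolding topspace_end_space by auto
      have nuK: "\<nu> K \<in> pi0_compl S K" if "compactin S K" for K using nu that by auto
      have "\<exists>w\<in>V. d w = Suc n \<and> \<nu> (core n) = branch w" for n
        using component_branch[OF nuK[OF compact_core]] .
      then obtain w where w: "\<And>n. w n \<in> V" "\<And>n. d (w n) = Suc n" "\<And>n. \<nu> (core n) = branch (w n)" by metis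
      define \<xi> where "\<xi> n = (case n of 0 \<Rightarrow> r | Suc m \<Rightarrow> w m)" for n
      have \<xi>: "\<xi> 0 = r" "\<xi> (Suc m) = w m" for m by (simp_all add: \<xi>_def)
      have wr: "w n \<noteq> r" for n using w(2)[of n] by (metis d_root nat.distinct(1))
      have "par (\<xi> (Suc n)) = \<xi> n" for n
      proof (cases n)
        case 0
        have "d (par (w 0)) = 0" "par (w 0) \<in> V" using d_par[OF w(1) wr, of 0] w(2)[of 0] par_in[OF w(1) wr] by auto
        then show ?thesis using 0 d_zero \<xi> by simp
      next
        case (Suc m)
        obtain x where x: "x \<in> branch (w (Suc m))" using vertex_in_branch[OF w(1)] by blast
        have "branch (w (Suc m)) \<subseteq> branch (w m)"
          using compat[OF compact_core compact_core core_mono[of m "Suc m"]] w(3) by simp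
        then have "x \<in> branch (w m)" using x by blast
        moreover have "x \<in> branch (par (w (Suc m)))" using x branch_mono[OF w(1) below_par[OF w(1) wr]] by blast
        moreover have "d (par (w (Suc m))) = Suc m" using d_par[OF w(1) wr, of "Suc m"] w(2)[of "Suc m"] by simp
        ultimately show ?thesis
          using branch_disjoint[of "par (w (Suc m))" "w m" x] par_in[OF w(1) wr] w(1,2) \<xi> Suc by simp
      qed
      moreover have "\<xi> n \<in> V \<and> d (\<xi> n) = n" for n using w root_in by (cases n) (auto simp: \<xi>)
      ultimately have ray: "\<xi> \<in> rays" by (simp add: rays_def)
      have "endpt \<xi> = \<nu>"
      proof
        fix K
        show "endpt \<xi> K = \<nu> K"
        proof (cases "compactin S K")
          case True
          obtain n where n: "K \<subseteq> core n" using compact_in_core[OF True] by blast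
          have "branch (\<xi> (Suc n)) \<subseteq> \<nu> K" using compat[OF True compact_core n] w(3) \<xi> by simp
          then show ?thesis using endpt_eqI[OF True ray nuK[OF True]] by blast
        next
          case False
          then have "\<nu> K = undefined" using PiE_arb[OF nu, of K] by simp
          then show ?thesis using False by (simp add: endpt_def)
        qed
      qed
      then show "\<nu> \<in> endpt ` topspace ends" using ray by auto
    qed (use endpt_in in auto)
  qed
  then show ?thesis using homeomorphic_space by blast
qed

end

section \<open>The realization of a rooted tree\<close>

locale graph_tree = rooted_tree V r par d
  for V :: "'v set" and r :: 'v and par :: "'v \<Rightarrow> 'v" and d :: "'v \<Rightarrow> nat" +
  fixes G :: "'v graph"
  assumes verts_G: "verts G = V"
    and edges_G: "edges G = {{v, par v} | v. v \<in> V \<and> v \<noteq> r}"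
begin

text \<open>The path coordinates of a point \<open>p\<close> in barycentric coordinates: the path to \<open>p\<close> has advanced on the
  edge into \<open>u\<close> by the total weight of the vertices beyond \<open>u\<close>.\<close>

definition crd :: "('v \<Rightarrow> real) \<Rightarrow> 'v \<Rightarrow> real" where
  "crd p u = (if u \<in> V then (\<Sum>x\<in>{x. p x \<noteq> 0 \<and> below u x}. p x) else 0)"

definition pt :: "('v \<Rightarrow> real) \<Rightarrow> 'v \<Rightarrow> real" where
  "pt = inv_into (realization G) crd"

definition seg :: "'v \<Rightarrow> real \<Rightarrow> 'v \<Rightarrow> real" where
  "seg v s u = (if u = v then s else if u = par v then 1 - s else 0)"

text \<open>Every point has the form \<open>seg v s\<close>. Excluding \<open>s = 0\<close> makes this form unique; the root, which has no
  edge towards its parent, is \<open>seg r 1\<close>.\<close>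

definition on_tree :: "'v \<Rightarrow> real \<Rightarrow> bool" where
  "on_tree v s \<longleftrightarrow> v \<in> V \<and> 0 < s \<and> s \<le> 1 \<and> (v = r \<longrightarrow> s = 1)"

lemma par_neq: "v \<in> V \<Longrightarrow> v \<noteq> r \<Longrightarrow> par v \<noteq> v"
  using d_par[of v] by auto

lemma cells_G: "cells G = (\<lambda>v. cell {v}) ` V \<union> (\<lambda>v. cell {v, par v}) ` {v \<in> V. v \<noteq> r}"
  unfolding cells_def verts_G edges_G by auto

lemma cells_finite: "c \<in> cells G \<Longrightarrow> \<exists>e. finite e \<and> e \<subseteq> V \<and> c = cell e"
proof -
  assume "c \<in> cells G"
  then consider v where "v \<in> V" "c = cell {v}" | v where "v \<in> V" "v \<noteq> r" "c = cell {v, par v}"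
    unfolding cells_G by auto
  then show ?thesis
  proof cases
    case 1 then show ?thesis by (intro exI[of _ "{v}"]) auto
  next
    case 2 then show ?thesis using par_in by (intro exI[of _ "{v, par v}"]) auto
  qed
qed

lemma cell_single: "cell {v} = {seg v 1}"
  by (auto simp: cell_def seg_def fun_eq_iff)

lemma cell_pair:
  assumes "v \<in> V" "v \<noteq> r"
  shows "cell {v, par v} = seg v ` {0..1}"
proof (intro equalityI subsetI)
  fix p assume p: "p \<in> cell {v, par v}"
  then have s: "p v + p (par v) = 1" "0 \<le> p v" "0 \<le> p (par v)" "\<And>u. u \<noteq> v \<Longrightarrow> u \<noteq> par v \<Longrightarrow> p u = 0"
    using par_neq[OF assms] by (auto simp: cell_def)
  then have "p = seg v (p v)" by (auto simp: seg_def fun_eq_iff)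
  moreover have "p v \<in> {0..1}" using s by auto
  ultimately show "p \<in> seg v ` {0..1}" by blast
next
  fix p assume "p \<in> seg v ` {0..1}"
  then show "p \<in> cell {v, par v}" using par_neq[OF assms] by (auto simp: cell_def seg_def)
qed

lemma seg_0: "v \<in> V \<Longrightarrow> v \<noteq> r \<Longrightarrow> seg v 0 = seg (par v) 1"
  using par_neq by (auto simp: seg_def fun_eq_iff)

lemma realizationE:
  assumes "p \<in> realization G"
  obtains v s where "on_tree v s" "p = seg v s"
proof -
  note goal = that
  have one: "thesis" if "v \<in> V" "p = seg v 1" for v using goal[of v 1] that by (auto simp: on_tree_def)
  obtain c where c: "c \<in> cells G" "p \<in> c" using assms by (auto simp: realization_def)
  then consider v where "v \<in> V" "p \<in> cell {v}" | v where "v \<in> V" "v \<noteq> r" "p \<in> cell {v, par v}"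
    unfolding cells_G by auto
  then show thesis
  proof cases
    case 1 then show thesis using one by (simp add: cell_single)
  next
    case 2
    then obtain s where s: "s \<in> {0..1}" "p = seg v s" using cell_pair by auto
    show thesis
    proof (cases "s = 0")
      case True then show thesis using one[of "par v"] seg_0 2 s par_in by simp
    next
      case False then show thesis using goal[of v s] s 2 by (auto simp: on_tree_def)
    qed
  qed
qed

lemma seg_in_cell:
  assumes "on_tree v s"
  shows "seg v s \<in> (if v = r then cell {r} else cell {v, par v})"
  using assms cell_single cell_pair[of v] by (auto simp: on_tree_def)

lemma seg_realization: "on_tree v s \<Longrightarrow> seg v s \<in> realization G"
  using seg_in_cell[of v s] root_in unfolding realization_def cells_G on_tree_def by (auto split: if_splits)

lemma crd_sum:
  assumes "finite e" "\<And>x. x \<notin> e \<Longrightarrow> p x = 0" "u \<in> V"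
  shows "crd p u = (\<Sum>x\<in>{x \<in> e. below u x}. p x)"
proof -
  have "(\<Sum>x\<in>{x. p x \<noteq> 0 \<and> below u x}. p x) = (\<Sum>x\<in>{x \<in> e. below u x}. p x)"
    using assms by (intro sum.mono_neutral_left) auto
  then show ?thesis using assms by (simp add: crd_def)
qed

lemma crd_seg:
  assumes "on_tree v s"
  shows "crd (seg v s) u = (if u = v then s else if u \<in> V \<and> below u v then 1 else 0)"
proof (cases "v = r")
  case True
  have s: "s = 1" using assms True by (simp add: on_tree_def)
  show ?thesis
  proof (cases "u \<in> V")
    case uV: True
    have "crd (seg v s) u = (\<Sum>x\<in>{x \<in> {r}. below u x}. seg v s x)"
      by (rule crd_sum) (use uV True s in \<open>auto simp: seg_def\<close>)
    also have "{x \<in> {r}. below u x} = (if u = r then {r} else {})"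
      using uV d_zero[of u] by (auto simp: below_def)
    also have "(\<Sum>x\<in>(if u = r then {r} else {}). seg v s x) = (if u = r then 1 else 0)"
      using True s by (simp add: seg_def)
    finally show ?thesis using True s uV d_zero[of u] by (auto simp: below_def)
  next
    case False then show ?thesis using True root_in by (auto simp: crd_def)
  qed
next
  case False
  have v: "v \<in> V" "0 < s" "s \<le> 1" using assms by (auto simp: on_tree_def)
  have pv: "par v \<noteq> v" "par v \<in> V" using par_neq v False par_in by auto
  show ?thesis
  proof (cases "u \<in> V")
    case uV: True
    have c: "crd (seg v s) u = (\<Sum>x\<in>{x \<in> {v, par v}. below u x}. seg v s x)"
      by (rule crd_sum) (use uV in \<open>auto simp: seg_def\<close>)
    consider "u = v" | "u \<noteq> v" "below u v" | "\<not> below u v" by blast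
    then show ?thesis
    proof cases
      case 1
      have "\<not> below v (par v)" using d_par[OF v(1) False] by (auto simp: below_def)
      then have "{x \<in> {v, par v}. below u x} = {v}" using 1 by auto
      then show ?thesis using c 1 by (simp add: seg_def)
    next
      case 2
      then have "below u (par v)" using below_par_cases[OF v(1) False] by blast
      then have "{x \<in> {v, par v}. below u x} = {v, par v}" using 2 by auto
      then show ?thesis using c 2 pv uV by (simp add: seg_def)
    next
      case 3
      then have "\<not> below u (par v)" using below_trans[OF v(1) _ below_par[OF v(1) False]] by blast
      then have e: "{x \<in> {v, par v}. below u x} = {}" using 3 by auto
      show ?thesis using c 3 unfolding e by auto
    qed
  next
    case uV: False then show ?thesis using v by (auto simp: crd_def)
  qed
qed

lemma crd_seg_Y:
  assumes "on_tree v s" shows "crd (seg v s) \<in> Y"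
proof -
  have v: "v \<in> V" "0 < s" "s \<le> 1" "v = r \<Longrightarrow> s = 1" using assms by (auto simp: on_tree_def)
  note c = crd_seg[OF assms]
  have pos: "below u v" if "0 < crd (seg v s) u" for u using that by (auto simp: c split: if_splits)
  show ?thesis
  proof (rule YI[where n = "d v"])
    show "crd (seg v s) r = 1" using v below_root[OF v(1)] root_in by (auto simp: c)
    show "crd (seg v s) u = 0" if "u \<notin> V" for u using that v by (auto simp: c)
    show "crd (seg v s) u = 0" if "d v < d u" for u using that by (auto simp: c below_def)
    show "crd (seg v s) (par u) = 1" if u: "u \<in> V" "u \<noteq> r" "0 < crd (seg v s) u" for u
    proof -
      have b: "below u v" using pos u by blast
      then have "below (par u) v" using below_trans[OF v(1) below_par[OF u(1,2)]] by blast
      moreover have "par u \<noteq> v" using d_par[OF u(1,2)] b by (auto simp: below_def)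
      ultimately show ?thesis using par_in u by (simp add: c)
    qed
    show "u = w" if "u \<in> V" "w \<in> V" "d u = d w" "0 < crd (seg v s) u" "0 < crd (seg v s) w" for u w
      using pos[OF that(4)] pos[OF that(5)] that(3) by (auto simp: below_def)
  qed (use v in \<open>auto simp: c\<close>)
qed

lemma Y_cases:
  assumes y: "y \<in> Y"
  obtains v s where "on_tree v s" "y = crd (seg v s)"
proof -
  obtain v where vV: "v \<in> V" "0 < y v" and tip: "\<And>w. w \<in> V \<Longrightarrow> w \<noteq> r \<Longrightarrow> par w = v \<Longrightarrow> y w = 0"
    using Y_tip[OF y] by metis
  have t: "on_tree v (y v)" using vV Y_le1[OF y] Y_root[OF y] by (simp add: on_tree_def)
  have "y = crd (seg v (y v))"
  proof (rule Y_eqI[OF y crd_seg_Y[OF t] vV(1) _ vV(2)])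
    show "y v = crd (seg v (y v)) v" by (simp add: crd_seg[OF t])
    have "y w = 0 \<and> crd (seg v (y v)) w = 0" if w: "w \<in> V" "w \<noteq> r" "par w = v" for w
    proof -
      have dw: "d w = Suc (d v)" using d_par w by simp
      have "y w = 0" using tip[OF w] .
      moreover have "\<not> below w v" using dw by (simp add: below_def)
      ultimately show ?thesis using dw by (auto simp: crd_seg[OF t])
    qed
    then show "y v < 1 \<or> (\<forall>w\<in>V. w \<noteq> r \<longrightarrow> par w = v \<longrightarrow> y w = 0 \<and> crd (seg v (y v)) w = 0)" by blast
  qed
  then show thesis using that t by blast
qed

lemma crd_inj_on: "inj_on crd (realization G)"
proof (rule inj_onI)
  fix p q assume p: "p \<in> realization G" and q: "q \<in> realization G" and eq: "crd p = crd q"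
  obtain v s where v: "on_tree v s" "p = seg v s" using realizationE[OF p] .
  obtain w t where w: "on_tree w t" "q = seg w t" using realizationE[OF q] .
  have "0 < crd q v" using v eq crd_seg[OF v(1), of v] by (simp add: on_tree_def)
  then have a: "below v w" using w crd_seg[OF w(1), of v] by (auto split: if_splits)
  have "0 < crd p w" using w eq crd_seg[OF w(1), of w] by (simp add: on_tree_def)
  then have b: "below w v" using v crd_seg[OF v(1), of w] by (auto split: if_splits)
  have "v = w" using a b by (intro below_level) (auto simp: below_def)
  moreover from this have "s = t" using fun_cong[OF eq, of v] v w crd_seg[OF v(1), of v] crd_seg[OF w(1), of v] by simp
  ultimately show "p = q" using v w by simp
qed

lemma crd_image: "crd ` realization G = Y"
proof (intro equalityI subsetI)
  fix y assume "y \<in> crd ` realization G"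
  then show "y \<in> Y" using crd_seg_Y by (auto elim: realizationE)
next
  fix y assume "y \<in> Y"
  then show "y \<in> crd ` realization G" using seg_realization by (auto elim!: Y_cases)
qed

lemma pt_crd0: "p \<in> realization G \<Longrightarrow> pt (crd p) = p"
  unfolding pt_def using inv_into_f_f[OF crd_inj_on] .

lemma crd_pt0: "y \<in> Y \<Longrightarrow> crd (pt y) = y" and pt_in0: "y \<in> Y \<Longrightarrow> pt y \<in> realization G"
  unfolding pt_def using f_inv_into_f[of y crd "realization G"] inv_into_into[of y crd "realization G"]
  by (simp_all add: crd_image)

lemma continuous_crd: "continuous_map (graph_space G) (top_of_set Y) crd"
proof -
  have "openin (graph_space G) {p \<in> realization G. crd p \<in> U}" if U: "openin (top_of_set Y) U" for U
    unfolding openin_graph_space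
  proof (intro conjI ballI)
    fix c assume c: "c \<in> cells G"
    then obtain e where e: "finite e" "e \<subseteq> V" "c = cell e" using cells_finite by blast
    have sub: "c \<subseteq> realization G" using c by (auto simp: realization_def)
    have "continuous_on c (\<lambda>p. crd p u)" for u
    proof (cases "u \<in> V")
      case True
      have "continuous_on c (\<lambda>p :: 'v \<Rightarrow> real. \<Sum>x\<in>{x \<in> e. below u x}. p x)"
        by (intro continuous_on_sum continuous_on_product_coordinates[THEN continuous_on_subset]) auto
      moreover have "crd p u = (\<Sum>x\<in>{x \<in> e. below u x}. p x)" if "p \<in> c" for p
        using that e by (intro crd_sum[OF e(1) _ True]) (auto simp: cell_def)
      ultimately show ?thesis by (simp cong: continuous_on_cong_simp)
    qed (simp add: crd_def)
    then have "continuous_on c crd" by (rule continuous_on_coordinatewise_then_product)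
    moreover have "crd \<in> c \<rightarrow> Y" using sub crd_image by blast
    ultimately have "continuous_map (top_of_set c) (top_of_set Y) crd"
      by (simp add: continuous_map_in_subtopology)
    then have "openin (top_of_set c) {p \<in> topspace (top_of_set c). crd p \<in> U}"
      using U by (rule openin_continuous_map_preimage)
    moreover have "{p \<in> topspace (top_of_set c). crd p \<in> U} = {p \<in> realization G. crd p \<in> U} \<inter> c"
      using sub by auto
    ultimately show "openin (top_of_set c) ({p \<in> realization G. crd p \<in> U} \<inter> c)" by simp
  qed auto
  then show ?thesis using crd_image by (auto simp: continuous_map_def)
qed

lemma compact_cell: 
  fixes e :: "'v set"
  assumes "finite e" shows "compact (cell e)"
proof -
  define I where "I v = (if v \<in> e then {0..1::real} else {0})" for v
  have "compactin (product_topology (\<lambda>_. euclideanreal) UNIV) (Pi\<^sub>E UNIV I)"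
    unfolding compactin_PiE by (auto simp: I_def)
  then have 1: "compact (Pi\<^sub>E UNIV I)" by (simp add: euclidean_product_topology)
  have 2: "closed {p :: 'v \<Rightarrow> real. (\<Sum>v\<in>e. p v) = 1}"
    by (intro closed_Collect_eq continuous_on_sum continuous_on_product_coordinates continuous_on_const)
  have le: "p v \<le> (\<Sum>v\<in>e. p v)" if "v \<in> e" "\<And>v. 0 \<le> p v" for p :: "'v \<Rightarrow> real" and v
    using assms that by (intro member_le_sum) auto
  have "cell e = Pi\<^sub>E UNIV I \<inter> {p. (\<Sum>v\<in>e. p v) = 1}"
  proof (intro equalityI subsetI)
    fix p assume p: "p \<in> cell e"
    have "p v \<in> I v" for v
      using p le[of v p] by (auto simp: I_def cell_def)
    then show "p \<in> Pi\<^sub>E UNIV I \<inter> {p. (\<Sum>v\<in>e. p v) = 1}" using p by (auto simp: cell_def)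
  next
    fix p assume p: "p \<in> Pi\<^sub>E UNIV I \<inter> {p. (\<Sum>v\<in>e. p v) = 1}"
    then have "p v \<in> I v" for v by (auto simp: PiE_iff)
    then have "0 \<le> p v" "v \<notin> e \<longrightarrow> p v = 0" for v
      by (metis I_def atLeastAtMost_iff order_refl singletonD)+
    then show "p \<in> cell e" using p by (simp add: cell_def)
  qed
  then show ?thesis using compact_Int_closed[OF 1 2] by simp
qed

lemma compactin_cell: "c \<in> cells G \<Longrightarrow> compactin (graph_space G) c"
proof -
  assume c: "c \<in> cells G"
  have sub: "c \<subseteq> realization G" using c by (auto simp: realization_def)
  have "{x \<in> c. x \<in> U} = U \<inter> c" for U :: "('v \<Rightarrow> real) set" by blast
  then have "continuous_map (top_of_set c) (graph_space G) (\<lambda>p. p)"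
    using sub c by (auto simp: continuous_map_def openin_graph_space)
  moreover have "compactin (top_of_set c) c"
    using compact_cell cells_finite[OF c] by (auto simp: compactin_subtopology)
  ultimately have "compactin (graph_space G) ((\<lambda>p. p) ` c)" by (rule image_compactin[rotated])
  then show ?thesis by simp
qed

definition ball_graph :: "nat \<Rightarrow> 'v graph" where
  "ball_graph n = \<lparr>verts = {v \<in> V. d v \<le> n}, edges = {{v, par v} | v. v \<in> V \<and> v \<noteq> r \<and> d v \<le> n}\<rparr>"

lemma cells_ball_graph:
  "cells (ball_graph n) = (\<lambda>v. cell {v}) ` {v \<in> V. d v \<le> n} \<union> (\<lambda>v. cell {v, par v}) ` {v \<in> V. v \<noteq> r \<and> d v \<le> n}"
  unfolding cells_def ball_graph_def by auto

lemma finite_subgraph_ball_graph: "finite_subgraph (ball_graph n) G"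
proof -
  have "{{v, par v} | v. v \<in> V \<and> v \<noteq> r \<and> d v \<le> n} \<subseteq> (\<lambda>v. {v, par v}) ` {v \<in> V. d v \<le> n}" by auto
  then have "finite {{v, par v} | v. v \<in> V \<and> v \<noteq> r \<and> d v \<le> n}"
    using finite_upto finite_subset by blast
  moreover have "{v, par v} \<subseteq> {v \<in> V. d v \<le> n} \<and> card {v, par v} = 2" if "v \<in> V" "v \<noteq> r" "d v \<le> n" for v
    using that par_in[OF that(1,2)] d_par[OF that(1,2)] par_neq[OF that(1,2)] by simp
  then have "wf_graph (ball_graph n)" unfolding wf_graph_def ball_graph_def by auto
  moreover have "verts (ball_graph n) \<subseteq> verts G" "edges (ball_graph n) \<subseteq> edges G"
    by (auto simp: ball_graph_def verts_G edges_G)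
  moreover have "finite (verts (ball_graph n))" using finite_upto by (simp add: ball_graph_def)
  ultimately show ?thesis by (simp add: finite_subgraph_def ball_graph_def)
qed

lemma realization_ball_graph:
  "realization (ball_graph n) = {p \<in> realization G. \<forall>v. n < d v \<longrightarrow> crd p v = 0}"
proof (intro equalityI subsetI)
  fix p assume "p \<in> realization (ball_graph n)"
  then obtain c where c: "c \<in> cells (ball_graph n)" "p \<in> c" by (auto simp: realization_def)
  then have "c \<in> cells G" unfolding cells_ball_graph cells_G by auto
  then have "p \<in> realization G" using c by (auto simp: realization_def)
  moreover obtain e where e: "finite e" "c = cell e" "\<forall>x\<in>e. d x \<le> n"
  proof -
    consider v where "d v \<le> n" "c = cell {v}" | v where "v \<in> V" "v \<noteq> r" "d v \<le> n" "c = cell {v, par v}"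
      using c(1) unfolding cells_ball_graph by auto
    then show thesis
    proof cases
      case 1 then show thesis using that[of "{v}"] by simp
    next
      case 2 then show thesis using that[of "{v, par v}"] d_par[of v] by simp
    qed
  qed
  moreover have "crd p u = 0" if u: "n < d u" for u
  proof (cases "u \<in> V")
    case True
    have "crd p u = (\<Sum>x\<in>{x \<in> e. below u x}. p x)"
      using c e by (intro crd_sum[OF e(1) _ True]) (auto simp: cell_def)
    also have "{x \<in> e. below u x} = {}" using e u by (force simp: below_def)
    finally show ?thesis by simp
  qed (simp add: crd_def)
  ultimately show "p \<in> {p \<in> realization G. \<forall>v. n < d v \<longrightarrow> crd p v = 0}" by blast
next
  fix p assume p: "p \<in> {p \<in> realization G. \<forall>v. n < d v \<longrightarrow> crd p v = 0}"
  then have "p \<in> realization G" by simp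
  then obtain v s where v: "on_tree v s" "p = seg v s" by (rule realizationE)
  then have "crd p v \<noteq> 0" using crd_seg[OF v(1), of v] by (simp add: on_tree_def)
  then have "d v \<le> n" "v \<in> V" using p v by (auto simp: on_tree_def intro: leI)
  then show "p \<in> realization (ball_graph n)"
    using seg_in_cell[OF v(1)] v(2) unfolding realization_def cells_ball_graph by (auto split: if_splits)
qed

lemma compactin_ball_graph: "compactin (graph_space G) (realization (ball_graph n))"
  unfolding realization_def
proof (rule compactin_Union)
  show "finite (cells (ball_graph n))"
    unfolding cells_ball_graph using finite_upto[of n] by (auto intro: finite_subset[of _ "{v \<in> V. d v \<le> n}"])
  have "cells (ball_graph n) \<subseteq> cells G" unfolding cells_ball_graph cells_G by auto
  then show "compactin (graph_space G) c" if "c \<in> cells (ball_graph n)" for c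
    using compactin_cell that by blast
qed

text \<open>The inverse is continuous although the graph has the weak topology: near a point with coordinates
  vanishing beyond depth \<open>n\<close>, the coordinates vanish beyond depth \<open>n + 1\<close>, and on the compact realization of
  \<open>ball_graph (n + 1)\<close> the continuous bijection \<open>crd\<close> is closed.\<close>

lemma homeomorphic_crd: "homeomorphic_maps (graph_space G) (top_of_set Y) crd pt"
  unfolding homeomorphic_maps_def
proof (intro conjI ballI)
  show "continuous_map (top_of_set Y) (graph_space G) pt"
    unfolding continuous_map_def
  proof (intro conjI allI impI)
    show "pt \<in> topspace (top_of_set Y) \<rightarrow> topspace (graph_space G)" using pt_in0 by auto
    fix U assume U: "openin (graph_space G) U"
    have "\<exists>T. openin (top_of_set Y) T \<and> y \<in> T \<and> T \<subseteq> {y \<in> Y. pt y \<in> U}"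
      if y: "y \<in> Y" "pt y \<in> U" for y
    proof -
      obtain n where n: "\<forall>v. n < d v \<longrightarrow> y v = 0" using Y_bounded[OF y(1)] by blast
      define W where "W = Y \<inter> (\<Inter>v\<in>{v \<in> V. d v = Suc n}. {y. y v < 1})"
      have "open (\<Inter>v\<in>{v \<in> V. d v = Suc n}. {y :: 'v \<Rightarrow> real. y v < 1})"
        using finite_level by (intro open_INT ballI open_Collect_less continuous_on_product_coordinates continuous_on_const)
      then have W: "openin (top_of_set Y) W" unfolding W_def by blast
      define C where "C = realization (ball_graph (Suc n)) - U"
      have "closedin (graph_space G) (realization G - U)" using U by (simp add: closedin_def openin_subset[OF U, simplified] double_diff)
      then have "compactin (graph_space G) (realization (ball_graph (Suc n)) \<inter> (realization G - U))"
        using compactin_ball_graph by (rule compact_Int_closedin[rotated])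
      moreover have "realization (ball_graph (Suc n)) \<inter> (realization G - U) = C"
        using realization_ball_graph by (auto simp: C_def)
      ultimately have "compactin (top_of_set Y) (crd ` C)" using image_compactin[OF _ continuous_crd] by simp
      moreover have "Hausdorff_space (top_of_set Y)"
        by (rule Hausdorff_space_subtopology) (simp add: flip: euclidean_product_topology, simp add: Hausdorff_space_product_topology)
      ultimately have C: "closedin (top_of_set Y) (crd ` C)" using compactin_imp_closedin by blast
      have "openin (top_of_set Y) (W - crd ` C)" using W C by (rule openin_diff)
      moreover have "y \<in> W - crd ` C"
      proof
        show "y \<in> W" using y(1) n by (auto simp: W_def)
        show "y \<notin> crd ` C"
        proof
          assume "y \<in> crd ` C"
          then obtain p where "p \<in> C" "y = crd p" by blast
          then show False using y(2) pt_crd0 realization_ball_graph by (auto simp: C_def)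
        qed
      qed
      moreover have "W - crd ` C \<subseteq> {y \<in> Y. pt y \<in> U}"
      proof
        fix z assume z: "z \<in> W - crd ` C"
        then have zY: "z \<in> Y" by (simp add: W_def)
        have "z v = 0" if "Suc n < d v" for v using z Y_bound_next[OF zY _ that] by (auto simp: W_def)
        then have "pt z \<in> realization (ball_graph (Suc n))"
          unfolding realization_ball_graph using pt_in0[OF zY] crd_pt0[OF zY] by simp
        moreover have "pt z \<notin> C" using z crd_pt0[OF zY] by (metis DiffD2 imageI)
        ultimately show "z \<in> {y \<in> Y. pt y \<in> U}" using zY by (simp add: C_def)
      qed
      ultimately show ?thesis by blast
    qed
    then have "openin (top_of_set Y) {y \<in> Y. pt y \<in> U}" by (subst openin_subopen) blast
    then show "openin (top_of_set Y) {y \<in> topspace (top_of_set Y). pt y \<in> U}" by simp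
  qed
qed (use continuous_crd pt_crd0 crd_pt0 in auto)

sublocale tree_space V r par d "graph_space G" crd pt
  by unfold_locales (rule homeomorphic_crd)

lemma realization_ball_core: "realization (ball_graph n) = core n"
  using realization_ball_graph by (simp add: core_def)

lemma finite_subgraph_core:
  assumes "finite_subgraph K G"
  shows "realization K \<subseteq> realization G" "\<exists>n. realization K \<subseteq> core n"
proof -
  have K: "verts K \<subseteq> V" "edges K \<subseteq> edges G" "finite (verts K)" "finite (edges K)"
    using assms by (auto simp: finite_subgraph_def verts_G)
  then have sub: "cells K \<subseteq> cells G" by (auto simp: cells_def verts_G)
  then show "realization K \<subseteq> realization G" by (auto simp: realization_def)
  have "compactin (graph_space G) (\<Union> (cells K))"
    by (rule compactin_Union) (use K sub compactin_cell in \<open>auto simp: cells_def\<close>)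
  then show "\<exists>n. realization K \<subseteq> core n" using compact_in_core by (simp add: realization_def)
qed

end

section \<open>Group topologies from a family of open subgroups\<close>

text \<open>Such subgroups form a neighbourhood base of the identity for a unique group topology. A
  group topology in which they are open has all their left cosets as open sets, and these are a base of
  the former; so it is the coarsest one.\<close>

locale subgroup_base = group M for M :: "('g, 'm) monoid_scheme" (structure) +
  fixes \<B> :: "'g set set"
  assumes base_nonempty: "\<B> \<noteq> {}"
    and base_subgroup: "U \<in> \<B> \<Longrightarrow> subgroup U M"
    and base_Int: "U \<in> \<B> \<Longrightarrow> W \<in> \<B> \<Longrightarrow> \<exists>X\<in>\<B>. X \<subseteq> U \<inter> W"
    and base_conj: "g \<in> carrier M \<Longrightarrow> U \<in> \<B> \<Longrightarrow> \<exists>W\<in>\<B>. \<forall>w\<in>W. g \<otimes> w \<otimes> inv g \<in> U"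
begin

definition opens :: "'g set \<Rightarrow> bool" where
  "opens A \<longleftrightarrow> A \<subseteq> carrier M \<and> (\<forall>a\<in>A. \<exists>U\<in>\<B>. \<forall>u\<in>U. a \<otimes> u \<in> A)"

definition base_topology :: "'g topology" where
  "base_topology = topology opens"

lemma base_in: "U \<in> \<B> \<Longrightarrow> u \<in> U \<Longrightarrow> u \<in> carrier M"
  using base_subgroup subgroup.subset by blast

lemma cancel_left:
  assumes "x \<in> carrier M" "y \<in> carrier M"
  shows "x \<otimes> (inv x \<otimes> y) = y" "inv x \<otimes> (x \<otimes> y) = y"
  using m_assoc[of x "inv x" y] m_assoc[of "inv x" x y] assms by simp_all

lemma istopology_opens: "istopology opens"
  unfolding istopology_def
proof (intro conjI allI impI)
  fix A B assume A: "opens A" and B: "opens B"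
  show "opens (A \<inter> B)"
    unfolding opens_def
  proof (intro conjI ballI)
    fix a assume a: "a \<in> A \<inter> B"
    obtain U where U: "U \<in> \<B>" "\<forall>u\<in>U. a \<otimes> u \<in> A" using A a unfolding opens_def by blast
    obtain W where W: "W \<in> \<B>" "\<forall>u\<in>W. a \<otimes> u \<in> B" using B a unfolding opens_def by blast
    obtain X where "X \<in> \<B>" "X \<subseteq> U \<inter> W" using base_Int[OF U(1) W(1)] by blast
    then show "\<exists>U\<in>\<B>. \<forall>u\<in>U. a \<otimes> u \<in> A \<inter> B" using U W by blast
  qed (use A in \<open>auto simp: opens_def\<close>)
next
  fix \<K> assume K: "\<forall>K\<in>\<K>. opens K"
  show "opens (\<Union>\<K>)"
    unfolding opens_def
  proof (intro conjI ballI)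
    show "\<Union>\<K> \<subseteq> carrier M" using K unfolding opens_def by blast
    fix a assume "a \<in> \<Union>\<K>"
    then obtain A where A: "A \<in> \<K>" "a \<in> A" by blast
    then obtain U where "U \<in> \<B>" "\<forall>u\<in>U. a \<otimes> u \<in> A" using K unfolding opens_def by blast
    then show "\<exists>U\<in>\<B>. \<forall>u\<in>U. a \<otimes> u \<in> \<Union>\<K>" using A by blast
  qed
qed

lemma openin_base: "openin base_topology A \<longleftrightarrow> opens A"
  unfolding base_topology_def by (simp add: topology_inverse'[OF istopology_opens])

lemma topspace_base [simp]: "topspace base_topology = carrier M"
proof
  show "topspace base_topology \<subseteq> carrier M"
    using openin_topspace[of base_topology] unfolding openin_base opens_def by blast
  obtain U where U: "U \<in> \<B>" using base_nonempty by blast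
  have "opens (carrier M)" unfolding opens_def using U base_in[OF U] by (meson m_closed order_refl)
  then show "carrier M \<subseteq> topspace base_topology" using openin_subset openin_base by blast
qed

lemma openin_coset:
  assumes a: "a \<in> carrier M" and U: "U \<in> \<B>"
  shows "openin base_topology ((\<lambda>u. a \<otimes> u) ` U)"
  unfolding openin_base opens_def
proof (intro conjI ballI)
  show "(\<lambda>u. a \<otimes> u) ` U \<subseteq> carrier M" using m_closed[OF a base_in[OF U]] by blast
  fix b assume "b \<in> (\<lambda>u. a \<otimes> u) ` U"
  then obtain u where u: "u \<in> U" "b = a \<otimes> u" by blast
  have "b \<otimes> w \<in> (\<lambda>u. a \<otimes> u) ` U" if w: "w \<in> U" for w
  proof -
    have "b \<otimes> w = a \<otimes> (u \<otimes> w)" using u w a base_in[OF U] by (simp add: m_assoc)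
    moreover have "u \<otimes> w \<in> U" using subgroup.m_closed[OF base_subgroup[OF U] u(1) w] .
    ultimately show ?thesis by blast
  qed
  then show "\<exists>W\<in>\<B>. \<forall>w\<in>W. b \<otimes> w \<in> (\<lambda>u. a \<otimes> u) ` U" using U by blast
qed

lemma openin_base_member:
  assumes U: "U \<in> \<B>" shows "openin base_topology U"
proof -
  have "(\<lambda>u. \<one> \<otimes> u) ` U = (\<lambda>u. u) ` U" using base_in[OF U] by (intro image_cong) auto
  then show ?thesis using openin_coset[OF one_closed U] by (simp add: image_ident)
qed

lemma base_continuous_mult:
  "continuous_map (prod_topology base_topology base_topology) base_topology (\<lambda>(a, b). a \<otimes> b)"
  unfolding continuous_map_def
proof (intro conjI allI impI)
  fix A assume A: "openin base_topology A"
  let ?P = "{z \<in> topspace (prod_topology base_topology base_topology). (case z of (a, b) \<Rightarrow> a \<otimes> b) \<in> A}"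
  have "\<exists>S T. openin base_topology S \<and> openin base_topology T \<and> z \<in> S \<times> T \<and> S \<times> T \<subseteq> ?P" if z: "z \<in> ?P" for z
  proof -
    obtain a b where ab: "z = (a, b)" "a \<in> carrier M" "b \<in> carrier M" "a \<otimes> b \<in> A" using z by auto
    obtain U where U: "U \<in> \<B>" "\<forall>u\<in>U. a \<otimes> b \<otimes> u \<in> A" using A ab unfolding openin_base opens_def by blast
    \<comment> \<open>The choice of \<open>W\<close> allows to move \<open>w\<close> past \<open>b\<close>: \<open>a w b u = a b (inv b w b) u\<close>.\<close>
    obtain W where W: "W \<in> \<B>" "\<forall>w\<in>W. inv b \<otimes> w \<otimes> inv (inv b) \<in> U"
      using base_conj[OF inv_closed[OF ab(3)] U(1)] by blast
    have one: "\<one> \<in> W" "\<one> \<in> U" using W U base_subgroup subgroup.one_closed by blast+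
    have "a \<otimes> w \<otimes> (b \<otimes> u) \<in> A" if wu: "w \<in> W" "u \<in> U" for w u
    proof -
      have c: "w \<in> carrier M" "u \<in> carrier M" using wu W U base_in by auto
      have "inv b \<otimes> w \<otimes> b \<in> U" using W wu ab by simp
      then have "inv b \<otimes> w \<otimes> b \<otimes> u \<in> U" using subgroup.m_closed[OF base_subgroup[OF U(1)]] wu by blast
      then have "a \<otimes> b \<otimes> (inv b \<otimes> w \<otimes> b \<otimes> u) \<in> A" using U by blast
      moreover have "a \<otimes> b \<otimes> (inv b \<otimes> w \<otimes> b \<otimes> u) = a \<otimes> w \<otimes> (b \<otimes> u)"
        using ab c by (simp add: m_assoc cancel_left)
      ultimately show ?thesis by simp
    qed
    then have "(\<lambda>w. a \<otimes> w) ` W \<times> (\<lambda>u. b \<otimes> u) ` U \<subseteq> ?P" using ab W U base_in by auto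
    moreover have "z \<in> (\<lambda>w. a \<otimes> w) ` W \<times> (\<lambda>u. b \<otimes> u) ` U"
      using ab one by (auto intro!: image_eqI[of _ _ \<one>])
    ultimately show ?thesis using openin_coset[OF ab(2) W(1)] openin_coset[OF ab(3) U(1)] by blast
  qed
  note ex = this
  show "openin (prod_topology base_topology base_topology) ?P"
    unfolding openin_prod_topology_alt
  proof (intro allI impI)
    fix x y assume "(x, y) \<in> ?P"
    from ex[OF this] obtain S T where "openin base_topology S" "openin base_topology T" "(x, y) \<in> S \<times> T" "S \<times> T \<subseteq> ?P"
      by blast
    then show "\<exists>S T. openin base_topology S \<and> openin base_topology T \<and> x \<in> S \<and> y \<in> T \<and> S \<times> T \<subseteq> ?P" by blast
  qed
qed auto

lemma base_continuous_inv: "continuous_map base_topology base_topology (\<lambda>a. inv a)"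
  unfolding continuous_map_def
proof (intro conjI allI impI)
  fix A assume A: "openin base_topology A"
  show "openin base_topology {a \<in> topspace base_topology. inv a \<in> A}"
    unfolding openin_base opens_def topspace_base
  proof (intro conjI ballI)
    fix a assume "a \<in> {a \<in> carrier M. inv a \<in> A}"
    then have a: "a \<in> carrier M" "inv a \<in> A" by auto
    obtain U where U: "U \<in> \<B>" "\<forall>u\<in>U. inv a \<otimes> u \<in> A" using A a unfolding openin_base opens_def by blast
    obtain W where W: "W \<in> \<B>" "\<forall>w\<in>W. a \<otimes> w \<otimes> inv a \<in> U" using base_conj[OF a(1) U(1)] by blast
    have "inv (a \<otimes> w) \<in> A" if w: "w \<in> W" for w
    proof -
      have c: "w \<in> carrier M" using w W base_in by auto
      have iw: "inv w \<in> W" using subgroup.m_inv_closed[OF base_subgroup[OF W(1)] w] .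
      then have "inv a \<otimes> (a \<otimes> inv w \<otimes> inv a) \<in> A" using U W by blast
      moreover have "inv a \<otimes> (a \<otimes> inv w \<otimes> inv a) = inv (a \<otimes> w)"
        using a c by (simp add: m_assoc inv_mult_group cancel_left)
      ultimately show ?thesis by simp
    qed
    then show "\<exists>W\<in>\<B>. \<forall>w\<in>W. a \<otimes> w \<in> {a \<in> carrier M. inv a \<in> A}"
      using W a base_in[OF W(1)] by (intro bexI[of _ W]) auto
  qed auto
qed auto

lemma base_coarsest:
  assumes T: "topspace T = carrier M" "continuous_map (prod_topology T T) T (\<lambda>(a, b). a \<otimes> b)"
    and U: "\<And>U. U \<in> \<B> \<Longrightarrow> openin T U" and A: "openin base_topology A"
  shows "openin T A"
proof -
  have "\<exists>N. openin T N \<and> a \<in> N \<and> N \<subseteq> A" if a: "a \<in> A" for a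
  proof -
    have aM: "a \<in> carrier M" using a A unfolding openin_base opens_def by blast
    obtain U where U': "U \<in> \<B>" "\<forall>u\<in>U. a \<otimes> u \<in> A" using A a unfolding openin_base opens_def by blast
    have "continuous_map T (prod_topology T T) (\<lambda>b. (inv a, b))"
      using aM T(1) by (simp add: continuous_map_pairedI)
    from continuous_map_compose[OF this T(2)] have "continuous_map T T (\<lambda>b. inv a \<otimes> b)" by (simp add: o_def)
    then have "openin T {b \<in> topspace T. inv a \<otimes> b \<in> U}" using openin_continuous_map_preimage U[OF U'(1)] by blast
    moreover have "a \<in> {b \<in> topspace T. inv a \<otimes> b \<in> U}"
      using aM T(1) subgroup.one_closed[OF base_subgroup[OF U'(1)]] by simp
    moreover have "{b \<in> topspace T. inv a \<otimes> b \<in> U} \<subseteq> A"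
    proof
      fix b assume "b \<in> {b \<in> topspace T. inv a \<otimes> b \<in> U}"
      then have b: "b \<in> carrier M" "inv a \<otimes> b \<in> U" using T(1) by auto
      then have "a \<otimes> (inv a \<otimes> b) \<in> A" using U' by blast
      then show "b \<in> A" using cancel_left(1)[OF aM b(1)] by simp
    qed
    ultimately show ?thesis by blast
  qed
  then show ?thesis by (subst openin_subopen) blast
qed

lemma closure_conjugacy_class:
  assumes a: "a \<in> carrier M"
    and dense: "\<And>g U. g \<in> carrier M \<Longrightarrow> U \<in> \<B> \<Longrightarrow> \<exists>b\<in>carrier M. inv g \<otimes> (b \<otimes> a \<otimes> inv b) \<in> U"
  shows "base_topology closure_of (conjugacy_class M a) = carrier M"
proof
  show "base_topology closure_of (conjugacy_class M a) \<subseteq> carrier M"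
    using closure_of_subset_topspace[of base_topology] by simp
  show "carrier M \<subseteq> base_topology closure_of (conjugacy_class M a)"
  proof
    fix g assume g: "g \<in> carrier M"
    have "\<exists>y\<in>conjugacy_class M a. y \<in> A" if A: "g \<in> A" "openin base_topology A" for A
    proof -
      obtain U where U: "U \<in> \<B>" "\<forall>u\<in>U. g \<otimes> u \<in> A" using A unfolding openin_base opens_def by blast
      obtain b where b: "b \<in> carrier M" "inv g \<otimes> (b \<otimes> a \<otimes> inv b) \<in> U" using dense[OF g U(1)] by blast
      then have "g \<otimes> (inv g \<otimes> (b \<otimes> a \<otimes> inv b)) \<in> A" using U by blast
      moreover have "b \<otimes> a \<otimes> inv b \<in> carrier M" using a b by simp
      ultimately have "b \<otimes> a \<otimes> inv b \<in> A" using cancel_left(1)[OF g] by simp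
      then show ?thesis using b unfolding conjugacy_class_def by blast
    qed
    then show "g \<in> base_topology closure_of (conjugacy_class M a)"
      using g by (auto simp: in_closure_of)
  qed
qed

end

section \<open>The mapping class group of a tree\<close>

context graph_tree
begin

abbreviation S :: "('v \<Rightarrow> real) topology" where "S \<equiv> graph_space G"

definition Homeos :: "((nat \<Rightarrow> 'v) \<Rightarrow> (nat \<Rightarrow> 'v)) set" where
  "Homeos = {\<phi>. homeomorphic_map ends ends \<phi>}"

text \<open>The class in \<open>Maps G\<close> that induces \<open>\<phi>\<close> on the ends.\<close>

definition cls :: "((nat \<Rightarrow> 'v) \<Rightarrow> (nat \<Rightarrow> 'v)) \<Rightarrow> (('v \<Rightarrow> real) \<Rightarrow> ('v \<Rightarrow> real)) set" where
  "cls \<phi> = {f \<in> proper_homotopy_equivs S. \<forall>\<xi>\<in>rays. bd f \<xi> = \<phi> \<xi>}"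

lemma Homeos_rays: "\<phi> \<in> Homeos \<Longrightarrow> \<xi> \<in> rays \<Longrightarrow> \<phi> \<xi> \<in> rays"
  unfolding Homeos_def using homeomorphic_imp_surjective_map[of ends ends \<phi>] by auto

lemma Homeos_cont: "\<phi> \<in> Homeos \<Longrightarrow> continuous_map ends ends \<phi>"
  unfolding Homeos_def using homeomorphic_imp_continuous_map by blast

lemma Homeos_comp: "\<phi> \<in> Homeos \<Longrightarrow> \<psi> \<in> Homeos \<Longrightarrow> \<phi> \<circ> \<psi> \<in> Homeos"
  unfolding Homeos_def using homeomorphic_map_compose by blast

lemma Homeos_id: "id \<in> Homeos"
  by (simp add: Homeos_def)

lemma Homeos_inverse:
  assumes "\<phi> \<in> Homeos"
  obtains \<psi> where "\<psi> \<in> Homeos" "\<And>\<xi>. \<xi> \<in> rays \<Longrightarrow> \<psi> (\<phi> \<xi>) = \<xi>" "\<And>\<xi>. \<xi> \<in> rays \<Longrightarrow> \<phi> (\<psi> \<xi>) = \<xi>"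
proof -
  obtain \<psi> where "homeomorphic_maps ends ends \<phi> \<psi>"
    using assms unfolding Homeos_def homeomorphic_map_maps by blast
  then show thesis using that[of \<psi>] unfolding homeomorphic_maps_map Homeos_def by simp
qed

lemma cls_cong: "(\<And>\<xi>. \<xi> \<in> rays \<Longrightarrow> \<phi> \<xi> = \<psi> \<xi>) \<Longrightarrow> cls \<phi> = cls \<psi>"
  by (auto simp: cls_def)

lemma PHE_proper: "f \<in> proper_homotopy_equivs S \<Longrightarrow> continuous_proper S S f"
  by (simp add: PHE_iff)

lemma PHE_Homeos: "f \<in> proper_homotopy_equivs S \<Longrightarrow> bd f \<in> Homeos"
  by (simp add: PHE_iff Homeos_def)

lemma rel_iff:
  "(f, g) \<in> proper_homotopy_rel S \<longleftrightarrow>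
     f \<in> proper_homotopy_equivs S \<and> g \<in> proper_homotopy_equivs S \<and> (\<forall>\<xi>\<in>rays. bd f \<xi> = bd g \<xi>)"
  unfolding proper_homotopy_rel_def using homotopic_iff[OF PHE_proper PHE_proper, of f g] by auto

lemma rel_class: "f \<in> proper_homotopy_equivs S \<Longrightarrow> proper_homotopy_rel S `` {f} = cls (bd f)"
  by (auto simp: rel_iff cls_def)

lemma realize:
  assumes \<phi>: "\<phi> \<in> Homeos" and pres: "\<And>v. v \<in> V \<Longrightarrow> d v \<le> m \<Longrightarrow> \<phi> ` shadow v \<subseteq> shadow v"
  obtains f where "f \<in> cls \<phi>" "\<And>x. x \<in> core m \<Longrightarrow> f x = x" "\<And>v. v \<in> V \<Longrightarrow> d v \<le> m \<Longrightarrow> f ` branch v \<subseteq> branch v"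
proof (rule bd_realize[OF Homeos_cont[OF \<phi>], of m])
  show "\<phi> ` shadow v \<subseteq> shadow v" if "v \<in> V" "d v \<le> m" for v using pres that by blast
  fix f assume f: "continuous_proper S S f" "\<And>\<xi>. \<xi> \<in> rays \<Longrightarrow> bd f \<xi> = \<phi> \<xi>"
    "\<And>x. x \<in> core m \<Longrightarrow> f x = x" "\<And>v. v \<in> V \<Longrightarrow> d v \<le> m \<Longrightarrow> f ` branch v \<subseteq> branch v"
  have "homeomorphic_map ends ends (bd f)"
    using \<phi> homeomorphic_map_eq[of ends ends \<phi> "bd f"] f(2) unfolding Homeos_def by simp
  then have "f \<in> cls \<phi>" using f by (simp add: cls_def PHE_iff)
  then show thesis using that f by blast
qed

lemma cls_nonempty: "\<phi> \<in> Homeos \<Longrightarrow> cls \<phi> \<noteq> {}"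
proof -
  assume p: "\<phi> \<in> Homeos"
  show ?thesis
  proof (rule realize[OF p, of 0])
    fix v assume "v \<in> V" "d v \<le> 0"
    then have v: "v = r" using d_zero[of v] by simp
    show "\<phi> ` shadow v \<subseteq> shadow v" unfolding v shadow_root using Homeos_rays[OF p] by blast
  qed blast
qed

text \<open>Together with \<open>mult_Maps\<close>: \<open>Maps G\<close> is the homeomorphism group of the end space.\<close>

lemma carrier_Maps: "carrier (Maps G) = cls ` Homeos"
proof -
  have "carrier (Maps G) = proper_homotopy_equivs S // proper_homotopy_rel S"
    by (simp add: Maps_def Let_def)
  also have "\<dots> = (\<lambda>f. cls (bd f)) ` proper_homotopy_equivs S"
    unfolding quotient_def using rel_class by auto
  also have "\<dots> = cls ` Homeos"
  proof (intro equalityI subsetI)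
    fix A assume "A \<in> (\<lambda>f. cls (bd f)) ` proper_homotopy_equivs S"
    then show "A \<in> cls ` Homeos" using PHE_Homeos by blast
  next
    fix A assume "A \<in> cls ` Homeos"
    then obtain \<phi> where p: "\<phi> \<in> Homeos" "A = cls \<phi>" by blast
    obtain f where f: "f \<in> cls \<phi>" using cls_nonempty[OF p(1)] by blast
    then have "f \<in> proper_homotopy_equivs S" "cls (bd f) = cls \<phi>" by (auto simp: cls_def)
    then show "A \<in> (\<lambda>f. cls (bd f)) ` proper_homotopy_equivs S" using p by blast
  qed
  finally show ?thesis .
qed

lemma PHE_comp: "f \<in> proper_homotopy_equivs S \<Longrightarrow> g \<in> proper_homotopy_equivs S \<Longrightarrow> f \<circ> g \<in> proper_homotopy_equivs S"
proof -
  assume f: "f \<in> proper_homotopy_equivs S" and g: "g \<in> proper_homotopy_equivs S"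
  have "homeomorphic_map ends ends (bd (f \<circ> g))"
  proof (rule homeomorphic_map_eq)
    show "homeomorphic_map ends ends (bd f \<circ> bd g)"
      using Homeos_comp[OF PHE_Homeos[OF f] PHE_Homeos[OF g]] by (simp add: Homeos_def)
    show "(bd f \<circ> bd g) \<xi> = bd (f \<circ> g) \<xi>" if "\<xi> \<in> topspace ends" for \<xi>
      using bd_comp[OF PHE_proper[OF f] PHE_proper[OF g]] that by simp
  qed
  then show ?thesis using continuous_proper_comp[OF PHE_proper[OF f] PHE_proper[OF g]] by (simp add: PHE_iff)
qed

lemma cls_comp_in: "f \<in> cls \<phi> \<Longrightarrow> g \<in> cls \<psi> \<Longrightarrow> \<psi> \<in> Homeos \<Longrightarrow> f \<circ> g \<in> cls (\<phi> \<circ> \<psi>)"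
  using PHE_comp bd_comp[OF PHE_proper PHE_proper, of f g] Homeos_rays by (auto simp: cls_def)

lemma mult_Maps:
  assumes \<phi>: "\<phi> \<in> Homeos" and \<psi>: "\<psi> \<in> Homeos"
  shows "cls \<phi> \<otimes>\<^bsub>Maps G\<^esub> cls \<psi> = cls (\<phi> \<circ> \<psi>)"
proof -
  have "cls \<phi> \<otimes>\<^bsub>Maps G\<^esub> cls \<psi> = (\<Union>f\<in>cls \<phi>. \<Union>g\<in>cls \<psi>. proper_homotopy_rel S `` {f \<circ> g})"
    by (simp only: Maps_def Let_def monoid.select_convs)
  also have "\<dots> = (\<Union>f\<in>cls \<phi>. \<Union>g\<in>cls \<psi>. cls (\<phi> \<circ> \<psi>))"
  proof (intro SUP_cong refl)
    fix f g assume "f \<in> cls \<phi>" "g \<in> cls \<psi>"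
    then have fg: "f \<circ> g \<in> cls (\<phi> \<circ> \<psi>)" using cls_comp_in \<psi> by blast
    then have "f \<circ> g \<in> proper_homotopy_equivs S" by (simp add: cls_def)
    then have "proper_homotopy_rel S `` {f \<circ> g} = cls (bd (f \<circ> g))" by (rule rel_class)
    also have "\<dots> = cls (\<phi> \<circ> \<psi>)" using fg by (intro cls_cong) (simp add: cls_def)
    finally show "proper_homotopy_rel S `` {f \<circ> g} = cls (\<phi> \<circ> \<psi>)" .
  qed
  also have "\<dots> = cls (\<phi> \<circ> \<psi>)" using cls_nonempty[OF \<phi>] cls_nonempty[OF \<psi>] by auto
  finally show ?thesis .
qed

lemma id_PHE: "id \<in> proper_homotopy_equivs S"
proof -
  have "homeomorphic_map ends ends (bd id)"
    using homeomorphic_map_eq[of ends ends id "bd id"] bd_id by simp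
  then show ?thesis using continuous_proper_id by (simp add: PHE_iff)
qed

lemma id_cls: "id \<in> cls id"
  using id_PHE bd_id by (simp add: cls_def)

lemma one_Maps: "\<one>\<^bsub>Maps G\<^esub> = cls id"
proof -
  have "\<one>\<^bsub>Maps G\<^esub> = cls (bd id)" using rel_class[OF id_PHE] by (simp add: Maps_def Let_def)
  also have "\<dots> = cls id" using bd_id by (intro cls_cong) simp
  finally show ?thesis .
qed

lemma group_Maps: "group (Maps G)"
proof (rule groupI)
  fix A B C assume "A \<in> carrier (Maps G)" "B \<in> carrier (Maps G)" "C \<in> carrier (Maps G)"
  then show "A \<otimes>\<^bsub>Maps G\<^esub> B \<otimes>\<^bsub>Maps G\<^esub> C = A \<otimes>\<^bsub>Maps G\<^esub> (B \<otimes>\<^bsub>Maps G\<^esub> C)"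
    by (auto simp: carrier_Maps mult_Maps Homeos_comp o_assoc)
next
  fix A assume "A \<in> carrier (Maps G)"
  then obtain \<phi> where p: "\<phi> \<in> Homeos" "A = cls \<phi>" by (auto simp: carrier_Maps)
  then show "\<one>\<^bsub>Maps G\<^esub> \<otimes>\<^bsub>Maps G\<^esub> A = A" by (simp add: one_Maps mult_Maps Homeos_id)
  obtain \<psi> where q: "\<psi> \<in> Homeos" "\<And>\<xi>. \<xi> \<in> rays \<Longrightarrow> \<psi> (\<phi> \<xi>) = \<xi>" using Homeos_inverse[OF p(1)] by metis
  have "cls \<psi> \<otimes>\<^bsub>Maps G\<^esub> A = cls (\<psi> \<circ> \<phi>)" using p q by (simp add: mult_Maps)
  also have "\<dots> = cls id" using q by (intro cls_cong) simp
  finally show "\<exists>B\<in>carrier (Maps G). B \<otimes>\<^bsub>Maps G\<^esub> A = \<one>\<^bsub>Maps G\<^esub>"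
    using q one_Maps carrier_Maps by auto
qed (auto simp: carrier_Maps mult_Maps one_Maps Homeos_comp Homeos_id)

lemma inv_Maps:
  assumes "\<phi> \<in> Homeos" "\<psi> \<in> Homeos" "\<And>\<xi>. \<xi> \<in> rays \<Longrightarrow> \<phi> (\<psi> \<xi>) = \<xi>"
  shows "inv\<^bsub>Maps G\<^esub> cls \<psi> = cls \<phi>"
proof -
  interpret M: group "Maps G" by (rule group_Maps)
  have "cls \<phi> \<otimes>\<^bsub>Maps G\<^esub> cls \<psi> = \<one>\<^bsub>Maps G\<^esub>"
    using assms by (simp add: mult_Maps one_Maps) (intro cls_cong, simp)
  then show ?thesis using M.inv_equality assms carrier_Maps by blast
qed

end

section \<open>The topology of the mapping class group\<close>

context graph_tree
begin

text \<open>Geodesics with end points in a component stay in it, by \<open>connected_convex\<close>.\<close>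

lemma geo_fixes_preserves:
  assumes f: "fixes_preserves S L f" and L: "L \<subseteq> topspace S"
  shows "fixes_preserves S L (\<lambda>x. geo_pt t (f x) x)"
  unfolding fixes_preserves_def
proof (intro conjI ballI subsetI)
  fix x assume x: "x \<in> L"
  then have "f x = x" "x \<in> topspace S" using f L by (auto simp: fixes_preserves_def)
  then show "geo_pt t (f x) x = x" using geo_pt_same by simp
next
  fix D y assume D: "D \<in> pi0_compl S L" and "y \<in> (\<lambda>x. geo_pt t (f x) x) ` D"
  then obtain x where x: "x \<in> D" "y = geo_pt t (f x) x" by blast
  have fx: "f x \<in> D" using f D x unfolding fixes_preserves_def by blast
  have c: "connectedin S D" using pi0_path_connected(1)[OF D] path_connectedin_imp_connectedin by blast
  have xS: "x \<in> topspace S" "f x \<in> topspace S" using x(1) fx pi0_path_connected(2)[OF D] by auto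
  show "y \<in> D"
    unfolding x(2)
  proof (rule connected_convex[OF c fx x(1) geo_pt_in[OF xS(2,1)]])
    fix v
    show "min (crd (f x) v) (crd x v) \<le> crd (geo_pt t (f x) x) v"
      unfolding crd_geo_pt[OF xS(2,1)] by (rule geo_ge)
    show "crd (geo_pt t (f x) x) v \<le> max (crd (f x) v) (crd x v)"
      unfolding crd_geo_pt[OF xS(2,1)] by (rule geo_le[OF crd_in crd_in]) (use xS in auto)
  qed
qed

lemma fixes_preserves_comp:
  "fixes_preserves S L f \<Longrightarrow> fixes_preserves S L g \<Longrightarrow> fixes_preserves S L (f \<circ> g)"
  unfolding fixes_preserves_def by fastforce

lemma fixes_preserves_homotopy:
  assumes f: "continuous_proper S S f" "\<And>\<xi>. \<xi> \<in> rays \<Longrightarrow> bd f \<xi> = \<xi>"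
    and fp: "fixes_preserves S L f" and L: "L \<subseteq> topspace S"
  shows "\<exists>H. proper_homotopy S S f id H \<and> (\<forall>t\<in>{0..1}. fixes_preserves S L (\<lambda>x. H (t, x)))"
proof (intro exI conjI ballI)
  show "proper_homotopy S S f id (geo_homotopy f id)"
    using f bd_id by (intro geo_homotopy_proper continuous_proper_id) auto
  show "fixes_preserves S L (\<lambda>x. geo_homotopy f id (t, x))" for t
    using geo_fixes_preserves[OF fp L, of t] by (simp add: geo_homotopy_def)
qed

text \<open>The homotopies in the definition of \<open>basic_nbhd\<close> exist for any pair of inverse representatives that
  fix \<open>K\<close> and preserve the components: take the geodesic ones.\<close>

lemma nbhd_iff:
  assumes K: "finite_subgraph K G" and \<phi>: "\<phi> \<in> Homeos" "\<psi> \<in> Homeos"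
    and inv: "\<And>\<xi>. \<xi> \<in> rays \<Longrightarrow> \<psi> (\<phi> \<xi>) = \<xi>" "\<And>\<xi>. \<xi> \<in> rays \<Longrightarrow> \<phi> (\<psi> \<xi>) = \<xi>"
  shows "cls \<phi> \<in> basic_nbhd G K \<longleftrightarrow>
    (\<exists>f\<in>cls \<phi>. \<exists>g\<in>cls \<psi>. fixes_preserves S (realization K) f \<and> fixes_preserves S (realization K) g)"
    (is "?L \<longleftrightarrow> ?R")
proof
  have i: "inv\<^bsub>Maps G\<^esub> cls \<phi> = cls \<psi>" by (rule inv_Maps) (use \<phi> inv in auto)
  show "?L \<Longrightarrow> ?R" unfolding basic_nbhd_def mem_Collect_eq i by blast
  assume ?R
  then obtain f g where f: "f \<in> cls \<phi>" "fixes_preserves S (realization K) f"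
    and g: "g \<in> cls \<psi>" "fixes_preserves S (realization K) g" by blast
  have L: "realization K \<subseteq> topspace S" using finite_subgraph_core(1)[OF K] by simp
  have P: "f \<in> proper_homotopy_equivs S" "g \<in> proper_homotopy_equivs S" using f g by (auto simp: cls_def)
  have gf: "bd (g \<circ> f) \<xi> = \<xi>" if "\<xi> \<in> rays" for \<xi>
    using cls_comp_in[OF g(1) f(1) \<phi>(1)] that inv(1) by (simp add: cls_def)
  have fg: "bd (f \<circ> g) \<xi> = \<xi>" if "\<xi> \<in> rays" for \<xi>
    using cls_comp_in[OF f(1) g(1) \<phi>(2)] that inv(2) by (simp add: cls_def)
  note h1 = fixes_preserves_homotopy[OF PHE_proper[OF PHE_comp[OF P(2,1)]] gf fixes_preserves_comp[OF g(2) f(2)] L]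
  note h2 = fixes_preserves_homotopy[OF PHE_proper[OF PHE_comp[OF P]] fg fixes_preserves_comp[OF f(2) g(2)] L]
  have "cls \<phi> \<in> carrier (Maps G)" using \<phi> by (simp add: carrier_Maps)
  then show ?L unfolding basic_nbhd_def mem_Collect_eq i using f g h1 h2 by blast
qed

lemma subgroup_nbhd:
  assumes K: "finite_subgraph K G"
  shows "subgroup (basic_nbhd G K) (Maps G)"
proof -
  interpret M: group "Maps G" by (rule group_Maps)
  let ?fp = "fixes_preserves S (realization K)"
  have sub: "basic_nbhd G K \<subseteq> carrier (Maps G)" by (auto simp: basic_nbhd_def)
  have el: "\<exists>\<phi> \<psi> f g. A = cls \<phi> \<and> \<phi> \<in> Homeos \<and> \<psi> \<in> Homeos \<and> (\<forall>\<xi>\<in>rays. \<psi> (\<phi> \<xi>) = \<xi>) \<and> (\<forall>\<xi>\<in>rays. \<phi> (\<psi> \<xi>) = \<xi>)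
     \<and> f \<in> cls \<phi> \<and> g \<in> cls \<psi> \<and> ?fp f \<and> ?fp g" if A: "A \<in> basic_nbhd G K" for A
  proof -
    obtain \<phi> where p: "\<phi> \<in> Homeos" "A = cls \<phi>" using A sub carrier_Maps by blast
    obtain \<psi> where q: "\<psi> \<in> Homeos" "\<And>\<xi>. \<xi> \<in> rays \<Longrightarrow> \<psi> (\<phi> \<xi>) = \<xi>" "\<And>\<xi>. \<xi> \<in> rays \<Longrightarrow> \<phi> (\<psi> \<xi>) = \<xi>"
      using Homeos_inverse[OF p(1)] by metis
    then show ?thesis using nbhd_iff[OF K p(1) q] A p by blast
  qed
  show ?thesis
  proof (rule M.subgroupI[OF sub])
    have fp: "?fp id" by (simp add: fixes_preserves_def)
    have "cls id \<in> basic_nbhd G K"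
      by (rule iffD2[OF nbhd_iff[OF K Homeos_id Homeos_id]], simp, simp, use id_cls fp in blast)
    then show "basic_nbhd G K \<noteq> {}" by blast
  next
    fix A assume A: "A \<in> basic_nbhd G K"
    from el[OF A] obtain \<phi> \<psi> f g where p: "A = cls \<phi>" "\<phi> \<in> Homeos" "\<psi> \<in> Homeos" "\<forall>\<xi>\<in>rays. \<psi> (\<phi> \<xi>) = \<xi>" "\<forall>\<xi>\<in>rays. \<phi> (\<psi> \<xi>) = \<xi>"
      "f \<in> cls \<phi>" "g \<in> cls \<psi>" "?fp f" "?fp g" by (elim exE conjE) (rule that)
    have "inv\<^bsub>Maps G\<^esub> A = cls \<psi>" unfolding p(1) by (rule inv_Maps[OF p(3,2)]) (use p(4) in blast)
    moreover have "cls \<psi> \<in> basic_nbhd G K" using nbhd_iff[OF K p(3,2)] p(4-9) by blast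
    ultimately show "inv\<^bsub>Maps G\<^esub> A \<in> basic_nbhd G K" by simp
  next
    fix A A' assume A: "A \<in> basic_nbhd G K" "A' \<in> basic_nbhd G K"
    from el[OF A(1)] obtain \<phi> \<psi> f g where p: "A = cls \<phi>" "\<phi> \<in> Homeos" "\<psi> \<in> Homeos" "\<forall>\<xi>\<in>rays. \<psi> (\<phi> \<xi>) = \<xi>" "\<forall>\<xi>\<in>rays. \<phi> (\<psi> \<xi>) = \<xi>"
      "f \<in> cls \<phi>" "g \<in> cls \<psi>" "?fp f" "?fp g" by (elim exE conjE) (rule that)
    from el[OF A(2)] obtain \<phi>' \<psi>' f' g' where q: "A' = cls \<phi>'" "\<phi>' \<in> Homeos" "\<psi>' \<in> Homeos" "\<forall>\<xi>\<in>rays. \<psi>' (\<phi>' \<xi>) = \<xi>" "\<forall>\<xi>\<in>rays. \<phi>' (\<psi>' \<xi>) = \<xi>"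
      "f' \<in> cls \<phi>'" "g' \<in> cls \<psi>'" "?fp f'" "?fp g'" by (elim exE conjE) (rule that)
    have "f \<circ> f' \<in> cls (\<phi> \<circ> \<phi>')" using cls_comp_in[OF p(6) q(6,2)] .
    moreover have "g' \<circ> g \<in> cls (\<psi>' \<circ> \<psi>)" using cls_comp_in[OF q(7) p(7,3)] .
    moreover have "?fp (f \<circ> f')" using fixes_preserves_comp[OF p(8) q(8)] .
    moreover have "?fp (g' \<circ> g)" using fixes_preserves_comp[OF q(9) p(9)] .
    moreover have "(\<psi>' \<circ> \<psi>) ((\<phi> \<circ> \<phi>') \<xi>) = \<xi>" "(\<phi> \<circ> \<phi>') ((\<psi>' \<circ> \<psi>) \<xi>) = \<xi>" if "\<xi> \<in> rays" for \<xi>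
      using p(4,5) q(4,5) that Homeos_rays[OF q(2) that] Homeos_rays[OF p(3) that] by simp_all
    ultimately have "cls (\<phi> \<circ> \<phi>') \<in> basic_nbhd G K"
      using nbhd_iff[OF K Homeos_comp[OF p(2) q(2)] Homeos_comp[OF q(3) p(3)]] by blast
    then show "A \<otimes>\<^bsub>Maps G\<^esub> A' \<in> basic_nbhd G K" unfolding p(1) q(1) mult_Maps[OF p(2) q(2)] .
  qed
qed

text \<open>The homeomorphisms that preserve the ends of each component of the complement of \<open>core n\<close>; the next
  lemmas show that they form the basic neighbourhood of the ball of radius \<open>n\<close>.\<close>

definition stab :: "nat \<Rightarrow> ((nat \<Rightarrow> 'v) \<Rightarrow> (nat \<Rightarrow> 'v)) \<Rightarrow> bool" where
  "stab n \<phi> \<longleftrightarrow> (\<forall>v\<in>V. d v = Suc n \<longrightarrow> \<phi> ` shadow v = shadow v)"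

lemma stabD: "stab n \<phi> \<Longrightarrow> v \<in> V \<Longrightarrow> d v \<le> Suc n \<Longrightarrow> \<phi> ` shadow v \<subseteq> shadow v"
proof
  fix \<eta> assume s: "stab n \<phi>" and v: "v \<in> V" "d v \<le> Suc n" and "\<eta> \<in> \<phi> ` shadow v"
  then obtain \<xi> where xi: "\<xi> \<in> rays" "\<xi> (d v) = v" "\<eta> = \<phi> \<xi>" by (auto simp: in_shadow)
  have "\<eta> \<in> shadow (\<xi> (Suc n))"
    using s ray_in_shadow[OF xi(1), of "Suc n"] ray_in[OF xi(1)] ray_d[OF xi(1)] xi(3) unfolding stab_def by blast
  moreover have "below v (\<xi> (Suc n))" using ray_below[OF xi(1) v(2)] xi(2) by simp
  ultimately show "\<eta> \<in> shadow v" using shadow_below ray_in[OF xi(1)] by blast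
qed

text \<open>A component of the complement of \<open>K\<close> consists of points of the core, which are fixed, and of branches
  of level \<open>n + 1\<close>, which are preserved.\<close>

lemma fixes_preserves_core:
  assumes K: "realization K \<subseteq> core n"
    and f: "\<And>x. x \<in> core (Suc n) \<Longrightarrow> f x = x" "\<And>v. v \<in> V \<Longrightarrow> d v \<le> Suc n \<Longrightarrow> f ` branch v \<subseteq> branch v"
  shows "fixes_preserves S (realization K) f"
  unfolding fixes_preserves_def
proof (intro conjI ballI subsetI)
  fix x assume "x \<in> realization K"
  then show "f x = x" using K core_mono[of n "Suc n"] f(1) by auto
next
  fix D y assume D: "D \<in> pi0_compl S (realization K)" and "y \<in> f ` D"
  then obtain x where x: "x \<in> D" "y = f x" by blast
  have xS: "x \<in> topspace S" using x pi0_path_connected(2)[OF D] by blast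
  show "y \<in> D"
  proof (cases "x \<in> core n")
    case True then show ?thesis using x core_mono[of n "Suc n"] f(1) by auto
  next
    case False
    then obtain v where v: "v \<in> V" "d v = Suc n" "x \<in> branch v" using outside_core[OF xS] by blast
    have "branch v \<subseteq> topspace S - realization K" using K branch_core[of _ v n] v(2) branch_subset by auto
    then have "branch v \<subseteq> D" using pi0_maximal[OF D path_connected_branch _ x(1) v(3)] by blast
    moreover have "f ` branch v \<subseteq> branch v" using f(2) v by simp
    ultimately show ?thesis using x(2) v(3) by blast
  qed
qed

lemma stab_nbhd:
  assumes \<phi>: "\<phi> \<in> Homeos" "stab n \<phi>" and K: "finite_subgraph K G" "realization K \<subseteq> core n"
  shows "cls \<phi> \<in> basic_nbhd G K"
proof -
  obtain \<psi> where q: "\<psi> \<in> Homeos" "\<And>\<xi>. \<xi> \<in> rays \<Longrightarrow> \<psi> (\<phi> \<xi>) = \<xi>" "\<And>\<xi>. \<xi> \<in> rays \<Longrightarrow> \<phi> (\<psi> \<xi>) = \<xi>"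
    using Homeos_inverse[OF \<phi>(1)] by metis
  have s: "stab n \<psi>"
    unfolding stab_def
  proof (intro ballI impI)
    fix v assume "v \<in> V" "d v = Suc n"
    then have "\<psi> ` shadow v = \<psi> ` \<phi> ` shadow v" using \<phi>(2) by (simp add: stab_def)
    also have "\<dots> = (\<lambda>\<xi>. \<xi>) ` shadow v"
      unfolding image_image using q(2) shadow_subset[of v] by (intro image_cong) auto
    finally show "\<psi> ` shadow v = shadow v" by simp
  qed
  have *: "\<exists>f\<in>cls \<phi>. fixes_preserves S (realization K) f" if "\<phi> \<in> Homeos" "stab n \<phi>" for \<phi>
  proof (rule realize[OF that(1), of "Suc n"])
    show "\<phi> ` shadow v \<subseteq> shadow v" if "v \<in> V" "d v \<le> Suc n" for v using stabD \<open>stab n \<phi>\<close> that by blast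
    fix f assume f: "f \<in> cls \<phi>" "\<And>x. x \<in> core (Suc n) \<Longrightarrow> f x = x" "\<And>v. v \<in> V \<Longrightarrow> d v \<le> Suc n \<Longrightarrow> f ` branch v \<subseteq> branch v"
    have "fixes_preserves S (realization K) f" by (rule fixes_preserves_core[OF K(2)]) (use f in auto)
    then show ?thesis using f by blast
  qed
  have "cls \<phi> \<in> basic_nbhd G K \<longleftrightarrow>
    (\<exists>f\<in>cls \<phi>. \<exists>g\<in>cls \<psi>. fixes_preserves S (realization K) f \<and> fixes_preserves S (realization K) g)"
    by (rule nbhd_iff[OF K(1) \<phi>(1) q(1)]) (use q in auto)
  then show ?thesis using *[OF \<phi>] *[OF q(1) s] by blast
qed

lemma nbhd_stab:
  assumes \<phi>: "\<phi> \<in> Homeos" and n: "cls \<phi> \<in> basic_nbhd G (ball_graph n)"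
  shows "stab n \<phi>"
proof -
  obtain f where f: "f \<in> cls \<phi>" "fixes_preserves S (core n) f"
    using n unfolding basic_nbhd_def realization_ball_core by blast
  have sub: "\<phi> \<xi> \<in> shadow (\<xi> (Suc n))" if xi: "\<xi> \<in> rays" for \<xi>
  proof -
    let ?v = "\<xi> (Suc n)"
    have v: "?v \<in> V" "d ?v = Suc n" using ray_in[OF xi] ray_d[OF xi] by auto
    have "f ` branch ?v \<subseteq> branch ?v"
      using f(2) branch_component[OF v] unfolding fixes_preserves_def by blast
    then have "bd f \<xi> (Suc n) = ?v" using bd_eqI[OF xi _ v(1)] v(2) by simp
    then have "\<phi> \<xi> (Suc n) = ?v" using f(1) xi by (simp add: cls_def)
    then show ?thesis using Homeos_rays[OF \<phi> xi] v by (simp add: in_shadow)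
  qed
  show ?thesis
    unfolding stab_def
  proof (intro ballI impI equalityI subsetI)
    fix v \<eta> assume v: "v \<in> V" "d v = Suc n"
    {
      assume "\<eta> \<in> \<phi> ` shadow v"
      then obtain \<xi> where xi: "\<xi> \<in> rays" "\<xi> (Suc n) = v" "\<eta> = \<phi> \<xi>" using v by (auto simp: in_shadow)
      then show "\<eta> \<in> shadow v" using sub[OF xi(1)] by simp
    }
    assume eta: "\<eta> \<in> shadow v"
    then have er: "\<eta> \<in> rays" by (simp add: in_shadow)
    obtain \<psi> where q: "\<psi> \<in> Homeos" "\<And>\<xi>. \<xi> \<in> rays \<Longrightarrow> \<phi> (\<psi> \<xi>) = \<xi>" using Homeos_inverse[OF \<phi>] by metis
    have "\<psi> \<eta> \<in> rays" using Homeos_rays[OF q(1) er] .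
    then have "\<eta> \<in> shadow (\<psi> \<eta> (Suc n))" using sub[of "\<psi> \<eta>"] q(2)[OF er] by simp
    then have "\<psi> \<eta> (Suc n) = v" using eta v ray_d[OF \<open>\<psi> \<eta> \<in> rays\<close>] by (simp add: in_shadow)
    then have "\<psi> \<eta> \<in> shadow v" using \<open>\<psi> \<eta> \<in> rays\<close> v by (simp add: in_shadow)
    then show "\<eta> \<in> \<phi> ` shadow v" using imageI[of "\<psi> \<eta>" "shadow v" \<phi>] q(2)[OF er] by simp
  qed
qed

lemma nbhd_Int:
  assumes K: "finite_subgraph K G" and L: "finite_subgraph L G"
  shows "\<exists>X. finite_subgraph X G \<and> basic_nbhd G X \<subseteq> basic_nbhd G K \<inter> basic_nbhd G L"
proof -
  obtain k l where k: "realization K \<subseteq> core k" and l: "realization L \<subseteq> core l"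
    using finite_subgraph_core(2) K L by meson
  define n where "n = max k l"
  have n: "realization K \<subseteq> core n" "realization L \<subseteq> core n"
    using k l core_mono[of k n] core_mono[of l n] by (auto simp: n_def)
  have "basic_nbhd G (ball_graph n) \<subseteq> basic_nbhd G K \<inter> basic_nbhd G L"
  proof
    fix A assume A: "A \<in> basic_nbhd G (ball_graph n)"
    then have "A \<in> carrier (Maps G)" by (simp add: basic_nbhd_def)
    then obtain \<phi> where p: "\<phi> \<in> Homeos" "A = cls \<phi>" by (auto simp: carrier_Maps)
    then have "stab n \<phi>" using nbhd_stab A by blast
    then show "A \<in> basic_nbhd G K \<inter> basic_nbhd G L" using stab_nbhd[OF p(1) _ K n(1)] stab_nbhd[OF p(1) _ L n(2)] p by blast
  qed
  then show ?thesis using finite_subgraph_ball_graph by blast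
qed

text \<open>The preimages under \<open>\<alpha>\<close> of the shadows of level \<open>n + 1\<close> are clopen, hence unions of shadows of a
  common level \<open>m + 1\<close>. A homeomorphism that preserves the latter preserves these unions.\<close>

lemma nbhd_conj:
  assumes A: "A \<in> carrier (Maps G)" and K: "finite_subgraph K G"
  shows "\<exists>L. finite_subgraph L G \<and>
    (\<forall>B\<in>basic_nbhd G L. A \<otimes>\<^bsub>Maps G\<^esub> B \<otimes>\<^bsub>Maps G\<^esub> inv\<^bsub>Maps G\<^esub> A \<in> basic_nbhd G K)"
proof -
  interpret M: group "Maps G" by (rule group_Maps)
  obtain n where n: "realization K \<subseteq> core n" using finite_subgraph_core(2)[OF K] by blast
  obtain \<alpha> where a: "\<alpha> \<in> Homeos" "A = cls \<alpha>" using A by (auto simp: carrier_Maps)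
  obtain \<beta> where b: "\<beta> \<in> Homeos" "\<And>\<xi>. \<xi> \<in> rays \<Longrightarrow> \<beta> (\<alpha> \<xi>) = \<xi>" "\<And>\<xi>. \<xi> \<in> rays \<Longrightarrow> \<alpha> (\<beta> \<xi>) = \<xi>"
    using Homeos_inverse[OF a(1)] by metis
  have iA: "inv\<^bsub>Maps G\<^esub> A = cls \<beta>" unfolding a(2) by (rule inv_Maps) (use a b in auto)
  define C where "C v = {\<xi> \<in> rays. \<alpha> \<xi> \<in> shadow v}" for v
  have "\<exists>N. \<forall>\<xi>\<in>rays. \<forall>k\<ge>N. shadow (\<xi> k) \<subseteq> C v \<or> shadow (\<xi> k) \<inter> C v = {}" for v
  proof (rule clopen_level)
    show "openin ends (C v)" "closedin ends (C v)"
      using openin_continuous_map_preimage[OF Homeos_cont[OF a(1)] openin_shadow]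
        closedin_continuous_map_preimage[OF Homeos_cont[OF a(1)] closedin_shadow] by (auto simp: C_def)
  qed
  then obtain N where N: "\<And>v \<xi> k. \<xi> \<in> rays \<Longrightarrow> N v \<le> k \<Longrightarrow> shadow (\<xi> k) \<subseteq> C v \<or> shadow (\<xi> k) \<inter> C v = {}"
    by metis
  obtain m where m: "\<forall>v\<in>{v \<in> V. d v = Suc n}. N v \<le> m" using finite_nat_bound[OF finite_level] by blast
  have "A \<otimes>\<^bsub>Maps G\<^esub> B \<otimes>\<^bsub>Maps G\<^esub> inv\<^bsub>Maps G\<^esub> A \<in> basic_nbhd G K" if B: "B \<in> basic_nbhd G (ball_graph m)" for B
  proof -
    have "B \<in> carrier (Maps G)" using B by (simp add: basic_nbhd_def)
    then obtain \<phi> where p: "\<phi> \<in> Homeos" "B = cls \<phi>" by (auto simp: carrier_Maps)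
    have s: "stab m \<phi>" using nbhd_stab B p by blast
    have AB: "A \<otimes>\<^bsub>Maps G\<^esub> B \<otimes>\<^bsub>Maps G\<^esub> inv\<^bsub>Maps G\<^esub> A = cls (\<alpha> \<circ> \<phi> \<circ> \<beta>)"
      unfolding iA unfolding a(2) p(2) using a b p by (simp add: mult_Maps Homeos_comp)
    have "stab n (\<alpha> \<circ> \<phi> \<circ> \<beta>)"
      unfolding stab_def
    proof (intro ballI impI)
      fix v assume v: "v \<in> V" "d v = Suc n"
      have C: "shadow (\<xi> (Suc m)) \<subseteq> C v" if "\<xi> \<in> C v" for \<xi>
      proof -
        have xi: "\<xi> \<in> rays" using that by (simp add: C_def)
        have "N v \<le> Suc m" using m v by (auto intro: le_SucI)
        then have "shadow (\<xi> (Suc m)) \<subseteq> C v \<or> shadow (\<xi> (Suc m)) \<inter> C v = {}" by (rule N[OF xi])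
        then show ?thesis using ray_in_shadow[OF xi] that by blast
      qed
      have CU: "C v = (\<Union>\<xi>\<in>C v. shadow (\<xi> (Suc m)))"
      proof
        show "C v \<subseteq> (\<Union>\<xi>\<in>C v. shadow (\<xi> (Suc m)))" using ray_in_shadow by (fastforce simp: C_def)
      qed (use C in blast)
      have "\<phi> ` C v = (\<Union>\<xi>\<in>C v. \<phi> ` shadow (\<xi> (Suc m)))" by (subst CU) (rule image_UN)
      also have "\<dots> = (\<Union>\<xi>\<in>C v. shadow (\<xi> (Suc m)))"
        using s ray_in ray_d unfolding stab_def C_def by (intro SUP_cong) auto
      finally have phC: "\<phi> ` C v = C v" using CU by simp
      have bs: "\<beta> ` shadow v = C v"
      proof (intro equalityI subsetI)
        fix \<xi> assume "\<xi> \<in> \<beta> ` shadow v"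
        then show "\<xi> \<in> C v" using b Homeos_rays[OF b(1)] shadow_subset[of v] by (force simp: C_def)
      next
        fix \<xi> assume "\<xi> \<in> C v"
        then show "\<xi> \<in> \<beta> ` shadow v" using b(2)[of \<xi>] by (auto simp: C_def intro!: image_eqI[of _ _ "\<alpha> \<xi>"])
      qed
      have as: "\<alpha> ` C v = shadow v"
        unfolding bs[symmetric] image_image using b(3) shadow_subset[of v] by force
      show "(\<alpha> \<circ> \<phi> \<circ> \<beta>) ` shadow v = shadow v"
        unfolding image_comp[symmetric] bs phC as ..
    qed
    then show ?thesis
      unfolding AB by (intro stab_nbhd[OF _ _ K n] Homeos_comp a b p)
  qed
  then show ?thesis using finite_subgraph_ball_graph by blast
qed

lemma base_Maps: "subgroup_base (Maps G) {basic_nbhd G K | K. finite_subgraph K G}"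
proof -
  interpret M: group "Maps G" by (rule group_Maps)
  have 1: "{basic_nbhd G K | K. finite_subgraph K G} \<noteq> {}" using finite_subgraph_ball_graph by blast
  show ?thesis
  proof (intro subgroup_base.intro subgroup_base_axioms.intro group_Maps 1)
    fix U W assume "U \<in> {basic_nbhd G K | K. finite_subgraph K G}"
    then obtain K where K: "U = basic_nbhd G K" "finite_subgraph K G" by blast
    show "subgroup U (Maps G)" unfolding K(1) by (rule subgroup_nbhd[OF K(2)])
    {
      assume "W \<in> {basic_nbhd G K | K. finite_subgraph K G}"
      then obtain L where L: "W = basic_nbhd G L" "finite_subgraph L G" by blast
      show "\<exists>X\<in>{basic_nbhd G K | K. finite_subgraph K G}. X \<subseteq> U \<inter> W"
        unfolding K(1) L(1) using nbhd_Int[OF K(2) L(2)] by blast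
    }
    fix A assume "A \<in> carrier (Maps G)"
    from nbhd_conj[OF this K(2)]
    show "\<exists>W\<in>{basic_nbhd G K | K. finite_subgraph K G}. \<forall>w\<in>W. A \<otimes>\<^bsub>Maps G\<^esub> w \<otimes>\<^bsub>Maps G\<^esub> inv\<^bsub>Maps G\<^esub> A \<in> U"
      unfolding K(1) by blast
  qed
qed

lemma Maps_topology_eq: "Maps_topology G = subgroup_base.base_topology (Maps G) {basic_nbhd G K | K. finite_subgraph K G}"
proof -
  interpret B: subgroup_base "Maps G" "{basic_nbhd G K | K. finite_subgraph K G}" by (rule base_Maps)
  have "admissible_topology G B.base_topology"
    unfolding admissible_topology_def
    using B.base_continuous_mult B.base_continuous_inv B.openin_base_member by auto
  moreover have "openin T A" if "admissible_topology G T" "openin B.base_topology A" for T A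
    by (rule B.base_coarsest[OF _ _ _ that(2)]) (use that(1) in \<open>auto simp: admissible_topology_def\<close>)
  ultimately have "coarsest_admissible G B.base_topology" by (simp add: coarsest_admissible_def)
  then show ?thesis unfolding Maps_topology_def by (intro the_equality) (simp_all add: coarsest_admissible_unique)
qed

text \<open>If \<open>h \<circ> \<phi>\<close> and \<open>\<phi> \<circ> g\<close> agree on the shadows of level \<open>n + 1\<close>, then
  \<open>inv g \<circ> (inv \<phi> \<circ> h \<circ> \<phi>)\<close> preserves these shadows and so lies in the basic neighbourhood.\<close>

theorem dense_conjugacy_class:
  assumes h: "homeomorphic_map ends ends h"
    and dense: "\<And>g \<A>. homeomorphic_map ends ends g \<Longrightarrow> finite \<A> \<Longrightarrow> (\<And>A. A \<in> \<A> \<Longrightarrow> openin ends A \<and> closedin ends A) \<Longrightarrow>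
      \<exists>\<phi>. homeomorphic_map ends ends \<phi> \<and> (\<forall>A\<in>\<A>. h ` \<phi> ` A = \<phi> ` g ` A)"
  shows "\<exists>a\<in>carrier (Maps G). Maps_topology G closure_of (conjugacy_class (Maps G) a) = carrier (Maps G)"
proof
  interpret B: subgroup_base "Maps G" "{basic_nbhd G K | K. finite_subgraph K G}" by (rule base_Maps)
  have hH: "h \<in> Homeos" using h by (simp add: Homeos_def)
  show aM: "cls h \<in> carrier (Maps G)" using hH by (simp add: carrier_Maps)
  show "Maps_topology G closure_of (conjugacy_class (Maps G) (cls h)) = carrier (Maps G)"
    unfolding Maps_topology_eq
  proof (rule B.closure_conjugacy_class[OF aM])
    fix g U assume g: "g \<in> carrier (Maps G)" and "U \<in> {basic_nbhd G K | K. finite_subgraph K G}"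
    then obtain K where K: "U = basic_nbhd G K" "finite_subgraph K G" by blast
    obtain n where n: "realization K \<subseteq> core n" using finite_subgraph_core(2)[OF K(2)] by blast
    obtain \<gamma> where c: "\<gamma> \<in> Homeos" "g = cls \<gamma>" using g by (auto simp: carrier_Maps)
    obtain \<gamma>' where c': "\<gamma>' \<in> Homeos" "\<And>\<xi>. \<xi> \<in> rays \<Longrightarrow> \<gamma>' (\<gamma> \<xi>) = \<xi>" "\<And>\<xi>. \<xi> \<in> rays \<Longrightarrow> \<gamma> (\<gamma>' \<xi>) = \<xi>"
      using Homeos_inverse[OF c(1)] by metis
    let ?A = "shadow ` {v \<in> V. d v = Suc n}"
    have "homeomorphic_map ends ends \<gamma>" using c by (simp add: Homeos_def)
    then have "\<exists>\<phi>. homeomorphic_map ends ends \<phi> \<and> (\<forall>A\<in>?A. h ` \<phi> ` A = \<phi> ` \<gamma> ` A)"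
      by (rule dense) (use finite_level openin_shadow closedin_shadow in auto)
    then obtain \<phi> where p0: "homeomorphic_map ends ends \<phi>" "\<forall>A\<in>?A. h ` \<phi> ` A = \<phi> ` \<gamma> ` A"
      by (elim exE conjE) (rule that)
    have p: "\<phi> \<in> Homeos" using p0(1) by (simp add: Homeos_def)
    have pv: "h ` \<phi> ` shadow v = \<phi> ` \<gamma> ` shadow v" if "v \<in> V" "d v = Suc n" for v
      using p0(2) that by simp
    obtain \<phi>' where q: "\<phi>' \<in> Homeos" "\<And>\<xi>. \<xi> \<in> rays \<Longrightarrow> \<phi>' (\<phi> \<xi>) = \<xi>" "\<And>\<xi>. \<xi> \<in> rays \<Longrightarrow> \<phi> (\<phi>' \<xi>) = \<xi>"
      using Homeos_inverse[OF p] by metis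
    have ig: "inv\<^bsub>Maps G\<^esub> g = cls \<gamma>'" unfolding c(2) by (rule inv_Maps) (use c c' in auto)
    have ib: "inv\<^bsub>Maps G\<^esub> cls \<phi>' = cls \<phi>" by (rule inv_Maps) (use p q in auto)
    have eq: "inv\<^bsub>Maps G\<^esub> g \<otimes>\<^bsub>Maps G\<^esub> (cls \<phi>' \<otimes>\<^bsub>Maps G\<^esub> cls h \<otimes>\<^bsub>Maps G\<^esub> inv\<^bsub>Maps G\<^esub> cls \<phi>') = cls (\<gamma>' \<circ> (\<phi>' \<circ> h \<circ> \<phi>))"
      unfolding ig ib using c' q p hH by (simp add: mult_Maps Homeos_comp)
    have "stab n (\<gamma>' \<circ> (\<phi>' \<circ> h \<circ> \<phi>))"
      unfolding stab_def
    proof (intro ballI impI)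
      fix v assume v: "v \<in> V" "d v = Suc n"
      have "(\<gamma>' \<circ> (\<phi>' \<circ> h \<circ> \<phi>)) ` shadow v = \<gamma>' ` \<phi>' ` h ` \<phi> ` shadow v" by (simp only: image_comp o_assoc)
      also have "\<dots> = \<gamma>' ` \<phi>' ` \<phi> ` \<gamma> ` shadow v" using pv[OF v] by simp
      also have "\<dots> = (\<lambda>\<xi>. \<xi>) ` shadow v"
        unfolding image_image using q(2) c'(2) shadow_subset[of v] Homeos_rays[OF c(1)] by (intro image_cong) auto
      finally show "(\<gamma>' \<circ> (\<phi>' \<circ> h \<circ> \<phi>)) ` shadow v = shadow v" by simp
    qed
    moreover have "\<gamma>' \<circ> (\<phi>' \<circ> h \<circ> \<phi>) \<in> Homeos" by (intro Homeos_comp c'(1) q(1) p hH)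
    ultimately have "cls (\<gamma>' \<circ> (\<phi>' \<circ> h \<circ> \<phi>)) \<in> U" unfolding K(1) by (intro stab_nbhd[OF _ _ K(2) n])
    then show "\<exists>b\<in>carrier (Maps G). inv\<^bsub>Maps G\<^esub> g \<otimes>\<^bsub>Maps G\<^esub> (b \<otimes>\<^bsub>Maps G\<^esub> cls h \<otimes>\<^bsub>Maps G\<^esub> inv\<^bsub>Maps G\<^esub> b) \<in> U"
      using eq q(1) by (intro bexI[of _ "cls \<phi>'"]) (auto simp: carrier_Maps)
  qed
qed

end

section \<open>Rooting a tree\<close>

locale tree_with_root =
  fixes X :: "'v graph" and x :: 'v
  assumes tree: "locally_finite_tree X" and root: "x \<in> verts X"
begin

definition adj :: "('v \<times> 'v) set" where
  "adj = {(a, b). {a, b} \<in> edges X}"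

definition dist_root :: "'v \<Rightarrow> nat" where
  "dist_root v = (LEAST n. (x, v) \<in> adj ^^ n)"

definition parent :: "'v \<Rightarrow> 'v" where
  "parent v = (SOME u. {u, v} \<in> edges X \<and> dist_root v = Suc (dist_root u))"

lemma edge_verts: "{a, b} \<in> edges X \<Longrightarrow> a \<in> verts X \<and> b \<in> verts X \<and> a \<noteq> b"
  using tree unfolding locally_finite_tree_def wf_graph_def by (metis card_2_iff doubleton_eq_iff insertCI subsetD)

lemma reachable: "v \<in> verts X \<Longrightarrow> (x, v) \<in> adj ^^ dist_root v"
proof -
  assume "v \<in> verts X"
  then have "(x, v) \<in> adj\<^sup>*" using tree root unfolding locally_finite_tree_def connected_graph_def adj_def by blast
  then obtain n where "(x, v) \<in> adj ^^ n" using rtrancl_imp_relpow by blast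
  then show ?thesis unfolding dist_root_def by (rule LeastI)
qed

lemma dist_le: "(x, v) \<in> adj ^^ n \<Longrightarrow> dist_root v \<le> n"
  unfolding dist_root_def by (rule Least_le)

lemma dist_zero: "v \<in> verts X \<Longrightarrow> dist_root v = 0 \<longleftrightarrow> v = x"
proof
  assume v: "v \<in> verts X"
  show "dist_root v = 0 \<Longrightarrow> v = x" using reachable[OF v] by simp
  show "v = x \<Longrightarrow> dist_root v = 0" using dist_le[of x 0] by simp
qed

lemma parent_props:
  assumes v: "v \<in> verts X" "v \<noteq> x"
  shows "{parent v, v} \<in> edges X" "dist_root v = Suc (dist_root (parent v))" "parent v \<in> verts X"
proof -
  obtain k where k: "dist_root v = Suc k" using dist_zero[OF v(1)] v(2) by (cases "dist_root v") auto
  then have "(x, v) \<in> adj ^^ Suc k" using reachable[OF v(1)] by simp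
  then obtain u where u: "(x, u) \<in> adj ^^ k" "(u, v) \<in> adj" by auto
  then have e: "{u, v} \<in> edges X" by (simp add: adj_def)
  then have uV: "u \<in> verts X" using edge_verts by blast
  have "(x, v) \<in> adj ^^ Suc (dist_root u)" using reachable[OF uV] u(2) by auto
  then have "dist_root v \<le> Suc (dist_root u)" by (rule dist_le)
  moreover have "dist_root u \<le> k" using dist_le[OF u(1)] .
  ultimately have "dist_root v = Suc (dist_root u)" using k by simp
  with e have "\<exists>u. {u, v} \<in> edges X \<and> dist_root v = Suc (dist_root u)" by blast
  then have "{parent v, v} \<in> edges X \<and> dist_root v = Suc (dist_root (parent v))" unfolding parent_def by (rule someI_ex)
  then show "{parent v, v} \<in> edges X" "dist_root v = Suc (dist_root (parent v))" "parent v \<in> verts X"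
    using edge_verts by auto
qed

lemma parent_iter:
  assumes "v \<in> verts X" "k \<le> dist_root v"
  shows "(parent ^^ k) v \<in> verts X \<and> dist_root ((parent ^^ k) v) = dist_root v - k"
  using assms(2)
proof (induction k)
  case 0 then show ?case using assms by simp
next
  case (Suc k)
  let ?u = "(parent ^^ k) v"
  have u: "?u \<in> verts X" "dist_root ?u = dist_root v - k" using Suc by auto
  then have "?u \<noteq> x" using dist_zero[OF u(1)] Suc by auto
  then show ?case using parent_props[OF u(1)] u Suc by simp
qed

lemma parent_iter_edge:
  assumes "v \<in> verts X" "k < dist_root v"
  shows "{(parent ^^ Suc k) v, (parent ^^ k) v} \<in> edges X"
proof -
  have u: "(parent ^^ k) v \<in> verts X" "dist_root ((parent ^^ k) v) \<noteq> 0" using parent_iter[of v k] assms by auto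
  then show ?thesis using parent_props(1)[OF u(1)] dist_zero[OF u(1)] by simp
qed

lemma parent_iter_root:
  assumes "v \<in> verts X" shows "(parent ^^ dist_root v) v = x"
  using parent_iter[OF assms, of "dist_root v"] dist_zero[of "(parent ^^ dist_root v) v"] by simp

text \<open>An edge joins a vertex with its parent: otherwise the edge, together with the paths from its
  ends to the first common ancestor, would be a cycle.\<close>

lemma edge_parent:
  assumes e: "{u, v} \<in> edges X"
  shows "(u \<noteq> x \<and> parent u = v) \<or> (v \<noteq> x \<and> parent v = u)"
proof (rule ccontr)
  assume con: "\<not> ?thesis"
  have V: "u \<in> verts X" "v \<in> verts X" "u \<noteq> v" using edge_verts[OF e] by auto
  define a where "a k = (parent ^^ k) u" for k
  define b where "b k = (parent ^^ k) v" for k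
  \<comment> \<open>The paths from \<open>u\<close> and \<open>v\<close> to the root first meet at \<open>a i = b j\<close>; the cycle \<open>vs\<close> goes up to this vertex and down again.\<close>
  define M where "M i \<longleftrightarrow> i \<le> dist_root u \<and> (\<exists>j\<le>dist_root v. a i = b j)" for i
  have "M (dist_root u)" unfolding M_def a_def b_def using parent_iter_root V by auto
  then have "\<exists>i. M i" by blast
  define i where "i = (LEAST i. M i)"
  have Mi: "M i" unfolding i_def using \<open>\<exists>i. M i\<close> by (rule LeastI_ex)
  have least: "\<not> M k" if "k < i" for k using not_less_Least that unfolding i_def by blast
  obtain j where j: "j \<le> dist_root v" "a i = b j" using Mi unfolding M_def by blast
  have iu: "i \<le> dist_root u" using Mi unfolding M_def by blast
  have da: "dist_root (a k) = dist_root u - k" if "k \<le> dist_root u" for k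
    using parent_iter[OF V(1) that] by (simp add: a_def)
  have db: "dist_root (b k) = dist_root v - k" if "k \<le> dist_root v" for k
    using parent_iter[OF V(2) that] by (simp add: b_def)
  have ne: "2 \<le> i + j"
  proof (rule ccontr)
    assume "\<not> 2 \<le> i + j"
    then consider "i = 0" "j = 0" | "i = 1" "j = 0" | "i = 0" "j = 1" by linarith
    then show False
    proof cases
      case 1 then show False using j V by (simp add: a_def b_def)
    next
      case 2
      then have "parent u = v" using j by (simp add: a_def b_def)
      moreover have "u \<noteq> x" using iu 2 dist_zero[OF V(1)] by auto
      ultimately show False using con by blast
    next
      case 3
      then have "parent v = u" using j by (simp add: a_def b_def)
      moreover have "v \<noteq> x" using j 3 dist_zero[OF V(2)] by auto
      ultimately show False using con by blast
    qed
  qed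
  define vs where "vs = map a [0..<Suc i] @ rev (map b [0..<j])"
  have len: "length vs = Suc (i + j)" by (simp add: vs_def)
  have nth1: "vs ! m = a m" if "m \<le> i" for m
  proof -
    have "vs ! m = map a [0..<Suc i] ! m" unfolding vs_def nth_append using that by simp
    then show ?thesis using that by (simp del: upt_Suc)
  qed
  have nth2: "vs ! m = b (i + j - m)" if "i \<le> m" "m \<le> i + j" for m
  proof (cases "m = i")
    case True then show ?thesis using nth1[of i] j by simp
  next
    case False
    then have lt: "m - Suc i < j" using that by simp
    have "vs ! m = rev (map b [0..<j]) ! (m - Suc i)" unfolding vs_def nth_append using False that by simp
    also have "\<dots> = b (j - Suc (m - Suc i))" using lt by (simp add: rev_nth)
    also have "j - Suc (m - Suc i) = i + j - m" using False that by simp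
    finally show ?thesis .
  qed
  have "distinct vs"
    unfolding vs_def distinct_append
  proof (intro conjI)
    show "distinct (map a [0..<Suc i])"
      unfolding distinct_map
    proof
      show "inj_on a (set [0..<Suc i])"
      proof (rule inj_onI)
        fix k l assume kl: "k \<in> set [0..<Suc i]" "l \<in> set [0..<Suc i]" "a k = a l"
        then have "dist_root u - k = dist_root u - l" "k \<le> dist_root u" "l \<le> dist_root u"
          using da[of k] da[of l] iu by auto
        then show "k = l" by simp
      qed
    qed simp
    have "inj_on b {0..<j}"
    proof (rule inj_onI)
      fix k l assume kl: "k \<in> {0..<j}" "l \<in> {0..<j}" "b k = b l"
      then have "dist_root v - k = dist_root v - l" "k \<le> dist_root v" "l \<le> dist_root v"
        using db[of k] db[of l] j by auto
      then show "k = l" by simp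
    qed
    then show "distinct (rev (map b [0..<j]))" by (simp add: distinct_map)
    have "a k \<noteq> b l" if "k \<le> i" "l < j" for k l
    proof
      assume eq: "a k = b l"
      show False
      proof (cases "k = i")
        case True
        then have "b l = b j" using eq j by simp
        then have "dist_root v - l = dist_root v - j" using db[of l] db[of j] j that by simp
        then show False using that j by simp
      next
        case False
        then have "k < i" using that by simp
        moreover have "M k" unfolding M_def using eq that iu j by (auto intro!: exI[of _ l])
        ultimately show False using least by blast
      qed
    qed
    then show "set (map a [0..<Suc i]) \<inter> set (rev (map b [0..<j])) = {}" by auto
  qed
  moreover have "\<forall>m < length vs. {vs ! m, vs ! (Suc m mod length vs)} \<in> edges X"
  proof (intro allI impI)
    fix m assume m: "m < length vs"
    consider "m < i" | "i \<le> m" "m < i + j" | "m = i + j" using m len by linarith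
    then show "{vs ! m, vs ! (Suc m mod length vs)} \<in> edges X"
    proof cases
      case 1
      then have "{a (Suc m), a m} \<in> edges X" using parent_iter_edge[OF V(1), of m] iu unfolding a_def by simp
      moreover have "Suc m mod length vs = Suc m" using 1 len by simp
      ultimately show ?thesis using nth1[of m] nth1[of "Suc m"] 1 by (simp add: insert_commute)
    next
      case 2
      let ?l = "i + j - Suc m"
      have "{b (Suc ?l), b ?l} \<in> edges X" using parent_iter_edge[OF V(2), of ?l] j 2 unfolding b_def by simp
      moreover have "Suc ?l = i + j - m" using 2 by simp
      moreover have "Suc m mod length vs = Suc m" using 2 len by simp
      ultimately show ?thesis using nth2[of m] nth2[of "Suc m"] 2 by simp
    next
      case 3
      have "vs ! m = v" using nth2[of m] 3 by (simp add: b_def)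
      moreover have "Suc m mod length vs = 0" using 3 len by simp
      moreover have "vs ! 0 = u" using nth1[of 0] by (simp add: a_def)
      ultimately show ?thesis using e by (simp add: insert_commute)
    qed
  qed
  ultimately have "cycle_in X vs" using ne len unfolding cycle_in_def by simp
  then show False using tree unfolding locally_finite_tree_def by blast
qed

lemma edges_parent: "edges X = {{v, parent v} | v. v \<in> verts X \<and> v \<noteq> x}"
proof (intro equalityI subsetI)
  fix e assume e: "e \<in> edges X"
  then have "card e = 2" "e \<subseteq> verts X" using tree unfolding locally_finite_tree_def wf_graph_def by auto
  then obtain u v where uv: "e = {u, v}" "u \<in> verts X" "v \<in> verts X" by (auto simp: card_2_iff)
  consider "u \<noteq> x" "parent u = v" | "v \<noteq> x" "parent v = u" using edge_parent[of u v] e uv by blast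
  then show "e \<in> {{v, parent v} | v. v \<in> verts X \<and> v \<noteq> x}"
  proof cases
    case 1 then show ?thesis using uv by blast
  next
    case 2
    then have "e = {v, parent v}" using uv by auto
    then show ?thesis using uv 2 by blast
  qed
next
  fix e assume "e \<in> {{v, parent v} | v. v \<in> verts X \<and> v \<noteq> x}"
  then obtain v where "v \<in> verts X" "v \<noteq> x" "e = {v, parent v}" by blast
  then show "e \<in> edges X" using parent_props(1)[of v] by (simp add: insert_commute)
qed

lemma graph_tree: "graph_tree (verts X) x parent dist_root X"
proof
  show "x \<in> verts X" by (rule root)
  show "dist_root v = 0 \<longleftrightarrow> v = x" if "v \<in> verts X" for v using dist_zero[OF that] .
  show "parent v \<in> verts X" "dist_root v = Suc (dist_root (parent v))" if "v \<in> verts X" "v \<noteq> x" for v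
    using parent_props[OF that] by auto
  show "finite {w \<in> verts X - {x}. parent w = v}" if v: "v \<in> verts X" for v
  proof -
    have "finite {e \<in> edges X. v \<in> e}" using tree v unfolding locally_finite_tree_def locally_finite_graph_def by blast
    moreover have "finite e" if "e \<in> edges X" for e
      using tree that unfolding locally_finite_tree_def wf_graph_def by (metis card.infinite zero_neq_numeral)
    ultimately have "finite (\<Union>{e \<in> edges X. v \<in> e})" by blast
    moreover have "{w \<in> verts X - {x}. parent w = v} \<subseteq> \<Union>{e \<in> edges X. v \<in> e}"
    proof
      fix w assume w: "w \<in> {w \<in> verts X - {x}. parent w = v}"
      then have "{v, w} \<in> edges X" using parent_props(1)[of w] by auto
      then show "w \<in> \<Union>{e \<in> edges X. v \<in> e}" by blast
    qed
    ultimately show ?thesis using finite_subset by blast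
  qed
qed (use edges_parent in auto)

end

section \<open>Wedges\<close>

text \<open>Both trees are rooted at the vertex at which they are glued, so the wedge inherits its parents and
  depths from them.\<close>

locale wedge_tree = X: graph_tree V x par d X + C: graph_tree W c par' d' C
  for V :: "'a set" and x par d X and W :: "'b set" and c par' d' C
begin

definition wverts :: "('a + 'b) set" where
  "wverts = Inl ` V \<union> Inr ` (W - {c})"

definition wpar :: "'a + 'b \<Rightarrow> 'a + 'b" where
  "wpar = case_sum (Inl \<circ> par) (wedge_vertex x c \<circ> par')"

definition wdepth :: "'a + 'b \<Rightarrow> nat" where
  "wdepth = case_sum d d'"

lemma wsimps [simp]:
  "wpar (Inl v) = Inl (par v)" "wpar (Inr u) = wedge_vertex x c (par' u)"
  "wdepth (Inl v) = d v" "wdepth (Inr u) = d' u"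
  "Inl v \<in> wverts \<longleftrightarrow> v \<in> V" "Inr u \<in> wverts \<longleftrightarrow> u \<in> W \<and> u \<noteq> c"
  by (auto simp: wpar_def wdepth_def wverts_def)

lemma wedge_vertex_in: "u \<in> W \<Longrightarrow> wedge_vertex x c u \<in> wverts"
  using X.root_in by (simp add: wedge_vertex_def)

lemma wdepth_wedge_vertex: "wdepth (wedge_vertex x c u) = d' u"
  by (simp add: wedge_vertex_def)

lemma graph_tree_wedge: "graph_tree wverts (Inl x) wpar wdepth (wedge X x C c)"
proof
  show "Inl x \<in> wverts" using X.root_in by simp
  show "wdepth v = 0 \<longleftrightarrow> v = Inl x" if "v \<in> wverts" for v
    using that X.d_zero C.d_zero by (cases v) auto
  show "wpar v \<in> wverts" if "v \<in> wverts" "v \<noteq> Inl x" for v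
    using that X.par_in C.par_in wedge_vertex_in by (cases v) auto
  show "wdepth v = Suc (wdepth (wpar v))" if "v \<in> wverts" "v \<noteq> Inl x" for v
    using that X.d_par C.d_par by (cases v) (auto simp: wdepth_wedge_vertex)
  show "finite {w \<in> wverts - {Inl x}. wpar w = v}" if v: "v \<in> wverts" for v
  proof (cases v)
    case (Inl a)
    then have a: "a \<in> V" using v by simp
    have "{w \<in> wverts - {Inl x}. wpar w = v} \<subseteq> Inl ` {w \<in> V - {x}. par w = a} \<union> Inr ` {w \<in> W - {c}. par' w = c}"
    proof
      fix w assume "w \<in> {w \<in> wverts - {Inl x}. wpar w = v}"
      then show "w \<in> Inl ` {w \<in> V - {x}. par w = a} \<union> Inr ` {w \<in> W - {c}. par' w = c}"
        using Inl by (cases w) (auto simp: wedge_vertex_def split: if_splits)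
    qed
    moreover have "finite (Inl ` {w \<in> V - {x}. par w = a} \<union> Inr ` {w \<in> W - {c}. par' w = c} :: ('a + 'b) set)"
      using X.finite_children[OF a] C.finite_children[OF C.root_in] by simp
    ultimately show ?thesis by (rule finite_subset)
  next
    case (Inr b)
    then have b: "b \<in> W" using v by simp
    have "{w \<in> wverts - {Inl x}. wpar w = v} \<subseteq> Inr ` {w \<in> W - {c}. par' w = b}"
    proof
      fix w assume "w \<in> {w \<in> wverts - {Inl x}. wpar w = v}"
      then show "w \<in> Inr ` {w \<in> W - {c}. par' w = b}"
        using Inr by (cases w) (auto simp: wedge_vertex_def split: if_splits)
    qed
    then show ?thesis using C.finite_children[OF b] finite_subset by blast
  qed
  show "verts (wedge X x C c) = wverts"
    using X.root_in C.root_in by (auto simp: wedge_def X.verts_G C.verts_G wverts_def wedge_vertex_def)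
  show "edges (wedge X x C c) = {{v, wpar v} | v. v \<in> wverts \<and> v \<noteq> Inl x}"
  proof (intro equalityI subsetI)
    fix e assume "e \<in> edges (wedge X x C c)"
    then consider v where "v \<in> V" "v \<noteq> x" "e = Inl ` {v, par v}" | u where "u \<in> W" "u \<noteq> c" "e = wedge_vertex x c ` {u, par' u}"
      unfolding wedge_def X.edges_G C.edges_G by auto
    then show "e \<in> {{v, wpar v} | v. v \<in> wverts \<and> v \<noteq> Inl x}"
    proof cases
      case 1
      then have "e = {Inl v, wpar (Inl v)}" by simp
      then show ?thesis using 1 by (intro CollectI exI[of _ "Inl v"]) simp
    next
      case 2
      then have "e = {Inr u, wpar (Inr u)}" by (simp add: wedge_vertex_def[of x c u])
      then show ?thesis using 2 by (intro CollectI exI[of _ "Inr u"]) simp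
    qed
  next
    fix e assume "e \<in> {{v, wpar v} | v. v \<in> wverts \<and> v \<noteq> Inl x}"
    then obtain v where v: "v \<in> wverts" "v \<noteq> Inl x" "e = {v, wpar v}" by blast
    show "e \<in> edges (wedge X x C c)"
    proof (cases v)
      case (Inl a)
      then have "{a, par a} \<in> edges X" "e = Inl ` {a, par a}" using v by (auto simp: X.edges_G)
      then have "e \<in> (\<lambda>e. Inl ` e) ` edges X" by (intro image_eqI[of _ _ "{a, par a}"])
      then show ?thesis by (simp add: wedge_def)
    next
      case (Inr b)
      then have "{b, par' b} \<in> edges C" "e = wedge_vertex x c ` {b, par' b}"
        using v by (auto simp: C.edges_G wedge_vertex_def[of x c b])
      then have "e \<in> (\<lambda>e. wedge_vertex x c ` e) ` edges C" by (intro image_eqI[of _ _ "{b, par' b}"])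
      then show ?thesis by (simp add: wedge_def)
    qed
  qed
qed

sublocale T: graph_tree wverts "Inl x" wpar wdepth "wedge X x C c"
  by (rule graph_tree_wedge)

text \<open>The first step of a ray from the common root decides on which side the ray stays.\<close>

definition ends_left :: "(nat \<Rightarrow> 'a + 'b) set" where
  "ends_left = {\<xi> \<in> T.rays. isl (\<xi> 1)}"

definition ends_right :: "(nat \<Rightarrow> 'a + 'b) set" where
  "ends_right = {\<xi> \<in> T.rays. \<not> isl (\<xi> 1)}"

lemma ends_left_isl: "\<xi> \<in> ends_left \<Longrightarrow> isl (\<xi> n)"
proof (induction n)
  case 0
  then have "\<xi> 0 = Inl x" by (simp add: ends_left_def T.ray_root)
  then show ?case by simp
next
  case (Suc n)
  then have r: "\<xi> \<in> T.rays" by (simp add: ends_left_def)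
  show ?case
  proof (cases n)
    case 0 then show ?thesis using Suc by (simp add: ends_left_def)
  next
    case (Suc m)
    show ?thesis
    proof (rule ccontr)
      assume "\<not> isl (\<xi> (Suc n))"
      then obtain u where u: "\<xi> (Suc n) = Inr u" by (cases "\<xi> (Suc n)") auto
      obtain v where v: "\<xi> n = Inl v" using Suc.IH Suc.prems by (cases "\<xi> n") auto
      have "wedge_vertex x c (par' u) = Inl v" using T.ray_par[OF r, of n] u v by simp
      then have "v = x" by (simp add: wedge_vertex_def split: if_splits)
      moreover have "d v = n" using T.ray_d[OF r, of n] v by simp
      ultimately show False using Suc by simp
    qed
  qed
qed

lemma ends_right_not_isl: "\<xi> \<in> ends_right \<Longrightarrow> \<not> isl (\<xi> (Suc n))"
proof (induction n)
  case 0 then show ?case by (simp add: ends_right_def)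
next
  case (Suc n)
  then have r: "\<xi> \<in> T.rays" by (simp add: ends_right_def)
  show ?case
  proof
    assume "isl (\<xi> (Suc (Suc n)))"
    then obtain v where "\<xi> (Suc (Suc n)) = Inl v" by (cases "\<xi> (Suc (Suc n))") auto
    then have "isl (\<xi> (Suc n))" using T.ray_par[OF r, of "Suc n"] by (metis isl_def wsimps(1))
    then show False using Suc by simp
  qed
qed

lemma homeomorphic_left: "X.ends homeomorphic_space subtopology T.ends ends_left"
proof -
  let ?f = "\<lambda>\<xi> n. Inl (\<xi> n) :: 'a + 'b"
  have in_left: "?f \<xi> \<in> ends_left" if "\<xi> \<in> X.rays" for \<xi>
    using that by (auto simp: ends_left_def T.rays_def X.rays_def)
  have "homeomorphic_map X.ends (subtopology T.ends ends_left) ?f"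
  proof (rule continuous_imp_homeomorphic_map[OF _ X.compact_ends])
    show "Hausdorff_space (subtopology T.ends ends_left)" by (intro Hausdorff_space_subtopology T.Hausdorff_ends)
    show "inj_on ?f (topspace X.ends)" by (auto simp: inj_on_def fun_eq_iff)
    have "continuous_map X.ends (discrete_topology UNIV) (\<lambda>\<xi>. ?f \<xi> n)" for n
    proof -
      have "openin X.ends {\<xi> \<in> X.rays. ?f \<xi> n \<in> U}" for U by (rule X.openin_cyl)
      then show ?thesis by (simp add: continuous_map_def)
    qed
    then have "continuous_map X.ends (product_topology (\<lambda>_. discrete_topology UNIV) UNIV) ?f"
      by (simp add: continuous_map_componentwise_UNIV)
    then show "continuous_map X.ends (subtopology T.ends ends_left) ?f"
      using in_left unfolding T.ends_def
      by (auto simp: continuous_map_in_subtopology ends_left_def)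
    show "?f ` topspace X.ends = topspace (subtopology T.ends ends_left)"
    proof (intro equalityI subsetI)
      fix \<xi> assume "\<xi> \<in> topspace (subtopology T.ends ends_left)"
      then have xi: "\<xi> \<in> ends_left" "\<xi> \<in> T.rays" by auto
      have eq: "\<xi> n = Inl (projl (\<xi> n))" for n using ends_left_isl[OF xi(1), of n] by simp
      have "projl (\<xi> n) \<in> V \<and> d (projl (\<xi> n)) = n \<and> par (projl (\<xi> (Suc n))) = projl (\<xi> n)" for n
        using T.ray_in[OF xi(2), of n] T.ray_d[OF xi(2), of n] T.ray_par[OF xi(2), of n]
        by (metis eq wsimps(1,3,5) sum.inject(1))
      then have "(\<lambda>n. projl (\<xi> n)) \<in> X.rays" by (simp add: X.rays_def)
      moreover have "\<xi> = ?f (\<lambda>n. projl (\<xi> n))" using eq by auto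
      ultimately show "\<xi> \<in> ?f ` topspace X.ends" by auto
    qed (use in_left in \<open>auto simp: ends_left_def\<close>)
  qed
  then show ?thesis using homeomorphic_space by blast
qed

lemma homeomorphic_right: "C.ends homeomorphic_space subtopology T.ends ends_right"
proof -
  let ?f = "\<lambda>\<xi> n. wedge_vertex x c (\<xi> n)"
  have in_right: "?f \<xi> \<in> ends_right" if xi: "\<xi> \<in> C.rays" for \<xi>
  proof -
    have s: "\<xi> (Suc n) \<noteq> c" for n
    proof
      assume "\<xi> (Suc n) = c"
      then show False using C.ray_d[OF xi, of "Suc n"] by simp
    qed
    have "wpar (?f \<xi> (Suc n)) = ?f \<xi> n" for n
      using s[of n] C.ray_par[OF xi, of n] by (simp add: wedge_vertex_def[of x c "\<xi> (Suc n)"])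
    then have "?f \<xi> \<in> T.rays"
      using C.ray_in[OF xi] C.ray_d[OF xi] wedge_vertex_in wdepth_wedge_vertex by (simp add: T.rays_def)
    then show ?thesis using s[of 0] by (simp add: ends_right_def wedge_vertex_def)
  qed
  have "homeomorphic_map C.ends (subtopology T.ends ends_right) ?f"
  proof (rule continuous_imp_homeomorphic_map[OF _ C.compact_ends])
    show "Hausdorff_space (subtopology T.ends ends_right)" by (intro Hausdorff_space_subtopology T.Hausdorff_ends)
    have "inj (wedge_vertex x c)" by (auto simp: inj_on_def wedge_vertex_def split: if_splits)
    then show "inj_on ?f (topspace C.ends)" by (auto simp: inj_on_def fun_eq_iff)
    have "continuous_map C.ends (discrete_topology UNIV) (\<lambda>\<xi>. ?f \<xi> n)" for n
    proof -
      have "openin C.ends {\<xi> \<in> C.rays. ?f \<xi> n \<in> U}" for U by (rule C.openin_cyl)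
      then show ?thesis by (simp add: continuous_map_def)
    qed
    then have "continuous_map C.ends (product_topology (\<lambda>_. discrete_topology UNIV) UNIV) ?f"
      by (simp add: continuous_map_componentwise_UNIV)
    then show "continuous_map C.ends (subtopology T.ends ends_right) ?f"
      using in_right unfolding T.ends_def
      by (auto simp: continuous_map_in_subtopology ends_right_def)
    show "?f ` topspace C.ends = topspace (subtopology T.ends ends_right)"
    proof (intro equalityI subsetI)
      fix \<xi> assume "\<xi> \<in> topspace (subtopology T.ends ends_right)"
      then have xi: "\<xi> \<in> ends_right" "\<xi> \<in> T.rays" by auto
      define \<eta> where "\<eta> n = (case n of 0 \<Rightarrow> c | Suc m \<Rightarrow> projr (\<xi> (Suc m)))" for n
      have e: "\<eta> 0 = c" "\<eta> (Suc m) = projr (\<xi> (Suc m))" for m by (simp_all add: \<eta>_def)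
      have r: "\<xi> (Suc m) = Inr (\<eta> (Suc m))" for m using ends_right_not_isl[OF xi(1), of m] by (simp add: e)
      have inW: "\<eta> (Suc m) \<in> W" "\<eta> (Suc m) \<noteq> c" "d' (\<eta> (Suc m)) = Suc m" for m
        using T.ray_in[OF xi(2), of "Suc m"] T.ray_d[OF xi(2), of "Suc m"] r[of m] by auto
      have f: "\<xi> n = wedge_vertex x c (\<eta> n)" for n
      proof (cases n)
        case 0 then show ?thesis using T.ray_root[OF xi(2)] e by (simp add: wedge_vertex_def)
      next
        case (Suc m) then show ?thesis using r[of m] inW(2)[of m] by (simp add: wedge_vertex_def)
      qed
      have inj: "wedge_vertex x c a = wedge_vertex x c b \<Longrightarrow> a = b" for a b by (auto simp: wedge_vertex_def split: if_splits)
      have "par' (\<eta> (Suc n)) = \<eta> n" for n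
      proof (rule inj)
        show "wedge_vertex x c (par' (\<eta> (Suc n))) = wedge_vertex x c (\<eta> n)"
          using T.ray_par[OF xi(2), of n] r[of n] f[of n] by simp
      qed
      moreover have "\<eta> n \<in> W \<and> d' (\<eta> n) = n" for n using inW C.root_in by (cases n) (auto simp: e(1))
      ultimately have "\<eta> \<in> C.rays" by (simp add: C.rays_def)
      moreover have "\<xi> = ?f \<eta>" using f by blast
      ultimately show "\<xi> \<in> ?f ` topspace C.ends" by auto
    qed (use in_right in \<open>auto simp: ends_right_def\<close>)
  qed
  then show ?thesis using homeomorphic_space by blast
qed

end

section \<open>The ends of the wedge\<close>

lemma zero_dimensional_homeomorphic:
  assumes "T homeomorphic_space T'" "zero_dimensional T"
  shows "zero_dimensional T'"
proof
  interpret zero_dimensional T by (rule assms(2))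
  obtain k where k: "homeomorphic_map T T' k" using assms(1) homeomorphic_space by blast
  obtain k' where k': "homeomorphic_map T' T k'" "\<And>x. x \<in> topspace T \<Longrightarrow> k' (k x) = x"
    "\<And>y. y \<in> topspace T' \<Longrightarrow> k (k' y) = y"
    using homeomorphic_inverse[OF k] by blast
  show "compact_space T'" using homeomorphic_compact_space[OF assms(1)] compact_E by simp
  show "Hausdorff_space T'" using homeomorphic_Hausdorff_space[OF assms(1)] Hausdorff_E by simp
  show "\<exists>A. clopenin T' A \<and> y \<in> A \<and> A \<subseteq> U" if U: "openin T' U" "y \<in> U" for U y
  proof -
    have y: "y \<in> topspace T'" using openin_subset[OF U(1)] U(2) by blast
    have "k' y \<in> topspace T" using homeomorphic_image[OF k'(1)] y by blast
    moreover have "openin T {x \<in> topspace T. k x \<in> U}"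
      using homeomorphic_imp_continuous_map[OF k] U(1) by (rule openin_continuous_map_preimage)
    ultimately obtain A where A: "clopenin T A" "k' y \<in> A" "A \<subseteq> {x \<in> topspace T. k x \<in> U}"
      using zero_dim[of "{x \<in> topspace T. k x \<in> U}" "k' y"] U(2) k'(3)[OF y] by auto
    have "y \<in> k ` A" using imageI[OF A(2), of k] k'(3)[OF y] by simp
    then show ?thesis using homeomorphic_clopenin[OF k A(1)] A(3) by blast
  qed
  have "{A. clopenin T' A} \<subseteq> (`) k ` {A. clopenin T A}"
  proof
    fix A assume A: "A \<in> {A. clopenin T' A}"
    have "k ` k' ` A = (\<lambda>y. y) ` A"
      unfolding image_image using clopenin_subset[of T' A] A k'(3) by (intro image_cong) auto
    then show "A \<in> (`) k ` {A. clopenin T A}"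
      using homeomorphic_clopenin[OF k'(1)] A by (intro image_eqI[of _ _ "k' ` A"]) auto
  qed
  then show "countable {A. clopenin T' A}" using countable_subset[OF _ countable_image[OF countable_clopen]] by blast
qed

lemma (in rooted_tree) zero_dimensional_ends: "zero_dimensional ends"
proof
  show "compact_space ends" by (rule compact_ends)
  show "Hausdorff_space ends" by (rule Hausdorff_ends)
  show "countable {A. clopenin ends A}" using countable_clopen_ends by (simp add: clopenin_def)
  show "\<exists>A. clopenin ends A \<and> \<xi> \<in> A \<and> A \<subseteq> U" if U: "openin ends U" "\<xi> \<in> U" for U \<xi>
  proof -
    obtain n where n: "shadow (\<xi> n) \<subseteq> U" and r: "\<xi> \<in> rays" using U unfolding openin_ends by blast
    have "\<xi> \<in> shadow (\<xi> n)" using r ray_d[OF r] by (simp add: shadow_def)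
    then show ?thesis using n openin_shadow closedin_shadow unfolding clopenin_def by blast
  qed
qed

text \<open>A diagonal argument inside a cylinder contained in \<open>U\<close>: the coordinate \<open>m + n\<close> of \<open>y\<close> differs from that of
  the \<open>m\<close>-th point of \<open>U\<close>.\<close>

lemma uncountable_open_cantor:
  assumes U: "openin cantor_space U" "U \<noteq> {}" shows "uncountable U"
proof
  assume cU: "countable U"
  obtain x where "x \<in> U" using U(2) by blast
  then obtain n where n: "\<And>y. (\<forall>i<n. y i = x i) \<Longrightarrow> y \<in> U" using openin_cantor[OF U(1)] by blast
  define y where "y i = (if i < n then x i else \<not> from_nat_into U (i - n) i)" for i
  have "y \<in> U" by (rule n) (simp add: y_def)
  then obtain m where "y = from_nat_into U m" using range_from_nat_into[OF U(2) cU] by (metis imageE)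
  then have "y (m + n) = from_nat_into U m (m + n)" by simp
  then show False by (simp add: y_def)
qed

text \<open>The image of \<open>W\<close> meets \<open>W'\<close> in a countable open set.\<close>

lemma countable_part_invariant:
  assumes W: "clopenin T W" "clopenin T W'" "W \<union> W' = topspace T" and "countable W"
    and unc: "\<And>U. openin T U \<Longrightarrow> U \<subseteq> W' \<Longrightarrow> U \<noteq> {} \<Longrightarrow> uncountable U"
    and g: "homeomorphic_map T T g"
  shows "g ` W = W"
proof
  have sub: "k ` W \<subseteq> W" if k: "homeomorphic_map T T k" for k
  proof (rule ccontr)
    assume "\<not> k ` W \<subseteq> W"
    have kW: "clopenin T (k ` W)" by (rule homeomorphic_clopenin[OF k W(1)])
    then have "openin T (k ` W \<inter> W')" using W(2) by (simp add: clopenin_def openin_Int)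
    moreover have "k ` W \<inter> W' \<noteq> {}" using \<open>\<not> k ` W \<subseteq> W\<close> clopenin_subset[OF kW] W(3) by blast
    ultimately have "uncountable (k ` W \<inter> W')" by (intro unc) auto
    then show False using \<open>countable W\<close> countable_subset[of "k ` W \<inter> W'" "k ` W"] by blast
  qed
  show "g ` W \<subseteq> W" by (rule sub[OF g])
  obtain g' where g': "homeomorphic_map T T g'" "\<And>y. y \<in> topspace T \<Longrightarrow> g (g' y) = y"
    using homeomorphic_inverse[OF g] by blast
  show "W \<subseteq> g ` W"
  proof
    fix y assume y: "y \<in> W"
    then have "g' y \<in> W" using sub[OF g'(1)] by blast
    moreover have "g (g' y) = y" using g'(2) y clopenin_subset[OF W(1)] by blast
    ultimately show "y \<in> g ` W" by (metis imageI)
  qed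
qed

context wedge_tree
begin

lemma clopenin_ends_left: "clopenin T.ends ends_left"
  and clopenin_ends_right: "clopenin T.ends ends_right"
  unfolding clopenin_def ends_left_def ends_right_def
  using T.openin_cyl[of isl 1] T.closedin_cyl[of isl 1]
    T.openin_cyl[of "\<lambda>v. \<not> isl v" 1] T.closedin_cyl[of "\<lambda>v. \<not> isl v" 1] by auto

theorem rokhlin_ends:
  assumes X: "rokhlin (end_space (graph_space X))" "countable (topspace (end_space (graph_space X)))"
    and C: "end_space (graph_space C) homeomorphic_space cantor_space"
  shows "rokhlin T.ends"
proof (rule rokhlin_sum[OF clopenin_ends_left clopenin_ends_right])
  have left: "end_space (graph_space X) homeomorphic_space subtopology T.ends ends_left"
    by (rule homeomorphic_space_trans[OF homeomorphic_space_sym[THEN iffD1, OF X.end_space_homeomorphic] homeomorphic_left])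
  have right: "cantor_space homeomorphic_space subtopology T.ends ends_right"
    by (rule homeomorphic_space_trans[OF homeomorphic_space_sym[THEN iffD1, OF C] homeomorphic_space_trans[OF
      homeomorphic_space_sym[THEN iffD1, OF C.end_space_homeomorphic] homeomorphic_right]])
  show "rokhlin (subtopology T.ends ends_left)" by (rule rokhlin_homeomorphic[OF left X(1)])
  show "rokhlin (subtopology T.ends ends_right)" by (rule rokhlin_homeomorphic[OF right rokhlin_cantor])
  show un: "ends_left \<union> ends_right = topspace T.ends" by (auto simp: ends_left_def ends_right_def)
  show "ends_left \<inter> ends_right = {}" by (auto simp: ends_left_def ends_right_def)
  fix g assume g: "homeomorphic_map T.ends T.ends g"
  show "g ` ends_left = ends_left"
  proof (rule countable_part_invariant[OF clopenin_ends_left clopenin_ends_right un _ _ g])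
    obtain k where "homeomorphic_map (end_space (graph_space X)) (subtopology T.ends ends_left) k"
      using left homeomorphic_space by blast
    then have "k ` topspace (end_space (graph_space X)) = topspace (subtopology T.ends ends_left)"
      by (rule homeomorphic_image)
    also have "\<dots> = ends_left" using un by auto
    finally have "k ` topspace (end_space (graph_space X)) = ends_left" .
    then show "countable ends_left" using X(2) by (metis countable_image)
  next
    fix U assume U: "openin T.ends U" "U \<subseteq> ends_right" "U \<noteq> {}"
    obtain k where k: "homeomorphic_map (subtopology T.ends ends_right) cantor_space k"
      using homeomorphic_space_sym[THEN iffD1, OF right] homeomorphic_space by blast
    have "openin (subtopology T.ends ends_right) U"
      using U(1,2) clopenin_ends_right by (simp add: openin_open_subtopology clopenin_def)
    then have "openin cantor_space (k ` U)"
      using homeomorphic_imp_open_map[OF k] unfolding open_map_def by blast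
    then have "uncountable (k ` U)" using U(3) by (intro uncountable_open_cantor) auto
    then show "uncountable U" by blast
  qed
qed

end

theorem theorem1p4:
  fixes X :: "'a graph" and C :: "'b graph" and x :: 'a and c :: 'b
  assumes "locally_finite_tree X"
    and "countable (topspace (end_space (graph_space X)))"
    and "\<exists>!\<mu>. maximal_end (end_space (graph_space X)) \<mu>"
    and "locally_finite_tree C"
    and "end_space (graph_space C) homeomorphic_space cantor_space"
    and "x \<in> verts X" and "c \<in> verts C"
  shows "\<exists>a \<in> carrier (Maps (wedge X x C c)).
           Maps_topology (wedge X x C c) closure_of conjugacy_class (Maps (wedge X x C c)) a
             = carrier (Maps (wedge X x C c))"
proof -
  interpret rX: tree_with_root X x by (rule tree_with_root.intro) (fact assms)+
  interpret rC: tree_with_root C c by (rule tree_with_root.intro) (fact assms)+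
  interpret wedge_tree "verts X" x rX.parent rX.dist_root X "verts C" c rC.parent rC.dist_root C
    by (intro wedge_tree.intro rX.graph_tree rC.graph_tree)
  interpret E: zero_dimensional "end_space (graph_space X)"
    by (rule zero_dimensional_homeomorphic[OF X.end_space_homeomorphic X.zero_dimensional_ends])
  have "rokhlin T.ends" using rokhlin_ends E.rokhlin_if_unique_maximal assms by blast
  then obtain h where h: "homeomorphic_map T.ends T.ends h"
    and dense: "\<forall>g \<A>. homeomorphic_map T.ends T.ends g \<longrightarrow> finite \<A> \<longrightarrow> (\<forall>A\<in>\<A>. clopenin T.ends A) \<longrightarrow>
      (\<exists>\<phi>. homeomorphic_map T.ends T.ends \<phi> \<and> (\<forall>A\<in>\<A>. h ` \<phi> ` A = \<phi> ` g ` A))"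
    unfolding rokhlin_def by (elim exE conjE) (rule that)
  show ?thesis
    by (rule T.dense_conjugacy_class[OF h], rule dense[rule_format]) (auto simp: clopenin_def)
qed

end
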